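(* Let $P$ be a strongly simple Poisson algebra over a field $K$, and let $C$ be an isotropic subalgebra of $P$, i.e. $\{C,C\}=0$. Then $$\mathrm{GK}(C)\leq\frac{\mathrm{GK}(A(P))}{2}\left(1-\frac{1}{f_{A(P)}+\max\{f_{A(P)},1\}}\right),$$ where $f_{A(P)}:=\max\{\mathrm{d}_{Q_m}(Q_m\otimes_K A(P))\mid 0\leq m\leq\mathrm{GK}(A(P))\}$ ($m$ an integer), $Q_0:=K$, and $Q_m:=K(x_1,\ldots,x_m)$ is the rational function field in $m$ indeterminates.
   Context: A Poisson algebra $(P,\{\cdot,\cdot\})$ over $K$ is an associative commutative $K$-algebra that is a Lie algebra under $\{\cdot,\cdot\}$ and satisfies $\{a,xy\}=\{a,x\}y+x\{a,y\}$ for all $a,x,y\in P$. For $a\in P$, $\mathrm{ad}(a):P\to P$, $x\mapsto\{a,x\}$, is a derivation. $A(P)$ denotes the associative subalgebra of the ring of differential operators $\mathcal{D}(P)\subseteq\mathrm{End}_K(P)$ generated by $P$ (acting by multiplication) and $\mathrm{ad}(P):=\{\mathrm{ad}(a)\mid a\in P\}$. If $P$ is finitely generated then so is $A(P)$, and $\mathrm{GK}(A(P))<\infty$. A Poisson algebra $P$ is strongly simple if: (1) $P$ is a finitely generated (associative) algebra which is a domain; (2) $A(P)$ is central simple (simple with centre $K$); (3) for each set of algebraically independent elements $a_1,\ldots,a_m$ of $P$ such that $\{a_i,a_j\}=0$ for all $i,j=1,\ldots,m$, the (commuting) elements $a_1,\ldots,a_m,\mathrm{ad}(a_1),\ldots,\mathrm{ad}(a_m)$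 of $A(P)$ are algebraically independent. For $f:\mathbb{N}\to\mathbb{N}$ put $\gamma(f):=\inf\{r\in\mathbb{R}\mid f(i)\leq i^r \text{ for } i\gg 0\}\in[0,\infty]$. For a finitely generated algebra $A=k\langle a_1,\ldots,a_s\rangle$ over a field $k$, the standard filtration associated with the generators is $A_0=k$, $A_1=k+\sum_jka_j$, $A_i=A_1^i$; $\mathrm{GK}_k(A)=\gamma(i\mapsto\dim_kA_i)$ is the Gelfand-Kirillov dimension (for an algebra that is not finitely generated, take the supremum over finitely generated subalgebras), and $\mathrm{GK}=\mathrm{GK}_K$. Filter dimensions: let $A$ be a simple finitely generated algebra over a field $k$ whose centre is algebraic over $k$, and let $F=\{A_i\}$ be a standard filtration. Define $\nu_F(i):=\min\{j\in\mathbb{N}\mid 1\in A_jaA_j \text{ for all } 0\neq a\in A_i\}$ and $\lambda_F(i):=\min\{j\in\mathbb{N}\mid 1\in AaA_j\text{ for all }0\neq a\in A_i\}$, where $A_jaA_j$ is the $k$-span of all $xay$ with $x,y\in A_j$, and $AaA_j$ is the left ideal of $A$ generated by $aA_j$. Then $\mathrm{fd}_k(A):=\gamma(\nu_F)$ and $\mathrm{lfd}_k(A):=\gamma(\lambda_F)$ (both independent of $F$). The symbol $\mathrm{d}_k$ denotes either $\mathrm{fd}_k$ or $\mathrm{lfd}_k$ (one fixed choice; the statement is asserted for each choice). Here $Q_m\otimes_K A(P)$ is regarded as a $Q_m$-algebra, so $k=Q_m$. If $f_{A(P)}=\infty$, the fraction is read as $0$. *)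

theory Defs
  imports
    "HOL-Library.Extended_Real"
    "HOL-Library.Poly_Mapping"
    "HOL-Algebra.QuotRing"
    "HOL-Algebra.Subrings"
    "Jordan_Normal_Form.Missing_VectorSpace"
begin

text \<open>
  An associative, not necessarily commutative, unital algebra over a field is a record of type
  \<open>('k, 'a) module\<close>: a ring together with a scalar multiplication.
  All subalgebras contain the unit of the ambient algebra.
\<close>

definition is_subalgebra :: "('k, 'x) ring_scheme \<Rightarrow> ('k, 'a) module \<Rightarrow> 'a set \<Rightarrow> bool" where
  "is_subalgebra k A B \<longleftrightarrow>
     subring B A \<and> (\<forall>c\<in>carrier k. \<forall>x\<in>B. c \<odot>\<^bsub>A\<^esub> x \<in> B)"

definition gen_subalgebra :: "('k, 'x) ring_scheme \<Rightarrow> ('k, 'a) module \<Rightarrow> 'a set \<Rightarrow> 'a set" where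
  "gen_subalgebra k A S = \<Inter> {B. is_subalgebra k A B \<and> S \<subseteq> B}"

definition finite_generators :: "('k, 'x) ring_scheme \<Rightarrow> ('k, 'a) module \<Rightarrow> 'a set \<Rightarrow> bool" where
  "finite_generators k A S \<longleftrightarrow>
     finite S \<and> S \<subseteq> carrier A \<and> gen_subalgebra k A S = carrier A"

definition fin_gen_algebra :: "('k, 'x) ring_scheme \<Rightarrow> ('k, 'a) module \<Rightarrow> bool" where
  "fin_gen_algebra k A \<longleftrightarrow> (\<exists>S. finite_generators k A S)"

definition simple_ring :: "('a, 'x) ring_scheme \<Rightarrow> bool" where
  "simple_ring R \<longleftrightarrow>
     ring R \<and> carrier R \<noteq> {\<zero>\<^bsub>R\<^esub>} \<and> (\<forall>I. ideal I R \<longrightarrow> I = {\<zero>\<^bsub>R\<^esub>} \<or> I = carrier R)"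

definition ring_centre :: "('a, 'x) ring_scheme \<Rightarrow> 'a set" where
  "ring_centre R = {z \<in> carrier R. \<forall>x\<in>carrier R. z \<otimes>\<^bsub>R\<^esub> x = x \<otimes>\<^bsub>R\<^esub> z}"

definition central_simple :: "('k, 'x) ring_scheme \<Rightarrow> ('k, 'a) module \<Rightarrow> bool" where
  "central_simple k A \<longleftrightarrow>
     simple_ring A \<and> ring_centre A = {c \<odot>\<^bsub>A\<^esub> \<one>\<^bsub>A\<^esub> | c. c \<in> carrier k}"

text \<open>
  A monomial exponent in \<open>n\<close> variables is a list of \<open>n\<close> natural numbers.
\<close>

definition monomial_at :: "('a, 'x) ring_scheme \<Rightarrow> 'a list \<Rightarrow> nat list \<Rightarrow> 'a" where
  "monomial_at A bs \<alpha> =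
     foldr (\<lambda>x y. x \<otimes>\<^bsub>A\<^esub> y) (map2 (\<lambda>b n. b [^]\<^bsub>A\<^esub> (n::nat)) bs \<alpha>) \<one>\<^bsub>A\<^esub>"

text \<open>
  No nonzero polynomial over \<open>k\<close> vanishes at \<open>bs\<close>.  This is only used for lists of pairwise
  commuting elements, so the order of the factors in a monomial is immaterial.
\<close>

definition alg_independent ::
  "('k, 'x) ring_scheme \<Rightarrow> ('k, 'a) module \<Rightarrow> 'a list \<Rightarrow> bool" where
  "alg_independent k A bs \<longleftrightarrow>
     set bs \<subseteq> carrier A \<and>
     (\<forall>S. finite S \<and> S \<subseteq> {\<alpha>. length \<alpha> = length bs} \<longrightarrow>
       (\<forall>c \<in> S \<rightarrow> carrier k.
          finsum A (\<lambda>\<alpha>. c \<alpha> \<odot>\<^bsub>A\<^esub> monomial_at A bs \<alpha>) S = \<zero>\<^bsub>A\<^esub>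
          \<longrightarrow> (\<forall>\<alpha>\<in>S. c \<alpha> = \<zero>\<^bsub>k\<^esub>)))"

text \<open>
  The exponent \<open>r\<close> ranges over the nonnegative reals, so that the growth of a function that is
  eventually \<open>0\<close> is \<open>0\<close> rather than \<open>-\<infinity>\<close>, and values lie in \<open>[0, \<infinity>]\<close>.
\<close>

definition growth :: "(nat \<Rightarrow> nat) \<Rightarrow> ereal" where
  "growth f =
     Inf (ereal ` {r::real. 0 \<le> r \<and> eventually (\<lambda>i. real (f i) \<le> real i powr r) sequentially})"

primrec std_filtration ::
  "('k, 'x) ring_scheme \<Rightarrow> ('k, 'a) module \<Rightarrow> 'a set \<Rightarrow> nat \<Rightarrow> 'a set" where
  "std_filtration k A S 0 = module.span k A {\<one>\<^bsub>A\<^esub>}"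
| "std_filtration k A S (Suc i) =
     module.span k A {x \<otimes>\<^bsub>A\<^esub> y | x y.
       x \<in> std_filtration k A S i \<and> y \<in> module.span k A (insert \<one>\<^bsub>A\<^esub> S)}"

text \<open>
  The growth of the filtration does not depend on the finite generating set, so an arbitrary one
  is chosen.
\<close>

definition GK_fin_gen :: "('k, 'x) ring_scheme \<Rightarrow> ('k, 'a) module \<Rightarrow> ereal" where
  "GK_fin_gen k A =
     growth (\<lambda>i. vectorspace.dim k
       (A\<lparr>carrier := std_filtration k A (SOME S. finite_generators k A S) i\<rparr>))"

definition GK :: "('k, 'x) ring_scheme \<Rightarrow> ('k, 'a) module \<Rightarrow> ereal" where
  "GK k A =
     (if fin_gen_algebra k A then GK_fin_gen k A
      else (SUP B \<in> {B. is_subalgebra k A B \<and> fin_gen_algebra k (A\<lparr>carrier := B\<rparr>)}.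
              GK_fin_gen k (A\<lparr>carrier := B\<rparr>)))"

definition span_sandwich ::
  "('k, 'x) ring_scheme \<Rightarrow> ('k, 'a) module \<Rightarrow> 'a set \<Rightarrow> 'a \<Rightarrow> 'a set \<Rightarrow> 'a set" where
  "span_sandwich k A X a Y =
     module.span k A {x \<otimes>\<^bsub>A\<^esub> a \<otimes>\<^bsub>A\<^esub> y | x y. x \<in> X \<and> y \<in> Y}"

definition return_fun ::
  "('k, 'x) ring_scheme \<Rightarrow> ('k, 'a) module \<Rightarrow> 'a set \<Rightarrow> nat \<Rightarrow> nat" where
  "return_fun k A S i =
     (LEAST j. \<forall>a \<in> std_filtration k A S i - {\<zero>\<^bsub>A\<^esub>}.
        \<one>\<^bsub>A\<^esub> \<in> span_sandwich k A (std_filtration k A S j) a (std_filtration k A S j))"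

definition left_return_fun ::
  "('k, 'x) ring_scheme \<Rightarrow> ('k, 'a) module \<Rightarrow> 'a set \<Rightarrow> nat \<Rightarrow> nat" where
  "left_return_fun k A S i =
     (LEAST j. \<forall>a \<in> std_filtration k A S i - {\<zero>\<^bsub>A\<^esub>}.
        \<one>\<^bsub>A\<^esub> \<in> span_sandwich k A (carrier A) a (std_filtration k A S j))"

text \<open>
  The filter dimensions, for a finitely generated simple \<open>k\<close>-algebra whose centre is algebraic
  over \<open>k\<close>.  The minima above then exist, and again the choice of generators is immaterial.
\<close>

definition filter_dim :: "('k, 'x) ring_scheme \<Rightarrow> ('k, 'a) module \<Rightarrow> ereal" where
  "filter_dim k A = growth (return_fun k A (SOME S. finite_generators k A S))"

definition left_filter_dim :: "('k, 'x) ring_scheme \<Rightarrow> ('k, 'a) module \<Rightarrow> ereal" where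
  "left_filter_dim k A = growth (left_return_fun k A (SOME S. finite_generators k A S))"

text \<open>
  A polynomial in \<open>m\<close> indeterminates is its coefficient function on exponents.
\<close>

definition mpoly_algebra :: "('k, 'x) ring_scheme \<Rightarrow> nat \<Rightarrow> ('k, nat list \<Rightarrow> 'k) module" where
  "mpoly_algebra k m =
    \<lparr>carrier = {p. (\<forall>\<alpha>. p \<alpha> \<in> carrier k) \<and> finite {\<alpha>. p \<alpha> \<noteq> \<zero>\<^bsub>k\<^esub>} \<and>
                   {\<alpha>. p \<alpha> \<noteq> \<zero>\<^bsub>k\<^esub>} \<subseteq> {\<alpha>. length \<alpha> = m}},
     mult = (\<lambda>p q \<gamma>. finsum k (\<lambda>(\<alpha>, \<beta>). p \<alpha> \<otimes>\<^bsub>k\<^esub> q \<beta>)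
               {(\<alpha>, \<beta>). length \<alpha> = m \<and> length \<beta> = m \<and> map2 (+) \<alpha> \<beta> = \<gamma>}),
     one = (\<lambda>\<alpha>. if \<alpha> = replicate m 0 then \<one>\<^bsub>k\<^esub> else \<zero>\<^bsub>k\<^esub>),
     zero = (\<lambda>\<alpha>. \<zero>\<^bsub>k\<^esub>),
     add = (\<lambda>p q \<alpha>. p \<alpha> \<oplus>\<^bsub>k\<^esub> q \<alpha>),
     smult = (\<lambda>c p \<alpha>. c \<otimes>\<^bsub>k\<^esub> p \<alpha>)\<rparr>"

definition frac_class :: "('a, 'x) ring_scheme \<Rightarrow> 'a \<Rightarrow> 'a \<Rightarrow> ('a \<times> 'a) set" where
  "frac_class R a b =
     {(c, d). c \<in> carrier R \<and> d \<in> carrier R - {\<zero>\<^bsub>R\<^esub>} \<and> a \<otimes>\<^bsub>R\<^esub> d = c \<otimes>\<^bsub>R\<^esub> b}"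

text \<open>
  The field of fractions of a commutative domain \<open>R\<close> that is an algebra over a field.  In the
  operations, all representatives yield the same class, so the unions are over equal sets.
\<close>

definition frac_algebra :: "('k, 'a) module \<Rightarrow> ('k, ('a \<times> 'a) set) module" where
  "frac_algebra R =
    \<lparr>carrier = {frac_class R a b | a b. a \<in> carrier R \<and> b \<in> carrier R - {\<zero>\<^bsub>R\<^esub>}},
     mult = (\<lambda>X Y. \<Union>(a, b)\<in>X. \<Union>(c, d)\<in>Y. frac_class R (a \<otimes>\<^bsub>R\<^esub> c) (b \<otimes>\<^bsub>R\<^esub> d)),
     one = frac_class R \<one>\<^bsub>R\<^esub> \<one>\<^bsub>R\<^esub>,
     zero = frac_class R \<zero>\<^bsub>R\<^esub> \<one>\<^bsub>R\<^esub>,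
     add = (\<lambda>X Y. \<Union>(a, b)\<in>X. \<Union>(c, d)\<in>Y.
              frac_class R (a \<otimes>\<^bsub>R\<^esub> d \<oplus>\<^bsub>R\<^esub> c \<otimes>\<^bsub>R\<^esub> b) (b \<otimes>\<^bsub>R\<^esub> d)),
     smult = (\<lambda>s X. \<Union>(a, b)\<in>X. frac_class R (s \<odot>\<^bsub>R\<^esub> a) b)\<rparr>"

text \<open>
  For \<open>m = 0\<close> this is an isomorphic copy of \<open>k\<close>.
\<close>

definition rational_functions ::
  "('k, 'x) ring_scheme \<Rightarrow> nat \<Rightarrow> ('k, ((nat list \<Rightarrow> 'k) \<times> (nat list \<Rightarrow> 'k)) set) module" where
  "rational_functions k m = frac_algebra (mpoly_algebra k m)"

text \<open>
  \<open>free_product_ring Q A\<close> is the free abelian group on pairs \<open>(q, a)\<close>, multiplied by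
  \<open>(q, a) (q', a') = (q q', a a')\<close>.  The additive subgroup generated by the tensor relations is
  already a two-sided ideal, since multiplying a relation by a pair gives another relation;
  so the quotient by \<open>Idl\<close> below has the usual tensor product as its additive group.
\<close>

definition free_product_ring ::
  "('q, 'x) ring_scheme \<Rightarrow> ('a, 'y) ring_scheme \<Rightarrow> (('q \<times> 'a) \<Rightarrow>\<^sub>0 int) ring" where
  "free_product_ring Q A =
    \<lparr>carrier = {u. Poly_Mapping.keys u \<subseteq> carrier Q \<times> carrier A},
     mult = (\<lambda>u v. frag_extend (\<lambda>(q, a).
               frag_extend (\<lambda>(q', a'). frag_of (q \<otimes>\<^bsub>Q\<^esub> q', a \<otimes>\<^bsub>A\<^esub> a')) v) u),
     one = frag_of (\<one>\<^bsub>Q\<^esub>, \<one>\<^bsub>A\<^esub>),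
     zero = 0,
     add = (+)\<rparr>"

definition tensor_relations ::
  "('k, 'x) ring_scheme \<Rightarrow> ('k, 'q) module \<Rightarrow> ('k, 'a) module \<Rightarrow> (('q \<times> 'a) \<Rightarrow>\<^sub>0 int) set" where
  "tensor_relations k Q A =
     {frag_of (q \<oplus>\<^bsub>Q\<^esub> q', a) - frag_of (q, a) - frag_of (q', a) | q q' a.
        q \<in> carrier Q \<and> q' \<in> carrier Q \<and> a \<in> carrier A} \<union>
     {frag_of (q, a \<oplus>\<^bsub>A\<^esub> a') - frag_of (q, a) - frag_of (q, a') | q a a'.
        q \<in> carrier Q \<and> a \<in> carrier A \<and> a' \<in> carrier A} \<union>
     {frag_of (c \<odot>\<^bsub>Q\<^esub> q, a) - frag_of (q, c \<odot>\<^bsub>A\<^esub> a) | c q a.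
        c \<in> carrier k \<and> q \<in> carrier Q \<and> a \<in> carrier A}"

definition tensor_ideal ::
  "('k, 'x) ring_scheme \<Rightarrow> ('k, 'q) module \<Rightarrow> ('k, 'a) module \<Rightarrow> (('q \<times> 'a) \<Rightarrow>\<^sub>0 int) set" where
  "tensor_ideal k Q A = Idl\<^bsub>free_product_ring Q A\<^esub> (tensor_relations k Q A)"

text \<open>
  The tensor product of \<open>Q\<close> and \<open>A\<close> over \<open>k\<close>, as an algebra over the commutative algebra \<open>Q\<close>;
  \<open>q\<close> acts as multiplication by the class of \<open>(q, 1)\<close>.
\<close>

definition scalar_extension ::
  "('k, 'x) ring_scheme \<Rightarrow> ('k, 'q) module \<Rightarrow> ('k, 'a) module
     \<Rightarrow> ('q, (('q \<times> 'a) \<Rightarrow>\<^sub>0 int) set) module" where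
  "scalar_extension k Q A =
    (let F = free_product_ring Q A; I = tensor_ideal k Q A; T = F Quot I in
     \<lparr>carrier = carrier T, mult = mult T, one = one T, zero = zero T, add = add T,
      smult = (\<lambda>q X. (I +>\<^bsub>F\<^esub> frag_of (q, \<one>\<^bsub>A\<^esub>)) \<otimes>\<^bsub>T\<^esub> X)\<rparr>)"

locale poisson_algebra = algebra K P + field K
  for K :: "('k, 'x) ring_scheme" (structure) and P :: "('k, 'p) module" (structure) +
  fixes br :: "'p \<Rightarrow> 'p \<Rightarrow> 'p"
  assumes br_closed:
      "\<lbrakk>a \<in> carrier P; b \<in> carrier P\<rbrakk> \<Longrightarrow> br a b \<in> carrier P"
    and br_add_left:
      "\<lbrakk>a \<in> carrier P; b \<in> carrier P; c \<in> carrier P\<rbrakk>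
        \<Longrightarrow> br (a \<oplus>\<^bsub>P\<^esub> b) c = br a c \<oplus>\<^bsub>P\<^esub> br b c"
    and br_add_right:
      "\<lbrakk>a \<in> carrier P; b \<in> carrier P; c \<in> carrier P\<rbrakk>
        \<Longrightarrow> br a (b \<oplus>\<^bsub>P\<^esub> c) = br a b \<oplus>\<^bsub>P\<^esub> br a c"
    and br_smult_left:
      "\<lbrakk>s \<in> carrier K; a \<in> carrier P; b \<in> carrier P\<rbrakk>
        \<Longrightarrow> br (s \<odot>\<^bsub>P\<^esub> a) b = s \<odot>\<^bsub>P\<^esub> br a b"
    and br_smult_right:
      "\<lbrakk>s \<in> carrier K; a \<in> carrier P; b \<in> carrier P\<rbrakk>
        \<Longrightarrow> br a (s \<odot>\<^bsub>P\<^esub> b) = s \<odot>\<^bsub>P\<^esub> br a b"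
    and br_alternating:
      "a \<in> carrier P \<Longrightarrow> br a a = \<zero>\<^bsub>P\<^esub>"
    and br_jacobi:
      "\<lbrakk>a \<in> carrier P; b \<in> carrier P; c \<in> carrier P\<rbrakk>
        \<Longrightarrow> br a (br b c) \<oplus>\<^bsub>P\<^esub> br b (br c a) \<oplus>\<^bsub>P\<^esub> br c (br a b) = \<zero>\<^bsub>P\<^esub>"
    and br_leibniz:
      "\<lbrakk>a \<in> carrier P; x \<in> carrier P; y \<in> carrier P\<rbrakk>
        \<Longrightarrow> br a (x \<otimes>\<^bsub>P\<^esub> y) = br a x \<otimes>\<^bsub>P\<^esub> y \<oplus>\<^bsub>P\<^esub> x \<otimes>\<^bsub>P\<^esub> br a y"

definition End_algebra ::
  "('k, 'x) ring_scheme \<Rightarrow> ('k, 'p) module \<Rightarrow> ('k, 'p \<Rightarrow> 'p) module" where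
  "End_algebra K P =
    \<lparr>carrier = module_hom K P P \<inter> extensional (carrier P),
     mult = (\<lambda>f g. compose (carrier P) f g),
     one = (\<lambda>x\<in>carrier P. x),
     zero = (\<lambda>x\<in>carrier P. \<zero>\<^bsub>P\<^esub>),
     add = (\<lambda>f g. \<lambda>x\<in>carrier P. f x \<oplus>\<^bsub>P\<^esub> g x),
     smult = (\<lambda>c f. \<lambda>x\<in>carrier P. c \<odot>\<^bsub>P\<^esub> f x)\<rparr>"

definition mult_op :: "('k, 'p) module \<Rightarrow> 'p \<Rightarrow> 'p \<Rightarrow> 'p" where
  "mult_op P a = (\<lambda>x\<in>carrier P. a \<otimes>\<^bsub>P\<^esub> x)"

definition ad_op :: "('k, 'p) module \<Rightarrow> ('p \<Rightarrow> 'p \<Rightarrow> 'p) \<Rightarrow> 'p \<Rightarrow> 'p \<Rightarrow> 'p" where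
  "ad_op P br a = (\<lambda>x\<in>carrier P. br a x)"

text \<open>
  The algebra \<open>A(P)\<close>.  Multiplication operators and derivations are differential operators, so
  generating inside the ring of differential operators or inside all endomorphisms is the same.
\<close>

definition AP_algebra ::
  "('k, 'x) ring_scheme \<Rightarrow> ('k, 'p) module \<Rightarrow> ('p \<Rightarrow> 'p \<Rightarrow> 'p) \<Rightarrow> ('k, 'p \<Rightarrow> 'p) module" where
  "AP_algebra K P br =
     (End_algebra K P)\<lparr>carrier := gen_subalgebra K (End_algebra K P)
        (mult_op P ` carrier P \<union> ad_op P br ` carrier P)\<rparr>"

definition strongly_simple ::
  "('k, 'x) ring_scheme \<Rightarrow> ('k, 'p) module \<Rightarrow> ('p \<Rightarrow> 'p \<Rightarrow> 'p) \<Rightarrow> bool" where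
  "strongly_simple K P br \<longleftrightarrow>
     fin_gen_algebra K P \<and> domain P \<and>
     central_simple K (AP_algebra K P br) \<and>
     (\<forall>as. alg_independent K P as \<and> (\<forall>a\<in>set as. \<forall>b\<in>set as. br a b = \<zero>\<^bsub>P\<^esub>)
        \<longrightarrow> alg_independent K (AP_algebra K P br) (map (mult_op P) as @ map (ad_op P br) as))"

definition isotropic_subalgebra ::
  "('k, 'x) ring_scheme \<Rightarrow> ('k, 'p) module \<Rightarrow> ('p \<Rightarrow> 'p \<Rightarrow> 'p) \<Rightarrow> 'p set \<Rightarrow> bool" where
  "isotropic_subalgebra K P br C \<longleftrightarrow>
     is_subalgebra K P C \<and> (\<forall>a\<in>C. \<forall>b\<in>C. br a b = \<zero>\<^bsub>P\<^esub>)"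

text \<open>
  The invariant \<open>f_A(P)\<close>, where \<open>d\<close> is the filter dimension or the left filter dimension.  The
  index set is finite because \<open>A(P)\<close> has finite Gelfand-Kirillov dimension.
\<close>

definition f_AP where
  "f_AP d K P br =
     (Max ((\<lambda>m. d (rational_functions K m)
                  (scalar_extension K (rational_functions K m) (AP_algebra K P br)))
           ` {m::nat. ereal (real m) \<le> GK K (AP_algebra K P br)}) :: ereal)"

end

(*
  Algebraically independent elements a_1,...,a_r of C give n = 2r commuting algebraically
  independent elements c_l of A = A(P), namely the multiplications by the a_l and the derivations
  ad(a_l).  Let Q = K(x_1,...,x_n), let T = Q (x) A, and let N be a proper left ideal of T that
  contains all c_l - x_l.  Write D(i) for the dimension of the i-th filtration step of A and
  R(j) for the dimension over Q of its image in T/N.  Lifting a basis of that image and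
  multiplying by monomials in the c_l keeps independence, so R(j) (i+1)^n <= D(j + c i).  On the
  other hand, if j is the value of the (left) return function at i, then a nonzero element of
  degree i cannot map the image of degree j to 0, whence, up to constants in the arguments,
  D(i) <= R(j) R(i + j).  Combining both estimates yields n <= GK(A) (1 - 1 / (f + max(f, 1))),
  which is the bound for r.

  The largest possible r bounds GK(C): in a commutative algebra, the monomials that are not
  combinations of deglex-smaller ones have at most r large exponents.  Moreover GK(A) is
  finite, because a differential operator of order at most i is determined by its values in
  degree at most i.
*)
theory Submission
  imports Defs "HOL-Algebra.Free_Abelian_Groups"
begin

section \<open>Finite sums and linear algebra\<close>

text \<open>The delicate point is that N exists: nothing allows K[c] = K[c_1,...,c_n] to be inverted
  inside A, and 1 could a priori lie in the left ideal generated by the c_l - x_l. A K-linear map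
  phi from A to Q with phi(1) = 1 and phi(b c_l) = phi(b) x_l suffices: extend it to a Q-linear map
  H on T and take the largest left ideal in its kernel. To find phi, regard A as a right K[c]-module
  and choose a submodule maximal among those meeting K[c] in 0; the quotient is an essential
  extension of K[c], so it embeds in the fraction field. Central simplicity enters through a density
  theorem: the operators a -> sum x a y separate linearly independent elements of A. Thus K-bases of
  A stay independent in T, and the return functions of T are finite. The term max(f, 1) stems from
  R(i + j), whose argument grows like i^max(f, 1) when j grows like i^f. The first estimate and R(j)
  >= 1 alone give n \<le> GK(A); this settles f = infinity and shows that m = n is an index of the
  maximum that defines f.\<close>

lemma finsum_hom:
  assumes "abelian_monoid G" "abelian_monoid H"
    and "h \<in> carrier G \<rightarrow> carrier H" and "h \<zero>\<^bsub>G\<^esub> = \<zero>\<^bsub>H\<^esub>"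
    and "\<And>x y. x \<in> carrier G \<Longrightarrow> y \<in> carrier G \<Longrightarrow> h (x \<oplus>\<^bsub>G\<^esub> y) = h x \<oplus>\<^bsub>H\<^esub> h y"
    and "f \<in> I \<rightarrow> carrier G"
  shows "h (finsum G f I) = finsum H (\<lambda>i. h (f i)) I"
proof -
  interpret G: abelian_monoid G by fact
  interpret H: abelian_monoid H by fact
  show ?thesis
    using assms(6)
  proof (induction I rule: infinite_finite_induct)
    case (infinite I) then show ?case using assms(4) by simp
  next
    case empty then show ?case using assms(4) by simp
  next
    case (insert i I)
    have "(\<lambda>i. h (f i)) \<in> I \<rightarrow> carrier H" "h (f i) \<in> carrier H"
      using insert.prems assms(3) by auto
    then show ?case using insert assms(5)
      by (auto simp: G.finsum_insert H.finsum_insert Pi_iff G.finsum_closed)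
  qed
qed

context abelian_monoid
begin

lemma finsum_swap:
  assumes "finite I" "finite J" and "\<And>i j. i \<in> I \<Longrightarrow> j \<in> J \<Longrightarrow> f i j \<in> carrier G"
  shows "(\<Oplus>i\<in>I. \<Oplus>j\<in>J. f i j) = (\<Oplus>j\<in>J. \<Oplus>i\<in>I. f i j)"
  using assms(1,3)
proof (induction I)
  case empty then show ?case by (simp add: finsum_zero)
next
  case (insert i I)
  have "(\<Oplus>j\<in>J. \<Oplus>i\<in>insert i I. f i j) = (\<Oplus>j\<in>J. f i j \<oplus> (\<Oplus>i\<in>I. f i j))"
    using insert by (intro finsum_cong') (auto simp: finsum_insert Pi_iff intro!: finsum_closed)
  also have "\<dots> = (\<Oplus>j\<in>J. f i j) \<oplus> (\<Oplus>j\<in>J. \<Oplus>i\<in>I. f i j)"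
    using insert by (intro finsum_addf) (auto intro!: finsum_closed)
  finally show ?case using insert by (subst finsum_insert) (auto intro!: finsum_closed)
qed

lemma finsum_Sigma:
  assumes "finite I" "\<And>i. i \<in> I \<Longrightarrow> finite (J i)"
    and "\<And>i j. i \<in> I \<Longrightarrow> j \<in> J i \<Longrightarrow> f i j \<in> carrier G"
  shows "(\<Oplus>i\<in>I. \<Oplus>j\<in>J i. f i j) = finsum G (\<lambda>(i, j). f i j) (Sigma I J)"
  using assms
proof (induction I)
  case empty then show ?case by simp
next
  case (insert i I)
  have "finsum G (\<lambda>(i, j). f i j) (Sigma (insert i I) J) = finsum G (\<lambda>(i, j). f i j) (Pair i ` J i \<union> Sigma I J)"
    by (intro arg_cong[where f = "finsum G (\<lambda>(i, j). f i j)"]) auto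
  also have "\<dots> = finsum G (\<lambda>(i, j). f i j) (Pair i ` J i) \<oplus> finsum G (\<lambda>(i, j). f i j) (Sigma I J)"
    using insert by (intro finsum_Un_disjoint) auto
  also have "finsum G (\<lambda>(i, j). f i j) (Pair i ` J i) = (\<Oplus>j\<in>J i. f i j)"
    using insert by (subst finsum_reindex) (auto simp: inj_on_def)
  finally show ?case using insert by (subst finsum_insert) (auto intro!: finsum_closed)
qed

lemma finsum_single:
  assumes "finite I" "i \<in> I" "f \<in> I \<rightarrow> carrier G" "\<And>j. j \<in> I \<Longrightarrow> j \<noteq> i \<Longrightarrow> f j = \<zero>"
  shows "finsum G f I = f i"
proof -
  have "finsum G f I = (\<Oplus>j\<in>I. if i = j then f j else \<zero>)"
    using assms by (intro finsum_cong') auto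
  then show ?thesis using assms finsum_singleton[of i I f] by simp
qed

lemma finsum_superset:
  assumes "finite J" "I \<subseteq> J" "f \<in> I \<rightarrow> carrier G" "\<And>j. j \<in> J - I \<Longrightarrow> f j = \<zero>"
  shows "finsum G f J = finsum G f I"
  using assms by (intro add.finprod_mono_neutral_cong_left[symmetric]) auto

end

text \<open>Gaussian elimination by induction on the set of equations: an equation with a non-zero
  coefficient is solved for one unknown. This removes one equation and one unknown and so keeps the
  strict inequality of cardinalities.\<close>

lemma (in field) homogeneous_system:
  assumes "finite J" "finite I" "card J < card I"
    and "\<And>i j. i \<in> I \<Longrightarrow> j \<in> J \<Longrightarrow> m i j \<in> carrier R"
  shows "\<exists>c\<in>I \<rightarrow> carrier R. (\<exists>i\<in>I. c i \<noteq> \<zero>) \<and> (\<forall>j\<in>J. (\<Oplus>i\<in>I. c i \<otimes> m i j) = \<zero>)"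
  using assms
proof (induction J arbitrary: I m)
  case empty
  then have "I \<noteq> {}" by auto
  then show ?case by (intro bexI[of _ "\<lambda>_. \<one>"]) auto
next
  case (insert j0 J)
  show ?case
  proof (cases "\<forall>i\<in>I. m i j0 = \<zero>")
    case True
    obtain c where c: "c \<in> I \<rightarrow> carrier R" "\<exists>i\<in>I. c i \<noteq> \<zero>" "\<forall>j\<in>J. (\<Oplus>i\<in>I. c i \<otimes> m i j) = \<zero>"
      using insert.IH[of I m] insert.prems insert.hyps by auto
    have "(\<Oplus>i\<in>I. c i \<otimes> m i j0) = (\<Oplus>i\<in>I. \<zero>)"
      using True c(1) by (intro finsum_cong') (auto simp: Pi_iff intro!: r_null)
    then show ?thesis using c by (intro bexI[of _ c]) auto
  next
    case False
    then obtain i0 where i0: "i0 \<in> I" "m i0 j0 \<noteq> \<zero>" by auto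
    define p where "p = m i0 j0"
    define I' where "I' = I - {i0}"
    have p: "p \<in> carrier R" "inv p \<in> carrier R" "inv p \<otimes> p = \<one>"
      using i0 insert.prems(3) by (auto simp: p_def field_Units)
    have mc: "\<And>i j. i \<in> I \<Longrightarrow> j \<in> insert j0 J \<Longrightarrow> m i j \<in> carrier R" using insert.prems(3) by blast
    have fI: "finite I'" "I = insert i0 I'" "i0 \<notin> I'" using insert.prems i0 by (auto simp: I'_def)
    \<comment> \<open>Multiples of row \<open>i0\<close> are subtracted so that every other entry of
      column \<open>j0\<close> would become zero; the remaining columns form the smaller
      system.\<close>
    define m' where "m' i j = m i j \<ominus> m i j0 \<otimes> (inv p \<otimes> m i0 j)" for i j
    have "card J < card I'" using insert.prems insert.hyps fI by auto
    moreover have "\<And>i j. i \<in> I' \<Longrightarrow> j \<in> J \<Longrightarrow> m' i j \<in> carrier R"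
      using mc p i0 by (auto simp: m'_def fI)
    ultimately obtain c where c: "c \<in> I' \<rightarrow> carrier R" "\<exists>i\<in>I'. c i \<noteq> \<zero>"
        "\<forall>j\<in>J. (\<Oplus>i\<in>I'. c i \<otimes> m' i j) = \<zero>"
      using insert.IH[of I' m'] fI by blast
    define s where "s = (\<Oplus>i\<in>I'. c i \<otimes> m i j0)"
    have s: "s \<in> carrier R" unfolding s_def using c mc fI by (intro finsum_closed) auto
    \<comment> \<open>The value at \<open>i0\<close> is forced by equation \<open>j0\<close>, which
      now reads s + d(i0) p = 0.\<close>
    define d where "d = c(i0 := \<ominus> (s \<otimes> inv p))"
    have d: "d \<in> I \<rightarrow> carrier R" "\<exists>i\<in>I. d i \<noteq> \<zero>"
      using c fI s p by (auto simp: d_def)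
    have split: "(\<Oplus>i\<in>I. d i \<otimes> m i j) = \<ominus> (s \<otimes> inv p) \<otimes> m i0 j \<oplus> (\<Oplus>i\<in>I'. c i \<otimes> m i j)"
      if j: "j \<in> insert j0 J" for j
    proof -
      have "(\<Oplus>i\<in>I. d i \<otimes> m i j) = d i0 \<otimes> m i0 j \<oplus> (\<Oplus>i\<in>I'. d i \<otimes> m i j)"
        unfolding fI(2) using fI mc[OF _ j] d by (intro finsum_insert) auto
      also have "(\<Oplus>i\<in>I'. d i \<otimes> m i j) = (\<Oplus>i\<in>I'. c i \<otimes> m i j)"
        using fI mc[OF _ j] c by (intro finsum_cong') (auto simp: d_def)
      finally show ?thesis by (simp add: d_def)
    qed
    have "(\<Oplus>i\<in>I. d i \<otimes> m i j) = \<zero>" if j: "j \<in> J" for j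
    proof -
      have mj: "\<And>i. i \<in> I \<Longrightarrow> m i j \<in> carrier R" using mc j by auto
      have sc: "(\<Oplus>i\<in>I'. c i \<otimes> m i j) \<in> carrier R"
        using c mj fI by (intro finsum_closed) auto
      have q: "inv p \<otimes> m i0 j \<in> carrier R" using p mj i0 by auto
      have cc: "\<And>i. i \<in> I' \<Longrightarrow> c i \<in> carrier R" using c by auto
      have "\<zero> = (\<Oplus>i\<in>I'. c i \<otimes> m' i j)" using c j by auto
      also have "\<dots> = (\<Oplus>i\<in>I'. c i \<otimes> m i j \<oplus> (c i \<otimes> m i j0) \<otimes> (\<ominus> (inv p \<otimes> m i0 j)))"
        using cc mj mc fI q
        by (intro finsum_cong') (auto simp: m'_def r_distr a_minus_def r_minus m_assoc Pi_iff)
      also have "\<dots> = (\<Oplus>i\<in>I'. c i \<otimes> m i j) \<oplus> (\<Oplus>i\<in>I'. (c i \<otimes> m i j0) \<otimes> (\<ominus> (inv p \<otimes> m i0 j)))"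
        using cc mj mc fI q by (intro finsum_addf) auto
      also have "(\<Oplus>i\<in>I'. (c i \<otimes> m i j0) \<otimes> (\<ominus> (inv p \<otimes> m i0 j))) = s \<otimes> (\<ominus> (inv p \<otimes> m i0 j))"
        unfolding s_def using cc mj mc fI q by (intro finsum_ldistr[symmetric]) auto
      also have "\<dots> = \<ominus> (s \<otimes> inv p) \<otimes> m i0 j"
        using s p mj i0 q by (simp add: r_minus l_minus m_assoc)
      finally show ?thesis using split[of j] j sc s p mj i0 by (simp add: a_comm)
    qed
    moreover have "(\<Oplus>i\<in>I. d i \<otimes> m i j0) = \<zero>"
      using split[of j0] s p by (simp add: s_def[symmetric] p_def[symmetric] l_minus m_assoc l_neg)
    ultimately show ?thesis using d by (intro bexI[of _ d]) auto
  qed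
qed

text \<open>Linear independence of the family \<open>v\<close> modulo the submodule \<open>N\<close>.\<close>

definition indep_mod :: "('k, 'x) ring_scheme \<Rightarrow> ('k, 'a, 'y) module_scheme \<Rightarrow> 'a set \<Rightarrow> 'i set \<Rightarrow> ('i \<Rightarrow> 'a) \<Rightarrow> bool" where
  "indep_mod K V N I v \<longleftrightarrow>
     (\<forall>c\<in>I \<rightarrow> carrier K. (\<Oplus>\<^bsub>V\<^esub>i\<in>I. c i \<odot>\<^bsub>V\<^esub> v i) \<in> N \<longrightarrow> (\<forall>i\<in>I. c i = \<zero>\<^bsub>K\<^esub>))"

abbreviation indep where "indep K V \<equiv> indep_mod K V {\<zero>\<^bsub>V\<^esub>}"

lemma (in module) submodule_finsum:
  assumes "submodule R N M" "f \<in> I \<rightarrow> N"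
  shows "finsum M f I \<in> N"
proof -
  interpret N: submodule R N M by fact
  show ?thesis using assms(2)
  proof (induction I rule: infinite_finite_induct)
    case (insert i I)
    have "f \<in> I \<rightarrow> carrier M" "f i \<in> carrier M" using insert.prems N.subset by auto
    then show ?case using insert by (auto simp: M.finsum_insert)
  qed auto
qed

lemma (in module) submodule_uminus:
  assumes "submodule R N M" "x \<in> N"
  shows "\<ominus>\<^bsub>M\<^esub> x \<in> N"
proof -
  interpret N: submodule R N M by fact
  have "(\<ominus> \<one>) \<odot>\<^bsub>M\<^esub> x \<in> N" using assms by auto
  moreover have "x \<in> carrier M" using assms N.subset by auto
  ultimately show ?thesis by (simp add: smult_l_minus)
qed

lemma (in module) submodule_minus:
  assumes "submodule R N M" "x \<in> N" "y \<in> N"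
  shows "x \<ominus>\<^bsub>M\<^esub> y \<in> N"
  using assms submodule_uminus[OF assms(1,3)] unfolding a_minus_def
  by (simp add: submodule.m_closed)

lemma (in module) zero_submodule: "submodule R {\<zero>\<^bsub>M\<^esub>} M"
  by unfold_locales auto

context vectorspace
begin

text \<open>The coefficients of the \<open>v i\<close> in the \<open>w j\<close> form a homogeneous
  system with more unknowns than equations. A non-zero solution cancels the \<open>w\<close> part
  and leaves a combination of elements of N. The statement is made modulo N because quotient spaces
  are never formed.\<close>

lemma dependent_mod:
  assumes N: "submodule K N V" and fin: "finite I" "finite J" and card: "card J < card I"
    and v: "v \<in> I \<rightarrow> carrier V" and w: "w \<in> J \<rightarrow> carrier V"
    and m: "\<And>i. i \<in> I \<Longrightarrow> \<exists>c\<in>J \<rightarrow> carrier K. v i \<ominus>\<^bsub>V\<^esub> (\<Oplus>\<^bsub>V\<^esub>j\<in>J. c j \<odot>\<^bsub>V\<^esub> w j) \<in> N"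
  shows "\<not> indep_mod K V N I v"
proof -
  interpret N: submodule K N V by fact
  obtain m where mc: "\<And>i. i \<in> I \<Longrightarrow> m i \<in> J \<rightarrow> carrier K"
    and mN: "\<And>i. i \<in> I \<Longrightarrow> v i \<ominus>\<^bsub>V\<^esub> (\<Oplus>\<^bsub>V\<^esub>j\<in>J. m i j \<odot>\<^bsub>V\<^esub> w j) \<in> N"
    using m by metis
  obtain c where c: "c \<in> I \<rightarrow> carrier K" "\<exists>i\<in>I. c i \<noteq> \<zero>\<^bsub>K\<^esub>"
      "\<forall>j\<in>J. (\<Oplus>\<^bsub>K\<^esub>i\<in>I. c i \<otimes>\<^bsub>K\<^esub> m i j) = \<zero>\<^bsub>K\<^esub>"
    using homogeneous_system[OF fin(2,1) card, of m] mc by blast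
  define u where "u i = (\<Oplus>\<^bsub>V\<^esub>j\<in>J. m i j \<odot>\<^bsub>V\<^esub> w j)" for i
  have mw: "m i j \<odot>\<^bsub>V\<^esub> w j \<in> carrier V" if "i \<in> I" "j \<in> J" for i j
    using mc[OF that(1)] that w by auto
  have u: "u i \<in> carrier V" if "i \<in> I" for i
    unfolding u_def using mw that by (intro M.finsum_closed) auto
  have cw: "c i \<in> carrier K" if "i \<in> I" for i using c that by auto
  have "(\<Oplus>\<^bsub>V\<^esub>i\<in>I. c i \<odot>\<^bsub>V\<^esub> u i) = (\<Oplus>\<^bsub>V\<^esub>i\<in>I. \<Oplus>\<^bsub>V\<^esub>j\<in>J. c i \<odot>\<^bsub>V\<^esub> (m i j \<odot>\<^bsub>V\<^esub> w j))"
    unfolding u_def using cw mw fin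
    by (intro M.finsum_cong') (auto simp: finsum_smult[symmetric] Pi_iff intro!: M.finsum_closed)
  also have "\<dots> = (\<Oplus>\<^bsub>V\<^esub>j\<in>J. \<Oplus>\<^bsub>V\<^esub>i\<in>I. c i \<odot>\<^bsub>V\<^esub> (m i j \<odot>\<^bsub>V\<^esub> w j))"
    using cw mw fin by (intro M.finsum_swap) auto
  also have "\<dots> = (\<Oplus>\<^bsub>V\<^esub>j\<in>J. \<zero>\<^bsub>V\<^esub>)"
  proof (intro M.finsum_cong')
    fix j assume j: "j \<in> J"
    then have wj: "w j \<in> carrier V" using w by auto
    have mj: "\<And>i. i \<in> I \<Longrightarrow> m i j \<in> carrier K" using mc j by auto
    have "(\<Oplus>\<^bsub>V\<^esub>i\<in>I. c i \<odot>\<^bsub>V\<^esub> (m i j \<odot>\<^bsub>V\<^esub> w j)) = (\<Oplus>\<^bsub>V\<^esub>i\<in>I. (c i \<otimes>\<^bsub>K\<^esub> m i j) \<odot>\<^bsub>V\<^esub> w j)"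
      using cw mj wj by (intro M.finsum_cong') (auto simp: smult_assoc1)
    also have "\<dots> = (\<Oplus>\<^bsub>K\<^esub>i\<in>I. c i \<otimes>\<^bsub>K\<^esub> m i j) \<odot>\<^bsub>V\<^esub> w j"
      using cw mj wj
      by (intro finsum_hom[symmetric, where h = "\<lambda>x. x \<odot>\<^bsub>V\<^esub> w j"])
        (auto simp: smult_l_distr intro: M.abelian_monoid_axioms R.abelian_monoid_axioms)
    finally show "(\<Oplus>\<^bsub>V\<^esub>i\<in>I. c i \<odot>\<^bsub>V\<^esub> (m i j \<odot>\<^bsub>V\<^esub> w j)) = \<zero>\<^bsub>V\<^esub>" using c j wj by simp
  qed auto
  finally have z: "(\<Oplus>\<^bsub>V\<^esub>i\<in>I. c i \<odot>\<^bsub>V\<^esub> u i) = \<zero>\<^bsub>V\<^esub>" by simp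
  have vi: "\<And>i. i \<in> I \<Longrightarrow> v i \<in> carrier V" using v by auto
  have eq: "c i \<odot>\<^bsub>V\<^esub> v i = c i \<odot>\<^bsub>V\<^esub> (v i \<ominus>\<^bsub>V\<^esub> u i) \<oplus>\<^bsub>V\<^esub> c i \<odot>\<^bsub>V\<^esub> u i" if "i \<in> I" for i
    using cw[OF that] vi[OF that] u[OF that]
    by (simp add: smult_r_distr[symmetric] a_minus_def M.a_assoc M.l_neg)
  have "(\<Oplus>\<^bsub>V\<^esub>i\<in>I. c i \<odot>\<^bsub>V\<^esub> v i) = (\<Oplus>\<^bsub>V\<^esub>i\<in>I. c i \<odot>\<^bsub>V\<^esub> (v i \<ominus>\<^bsub>V\<^esub> u i) \<oplus>\<^bsub>V\<^esub> c i \<odot>\<^bsub>V\<^esub> u i)"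
    using cw vi u by (intro M.finsum_cong' refl) (auto simp: eq[symmetric])
  also have "\<dots> = (\<Oplus>\<^bsub>V\<^esub>i\<in>I. c i \<odot>\<^bsub>V\<^esub> (v i \<ominus>\<^bsub>V\<^esub> u i)) \<oplus>\<^bsub>V\<^esub> (\<Oplus>\<^bsub>V\<^esub>i\<in>I. c i \<odot>\<^bsub>V\<^esub> u i)"
    using cw vi u by (intro M.finsum_addf) auto
  also have "\<dots> = (\<Oplus>\<^bsub>V\<^esub>i\<in>I. c i \<odot>\<^bsub>V\<^esub> (v i \<ominus>\<^bsub>V\<^esub> u i))"
    using z cw vi u by (simp add: M.finsum_closed Pi_iff)
  also have "\<dots> \<in> N"
    using mN cw by (intro submodule_finsum[OF N]) (auto simp: u_def)
  finally show ?thesis using c unfolding indep_mod_def by blast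
qed

lemma dependent:
  assumes fin: "finite I" "finite J" and card: "card J < card I"
    and v: "v \<in> I \<rightarrow> carrier V" and w: "w \<in> J \<rightarrow> carrier V"
    and m: "\<And>i. i \<in> I \<Longrightarrow> \<exists>c\<in>J \<rightarrow> carrier K. v i = (\<Oplus>\<^bsub>V\<^esub>j\<in>J. c j \<odot>\<^bsub>V\<^esub> w j)"
  shows "\<not> indep K V I v"
proof (rule dependent_mod[OF zero_submodule fin card v w])
  fix i assume i: "i \<in> I"
  then obtain c where "c\<in>J \<rightarrow> carrier K" "v i = (\<Oplus>\<^bsub>V\<^esub>j\<in>J. c j \<odot>\<^bsub>V\<^esub> w j)" using m by blast
  then show "\<exists>c\<in>J \<rightarrow> carrier K. v i \<ominus>\<^bsub>V\<^esub> (\<Oplus>\<^bsub>V\<^esub>j\<in>J. c j \<odot>\<^bsub>V\<^esub> w j) \<in> {\<zero>\<^bsub>V\<^esub>}"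
    using v i by (intro bexI[of _ c]) (auto simp: a_minus_def M.r_neg Pi_iff)
qed

lemma span_eq_combinations:
  assumes "finite G" "G \<subseteq> carrier V"
  shows "span G = {\<Oplus>\<^bsub>V\<^esub>g\<in>G. c g \<odot>\<^bsub>V\<^esub> g | c. c \<in> G \<rightarrow> carrier K}"
  using finite_span[OF assms] by (simp add: lincomb_def)

lemma indep_iff_lin_indpt:
  assumes "finite B" "B \<subseteq> carrier V"
  shows "indep K V B (\<lambda>x. x) \<longleftrightarrow> lin_indpt B"
proof
  assume *: "indep K V B (\<lambda>x. x)"
  show "lin_indpt B"
    using * assms by (intro finite_lin_indpt2) (auto simp: indep_mod_def lincomb_def)
next
  assume "lin_indpt B"
  then show "indep K V B (\<lambda>x. x)"
    using assms unfolding indep_mod_def lin_dep_def lincomb_def by blast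
qed

text \<open>Bridge between the dimension of a restricted record and families in the ambient space:
  all later dimension counts compare independent and spanning families in V.\<close>

lemma subspace_basis:
  assumes G: "finite G" "G \<subseteq> carrier V" and W: "W = span G"
  obtains B where "finite B" "B \<subseteq> W" "card B = vectorspace.dim K (V\<lparr>carrier := W\<rparr>)"
    "indep K V B (\<lambda>x. x)" "\<And>w. w \<in> W \<Longrightarrow> \<exists>c\<in>B \<rightarrow> carrier K. w = (\<Oplus>\<^bsub>V\<^esub>b\<in>B. c b \<odot>\<^bsub>V\<^esub> b)"
proof -
  have sub: "submodule K W V" unfolding W by (rule span_is_submodule) fact
  interpret W: submodule K W V by fact
  interpret VW: vectorspace K "V\<lparr>carrier := W\<rparr>"
    by (rule subspace_is_vs) (auto simp: subspace_def sub vectorspace_axioms)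
  have GW: "G \<subseteq> W" unfolding W by (rule in_own_span) fact
  have "VW.fin_dim"
    unfolding VW.fin_dim_def using G GW span_li_not_depend(1)[OF GW sub] W by auto
  then obtain B where B: "finite B" "VW.basis B" using VW.finite_basis_exists by auto
  have BW: "B \<subseteq> W" "B \<subseteq> carrier V" using B W.subset unfolding VW.basis_def by auto
  have sp: "span B = W" using B(2) span_li_not_depend(1)[OF BW(1) sub] by (simp add: VW.basis_def)
  have "lin_indpt B" using B(2) span_li_not_depend(2)[OF BW(1) sub] by (simp add: VW.basis_def)
  then have "indep K V B (\<lambda>x. x)" using indep_iff_lin_indpt B BW by simp
  moreover have "\<exists>c\<in>B \<rightarrow> carrier K. w = (\<Oplus>\<^bsub>V\<^esub>b\<in>B. c b \<odot>\<^bsub>V\<^esub> b)" if "w \<in> W" for w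
    using that unfolding sp[symmetric] span_eq_combinations[OF B(1) BW(2)] by auto
  ultimately show ?thesis using that B BW VW.dim_basis by auto
qed

lemma indep_card_le_dim:
  assumes G: "finite G" "G \<subseteq> carrier V" and W: "W = span G"
    and I: "finite I" "v \<in> I \<rightarrow> W" "indep K V I v"
  shows "card I \<le> vectorspace.dim K (V\<lparr>carrier := W\<rparr>)"
proof -
  obtain B where B: "finite B" "B \<subseteq> W" "card B = vectorspace.dim K (V\<lparr>carrier := W\<rparr>)"
    "\<And>w. w \<in> W \<Longrightarrow> \<exists>c\<in>B \<rightarrow> carrier K. w = (\<Oplus>\<^bsub>V\<^esub>b\<in>B. c b \<odot>\<^bsub>V\<^esub> b)"
    by (rule subspace_basis[OF G W]) blast
  have "W \<subseteq> carrier V" unfolding W by (rule span_is_subset2) fact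
  then have "v \<in> I \<rightarrow> carrier V" "(\<lambda>x. x) \<in> B \<rightarrow> carrier V" using I B by auto
  moreover have "\<exists>c\<in>B \<rightarrow> carrier K. v i = (\<Oplus>\<^bsub>V\<^esub>b\<in>B. c b \<odot>\<^bsub>V\<^esub> b)" if "i \<in> I" for i
    using B(4)[of "v i"] I(2) that by blast
  ultimately show ?thesis
    using dependent[OF I(1) B(1), of v "\<lambda>x. x"] I(3) B(3) by fastforce
qed

lemma dim_le_card:
  assumes G: "finite G" "G \<subseteq> carrier V" and W: "W = span G"
    and J: "finite J" "w \<in> J \<rightarrow> carrier V"
    and m: "\<And>x. x \<in> W \<Longrightarrow> \<exists>c\<in>J \<rightarrow> carrier K. x = (\<Oplus>\<^bsub>V\<^esub>j\<in>J. c j \<odot>\<^bsub>V\<^esub> w j)"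
  shows "vectorspace.dim K (V\<lparr>carrier := W\<rparr>) \<le> card J"
proof -
  obtain B where B: "finite B" "B \<subseteq> W" "card B = vectorspace.dim K (V\<lparr>carrier := W\<rparr>)"
    "indep K V B (\<lambda>x. x)"
    by (rule subspace_basis[OF G W]) blast
  have "W \<subseteq> carrier V" unfolding W by (rule span_is_subset2) fact
  then have "(\<lambda>x. x) \<in> B \<rightarrow> carrier V" using B by auto
  moreover have "\<exists>c\<in>J \<rightarrow> carrier K. b = (\<Oplus>\<^bsub>V\<^esub>j\<in>J. c j \<odot>\<^bsub>V\<^esub> w j)" if "b \<in> B" for b
    using m[of b] B(2) that by blast
  ultimately show ?thesis
    using dependent[OF B(1) J(1), of "\<lambda>x. x" w] B(3,4) J(2) by fastforce
qed

end


section \<open>Growth\<close>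

lemma growth_le:
  assumes "0 \<le> r" "eventually (\<lambda>i. real (f i) \<le> real i powr r) sequentially"
  shows "growth f \<le> ereal r"
  unfolding growth_def using assms by (intro Inf_lower) auto

lemma growth_nonneg: "0 \<le> growth f"
  unfolding growth_def by (auto intro!: Inf_greatest)

lemma growth_less_imp:
  assumes "growth f < ereal r"
  shows "eventually (\<lambda>i. real (f i) \<le> real i powr r) sequentially"
proof -
  obtain s where s: "0 \<le> s" "eventually (\<lambda>i. real (f i) \<le> real i powr s) sequentially" "s < r"
    using assms unfolding growth_def Inf_less_iff by auto
  show ?thesis
    using s(2) eventually_ge_at_top[of 1]
  proof eventually_elim
    case (elim i)
    then have "real i powr s \<le> real i powr r" using s(3) by (intro powr_mono) auto
    then show ?case using elim by linarith
  qed
qed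

text \<open>A constant factor is eventually below i^e for each e > 0, so it raises the exponent by
  at most e and disappears in the infimum.\<close>

lemma growth_le_mult:
  assumes "0 \<le> r" "eventually (\<lambda>i. real (f i) \<le> C * real i powr r) sequentially"
  shows "growth f \<le> ereal r"
proof (rule ereal_le_epsilon2)
  fix e :: real assume e: "0 < e"
  \<comment> \<open>From this threshold on, i^e exceeds C; the maximum with 1 keeps the base of the
    power positive for every real C.\<close>
  have "eventually (\<lambda>i. max C 1 powr (1 / e) \<le> real i) sequentially"
    using filterlim_real_sequentially by (simp add: filterlim_at_top)
  then have "eventually (\<lambda>i. C \<le> real i powr e) sequentially"
  proof eventually_elim
    case (elim i)
    have "C \<le> (max C 1 powr (1 / e)) powr e" using e by (simp add: powr_powr)
    also have "\<dots> \<le> real i powr e" using elim e by (intro powr_mono2) auto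
    finally show ?case .
  qed
  then have "eventually (\<lambda>i. real (f i) \<le> real i powr (r + e)) sequentially"
    using assms(2)
  proof eventually_elim
    case (elim i)
    have "C * real i powr r \<le> real i powr e * real i powr r" using elim by (intro mult_right_mono) auto
    then show ?case using elim by (simp add: powr_add mult.commute)
  qed
  then have "growth f \<le> ereal (r + e)" using assms e by (intro growth_le) auto
  then show "growth f \<le> ereal r + ereal e" by simp
qed

text \<open>The purely numerical half of the argument. \<open>lower\<close> and \<open>upper\<close>
  are the two estimates with one common constant c; M is the number of commuting elements, and
  \<open>nu\<close> will be either return function of the scalar extension.\<close>

locale growth_data =
  fixes D rk nu :: "nat \<Rightarrow> nat" and c M :: nat and g :: real
  assumes upper: "\<And>i. D i \<le> rk (c * nu (c * i)) * rk (i + c * nu (c * i))"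
    and lower: "\<And>i j. rk j * (i + 1) ^ M \<le> D (j + c * i)"
    and rk_pos: "1 \<le> rk 0" and rk_mono: "mono rk"
    and g: "growth D = ereal g"
begin

text \<open>Taking i = j = n in \<open>lower\<close> compares rk(n) n^M with D((1 + c) n), so the
  ranks grow with exponent at most r - M. Since ranks are at least 1, this exponent cannot be
  negative, which is the inequality M \<le> r.\<close>

lemma rank_bound:
  assumes r: "g < r"
  obtains C where "0 < C" "\<And>n. real (rk n) \<le> C * (real n + 1) powr (r - M)" "real M \<le> r"
proof -
  have "eventually (\<lambda>i. real (D i) \<le> real i powr r) sequentially"
    using growth_less_imp[of D r] g r by simp
  then obtain n0 where n0: "\<And>i. i \<ge> n0 \<Longrightarrow> real (D i) \<le> real i powr r"
    by (auto simp: eventually_sequentially)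
  \<comment> \<open>From (n + c n)^r = (1 + c)^r n^r.\<close>
  define C where "C = (1 + real c) powr r"
  have C: "0 < C" unfolding C_def by simp
  have b: "real (rk n) \<le> C * real n powr (r - M)" if n: "n \<ge> max n0 1" for n
  proof -
    have "real (rk n) * real n ^ M \<le> real (rk n) * (real n + 1) ^ M"
      by (intro mult_left_mono power_mono) auto
    also have "\<dots> \<le> real (D (n + c * n))"
      using lower[of n n] by (metis of_nat_1 of_nat_add of_nat_le_iff of_nat_mult of_nat_power)
    also have "\<dots> \<le> real (n + c * n) powr r" using n by (intro n0) auto
    also have "\<dots> = C * real n powr r"
      unfolding C_def by (simp add: powr_mult[symmetric] algebra_simps)
    finally have "real (rk n) \<le> C * real n powr r / real n ^ M"
      using n by (simp add: field_simps)
    also have "\<dots> = C * real n powr (r - M)" using n by (simp add: powr_diff powr_realpow)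
    finally show ?thesis .
  qed
  have Mr: "real M \<le> r"
  proof (rule ccontr)
    assume "\<not> real M \<le> r"
    then have "((\<lambda>i. real i powr (r - M)) \<longlongrightarrow> 0) sequentially"
      by (intro tendsto_neg_powr filterlim_real_sequentially) auto
    then have "((\<lambda>i. C * real i powr (r - M)) \<longlongrightarrow> C * 0) sequentially" by (intro tendsto_mult_left)
    then have "eventually (\<lambda>i. C * real i powr (r - M) < 1) sequentially"
      by (intro order_tendstoD(2)[of _ 0]) auto
    then obtain n1 where n1: "\<And>i. i \<ge> n1 \<Longrightarrow> C * real i powr (r - M) < 1"
      by (auto simp: eventually_sequentially)
    define n where "n = max n1 (max n0 1)"
    have "real (rk n) < 1" using n1[of n] b[of n] by (simp add: n_def)
    moreover have "1 \<le> rk n" using rk_pos monoD[OF rk_mono, of 0 n] by simp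
    ultimately show False by simp
  qed
  \<comment> \<open>Enlarged to cover the finitely many n below the threshold by monotonicity. The
    base n + 1 instead of n makes the power at least 1 even at n = 0.\<close>
  define C' where "C' = max C (real (rk (max n0 1)))"
  have "real (rk n) \<le> C' * (real n + 1) powr (r - M)" for n
  proof (cases "n \<ge> max n0 1")
    case True
    have "real (rk n) \<le> C * real n powr (r - M)" by (rule b[OF True])
    also have "\<dots> \<le> C' * (real n + 1) powr (r - M)"
      using Mr C by (intro mult_mono powr_mono2) (auto simp: C'_def)
    finally show ?thesis .
  next
    case False
    then have "rk n \<le> rk (max n0 1)" by (intro monoD[OF rk_mono]) linarith
    then have "real (rk n) \<le> C' * 1" unfolding C'_def by (simp add: le_max_iff_disj)
    also have "\<dots> \<le> C' * (real n + 1) powr (r - M)"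
      using Mr C by (intro mult_left_mono ge_one_powr_ge_zero) (auto simp: C'_def)
    finally show ?thesis .
  qed
  moreover have "0 < C'" using C by (simp add: C'_def)
  ultimately show ?thesis using that Mr by blast
qed

lemma M_le_g: "real M \<le> g"
proof (rule dense_ge)
  fix r assume "g < r" then show "real M \<le> r" by (rule rank_bound)
qed

text \<open>The bound on ranks is inserted into both factors of \<open>upper\<close>; the exponents
  s and max s 1 of their arguments add up to the factor in front of r - M.\<close>

lemma growth_step:
  assumes r: "g < r" and s: "growth nu < ereal s"
  shows "g \<le> (s + max s 1) * (r - M)"
proof -
  obtain C where C: "0 < C" "\<And>n. real (rk n) \<le> C * (real n + 1) powr (r - M)" "real M \<le> r"
    using rank_bound[OF r] by blast
  have s0: "0 < s" using s growth_nonneg[of nu] by (metis ereal_less(2) order.strict_trans1)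
  \<comment> \<open>The argument i + c nu(c i) is dominated by i if s < 1 and by i^s otherwise; this
    is where the maximum in the final bound originates.\<close>
  define t where "t = max s 1"
  have e: "0 \<le> r - M" using C by simp
  have ev: "eventually (\<lambda>i. real (nu i) \<le> real i powr s) sequentially" by (rule growth_less_imp[OF s])
  then obtain n0 where n0: "\<And>i. i \<ge> n0 \<Longrightarrow> real (nu i) \<le> real i powr s"
    by (auto simp: eventually_sequentially)
  \<comment> \<open>The summand 1 absorbs the + 1 of the rank bound, as i^s >= 1; the other summand
    comes from nu(c i) \<le> (c i)^s.\<close>
  define B where "B = 1 + real c * (1 + real c) powr s"
  have nu: "real (c * nu (c * i)) + 1 \<le> B * real i powr s" if i: "i \<ge> max n0 1" for i
  proof (cases "c = 0")
    \<comment> \<open>For c = 0 the argument c i does not tend to infinity, so the asymptotic bound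
      on \<open>nu\<close> says nothing about it; the left side is then just 1.\<close>
    case True
    then show ?thesis using i s0 by (simp add: B_def ge_one_powr_ge_zero)
  next
    case False
    have "1 * i \<le> c * i" using False by (intro mult_le_mono1) simp
    moreover have "n0 \<le> i" using i by simp
    ultimately have "n0 \<le> c * i" by linarith
    then have "real (nu (c * i)) \<le> real (c * i) powr s" by (rule n0)
    also have "\<dots> \<le> ((1 + real c) * real i) powr s"
      using s0 by (intro powr_mono2) (auto intro: mult_right_mono)
    also have "\<dots> = (1 + real c) powr s * real i powr s" by (simp add: powr_mult)
    finally have "real c * real (nu (c * i)) \<le> real c * ((1 + real c) powr s * real i powr s)"
      by (intro mult_left_mono) auto
    moreover have "1 \<le> real i powr s" using i s0 by (intro ge_one_powr_ge_zero) auto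
    ultimately show ?thesis by (simp add: B_def algebra_simps)
  qed
  have B: "0 \<le> B" unfolding B_def by (intro add_nonneg_nonneg mult_nonneg_nonneg) auto
  have "real (D i) \<le> (C * (B powr (r - M)) * (C * (1 + B) powr (r - M))) * real i powr ((s + t) * (r - M))"
    if i: "i \<ge> max n0 1" for i
  proof -
    define J where "J = c * nu (c * i)"
    have st: "real i powr s \<le> real i powr t" "real i \<le> real i powr t"
      using i powr_mono[of s t "real i"] powr_mono[of 1 t "real i"] by (auto simp: t_def)
    have J: "real J + 1 \<le> B * real i powr s" using nu[OF i] by (simp add: J_def)
    have "real (rk J) \<le> C * (real J + 1) powr (r - M)" by (rule C)
    also have "\<dots> \<le> C * (B * real i powr s) powr (r - M)"
      using C(1) J e by (intro mult_left_mono powr_mono2) auto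
    finally have 1: "real (rk J) \<le> C * (B powr (r - M) * real i powr (s * (r - M)))"
      using B by (simp add: powr_mult powr_powr)
    have "real (rk (i + J)) \<le> C * (real (i + J) + 1) powr (r - M)" by (rule C)
    also have "\<dots> \<le> C * ((1 + B) * real i powr t) powr (r - M)"
    proof (intro mult_left_mono powr_mono2 e)
      have "real (i + J) + 1 \<le> real i powr t + B * real i powr s" using J st by simp
      also have "\<dots> \<le> real i powr t + B * real i powr t" using B st by (intro add_left_mono mult_left_mono)
      finally show "real (i + J) + 1 \<le> (1 + B) * real i powr t" by (simp add: algebra_simps)
    qed (use C(1) in auto)
    finally have 2: "real (rk (i + J)) \<le> C * ((1 + B) powr (r - M) * real i powr (t * (r - M)))"
      using B by (simp add: powr_mult powr_powr)
    have "real (D i) \<le> real (rk J) * real (rk (i + J))"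
      using upper[of i] unfolding J_def by (metis of_nat_le_iff of_nat_mult)
    also have "\<dots> \<le> (C * (B powr (r - M) * real i powr (s * (r - M)))) *
        (C * ((1 + B) powr (r - M) * real i powr (t * (r - M))))"
      using C(1) by (intro mult_mono 1 2) auto
    also have "\<dots> = (C * (B powr (r - M)) * (C * (1 + B) powr (r - M))) * real i powr ((s + t) * (r - M))"
      by (simp add: powr_add distrib_right mult_ac)
    finally show ?thesis .
  qed
  then have "eventually (\<lambda>i. real (D i) \<le> (C * (B powr (r - M)) * (C * (1 + B) powr (r - M))) *
      real i powr ((s + t) * (r - M))) sequentially"
    by (rule eventually_sequentiallyI[of "max n0 1"])
  then have "growth D \<le> ereal ((s + t) * (r - M))"
    using e s0 by (intro growth_le_mult) (auto simp: t_def)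
  then show ?thesis by (simp add: g t_def)
qed

text \<open>\<open>growth\<close> is an infimum that need not be attained, so
  \<open>growth_step\<close> is available only for r > g and s > f; the inequality at g and f is the
  limit along 1 / (n + 1).\<close>

lemma growth_inequality:
  assumes f: "growth nu = ereal f"
  shows "g \<le> (f + max f 1) * (g - M)"
proof -
  have "(\<lambda>n. ((f + 1 / real (Suc n)) + max (f + 1 / real (Suc n)) 1) * ((g + 1 / real (Suc n)) - M))
      \<longlonglongrightarrow> ((f + 0) + max (f + 0) 1) * ((g + 0) - M)"
    by (intro tendsto_intros LIMSEQ_inverse_real_of_nat[unfolded inverse_eq_divide])
  then show ?thesis
    using growth_step[of "g + 1 / real (Suc _)" "f + 1 / real (Suc _)"] f
    by (intro LIMSEQ_le_const[where X = "\<lambda>n. ((f + 1 / real (Suc n)) + max (f + 1 / real (Suc n)) 1) * ((g + 1 / real (Suc n)) - M)"])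
      (auto intro!: exI[of _ 0] growth_step)
qed

text \<open>The inequality g \<le> (f + max f 1) (g - M) is solved for M. It is monotone in f
  because g - M is nonnegative, so an upper bound F of the growth suffices; F will be a maximum of
  several filter dimensions.\<close>

lemma M_bound:
  assumes F: "growth nu \<le> F"
  shows "ereal (real M) \<le> ereal g * (1 - 1 / (F + max F 1))"
proof (cases F)
  case PInf
  \<comment> \<open>Here 1 / \<infinity> = 0, so the claim is M \<le> g.\<close>
  then show ?thesis using M_le_g by simp
next
  case MInf
  then show ?thesis using F growth_nonneg[of nu] by simp
next
  case (real x)
  obtain f where f: "growth nu = ereal f" "0 \<le> f" "f \<le> x"
    using F real growth_nonneg[of nu] by (cases "growth nu") auto
  have pos: "0 < f + max f 1" "f + max f 1 \<le> x + max x 1" using f by auto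
  have "g \<le> (f + max f 1) * (g - M)" by (rule growth_inequality[OF f(1)])
  also have "\<dots> \<le> (x + max x 1) * (g - M)" using pos M_le_g by (intro mult_right_mono) auto
  finally have "g \<le> (x + max x 1) * (g - M)" .
  then have "g / (x + max x 1) \<le> g - M" using pos by (simp add: pos_divide_le_eq mult.commute)
  then have "real M \<le> g * (1 - 1 / (x + max x 1))" by (simp add: algebra_simps)
  then show ?thesis using real pos by (simp add: one_ereal_def ereal_max[symmetric] del: ereal_max)
qed

end


section \<open>Associative algebras and standard filtrations\<close>

declare std_filtration.simps [simp del]

text \<open>The counterpart of \<open>algebra\<close> for multiplications that need not commute:
  scalars have to be moved past each factor separately. It will be instantiated with P, its
  endomorphisms, A(P) and the scalar extensions.\<close>

locale assoc_algebra = vectorspace K A + A: ring A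
  for K :: "('k, 'x) ring_scheme" and A :: "('k, 'a) module" (structure) +
  assumes smult_left: "\<lbrakk>c \<in> carrier K; x \<in> carrier A; y \<in> carrier A\<rbrakk> \<Longrightarrow> (c \<odot> x) \<otimes> y = c \<odot> (x \<otimes> y)"
    and smult_right: "\<lbrakk>c \<in> carrier K; x \<in> carrier A; y \<in> carrier A\<rbrakk> \<Longrightarrow> x \<otimes> (c \<odot> y) = c \<odot> (x \<otimes> y)"
begin

lemma span_subset_submodule:
  assumes "submodule K N A" "S \<subseteq> N"
  shows "span S \<subseteq> N"
  using span_is_subset[OF assms(2,1)] .

lemma in_span: "S \<subseteq> carrier A \<Longrightarrow> x \<in> S \<Longrightarrow> x \<in> span S"
  using in_own_span by blast

text \<open>A property of all elements of a span is repeatedly proved by letting the elements with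
  that property form a submodule that contains the generators; linear preimages supply these
  submodules.\<close>

lemma preimage_submodule:
  assumes N: "submodule K N A"
    and h: "\<And>x. x \<in> carrier A \<Longrightarrow> h x \<in> carrier A"
    "\<And>x y. x \<in> carrier A \<Longrightarrow> y \<in> carrier A \<Longrightarrow> h (x \<oplus> y) = h x \<oplus> h y"
    "\<And>c x. c \<in> carrier K \<Longrightarrow> x \<in> carrier A \<Longrightarrow> h (c \<odot> x) = c \<odot> h x"
  shows "submodule K {x \<in> carrier A. h x \<in> N} A"
proof -
  interpret N: submodule K N A by fact
  have "h \<zero> = h (\<zero>\<^bsub>K\<^esub> \<odot> \<zero>)" by simp
  also have "\<dots> = \<zero>" using h(1)[of \<zero>] by (subst h(3)) auto
  finally show ?thesis using h by unfold_locales auto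
qed

lemma submodule_mult_left: "submodule K N A \<Longrightarrow> a \<in> carrier A \<Longrightarrow> submodule K {x \<in> carrier A. a \<otimes> x \<in> N} A"
  by (rule preimage_submodule) (auto simp: A.r_distr smult_right)

lemma submodule_mult_right: "submodule K N A \<Longrightarrow> a \<in> carrier A \<Longrightarrow> submodule K {x \<in> carrier A. x \<otimes> a \<in> N} A"
  by (rule preimage_submodule) (auto simp: A.l_distr smult_left)

lemma submodule_INT:
  assumes "\<And>i. i \<in> I \<Longrightarrow> submodule K (N i) A" "I \<noteq> {}"
  shows "submodule K (\<Inter>i\<in>I. N i) A"
proof (rule submodule.intro[OF module_axioms])
  show "(\<Inter>i\<in>I. N i) \<subseteq> carrier A" using assms submodule.subset by fastforce
qed (use assms in \<open>auto dest: submodule.m_closed submodule.smult_closed submodule.zero_closed\<close>)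

abbreviation filt where "filt \<equiv> std_filtration K A"

lemma span_insert_one:
  assumes "S \<subseteq> carrier A"
  shows "submodule K (span (insert \<one> S)) A" "\<one> \<in> span (insert \<one> S)"
    "S \<subseteq> span (insert \<one> S)" "span (insert \<one> S) \<subseteq> carrier A"
  using assms in_own_span[of "insert \<one> S"] span_is_submodule[of "insert \<one> S"]
    span_is_subset2[of "insert \<one> S"] by auto

lemma filt_submodule: "S \<subseteq> carrier A \<Longrightarrow> submodule K (filt S i) A"
proof (induction i)
  case 0 then show ?case by (simp add: std_filtration.simps span_is_submodule)
next
  case (Suc i)
  then interpret N: submodule K "filt S i" A by simp
  show ?case
    using span_insert_one(4)[OF Suc.prems] N.subset
    unfolding std_filtration.simps by (intro span_is_submodule) auto
qed

lemma filt_carrier: "S \<subseteq> carrier A \<Longrightarrow> filt S i \<subseteq> carrier A"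
  using filt_submodule submodule.subset by blast

lemma filt_mult_gen:
  assumes S: "S \<subseteq> carrier A" and x: "x \<in> filt S i" and y: "y \<in> span (insert \<one> S)"
  shows "x \<otimes> y \<in> filt S (Suc i)"
proof -
  have "{x \<otimes> y | x y. x \<in> filt S i \<and> y \<in> span (insert \<one> S)} \<subseteq> carrier A"
    using filt_carrier[OF S] span_insert_one(4)[OF S] by auto
  then show ?thesis unfolding std_filtration.simps using x y by (intro in_span) auto
qed

lemma filt_Suc_mono: "S \<subseteq> carrier A \<Longrightarrow> filt S i \<subseteq> filt S (Suc i)"
  using filt_mult_gen[of S _ i \<one>] span_insert_one(2)[of S] filt_carrier[of S i] by force

lemma filt_mono: "S \<subseteq> carrier A \<Longrightarrow> i \<le> j \<Longrightarrow> filt S i \<subseteq> filt S j"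
  by (rule lift_Suc_mono_le[of "filt S"]) (rule filt_Suc_mono)

text \<open>Each filtration step is spanned by products with one more generator on the right, so
  only right multiplication by a single generator has to be treated. As N depends on i, degree
  estimates are carried along; a constant N handles subalgebras.\<close>

lemma filt_induct:
  assumes S: "S \<subseteq> carrier A" and N: "\<And>i. submodule K (N i) A" and "\<one> \<in> N 0"
    and step: "\<And>i x y. x \<in> N i \<Longrightarrow> y \<in> insert \<one> S \<Longrightarrow> x \<otimes> y \<in> N (Suc i)"
  shows "filt S i \<subseteq> N i"
proof (induction i)
  case 0
  then show ?case using assms span_subset_submodule[OF N, of "{\<one>}" 0] by (simp add: std_filtration.simps)
next
  case (Suc i)
  have "x \<otimes> y \<in> N (Suc i)" if "x \<in> filt S i" "y \<in> span (insert \<one> S)" for x y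
  proof -
    have x: "x \<in> N i" "x \<in> carrier A" using that Suc filt_carrier[OF S] by auto
    have "insert \<one> S \<subseteq> {y \<in> carrier A. x \<otimes> y \<in> N (Suc i)}"
      using S step[OF x(1)] A.one_closed by blast
    then have "span (insert \<one> S) \<subseteq> {y \<in> carrier A. x \<otimes> y \<in> N (Suc i)}"
      using x by (intro span_subset_submodule submodule_mult_left N)
    then show ?thesis using that by auto
  qed
  then show ?case
    unfolding std_filtration.simps by (intro span_subset_submodule N) auto
qed

lemma one_filt: "S \<subseteq> carrier A \<Longrightarrow> \<one> \<in> filt S i"
  using filt_mono[of S 0 i] in_span[of "{\<one>}"] by (auto simp: std_filtration.simps)

lemma gen_filt: "S \<subseteq> carrier A \<Longrightarrow> x \<in> S \<Longrightarrow> x \<in> filt S 1"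
  using filt_mult_gen[of S \<one> 0 x] one_filt[of S 0] span_insert_one(3)[of S] by (auto simp: subset_iff)

lemma filt_mult:
  assumes S: "S \<subseteq> carrier A" and x: "x \<in> filt S i" and y: "y \<in> filt S j"
  shows "x \<otimes> y \<in> filt S (i + j)"
proof -
  have xc: "x \<in> carrier A" using x filt_carrier[OF S] by auto
  have "filt S j \<subseteq> {y \<in> carrier A. x \<otimes> y \<in> filt S (i + j)}"
  proof (rule filt_induct[OF S])
    fix k z y assume z: "z \<in> {y \<in> carrier A. x \<otimes> y \<in> filt S (i + k)}" and y: "y \<in> insert \<one> S"
    have yc: "y \<in> span (insert \<one> S)" "y \<in> carrier A" using y span_insert_one[OF S] S by auto
    then have "(x \<otimes> z) \<otimes> y \<in> filt S (Suc (i + k))"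
      using z by (intro filt_mult_gen[OF S]) auto
    then show "z \<otimes> y \<in> {y \<in> carrier A. x \<otimes> y \<in> filt S (i + Suc k)}"
      using z yc xc by (simp add: A.m_assoc)
  qed (use x xc in \<open>auto intro!: submodule_mult_left filt_submodule[OF S]\<close>)
  then show ?thesis using y by auto
qed

text \<open>A change of generators rescales the degree by a constant factor, which leaves growth
  exponents unchanged.\<close>

lemma filt_subset_filt:
  assumes S: "S \<subseteq> carrier A" and S': "S' \<subseteq> filt S c"
  shows "filt S' i \<subseteq> filt S (c * i)"
proof (rule filt_induct)
  show "S' \<subseteq> carrier A" using S' filt_carrier[OF S] by auto
  fix k x y assume "x \<in> filt S (c * k)" "y \<in> insert \<one> S'"
  then show "x \<otimes> y \<in> filt S (c * Suc k)"
    using filt_mult[OF S, of x "c * k" y c] S' one_filt[OF S] by (auto simp: add.commute)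
qed (use filt_submodule[OF S] one_filt[OF S] in auto)

lemma span_products:
  assumes G: "G \<subseteq> carrier A" and H: "H \<subseteq> carrier A"
  shows "span {x \<otimes> y | x y. x \<in> span G \<and> y \<in> span H} = span {x \<otimes> y | x y. x \<in> G \<and> y \<in> H}" (is "span ?L = span ?R")
proof
  have R: "?R \<subseteq> carrier A" using assms by auto
  have Gs: "span G \<subseteq> carrier A" and Hs: "span H \<subseteq> carrier A" using span_is_subset2 assms by auto
  have sub: "submodule K (span ?R) A" by (rule span_is_submodule[OF R])
  have 1: "x \<otimes> y \<in> span ?R" if "x \<in> G" "y \<in> span H" for x y
  proof -
    have "span H \<subseteq> {y \<in> carrier A. x \<otimes> y \<in> span ?R}"
      using that G H by (intro span_subset_submodule submodule_mult_left sub) (auto intro!: in_span[OF R])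
    then show ?thesis using that by auto
  qed
  have "x \<otimes> y \<in> span ?R" if "x \<in> span G" "y \<in> span H" for x y
  proof -
    have "span G \<subseteq> {x \<in> carrier A. x \<otimes> y \<in> span ?R}"
      using that G Hs 1 by (intro span_subset_submodule submodule_mult_right sub) auto
    then show ?thesis using that by auto
  qed
  then show "span ?L \<subseteq> span ?R" by (intro span_subset_submodule sub) auto
  show "span ?R \<subseteq> span ?L"
    using in_own_span assms by (intro span_is_monotone) blast
qed

lemma filt_finite_span:
  assumes S: "S \<subseteq> carrier A" "finite S"
  obtains G where "finite G" "G \<subseteq> carrier A" "filt S i = span G"
proof -
  have "\<exists>G. finite G \<and> G \<subseteq> carrier A \<and> filt S i = span G"
  proof (induction i)
    case 0 show ?case by (intro exI[of _ "{\<one>}"]) (auto simp: std_filtration.simps)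
  next
    case (Suc i)
    then obtain G where G: "finite G" "G \<subseteq> carrier A" "filt S i = span G" by auto
    let ?R = "{x \<otimes> y | x y. x \<in> G \<and> y \<in> insert \<one> S}"
    have "filt S (Suc i) = span ?R" using span_products[of G "insert \<one> S"] G S by (simp add: std_filtration.simps(2))
    moreover have "?R = (\<lambda>(x, y). x \<otimes> y) ` (G \<times> insert \<one> S)" by auto
    ultimately show ?case using G S by (intro exI[of _ ?R]) auto
  qed
  then show ?thesis using that by auto
qed

lemma subalgebra_submodule:
  assumes B: "is_subalgebra K A B"
  shows "submodule K B A"
proof (rule submodule.intro[OF module_axioms])
  have sr: "subring B A" using B by (simp add: is_subalgebra_def)
  show "B \<subseteq> carrier A" "\<zero> \<in> B" by (rule subringE(1)[OF sr], rule subringE(2)[OF sr])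
  show "x \<oplus> y \<in> B" if "x \<in> B" "y \<in> B" for x y using that by (rule subringE(7)[OF sr])
  show "c \<odot> x \<in> B" if "c \<in> carrier K" "x \<in> B" for c x using B that by (simp add: is_subalgebra_def)
qed

text \<open>The union is closed under products because degrees add, and under sums because the steps
  are nested; conversely \<open>filt_induct\<close> keeps each step inside any subalgebra containing
  S.\<close>

lemma gen_subalgebra_eq_Union_filt:
  assumes S: "S \<subseteq> carrier A"
  shows "gen_subalgebra K A S = (\<Union>i. filt S i)"
proof
  have "subring (\<Union>i. filt S i) A"
  proof (rule A.subringI)
    show "(\<Union>i. filt S i) \<subseteq> carrier A" using filt_carrier[OF S] by auto
    show "\<one> \<in> (\<Union>i. filt S i)" using one_filt[OF S] by auto
    show "\<ominus> h \<in> (\<Union>i. filt S i)" if "h \<in> (\<Union>i. filt S i)" for h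
      using that submodule_uminus[OF filt_submodule[OF S]] by auto
    fix x y assume "x \<in> (\<Union>i. filt S i)" "y \<in> (\<Union>i. filt S i)"
    then obtain i j where ij: "x \<in> filt S i" "y \<in> filt S j" by auto
    then have "x \<in> filt S (max i j)" "y \<in> filt S (max i j)"
      using filt_mono[OF S, of i "max i j"] filt_mono[OF S, of j "max i j"] by auto
    then show "x \<oplus> y \<in> (\<Union>i. filt S i)"
      using submodule.m_closed[OF filt_submodule[OF S]] by blast
    show "x \<otimes> y \<in> (\<Union>i. filt S i)" using filt_mult[OF S ij] by blast
  qed
  then have "is_subalgebra K A (\<Union>i. filt S i)"
    using submodule.smult_closed[OF filt_submodule[OF S]] unfolding is_subalgebra_def by blast
  moreover have "S \<subseteq> (\<Union>i. filt S i)" using gen_filt[OF S] by blast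
  ultimately show "gen_subalgebra K A S \<subseteq> (\<Union>i. filt S i)"
    unfolding gen_subalgebra_def by auto
  have "filt S i \<subseteq> B" if B: "is_subalgebra K A B" "S \<subseteq> B" for B i
  proof (rule filt_induct[OF S])
    have sr: "subring B A" using B by (simp add: is_subalgebra_def)
    show "submodule K B A" by (rule subalgebra_submodule[OF B(1)])
    show "\<one> \<in> B" by (rule subringE(3)[OF sr])
    show "x \<otimes> y \<in> B" if "x \<in> B" "y \<in> insert \<one> S" for x y
      using that B(2) subringE(3)[OF sr] by (intro subringE(6)[OF sr]) auto
  qed
  then show "(\<Union>i. filt S i) \<subseteq> gen_subalgebra K A S" unfolding gen_subalgebra_def by blast
qed

text \<open>The source of most constants: finitely many elements, for instance another generating
  set or the brackets of generators, lie in a single filtration step.\<close>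

lemma finite_generators_filt:
  assumes "finite_generators K A S" "finite X" "X \<subseteq> carrier A"
  obtains c where "X \<subseteq> filt S c"
proof -
  have S: "S \<subseteq> carrier A" "(\<Union>i. filt S i) = carrier A"
    using assms gen_subalgebra_eq_Union_filt[of S] by (auto simp: finite_generators_def)
  have "\<exists>c. X \<subseteq> filt S c"
    using assms(2,3)
  proof (induction X)
    case (insert x X)
    have "x \<in> (\<Union>i. filt S i)" using insert.prems S(2) by blast
    then obtain c' where "x \<in> filt S c'" by blast
    moreover obtain c where "X \<subseteq> filt S c" using insert by blast
    ultimately have "insert x X \<subseteq> filt S (max c c')"
      using filt_mono[OF S(1), of c "max c c'"] filt_mono[OF S(1), of c' "max c c'"] by auto
    then show ?case by blast
  qed auto
  then show ?thesis using that by blast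
qed

abbreviation dim_filt where "dim_filt S i \<equiv> vectorspace.dim K (A\<lparr>carrier := filt S i\<rparr>)"

lemma filt_basis:
  assumes S: "S \<subseteq> carrier A" "finite S"
  obtains B where "finite B" "B \<subseteq> filt S i" "card B = dim_filt S i"
    "indep K A B (\<lambda>x. x)" "\<And>w. w \<in> filt S i \<Longrightarrow> \<exists>c\<in>B \<rightarrow> carrier K. w = (\<Oplus>b\<in>B. c b \<odot> b)"
proof -
  obtain G where "finite G" "G \<subseteq> carrier A" "filt S i = span G" by (rule filt_finite_span[OF S])
  then show ?thesis by (rule subspace_basis) (rule that)
qed

lemma indep_card_le_dim_filt:
  assumes "S \<subseteq> carrier A" "finite S" "finite I" "v \<in> I \<rightarrow> filt S i" "indep K A I v"
  shows "card I \<le> dim_filt S i"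
proof -
  obtain G where "finite G" "G \<subseteq> carrier A" "filt S i = span G" by (rule filt_finite_span[OF assms(1,2)])
  then show ?thesis using assms(3-) by (rule indep_card_le_dim)
qed

lemma dim_filt_le_card:
  assumes "S \<subseteq> carrier A" "finite S" "finite J" "w \<in> J \<rightarrow> carrier A"
    and "\<And>x. x \<in> filt S i \<Longrightarrow> \<exists>c\<in>J \<rightarrow> carrier K. x = (\<Oplus>j\<in>J. c j \<odot> w j)"
  shows "dim_filt S i \<le> card J"
proof -
  obtain G where "finite G" "G \<subseteq> carrier A" "filt S i = span G" by (rule filt_finite_span[OF assms(1,2)])
  then show ?thesis using assms(3-) by (rule dim_le_card)
qed

lemma subalgebra_assoc_algebra:
  assumes B: "is_subalgebra K A B"
  shows "assoc_algebra K (A\<lparr>carrier := B\<rparr>)"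
proof -
  have sr: "subring B A" using B by (simp add: is_subalgebra_def)
  have BA: "\<And>x. x \<in> B \<Longrightarrow> x \<in> carrier A" using subringE(1)[OF sr] by auto
  have "subspace K B A"
    by (rule subspace.intro[OF vectorspace_axioms subalgebra_submodule[OF B]])
  then have "vectorspace K (A\<lparr>carrier := B\<rparr>)" by (rule subspace_is_vs)
  moreover have "ring (A\<lparr>carrier := B\<rparr>)" by (rule A.subring_is_ring[OF sr])
  ultimately show ?thesis
    by (intro assoc_algebra.intro assoc_algebra_axioms.intro) (simp_all add: smult_left smult_right BA)
qed

end


section \<open>Elementary operators on central simple algebras\<close>

text \<open>The action on a of an element of R \<otimes> R^op, written as a list of pure tensors:
  appending lists adds operators, and no tensor product has to be formed at this point.\<close>

definition sandwich :: "('a, 'x) ring_scheme \<Rightarrow> ('a \<times> 'a) list \<Rightarrow> 'a \<Rightarrow> 'a" where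
  "sandwich R ps a = foldr (\<lambda>(x, y) s. x \<otimes>\<^bsub>R\<^esub> a \<otimes>\<^bsub>R\<^esub> y \<oplus>\<^bsub>R\<^esub> s) ps \<zero>\<^bsub>R\<^esub>"

lemma sandwich_Nil [simp]: "sandwich R [] a = \<zero>\<^bsub>R\<^esub>"
  by (simp add: sandwich_def)

lemma sandwich_Cons [simp]: "sandwich R ((x, y) # ps) a = x \<otimes>\<^bsub>R\<^esub> a \<otimes>\<^bsub>R\<^esub> y \<oplus>\<^bsub>R\<^esub> sandwich R ps a"
  by (simp add: sandwich_def)

context ring
begin

abbreviation pairs where "pairs \<equiv> {ps. set ps \<subseteq> carrier R \<times> carrier R}"

lemma sandwich_closed [simp]: "ps \<in> pairs \<Longrightarrow> a \<in> carrier R \<Longrightarrow> sandwich R ps a \<in> carrier R"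
  by (induction ps) auto

lemma sandwich_append:
  "ps \<in> pairs \<Longrightarrow> qs \<in> pairs \<Longrightarrow> a \<in> carrier R \<Longrightarrow> sandwich R (ps @ qs) a = sandwich R ps a \<oplus> sandwich R qs a"
  by (induction ps) (auto simp: a_assoc)

lemma sandwich_mult_left:
  "ps \<in> pairs \<Longrightarrow> x \<in> carrier R \<Longrightarrow> a \<in> carrier R \<Longrightarrow>
    sandwich R (map (\<lambda>(p, q). (x \<otimes> p, q)) ps) a = x \<otimes> sandwich R ps a"
  by (induction ps) (auto simp: m_assoc r_distr)

lemma sandwich_mult_right:
  "ps \<in> pairs \<Longrightarrow> x \<in> carrier R \<Longrightarrow> a \<in> carrier R \<Longrightarrow>
    sandwich R (map (\<lambda>(p, q). (p, q \<otimes> x)) ps) a = sandwich R ps a \<otimes> x"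
  by (induction ps) (auto simp: m_assoc l_distr)

lemma map_left_pairs: "ps \<in> pairs \<Longrightarrow> x \<in> carrier R \<Longrightarrow> map (\<lambda>(p, q). (x \<otimes> p, q)) ps \<in> pairs"
  by auto

lemma map_right_pairs: "ps \<in> pairs \<Longrightarrow> x \<in> carrier R \<Longrightarrow> map (\<lambda>(p, q). (p, q \<otimes> x)) ps \<in> pairs"
  by auto

lemma sandwich_add:
  "ps \<in> pairs \<Longrightarrow> a \<in> carrier R \<Longrightarrow> b \<in> carrier R \<Longrightarrow> sandwich R ps (a \<oplus> b) = sandwich R ps a \<oplus> sandwich R ps b"
  by (induction ps) (auto simp: l_distr r_distr a_ac)

lemma sandwich_zero: "ps \<in> pairs \<Longrightarrow> sandwich R ps \<zero> = \<zero>"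
  by (induction ps) auto

lemma sandwich_finsum:
  assumes "ps \<in> pairs" "f \<in> I \<rightarrow> carrier R"
  shows "sandwich R ps (finsum R f I) = (\<Oplus>i\<in>I. sandwich R ps (f i))"
  by (rule finsum_hom[where h = "sandwich R ps"])
    (use assms in \<open>auto simp: sandwich_zero sandwich_add abelian_monoid_axioms\<close>)

text \<open>If a set of operators admits sums and multiplication of the values from either side,
  then its values at one point form a two-sided ideal. This is the form in which simplicity can be
  applied.\<close>

lemma sandwich_ideal:
  assumes U: "U \<subseteq> pairs" "[] \<in> U"
    and app: "\<And>ps qs. ps \<in> U \<Longrightarrow> qs \<in> U \<Longrightarrow> ps @ qs \<in> U"
    and left: "\<And>ps x. ps \<in> U \<Longrightarrow> x \<in> carrier R \<Longrightarrow> map (\<lambda>(p, q). (x \<otimes> p, q)) ps \<in> U"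
    and right: "\<And>ps x. ps \<in> U \<Longrightarrow> x \<in> carrier R \<Longrightarrow> map (\<lambda>(p, q). (p, q \<otimes> x)) ps \<in> U"
    and a: "a \<in> carrier R"
  shows "ideal {sandwich R ps a | ps. ps \<in> U} R" (is "ideal ?I R")
proof (rule idealI)
  have I: "\<And>ps. ps \<in> U \<Longrightarrow> sandwich R ps a \<in> ?I" by auto
  have UP: "\<And>ps. ps \<in> U \<Longrightarrow> ps \<in> pairs" using U by blast
  show "ring R" by (rule ring_axioms)
  show l: "x \<otimes> b \<in> ?I" if bx: "b \<in> ?I" "x \<in> carrier R" for b x
  proof -
    obtain ps where ps: "ps \<in> U" "b = sandwich R ps a" using bx by auto
    have "x \<otimes> b = sandwich R (map (\<lambda>(p, q). (x \<otimes> p, q)) ps) a"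
      unfolding ps(2) by (rule sandwich_mult_left[OF UP[OF ps(1)] bx(2) a, symmetric])
    then show ?thesis using I[OF left[OF ps(1) bx(2)]] by simp
  qed
  show "b \<otimes> x \<in> ?I" if bx: "b \<in> ?I" "x \<in> carrier R" for b x
  proof -
    obtain ps where ps: "ps \<in> U" "b = sandwich R ps a" using bx by auto
    have "b \<otimes> x = sandwich R (map (\<lambda>(p, q). (p, q \<otimes> x)) ps) a"
      unfolding ps(2) by (rule sandwich_mult_right[OF UP[OF ps(1)] bx(2) a, symmetric])
    then show ?thesis using I[OF right[OF ps(1) bx(2)]] by simp
  qed
  have Ic: "?I \<subseteq> carrier R" using UP a by auto
  show "subgroup ?I (add_monoid R)"
  proof (rule add.subgroupI[OF Ic])
    show "?I \<noteq> {}" using U by auto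
    show "\<ominus> b \<in> ?I" if "b \<in> ?I" for b
    proof -
      have "(\<ominus> \<one>) \<otimes> b \<in> ?I" by (rule l[OF that]) simp
      moreover have "b \<in> carrier R" using that Ic by auto
      ultimately show ?thesis by (simp add: l_minus)
    qed
    show "b \<oplus> b' \<in> ?I" if bb: "b \<in> ?I" "b' \<in> ?I" for b b'
    proof -
      obtain ps qs where ps: "ps \<in> U" "b = sandwich R ps a" "qs \<in> U" "b' = sandwich R qs a"
        using bb by auto
      have "b \<oplus> b' = sandwich R (ps @ qs) a"
        unfolding ps(2,4) by (rule sandwich_append[OF UP[OF ps(1)] UP[OF ps(3)] a, symmetric])
      then show ?thesis using I[OF app[OF ps(1,3)]] by simp
    qed
  qed
qed

definition annihilating_pairs where
  "annihilating_pairs X = {ps \<in> pairs. \<forall>a\<in>X. sandwich R ps a = \<zero>}"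

text \<open>The annihilator of X is a left ideal of R \<otimes> R^op, hence stable under multiplying
  the values on the outside; that is all \<open>sandwich_ideal\<close> asks for.\<close>

lemma annihilating_pairs_ideal:
  assumes X: "X \<subseteq> carrier R" and a: "a \<in> carrier R"
  shows "ideal {sandwich R ps a | ps. ps \<in> annihilating_pairs X} R"
proof (rule sandwich_ideal)
  have Xc: "\<And>a. a \<in> X \<Longrightarrow> a \<in> carrier R" using X by auto
  show "annihilating_pairs X \<subseteq> pairs" "[] \<in> annihilating_pairs X"
    by (auto simp: annihilating_pairs_def)
  fix ps assume ps: "ps \<in> annihilating_pairs X"
  then have ps': "ps \<in> pairs" "\<And>a. a \<in> X \<Longrightarrow> sandwich R ps a = \<zero>" by (auto simp: annihilating_pairs_def)
  show "ps @ qs \<in> annihilating_pairs X" if "qs \<in> annihilating_pairs X" for qs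
    using ps that by (auto simp: annihilating_pairs_def sandwich_append Xc)
  show "map (\<lambda>(p, q). (x \<otimes> p, q)) ps \<in> annihilating_pairs X" if "x \<in> carrier R" for x
    using ps' that map_left_pairs[OF ps'(1) that] unfolding annihilating_pairs_def
    by (simp add: sandwich_mult_left Xc)
  show "map (\<lambda>(p, q). (p, q \<otimes> x)) ps \<in> annihilating_pairs X" if "x \<in> carrier R" for x
    using ps' that map_right_pairs[OF ps'(1) that] unfolding annihilating_pairs_def
    by (simp add: sandwich_mult_right Xc)
qed fact

end

context assoc_algebra
begin

lemma sandwich_smult:
  "ps \<in> A.pairs \<Longrightarrow> c \<in> carrier K \<Longrightarrow> a \<in> carrier A \<Longrightarrow> sandwich A ps (c \<odot> a) = c \<odot> sandwich A ps a"
  by (induction ps) (auto simp: smult_left smult_right smult_r_distr)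

text \<open>The elementary operators act densely: a form of the Jacobson density theorem for the
  bimodule \<open>A\<close>, whose endomorphisms are the central scalars.\<close>

lemma density:
  assumes cs: "central_simple K A"
    and "finite J" "j0 \<notin> J" "v \<in> insert j0 J \<rightarrow> carrier A" "indep K A (insert j0 J) v"
  shows "\<exists>ps\<in>A.pairs. sandwich A ps (v j0) = \<one> \<and> (\<forall>j\<in>J. sandwich A ps (v j) = \<zero>)"
  using assms(2-)
proof (induction J arbitrary: j0 v)
  have simple: "I = {\<zero>} \<or> I = carrier A" if "ideal I A" for I
    using cs that by (auto simp: central_simple_def simple_ring_def)
  case empty
  let ?I = "{sandwich A ps (v j0) | ps. ps \<in> A.annihilating_pairs {}}"
  have v: "v j0 \<in> carrier A" using empty by auto
  have "v j0 \<noteq> \<zero>"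
  proof
    assume "v j0 = \<zero>"
    then have "(\<Oplus>i\<in>{j0}. (\<lambda>_. \<one>\<^bsub>K\<^esub>) i \<odot> v i) \<in> {\<zero>}" by (simp add: M.finsum_insert)
    moreover have "(\<lambda>_. \<one>\<^bsub>K\<^esub>) \<in> {j0} \<rightarrow> carrier K" by simp
    ultimately show False using empty(3) unfolding indep_mod_def by force
  qed
  \<comment> \<open>The identity operator puts v(j0) itself into the ideal, which is therefore not
    zero.\<close>
  moreover have "v j0 = sandwich A [(\<one>, \<one>)] (v j0)" using v by simp
  then have "v j0 \<in> ?I"
    unfolding A.annihilating_pairs_def by (intro CollectI exI[of _ "[(\<one>, \<one>)]"]) auto
  ultimately have "?I = carrier A" using simple[OF A.annihilating_pairs_ideal[of "{}" "v j0"]] v by auto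
  then have "\<one> \<in> ?I" by simp
  then show ?case unfolding A.annihilating_pairs_def by force
next
  have simple: "I = {\<zero>} \<or> I = carrier A" if "ideal I A" for I
    using cs that by (auto simp: central_simple_def simple_ring_def)
  case (insert j1 J)
  have j: "j0 \<noteq> j1" "j0 \<notin> J" "j1 \<notin> J" "finite J" using insert by auto
  have v: "v j0 \<in> carrier A" "v j1 \<in> carrier A" "\<And>j. j \<in> J \<Longrightarrow> v j \<in> carrier A" using insert.prems by auto
  have ind: "c i = \<zero>\<^bsub>K\<^esub>" if "c \<in> insert j0 (insert j1 J) \<rightarrow> carrier K"
    "c j0 \<odot> v j0 \<oplus> (c j1 \<odot> v j1 \<oplus> (\<Oplus>i\<in>J. c i \<odot> v i)) = \<zero>" "i \<in> insert j0 (insert j1 J)" for c i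
  proof -
    have "(\<Oplus>i\<in>insert j0 (insert j1 J). c i \<odot> v i) = c j0 \<odot> v j0 \<oplus> (c j1 \<odot> v j1 \<oplus> (\<Oplus>i\<in>J. c i \<odot> v i))"
      using j v that(1) by (subst M.finsum_insert; (subst M.finsum_insert)?) auto
    then show ?thesis using insert.prems(3) that unfolding indep_mod_def by auto
  qed
  have sumc: "(\<Oplus>i\<in>J. c i \<odot> v i) \<in> carrier A" if "c \<in> J \<rightarrow> carrier K" for c
    using that v by (intro M.finsum_closed) auto
  have "indep K A (insert j1 J) v"
    unfolding indep_mod_def
  proof (intro ballI impI)
    fix c i assume c: "c \<in> insert j1 J \<rightarrow> carrier K" "(\<Oplus>i\<in>insert j1 J. c i \<odot> v i) \<in> {\<zero>}" "i \<in> insert j1 J"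
    define c' where "c' = c(j0 := \<zero>\<^bsub>K\<^esub>)"
    have "(\<Oplus>i\<in>J. c' i \<odot> v i) = (\<Oplus>i\<in>J. c i \<odot> v i)"
      using c(1) v j by (intro M.finsum_cong') (auto simp: c'_def)
    moreover have "(\<Oplus>i\<in>insert j1 J. c i \<odot> v i) = c j1 \<odot> v j1 \<oplus> (\<Oplus>i\<in>J. c i \<odot> v i)"
      using c(1) v j by (intro M.finsum_insert) auto
    ultimately have "c' i = \<zero>\<^bsub>K\<^esub>"
      using c j v sumc[of c] by (intro ind[of c']) (auto simp: c'_def)
    then show "c i = \<zero>\<^bsub>K\<^esub>" using c j by (auto simp: c'_def split: if_splits)
  qed
  \<comment> \<open>w isolates v(j1) from J and is used to correct any other operator at j1.\<close>
  then obtain w where w: "w \<in> A.pairs" "sandwich A w (v j1) = \<one>" "\<And>j. j \<in> J \<Longrightarrow> sandwich A w (v j) = \<zero>"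
    using insert.IH[of j1 v] insert.prems j by auto
  let ?U = "A.annihilating_pairs (v ` insert j1 J)"
  have Xc: "v ` insert j1 J \<subseteq> carrier A" using insert.prems by auto
  \<comment> \<open>The operators that kill v on J and j1 take v(j0) to an ideal. Either this ideal
    contains 1 and the goal is reached, or it is zero; the second case is refuted.\<close>
  show ?case
  proof (cases "\<one> \<in> {sandwich A ps (v j0) | ps. ps \<in> ?U}")
    case True
    then show ?thesis unfolding A.annihilating_pairs_def by force
  next
    case False
    then have "{sandwich A ps (v j0) | ps. ps \<in> ?U} = {\<zero>}"
      using simple[OF A.annihilating_pairs_ideal[OF Xc v(1)]] by auto
    then have U0: "sandwich A ps (v j0) = \<zero>" if "ps \<in> ?U" for ps using that by blast
    define z where "z = sandwich A w (v j0)"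
    have z: "z \<in> carrier A" unfolding z_def using w v by auto
    \<comment> \<open>With y = ps(v(j1)), the operator ps - y w kills v on J and on j1, hence also
      v(j0); this says ps(v(j0)) = y w(v(j0)).\<close>
    have key: "sandwich A ps (v j0) = sandwich A ps (v j1) \<otimes> z"
      if ps: "ps \<in> A.pairs" "\<And>j. j \<in> J \<Longrightarrow> sandwich A ps (v j) = \<zero>" for ps
    proof -
      define y where "y = sandwich A ps (v j1)"
      have y: "y \<in> carrier A" "\<ominus> y \<in> carrier A" unfolding y_def using ps v by auto
      let ?qs = "ps @ map (\<lambda>(p, q). (\<ominus> y \<otimes> p, q)) w"
      have qs: "sandwich A ?qs a = sandwich A ps a \<oplus> (\<ominus> y) \<otimes> sandwich A w a" if "a \<in> carrier A" for a
        using A.sandwich_append[OF ps(1) A.map_left_pairs[OF w(1) y(2)] that]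
          A.sandwich_mult_left[OF w(1) y(2) that] by simp
      have "?qs \<in> A.pairs" using ps(1) A.map_left_pairs[OF w(1) y(2)] by simp
      moreover have "sandwich A ?qs (v j) = \<zero>" if "j \<in> insert j1 J" for j
        using that qs[of "v j"] v ps w y by (auto simp: y_def[symmetric] M.r_neg)
      ultimately have "?qs \<in> ?U" unfolding A.annihilating_pairs_def by auto
      then have "sandwich A ps (v j0) \<oplus> (\<ominus> y) \<otimes> z = \<zero>" using U0 qs[OF v(1)] by (simp add: z_def)
      moreover have "sandwich A ps (v j0) \<in> carrier A" using ps v by auto
      ultimately show ?thesis using y z
        by (metis A.l_minus A.m_closed M.minus_equality M.minus_minus M.a_inv_closed y_def)
    qed
    \<comment> \<open>\<open>key\<close> is applied to w followed by right multiplication by x: the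
      value at v(j0) is z x, the value at v(j1) is x.\<close>
    have "z \<in> ring_centre A"
      unfolding ring_centre_def
    proof (intro CollectI conjI ballI z)
      fix x assume x: "x \<in> carrier A"
      let ?ps = "map (\<lambda>(p, q). (p, q \<otimes> x)) w"
      have s: "sandwich A ?ps a = sandwich A w a \<otimes> x" if "a \<in> carrier A" for a
        by (rule A.sandwich_mult_right[OF w(1) x that])
      have "sandwich A ?ps (v j0) = sandwich A ?ps (v j1) \<otimes> z"
        by (rule key[OF A.map_right_pairs[OF w(1) x]]) (use s v w x in simp)
      then show "z \<otimes> x = x \<otimes> z" using s v w x by (simp add: z_def)
    qed
    then obtain k where k: "k \<in> carrier K" "z = k \<odot> \<one>" using cs by (auto simp: central_simple_def)
    \<comment> \<open>As z is the scalar k, \<open>key\<close> says that every operator killing J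
      also kills v(j0) - k v(j1). The family with this replacement is still independent, so the
      induction hypothesis yields such an operator with value 1, a contradiction.\<close>
    define v' where "v' = v(j0 := v j0 \<ominus> k \<odot> v j1)"
    have v': "v' \<in> insert j0 J \<rightarrow> carrier A" using v k by (auto simp: v'_def)
    have "indep K A (insert j0 J) v'"
      unfolding indep_mod_def
    proof (intro ballI impI)
      fix c i assume c: "c \<in> insert j0 J \<rightarrow> carrier K" "(\<Oplus>i\<in>insert j0 J. c i \<odot> v' i) \<in> {\<zero>}" "i \<in> insert j0 J"
      define c' where "c' = c(j1 := \<ominus>\<^bsub>K\<^esub> (c j0 \<otimes>\<^bsub>K\<^esub> k))"
      have cc: "c j0 \<in> carrier K" using c by auto
      have s: "(\<Oplus>i\<in>J. c' i \<odot> v i) = (\<Oplus>i\<in>J. c i \<odot> v i)"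
        using c(1) v j by (intro M.finsum_cong') (auto simp: c'_def)
      have "(\<Oplus>i\<in>insert j0 J. c i \<odot> v' i) = c j0 \<odot> v' j0 \<oplus> (\<Oplus>i\<in>J. c i \<odot> v' i)"
        using c(1) v' j by (intro M.finsum_insert) auto
      also have "(\<Oplus>i\<in>J. c i \<odot> v' i) = (\<Oplus>i\<in>J. c i \<odot> v i)"
        using c(1) v j by (intro M.finsum_cong') (auto simp: v'_def)
      also have "c j0 \<odot> v' j0 = c j0 \<odot> v j0 \<oplus> c' j1 \<odot> v j1"
        using cc v k by (simp add: v'_def c'_def a_minus_def smult_r_distr smult_r_minus smult_l_minus smult_assoc1)
      finally have "c j0 \<odot> v j0 \<oplus> (c' j1 \<odot> v j1 \<oplus> (\<Oplus>i\<in>J. c' i \<odot> v i)) = \<zero>"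
        using c cc v k sumc[of c] s by (simp add: c'_def M.a_assoc)
      moreover have "c' j0 = c j0" using j by (simp add: c'_def)
      moreover have "c' \<in> insert j0 (insert j1 J) \<rightarrow> carrier K" using c(1) cc k by (auto simp: c'_def)
      ultimately have "c' i = \<zero>\<^bsub>K\<^esub>" using c(3) by (intro ind[of c']) auto
      then show "c i = \<zero>\<^bsub>K\<^esub>" using c(3) j by (auto simp: c'_def split: if_splits)
    qed
    then obtain ps where ps: "ps \<in> A.pairs" "sandwich A ps (v' j0) = \<one>" "\<And>j. j \<in> J \<Longrightarrow> sandwich A ps (v' j) = \<zero>"
      using insert.IH[OF j(2) v'] by auto
    have "sandwich A ps (v j0) = sandwich A ps (v j1) \<otimes> z"
    proof (rule key[OF ps(1)])
      fix i assume "i \<in> J"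
      then show "sandwich A ps (v i) = \<zero>" using ps(3)[of i] j by (auto simp: v'_def split: if_splits)
    qed
    also have "\<dots> = k \<odot> sandwich A ps (v j1)" using ps(1) v k by (simp add: smult_right)
    finally have "sandwich A ps (v j0) = k \<odot> sandwich A ps (v j1)" .
    moreover have "sandwich A ps (v' j0) = sandwich A ps (v j0) \<oplus> (\<ominus>\<^bsub>K\<^esub> k) \<odot> sandwich A ps (v j1)"
      using ps(1) v k by (simp add: v'_def a_minus_def smult_l_minus[symmetric] A.sandwich_add sandwich_smult)
    ultimately have "\<one> = \<zero>" using ps v k by (simp add: smult_l_minus M.r_neg)
    moreover have "carrier A \<noteq> {\<zero>}" using cs by (auto simp: central_simple_def simple_ring_def)
    ultimately show ?thesis using A.one_zeroD by auto
  qed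
qed

end


section \<open>Base change of a central simple algebra\<close>

text \<open>In a non-trivial relation of the enlarged family, independence of the smaller one forces
  the coefficient at \<open>i0\<close> to be non-zero, so it can be divided out.\<close>

lemma (in vectorspace) indep_mod_extend:
  assumes N: "submodule K N V" and fin: "finite I" "i0 \<notin> I" and v: "v \<in> insert i0 I \<rightarrow> carrier V"
    and ind: "indep_mod K V N I v" "\<not> indep_mod K V N (insert i0 I) v"
  shows "\<exists>c\<in>I \<rightarrow> carrier K. v i0 \<ominus>\<^bsub>V\<^esub> (\<Oplus>\<^bsub>V\<^esub>i\<in>I. c i \<odot>\<^bsub>V\<^esub> v i) \<in> N"
proof -
  interpret N: submodule K N V by fact
  obtain c i where c: "c \<in> insert i0 I \<rightarrow> carrier K"
      "(\<Oplus>\<^bsub>V\<^esub>i\<in>insert i0 I. c i \<odot>\<^bsub>V\<^esub> v i) \<in> N" "i \<in> insert i0 I" "c i \<noteq> \<zero>\<^bsub>K\<^esub>"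
    using ind(2) unfolding indep_mod_def by blast
  have v0: "v i0 \<in> carrier V" "c i0 \<in> carrier K" using v c by auto
  have cI: "\<And>i. i \<in> I \<Longrightarrow> c i \<in> carrier K" "\<And>i. i \<in> I \<Longrightarrow> v i \<in> carrier V" using c v by auto
  define s where "s = (\<Oplus>\<^bsub>V\<^esub>i\<in>I. c i \<odot>\<^bsub>V\<^esub> v i)"
  have s: "s \<in> carrier V" unfolding s_def using cI by (intro M.finsum_closed) auto
  have eq: "(\<Oplus>\<^bsub>V\<^esub>i\<in>insert i0 I. c i \<odot>\<^bsub>V\<^esub> v i) = c i0 \<odot>\<^bsub>V\<^esub> v i0 \<oplus>\<^bsub>V\<^esub> s"
    unfolding s_def using fin v0 cI by (intro M.finsum_insert) auto
  have nz: "c i0 \<noteq> \<zero>\<^bsub>K\<^esub>"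
  proof
    assume z: "c i0 = \<zero>\<^bsub>K\<^esub>"
    then have "s \<in> N" using c(2) eq v0 s by simp
    then have "\<forall>i\<in>I. c i = \<zero>\<^bsub>K\<^esub>" using ind(1) c(1) unfolding indep_mod_def s_def by blast
    then show False using z c by auto
  qed
  define d where "d = inv\<^bsub>K\<^esub> (c i0)"
  have d: "d \<in> carrier K" "d \<otimes>\<^bsub>K\<^esub> c i0 = \<one>\<^bsub>K\<^esub>"
    using nz v0 field_Units by (auto simp: d_def)
  have "d \<odot>\<^bsub>V\<^esub> (c i0 \<odot>\<^bsub>V\<^esub> v i0 \<oplus>\<^bsub>V\<^esub> s) \<in> N" using c(2) eq d by auto
  also have "d \<odot>\<^bsub>V\<^esub> (c i0 \<odot>\<^bsub>V\<^esub> v i0 \<oplus>\<^bsub>V\<^esub> s) = v i0 \<oplus>\<^bsub>V\<^esub> d \<odot>\<^bsub>V\<^esub> s"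
    using d v0 s by (simp add: smult_r_distr smult_assoc1[symmetric])
  also have "d \<odot>\<^bsub>V\<^esub> s = \<ominus>\<^bsub>V\<^esub> (\<ominus>\<^bsub>K\<^esub> d \<odot>\<^bsub>V\<^esub> s)" using d s by (simp add: smult_l_minus)
  also have "\<ominus>\<^bsub>K\<^esub> d \<odot>\<^bsub>V\<^esub> s = (\<Oplus>\<^bsub>V\<^esub>i\<in>I. (\<ominus>\<^bsub>K\<^esub> d \<otimes>\<^bsub>K\<^esub> c i) \<odot>\<^bsub>V\<^esub> v i)"
  proof -
    have "\<ominus>\<^bsub>K\<^esub> d \<odot>\<^bsub>V\<^esub> s = (\<Oplus>\<^bsub>V\<^esub>i\<in>I. \<ominus>\<^bsub>K\<^esub> d \<odot>\<^bsub>V\<^esub> (c i \<odot>\<^bsub>V\<^esub> v i))"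
      unfolding s_def using cI d by (intro finsum_smult) auto
    also have "\<dots> = (\<Oplus>\<^bsub>V\<^esub>i\<in>I. (\<ominus>\<^bsub>K\<^esub> d \<otimes>\<^bsub>K\<^esub> c i) \<odot>\<^bsub>V\<^esub> v i)"
      using cI d by (intro M.finsum_cong') (auto simp: smult_assoc1)
    finally show ?thesis .
  qed
  finally show ?thesis
    using d cI by (intro bexI[of _ "\<lambda>i. \<ominus>\<^bsub>K\<^esub> d \<otimes>\<^bsub>K\<^esub> c i"]) (auto simp: a_minus_def)
qed

text \<open>The tensor product is kept abstract: T is a non-zero Q-algebra spanned over Q by the
  image of A. That K-independent elements stay independent over Q is not an axiom but a consequence
  of central simplicity, see \<open>iota_indep\<close>.\<close>

locale base_change =
  A: assoc_algebra K A + Q: algebra K Q + QF: field Q + T: assoc_algebra Q T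
  for K :: "('k, 'x) ring_scheme" and A :: "('k, 'a) module" and Q :: "('k, 'q) module"
    and T :: "('q, 't) module" +
  fixes \<iota> :: "'a \<Rightarrow> 't"
  assumes iota_hom: "\<iota> \<in> ring_hom A T"
    and iota_smult: "\<lbrakk>k \<in> carrier K; a \<in> carrier A\<rbrakk> \<Longrightarrow> \<iota> (k \<odot>\<^bsub>A\<^esub> a) = (k \<odot>\<^bsub>Q\<^esub> \<one>\<^bsub>Q\<^esub>) \<odot>\<^bsub>T\<^esub> \<iota> a"
    and span_iota: "T.span (\<iota> ` carrier A) = carrier T"
    and central: "central_simple K A"
    and nontrivial: "\<one>\<^bsub>T\<^esub> \<noteq> \<zero>\<^bsub>T\<^esub>"
begin

lemma iota [simp]:
  shows "a \<in> carrier A \<Longrightarrow> \<iota> a \<in> carrier T"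
    and "\<lbrakk>a \<in> carrier A; b \<in> carrier A\<rbrakk> \<Longrightarrow> \<iota> (a \<otimes>\<^bsub>A\<^esub> b) = \<iota> a \<otimes>\<^bsub>T\<^esub> \<iota> b"
    and "\<lbrakk>a \<in> carrier A; b \<in> carrier A\<rbrakk> \<Longrightarrow> \<iota> (a \<oplus>\<^bsub>A\<^esub> b) = \<iota> a \<oplus>\<^bsub>T\<^esub> \<iota> b"
    and "\<iota> \<one>\<^bsub>A\<^esub> = \<one>\<^bsub>T\<^esub>" and "\<iota> \<zero>\<^bsub>A\<^esub> = \<zero>\<^bsub>T\<^esub>"
  using iota_hom ring_hom_zero[OF iota_hom A.A.ring_axioms T.A.ring_axioms]
  by (auto simp: ring_hom_def)

lemma iota_finsum:
  "f \<in> I \<rightarrow> carrier A \<Longrightarrow> \<iota> (finsum A f I) = (\<Oplus>\<^bsub>T\<^esub>i\<in>I. \<iota> (f i))"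
  by (rule finsum_hom) (auto intro: A.M.abelian_monoid_axioms T.M.abelian_monoid_axioms)

lemma scalar_closed [simp]: "k \<in> carrier K \<Longrightarrow> k \<odot>\<^bsub>Q\<^esub> \<one>\<^bsub>Q\<^esub> \<in> carrier Q"
  by simp

lemma preimage_submodule:
  assumes "submodule Q N T"
  shows "submodule K {a \<in> carrier A. \<iota> a \<in> N} A"
proof -
  interpret N: submodule Q N T by fact
  show ?thesis
    by (rule submodule.intro[OF A.module_axioms]) (auto simp: iota_smult)
qed

lemma iota_sandwich:
  "ps \<in> A.A.pairs \<Longrightarrow> a \<in> carrier A \<Longrightarrow> \<iota> (sandwich A ps a) = sandwich T (map (map_prod \<iota> \<iota>) ps) (\<iota> a)"
  by (induction ps) auto

lemma iota_pairs: "ps \<in> A.A.pairs \<Longrightarrow> map (map_prod \<iota> \<iota>) ps \<in> T.A.pairs"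
  by (auto simp: map_prod_def split: prod.splits)

lemma sandwich_map_closed:
  "ps \<in> A.A.pairs \<Longrightarrow> t \<in> carrier T \<Longrightarrow> sandwich T (map (map_prod \<iota> \<iota>) ps) t \<in> carrier T"
  by (rule T.A.sandwich_closed[OF iota_pairs])

text \<open>By density some elementary operator of A takes a(i0) to 1 and the other a(i) to 0.
  Carried over to T it is Q-linear, because scalars pass through products, so it reads off the
  coefficient at i0.\<close>

lemma separate:
  assumes I: "finite I" "i0 \<in> I" and a: "a \<in> I \<rightarrow> carrier A" and ind: "indep K A I a"
  obtains ps where "ps \<in> A.A.pairs"
    "\<And>q. q \<in> I \<rightarrow> carrier Q \<Longrightarrow>
      sandwich T (map (map_prod \<iota> \<iota>) ps) (\<Oplus>\<^bsub>T\<^esub>i\<in>I. q i \<odot>\<^bsub>T\<^esub> \<iota> (a i)) = q i0 \<odot>\<^bsub>T\<^esub> \<one>\<^bsub>T\<^esub>"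
proof -
  have I': "insert i0 (I - {i0}) = I" using I by auto
  obtain ps where ps: "ps \<in> A.A.pairs" "sandwich A ps (a i0) = \<one>\<^bsub>A\<^esub>"
      "\<And>i. i \<in> I - {i0} \<Longrightarrow> sandwich A ps (a i) = \<zero>\<^bsub>A\<^esub>"
    using A.density[OF central, of "I - {i0}" i0 a] I a ind unfolding I' by auto
  have "sandwich T (map (map_prod \<iota> \<iota>) ps) (\<Oplus>\<^bsub>T\<^esub>i\<in>I. q i \<odot>\<^bsub>T\<^esub> \<iota> (a i)) = q i0 \<odot>\<^bsub>T\<^esub> \<one>\<^bsub>T\<^esub>"
    if q: "q \<in> I \<rightarrow> carrier Q" for q
  proof -
    have ai: "\<And>i. i \<in> I \<Longrightarrow> a i \<in> carrier A" "\<And>i. i \<in> I \<Longrightarrow> q i \<in> carrier Q" using a q by auto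
    have "sandwich T (map (map_prod \<iota> \<iota>) ps) (\<Oplus>\<^bsub>T\<^esub>i\<in>I. q i \<odot>\<^bsub>T\<^esub> \<iota> (a i)) =
        (\<Oplus>\<^bsub>T\<^esub>i\<in>I. sandwich T (map (map_prod \<iota> \<iota>) ps) (q i \<odot>\<^bsub>T\<^esub> \<iota> (a i)))"
      using ai by (intro T.A.sandwich_finsum iota_pairs ps) auto
    also have "\<dots> = (\<Oplus>\<^bsub>T\<^esub>i\<in>I. q i \<odot>\<^bsub>T\<^esub> \<iota> (sandwich A ps (a i)))"
      using ai ps(1)
      by (intro T.M.finsum_cong')
        (auto simp: T.sandwich_smult[OF iota_pairs[OF ps(1)]] iota_sandwich[OF ps(1)]
          sandwich_map_closed[OF ps(1)])
    also have "\<dots> = q i0 \<odot>\<^bsub>T\<^esub> \<iota> (sandwich A ps (a i0))"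
      using ai ps by (intro T.M.finsum_single I) auto
    finally show ?thesis by (simp add: ps)
  qed
  then show ?thesis using that ps(1) by blast
qed

text \<open>The operator of \<open>separate\<close> reduces a vanishing combination to q(i) 1 = 0,
  and a non-zero q(i) could be inverted, against 1 \<noteq> 0 in T.\<close>

lemma iota_indep:
  assumes I: "finite I" and a: "a \<in> I \<rightarrow> carrier A" and ind: "indep K A I a"
  shows "indep Q T I (\<lambda>i. \<iota> (a i))"
  unfolding indep_mod_def
proof (intro ballI impI)
  fix q i assume q: "q \<in> I \<rightarrow> carrier Q" "(\<Oplus>\<^bsub>T\<^esub>i\<in>I. q i \<odot>\<^bsub>T\<^esub> \<iota> (a i)) \<in> {\<zero>\<^bsub>T\<^esub>}" "i \<in> I"
  obtain ps where ps: "ps \<in> A.A.pairs" and sep: "\<And>q. q \<in> I \<rightarrow> carrier Q \<Longrightarrow>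
      sandwich T (map (map_prod \<iota> \<iota>) ps) (\<Oplus>\<^bsub>T\<^esub>i\<in>I. q i \<odot>\<^bsub>T\<^esub> \<iota> (a i)) = q i \<odot>\<^bsub>T\<^esub> \<one>\<^bsub>T\<^esub>"
    by (rule separate[OF I q(3) a ind]) (rule that)
  have z: "q i \<odot>\<^bsub>T\<^esub> \<one>\<^bsub>T\<^esub> = \<zero>\<^bsub>T\<^esub>"
    using q(2) T.A.sandwich_zero[OF iota_pairs[OF ps]] sep[OF q(1)] by simp
  have qi: "q i \<in> carrier Q" using q by auto
  show "q i = \<zero>\<^bsub>Q\<^esub>"
  proof (rule ccontr)
    assume "q i \<noteq> \<zero>\<^bsub>Q\<^esub>"
    then have "inv\<^bsub>Q\<^esub> (q i) \<in> carrier Q" "inv\<^bsub>Q\<^esub> (q i) \<otimes>\<^bsub>Q\<^esub> q i = \<one>\<^bsub>Q\<^esub>"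
      using qi QF.field_Units by auto
    then have "\<one>\<^bsub>T\<^esub> = inv\<^bsub>Q\<^esub> (q i) \<odot>\<^bsub>T\<^esub> (q i \<odot>\<^bsub>T\<^esub> \<one>\<^bsub>T\<^esub>)"
      using qi by (simp add: T.smult_assoc1[symmetric])
    then show False using z nontrivial \<open>inv\<^bsub>Q\<^esub> (q i) \<in> carrier Q\<close> by simp
  qed
qed

context
  fixes S ST
  assumes S: "finite_generators K A S" and ST: "finite_generators Q T ST"
begin

lemma gens: "S \<subseteq> carrier A" "finite S" "ST \<subseteq> carrier T" "finite ST"
  using S ST by (auto simp: finite_generators_def)

lemma filt_closed: "a \<in> A.filt S i \<Longrightarrow> a \<in> carrier A"
  using A.filt_carrier[OF gens(1)] by auto

text \<open>The image of Q \<otimes> A_i, where A_i is the i-th filtration step of A. The return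
  functions refer to an arbitrary generating set ST of T instead, so the two filtrations have to be
  compared.\<close>

abbreviation ext where "ext i \<equiv> T.span (\<iota> ` A.filt S i)"

lemma iota_filt_carrier: "\<iota> ` A.filt S i \<subseteq> carrier T"
  using filt_closed by auto

lemma ext_submodule: "submodule Q (ext i) T"
  by (rule T.span_is_submodule[OF iota_filt_carrier])

lemma ext_carrier: "ext i \<subseteq> carrier T"
  using ext_submodule submodule.subset by blast

lemma ext_mono: "i \<le> j \<Longrightarrow> ext i \<subseteq> ext j"
  using A.filt_mono[OF gens(1)] by (intro T.span_is_monotone) blast

lemma ext_mult:
  assumes "x \<in> ext i" "y \<in> ext j"
  shows "x \<otimes>\<^bsub>T\<^esub> y \<in> ext (i + j)"
proof -
  have *: "\<iota> a \<otimes>\<^bsub>T\<^esub> \<iota> b \<in> ext (i + j)" if "a \<in> A.filt S i" "b \<in> A.filt S j" for a b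
  proof -
    have "a \<in> carrier A" "b \<in> carrier A" using that A.filt_carrier[OF gens(1)] by auto
    then have "\<iota> a \<otimes>\<^bsub>T\<^esub> \<iota> b = \<iota> (a \<otimes>\<^bsub>A\<^esub> b)" by simp
    then show ?thesis using A.filt_mult[OF gens(1) that] T.in_span[OF iota_filt_carrier] by auto
  qed
  have "\<iota> a \<otimes>\<^bsub>T\<^esub> y \<in> ext (i + j)" if "a \<in> A.filt S i" for a
  proof -
    have "ext j \<subseteq> {y \<in> carrier T. \<iota> a \<otimes>\<^bsub>T\<^esub> y \<in> ext (i + j)}"
      using that
      by (intro T.span_subset_submodule T.submodule_mult_left ext_submodule) (auto intro: * iota(1) filt_closed)
    then show ?thesis using assms by auto
  qed
  then have "ext i \<subseteq> {x \<in> carrier T. x \<otimes>\<^bsub>T\<^esub> y \<in> ext (i + j)}"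
    using assms ext_carrier
    by (intro T.span_subset_submodule T.submodule_mult_right ext_submodule) (auto intro: iota(1) filt_closed)
  then show ?thesis using assms by auto
qed

lemma ext_exhausts:
  assumes "finite X" "X \<subseteq> carrier T"
  obtains c where "X \<subseteq> ext c"
proof -
  have one: "\<exists>c. x \<in> ext c" if x: "x \<in> carrier T" for x
  proof -
    have "x \<in> T.span (\<iota> ` carrier A)" using x span_iota by simp
    then     obtain q B where B: "finite B" "B \<subseteq> \<iota> ` carrier A" "q \<in> B \<rightarrow> carrier Q" "x = T.lincomb q B"
      unfolding T.span_def by auto
    obtain B' where B': "B' \<subseteq> carrier A" "finite B'" "B = \<iota> ` B'"
      using finite_subset_image[OF B(1,2)] by auto
    obtain c where c: "B' \<subseteq> A.filt S c"
      by (rule A.finite_generators_filt[OF S B'(2,1)]) (rule that)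
    have "B \<subseteq> \<iota> ` A.filt S c" unfolding B'(3) using c by (rule image_mono)
    then have "x \<in> ext c" unfolding T.span_def using B by auto
    then show ?thesis ..
  qed
  have "\<exists>c. X \<subseteq> ext c" using assms
  proof (induction X)
    case (insert x X)
    then obtain c c' where "X \<subseteq> ext c" "x \<in> ext c'" using one[of x] by blast
    then have "insert x X \<subseteq> ext (max c c')"
      using ext_mono[of c "max c c'"] ext_mono[of c' "max c c'"] by auto
    then show ?case by blast
  qed auto
  then show ?thesis using that by blast
qed

text \<open>Each of the two finite generating sets lies in one step of the filtration of the other,
  and multiplicativity turns this into a comparison of all steps with a linear change of
  degree.\<close>

lemma filtrations_equivalent:
  obtains c where "\<And>i. T.filt ST i \<subseteq> ext (c * i)" "\<And>i. \<iota> ` A.filt S i \<subseteq> T.filt ST (c * i)"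
proof -
  obtain c1 where c1: "ST \<subseteq> ext c1" by (rule ext_exhausts[OF gens(4,3)]) (rule that)
  have "finite (\<iota> ` S)" "\<iota> ` S \<subseteq> carrier T" using gens by auto
  then obtain c2 where c2: "\<iota> ` S \<subseteq> T.filt ST c2"
    by (rule T.finite_generators_filt[OF ST]) (rule that)
  define c where "c = max c1 c2"
  have one: "\<one>\<^bsub>T\<^esub> \<in> ext i" for i
  proof -
    have "\<iota> \<one>\<^bsub>A\<^esub> \<in> ext i"
      by (rule T.in_span[OF iota_filt_carrier]) (rule imageI[OF A.one_filt[OF gens(1)]])
    then show ?thesis by simp
  qed
  have "T.filt ST i \<subseteq> ext (c * i)" for i
  proof (rule T.filt_induct[OF gens(3)])
    fix i x y assume x: "x \<in> ext (c * i)" and y: "y \<in> insert \<one>\<^bsub>T\<^esub> ST"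
    have "y \<in> ext c" using y c1 one ext_mono[of c1 c] by (auto simp: c_def)
    then show "x \<otimes>\<^bsub>T\<^esub> y \<in> ext (c * Suc i)" using ext_mult[OF x] by (simp add: add.commute)
  qed (rule ext_submodule, rule one)
  moreover have "A.filt S i \<subseteq> {a \<in> carrier A. \<iota> a \<in> T.filt ST (c * i)}" for i
  proof (rule A.filt_induct[OF gens(1)])
    fix i x y assume x: "x \<in> {a \<in> carrier A. \<iota> a \<in> T.filt ST (c * i)}" and y: "y \<in> insert \<one>\<^bsub>A\<^esub> S"
    have yc: "y \<in> carrier A" using y gens by auto
    have "\<iota> y \<in> T.filt ST c"
      using y c2 T.one_filt[OF gens(3)] T.filt_mono[OF gens(3), of c2 c] by (auto simp: c_def)
    then show "x \<otimes>\<^bsub>A\<^esub> y \<in> {a \<in> carrier A. \<iota> a \<in> T.filt ST (c * Suc i)}"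
      using T.filt_mult[OF gens(3), of "\<iota> x" "c * i" "\<iota> y" c] x yc by (simp add: add.commute)
  next
    show "\<And>i. submodule K {a \<in> carrier A. \<iota> a \<in> T.filt ST (c * i)} A"
      by (rule preimage_submodule) (rule T.filt_submodule[OF gens(3)])
  qed (use T.one_filt[OF gens(3)] in auto)
  ultimately show ?thesis using that[of c] by blast
qed

text \<open>The Q-combinations of the images of B form a submodule that contains the image of the
  filtration step, because coefficients in K become scalars of Q. So elements of T have coordinates
  with respect to finite subsets of A.\<close>

lemma ext_combination:
  assumes "B \<subseteq> A.filt S i" "finite B" "x \<in> ext i"
    and B: "\<And>w. w \<in> A.filt S i \<Longrightarrow> \<exists>c\<in>B \<rightarrow> carrier K. w = (\<Oplus>\<^bsub>A\<^esub>b\<in>B. c b \<odot>\<^bsub>A\<^esub> b)"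
  shows "\<exists>q\<in>B \<rightarrow> carrier Q. x = (\<Oplus>\<^bsub>T\<^esub>b\<in>B. q b \<odot>\<^bsub>T\<^esub> \<iota> b)"
proof -
  have BA: "\<And>b. b \<in> B \<Longrightarrow> b \<in> carrier A" using assms(1) A.filt_carrier[OF gens(1)] by auto
  let ?N = "{\<Oplus>\<^bsub>T\<^esub>b\<in>B. q b \<odot>\<^bsub>T\<^esub> \<iota> b | q. q \<in> B \<rightarrow> carrier Q}"
  have NI: "(\<Oplus>\<^bsub>T\<^esub>b\<in>B. q b \<odot>\<^bsub>T\<^esub> \<iota> b) \<in> ?N" if "\<And>b. b \<in> B \<Longrightarrow> q b \<in> carrier Q" for q
    using that by auto
  have "submodule Q ?N T"
  proof (rule submodule.intro[OF T.module_axioms])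
    show "?N \<subseteq> carrier T" using BA by (auto intro!: T.M.finsum_closed)
    have "(\<Oplus>\<^bsub>T\<^esub>b\<in>B. \<zero>\<^bsub>Q\<^esub> \<odot>\<^bsub>T\<^esub> \<iota> b) = (\<Oplus>\<^bsub>T\<^esub>b\<in>B. \<zero>\<^bsub>T\<^esub>)"
      using BA by (intro T.M.finsum_cong') auto
    then show "\<zero>\<^bsub>T\<^esub> \<in> ?N" using NI[of "\<lambda>_. \<zero>\<^bsub>Q\<^esub>"] by simp
    fix x assume "x \<in> ?N"
    then obtain q where q: "q \<in> B \<rightarrow> carrier Q" "x = (\<Oplus>\<^bsub>T\<^esub>b\<in>B. q b \<odot>\<^bsub>T\<^esub> \<iota> b)" by auto
    have qb: "\<And>b. b \<in> B \<Longrightarrow> q b \<in> carrier Q" using q by auto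
    show "c \<odot>\<^bsub>T\<^esub> x \<in> ?N" if c: "c \<in> carrier Q" for c
    proof -
      have "c \<odot>\<^bsub>T\<^esub> x = (\<Oplus>\<^bsub>T\<^esub>b\<in>B. c \<odot>\<^bsub>T\<^esub> (q b \<odot>\<^bsub>T\<^esub> \<iota> b))"
        unfolding q(2) using c qb BA by (intro T.finsum_smult) auto
      also have "\<dots> = (\<Oplus>\<^bsub>T\<^esub>b\<in>B. (c \<otimes>\<^bsub>Q\<^esub> q b) \<odot>\<^bsub>T\<^esub> \<iota> b)"
        using c qb BA by (intro T.M.finsum_cong') (auto simp: T.smult_assoc1)
      finally show ?thesis using NI[of "\<lambda>b. c \<otimes>\<^bsub>Q\<^esub> q b"] c qb by auto
    qed
    fix y assume "y \<in> ?N"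
    then obtain r where r: "r \<in> B \<rightarrow> carrier Q" "y = (\<Oplus>\<^bsub>T\<^esub>b\<in>B. r b \<odot>\<^bsub>T\<^esub> \<iota> b)" by auto
    have rb: "\<And>b. b \<in> B \<Longrightarrow> r b \<in> carrier Q" using r by auto
    have "x \<oplus>\<^bsub>T\<^esub> y = (\<Oplus>\<^bsub>T\<^esub>b\<in>B. q b \<odot>\<^bsub>T\<^esub> \<iota> b \<oplus>\<^bsub>T\<^esub> r b \<odot>\<^bsub>T\<^esub> \<iota> b)"
      unfolding q(2) r(2) using qb rb BA by (intro T.M.finsum_addf[symmetric]) auto
    also have "\<dots> = (\<Oplus>\<^bsub>T\<^esub>b\<in>B. (q b \<oplus>\<^bsub>Q\<^esub> r b) \<odot>\<^bsub>T\<^esub> \<iota> b)"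
      using qb rb BA by (intro T.M.finsum_cong') (auto simp: T.smult_l_distr)
    finally show "x \<oplus>\<^bsub>T\<^esub> y \<in> ?N" using NI[of "\<lambda>b. q b \<oplus>\<^bsub>Q\<^esub> r b"] qb rb by auto
  qed
  moreover have "\<iota> ` A.filt S i \<subseteq> ?N"
  proof
    fix t assume "t \<in> \<iota> ` A.filt S i"
    then obtain w where w: "w \<in> A.filt S i" "t = \<iota> w" by auto
    then obtain c where c: "c \<in> B \<rightarrow> carrier K" "w = (\<Oplus>\<^bsub>A\<^esub>b\<in>B. c b \<odot>\<^bsub>A\<^esub> b)" using B by blast
    have cb: "\<And>b. b \<in> B \<Longrightarrow> c b \<in> carrier K" using c by auto
    have "t = (\<Oplus>\<^bsub>T\<^esub>b\<in>B. \<iota> (c b \<odot>\<^bsub>A\<^esub> b))"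
      unfolding w(2) c(2) using cb BA by (intro iota_finsum) auto
    also have "\<dots> = (\<Oplus>\<^bsub>T\<^esub>b\<in>B. (c b \<odot>\<^bsub>Q\<^esub> \<one>\<^bsub>Q\<^esub>) \<odot>\<^bsub>T\<^esub> \<iota> b)"
      using cb BA by (intro T.M.finsum_cong') (auto simp: iota_smult)
    finally show "t \<in> ?N" using NI[of "\<lambda>b. c b \<odot>\<^bsub>Q\<^esub> \<one>\<^bsub>Q\<^esub>"] cb by auto
  qed
  ultimately show ?thesis using T.span_subset_submodule assms(3) by blast
qed

lemma sandwich_in_span_sandwich:
  assumes "ps \<in> T.A.pairs" "set ps \<subseteq> X \<times> Y" "X \<subseteq> carrier T" "Y \<subseteq> carrier T" "a \<in> carrier T"
  shows "sandwich T ps a \<in> span_sandwich Q T X a Y"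
  using assms
proof (induction ps)
  have sub: "{x \<otimes>\<^bsub>T\<^esub> a \<otimes>\<^bsub>T\<^esub> y | x y. x \<in> X \<and> y \<in> Y} \<subseteq> carrier T"
    using subsetD[OF assms(3)] subsetD[OF assms(4)] assms(5) by auto
  then have m: "submodule Q (span_sandwich Q T X a Y) T"
    unfolding span_sandwich_def by (rule T.span_is_submodule)
  {
    case Nil then show ?case using m by (simp add: submodule.zero_closed)
  next
    case (Cons p ps)
    obtain x y where p: "p = (x, y)" by (cases p)
    have "x \<otimes>\<^bsub>T\<^esub> a \<otimes>\<^bsub>T\<^esub> y \<in> span_sandwich Q T X a Y"
      unfolding span_sandwich_def using Cons.prems p by (intro T.in_span[OF sub]) auto
    then show ?case using Cons p by (auto intro!: submodule.m_closed[OF m])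
  }
qed

text \<open>Without this the \<open>LEAST\<close> in the return functions would be meaningless. A
  step of T lies in the Q-span of a finite independent subset B of A; a non-zero element has a
  non-zero coordinate, and the separating operator for that b turns it into an invertible scalar.
  There are only finitely many b, so one j serves all elements.\<close>

lemma return_bound_exists:
  "\<exists>j. \<forall>a\<in>T.filt ST i - {\<zero>\<^bsub>T\<^esub>}. \<one>\<^bsub>T\<^esub> \<in> span_sandwich Q T (T.filt ST j) a (T.filt ST j)"
proof -
  obtain c where c: "\<And>i. T.filt ST i \<subseteq> ext (c * i)" "\<And>i. \<iota> ` A.filt S i \<subseteq> T.filt ST (c * i)"
    by (rule filtrations_equivalent) (rule that)
  obtain B where B: "finite B" "B \<subseteq> A.filt S (c * i)" "card B = A.dim_filt S (c * i)" "indep K A B (\<lambda>x. x)"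
      "\<And>w. w \<in> A.filt S (c * i) \<Longrightarrow> \<exists>c\<in>B \<rightarrow> carrier K. w = (\<Oplus>\<^bsub>A\<^esub>b\<in>B. c b \<odot>\<^bsub>A\<^esub> b)"
    by (rule A.filt_basis[OF gens(1,2)]) (rule that)
  have BA: "(\<lambda>x. x) \<in> B \<rightarrow> carrier A" using B(2) A.filt_carrier[OF gens(1)] by auto
  have "\<forall>b\<in>B. \<exists>ps. ps \<in> A.A.pairs \<and> (\<forall>q\<in>B \<rightarrow> carrier Q.
      sandwich T (map (map_prod \<iota> \<iota>) ps) (\<Oplus>\<^bsub>T\<^esub>b\<in>B. q b \<odot>\<^bsub>T\<^esub> \<iota> b) = q b \<odot>\<^bsub>T\<^esub> \<one>\<^bsub>T\<^esub>)"
  proof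
    fix b assume "b \<in> B"
    then obtain p where p: "p \<in> A.A.pairs" "\<And>q. q \<in> B \<rightarrow> carrier Q \<Longrightarrow>
      sandwich T (map (map_prod \<iota> \<iota>) p) (\<Oplus>\<^bsub>T\<^esub>b\<in>B. q b \<odot>\<^bsub>T\<^esub> \<iota> b) = q b \<odot>\<^bsub>T\<^esub> \<one>\<^bsub>T\<^esub>"
      by (rule separate[OF B(1) _ BA B(4)]) (rule that)
    then show "\<exists>ps. ps \<in> A.A.pairs \<and> (\<forall>q\<in>B \<rightarrow> carrier Q.
      sandwich T (map (map_prod \<iota> \<iota>) ps) (\<Oplus>\<^bsub>T\<^esub>b\<in>B. q b \<odot>\<^bsub>T\<^esub> \<iota> b) = q b \<odot>\<^bsub>T\<^esub> \<one>\<^bsub>T\<^esub>)"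
      by (intro exI[of _ p] conjI ballI)
  qed
  from bchoice[OF this] obtain ps where P: "\<forall>b\<in>B. ps b \<in> A.A.pairs \<and> (\<forall>q\<in>B \<rightarrow> carrier Q.
      sandwich T (map (map_prod \<iota> \<iota>) (ps b)) (\<Oplus>\<^bsub>T\<^esub>b\<in>B. q b \<odot>\<^bsub>T\<^esub> \<iota> b) = q b \<odot>\<^bsub>T\<^esub> \<one>\<^bsub>T\<^esub>)" ..
  have ps: "\<And>b. b \<in> B \<Longrightarrow> ps b \<in> A.A.pairs"
      "\<And>b q. b \<in> B \<Longrightarrow> q \<in> B \<rightarrow> carrier Q \<Longrightarrow>
        sandwich T (map (map_prod \<iota> \<iota>) (ps b)) (\<Oplus>\<^bsub>T\<^esub>b\<in>B. q b \<odot>\<^bsub>T\<^esub> \<iota> b) = q b \<odot>\<^bsub>T\<^esub> \<one>\<^bsub>T\<^esub>"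
    using bspec[OF P] by blast+
  \<comment> \<open>All left and right factors of the finitely many separating operators.\<close>
  define X where "X = (\<Union>b\<in>B. \<Union>(x, y)\<in>set (map (map_prod \<iota> \<iota>) (ps b)). {x, y})"
  have "finite X" unfolding X_def using B(1) by auto
  moreover have "X \<subseteq> carrier T" unfolding X_def using iota_pairs[OF ps(1)] by fast
  ultimately obtain j where j: "X \<subseteq> T.filt ST j" by (rule T.finite_generators_filt[OF ST]) (rule that)
  have fc: "T.filt ST j \<subseteq> carrier T" by (rule T.filt_carrier[OF gens(3)])
  have "\<one>\<^bsub>T\<^esub> \<in> span_sandwich Q T (T.filt ST j) a (T.filt ST j)" if a: "a \<in> T.filt ST i - {\<zero>\<^bsub>T\<^esub>}" for a
  proof -
    have ac: "a \<in> carrier T" using a T.filt_carrier[OF gens(3)] by auto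
    obtain q where q: "q \<in> B \<rightarrow> carrier Q" "a = (\<Oplus>\<^bsub>T\<^esub>b\<in>B. q b \<odot>\<^bsub>T\<^esub> \<iota> b)"
      using ext_combination[OF B(2,1) _ B(5)] a c by blast
    have "\<exists>b\<in>B. q b \<noteq> \<zero>\<^bsub>Q\<^esub>"
    proof (rule ccontr)
      assume *: "\<not> (\<exists>b\<in>B. q b \<noteq> \<zero>\<^bsub>Q\<^esub>)"
      have "a = (\<Oplus>\<^bsub>T\<^esub>b\<in>B. \<zero>\<^bsub>T\<^esub>)" unfolding q(2) using * Pi_mem[OF BA] by (intro T.M.finsum_cong') auto
      then show False using a by simp
    qed
    then obtain b where b: "b \<in> B" "q b \<noteq> \<zero>\<^bsub>Q\<^esub>" by blast
    have qb: "q b \<in> carrier Q" using q b by auto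
    let ?ps = "map (map_prod \<iota> \<iota>) (ps b)"
    have P: "?ps \<in> T.A.pairs" by (rule iota_pairs[OF ps(1)[OF b(1)]])
    have "set ?ps \<subseteq> X \<times> X" unfolding X_def using b(1) by fastforce
    then have "set ?ps \<subseteq> T.filt ST j \<times> T.filt ST j" using j by blast
    then have "sandwich T ?ps a \<in> span_sandwich Q T (T.filt ST j) a (T.filt ST j)"
      using P fc ac by (intro sandwich_in_span_sandwich) auto
    then have "q b \<odot>\<^bsub>T\<^esub> \<one>\<^bsub>T\<^esub> \<in> span_sandwich Q T (T.filt ST j) a (T.filt ST j)"
      using ps(2)[OF b(1) q(1)] q(2) by simp
    moreover have "{x \<otimes>\<^bsub>T\<^esub> a \<otimes>\<^bsub>T\<^esub> y | x y. x \<in> T.filt ST j \<and> y \<in> T.filt ST j} \<subseteq> carrier T"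
      using subsetD[OF fc] ac by auto
    then have "submodule Q (span_sandwich Q T (T.filt ST j) a (T.filt ST j)) T"
      unfolding span_sandwich_def by (rule T.span_is_submodule)
    moreover have iq: "inv\<^bsub>Q\<^esub> (q b) \<in> carrier Q" "inv\<^bsub>Q\<^esub> (q b) \<otimes>\<^bsub>Q\<^esub> q b = \<one>\<^bsub>Q\<^esub>"
      using qb b QF.field_Units by auto
    ultimately have "inv\<^bsub>Q\<^esub> (q b) \<odot>\<^bsub>T\<^esub> (q b \<odot>\<^bsub>T\<^esub> \<one>\<^bsub>T\<^esub>) \<in> span_sandwich Q T (T.filt ST j) a (T.filt ST j)"
      by (auto intro: submodule.smult_closed)
    then show ?thesis using iq qb by (simp add: T.smult_assoc1[symmetric])
  qed
  then show ?thesis by blast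
qed

lemma span_sandwich_mono:
  "X \<subseteq> X' \<Longrightarrow> Y \<subseteq> Y' \<Longrightarrow> span_sandwich Q T X a Y \<subseteq> span_sandwich Q T X' a Y'"
  unfolding span_sandwich_def by (intro T.span_is_monotone) blast

text \<open>Both return functions are used only through this one-sided consequence, with all of T on
  the left. This is why the choice between \<open>filter_dim\<close> and
  \<open>left_filter_dim\<close> makes no difference from here on.\<close>

lemma one_in_return_span:
  assumes nu: "nu = return_fun Q T ST \<or> nu = left_return_fun Q T ST"
    and a: "a \<in> T.filt ST i" "a \<noteq> \<zero>\<^bsub>T\<^esub>"
  shows "\<one>\<^bsub>T\<^esub> \<in> span_sandwich Q T (carrier T) a (T.filt ST (nu i))"
proof -
  have fc: "T.filt ST j \<subseteq> carrier T" for j by (rule T.filt_carrier[OF gens(3)])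
  have ex: "\<exists>j. \<forall>a\<in>T.filt ST i - {\<zero>\<^bsub>T\<^esub>}. \<one>\<^bsub>T\<^esub> \<in> span_sandwich Q T (carrier T) a (T.filt ST j)"
    using return_bound_exists[of i] span_sandwich_mono[OF fc order_refl] by blast
  show ?thesis
    using nu
  proof
    assume "nu = return_fun Q T ST"
    then have "\<forall>a\<in>T.filt ST i - {\<zero>\<^bsub>T\<^esub>}. \<one>\<^bsub>T\<^esub> \<in> span_sandwich Q T (T.filt ST (nu i)) a (T.filt ST (nu i))"
      using LeastI_ex[OF return_bound_exists[of i]] by (simp add: return_fun_def)
    then show ?thesis using a span_sandwich_mono[OF fc order_refl] by blast
  next
    assume "nu = left_return_fun Q T ST"
    then show ?thesis using LeastI_ex[OF ex] a by (simp add: left_return_fun_def)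
  qed
qed

end

end


section \<open>Ranks modulo a left ideal and the two estimates\<close>

lemma (in module) finsum_congruent:
  assumes N: "submodule R N M" and f: "f \<in> I \<rightarrow> carrier M" and g: "g \<in> I \<rightarrow> carrier M"
    and fg: "\<And>i. i \<in> I \<Longrightarrow> f i \<ominus>\<^bsub>M\<^esub> g i \<in> N"
  shows "finsum M f I \<in> N \<longleftrightarrow> finsum M g I \<in> N"
proof -
  have c: "\<And>i. i \<in> I \<Longrightarrow> f i \<in> carrier M" "\<And>i. i \<in> I \<Longrightarrow> g i \<in> carrier M" using f g by auto
  have e: "f i = (f i \<ominus>\<^bsub>M\<^esub> g i) \<oplus>\<^bsub>M\<^esub> g i" if "i \<in> I" for i
    using c[OF that] by (simp add: a_minus_def M.a_assoc M.l_neg)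
  define d where "d = (\<Oplus>\<^bsub>M\<^esub>i\<in>I. f i \<ominus>\<^bsub>M\<^esub> g i)"
  have d: "d \<in> N" unfolding d_def using fg by (intro submodule_finsum[OF N]) auto
  have dc: "d \<in> carrier M" using d submodule.subset[OF N] by auto
  have gc: "finsum M g I \<in> carrier M" using c by (intro M.finsum_closed) auto
  have "finsum M f I = (\<Oplus>\<^bsub>M\<^esub>i\<in>I. (f i \<ominus>\<^bsub>M\<^esub> g i) \<oplus>\<^bsub>M\<^esub> g i)"
    using c e by (intro M.finsum_cong') auto
  also have "\<dots> = d \<oplus>\<^bsub>M\<^esub> finsum M g I"
    unfolding d_def using c by (intro M.finsum_addf) auto
  finally have 1: "finsum M f I = d \<oplus>\<^bsub>M\<^esub> finsum M g I" .
  have "finsum M g I = finsum M f I \<oplus>\<^bsub>M\<^esub> \<ominus>\<^bsub>M\<^esub> d"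
    using 1 dc gc by (simp add: M.a_ac M.r_neg2)
  then show ?thesis
    using 1 submodule.m_closed[OF N _ submodule_uminus[OF N d], of "finsum M f I"]
      submodule.m_closed[OF N d, of "finsum M g I"] by metis
qed

lemma (in module) congruent_trans:
  assumes N: "submodule R N M" and "x \<in> carrier M" "y \<in> carrier M" "z \<in> carrier M"
    and "x \<ominus>\<^bsub>M\<^esub> y \<in> N" "y \<ominus>\<^bsub>M\<^esub> z \<in> N"
  shows "x \<ominus>\<^bsub>M\<^esub> z \<in> N"
proof -
  have "x \<ominus>\<^bsub>M\<^esub> z = (x \<ominus>\<^bsub>M\<^esub> y) \<oplus>\<^bsub>M\<^esub> (y \<ominus>\<^bsub>M\<^esub> z)"
    using assms(2-4) by (simp add: a_minus_def M.a_assoc M.r_neg2 M.r_neg1)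
  then show ?thesis using submodule.m_closed[OF N assms(5,6)] by simp
qed

lemma indep_modD:
  assumes "indep_mod K V N I v" "c \<in> I \<rightarrow> carrier K" "(\<Oplus>\<^bsub>V\<^esub>i\<in>I. c i \<odot>\<^bsub>V\<^esub> v i) \<in> N" "i \<in> I"
  shows "c i = \<zero>\<^bsub>K\<^esub>"
  using assms unfolding indep_mod_def by blast

lemma alg_independentD:
  assumes "alg_independent K A bs" "finite S" "S \<subseteq> {\<alpha>. length \<alpha> = length bs}" "c \<in> S \<rightarrow> carrier K"
    and "(\<Oplus>\<^bsub>A\<^esub>\<alpha>\<in>S. c \<alpha> \<odot>\<^bsub>A\<^esub> monomial_at A bs \<alpha>) = \<zero>\<^bsub>A\<^esub>" "\<alpha> \<in> S"
  shows "c \<alpha> = \<zero>\<^bsub>K\<^esub>"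
  using assms unfolding alg_independent_def by blast

lemma sum_list_le_length_mult: "(\<And>x. x \<in> set xs \<Longrightarrow> x \<le> i) \<Longrightarrow> sum_list xs \<le> length xs * (i::nat)"
  by (induction xs) (auto intro: add_mono)

lemma monomial_at_Nil [simp]: "monomial_at A [] \<alpha> = \<one>\<^bsub>A\<^esub>"
  by (simp add: monomial_at_def)

lemma monomial_at_Cons [simp]:
  "monomial_at A (b # bs) (n # \<alpha>) = b [^]\<^bsub>A\<^esub> n \<otimes>\<^bsub>A\<^esub> monomial_at A bs \<alpha>"
  by (simp add: monomial_at_def)

lemma (in ring) monomial_at_closed:
  "set bs \<subseteq> carrier R \<Longrightarrow> monomial_at R bs \<alpha> \<in> carrier R"
proof (induction bs arbitrary: \<alpha>)
  case (Cons b bs)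
  then show ?case by (cases \<alpha>) (auto simp: monomial_at_def)
qed simp

lemma (in assoc_algebra) pow_filt:
  assumes S: "S \<subseteq> carrier A" and b: "b \<in> filt S c"
  shows "b [^] (n::nat) \<in> filt S (c * n)"
proof (induction n)
  case 0 show ?case using one_filt[OF S] by simp
next
  case (Suc n)
  then show ?case using filt_mult[OF S Suc b] by (simp add: add.commute)
qed

lemma (in assoc_algebra) monomial_filt:
  assumes S: "S \<subseteq> carrier A"
  shows "set bs \<subseteq> filt S c \<Longrightarrow> length \<alpha> = length bs \<Longrightarrow> monomial_at A bs \<alpha> \<in> filt S (c * sum_list \<alpha>)"
proof (induction bs arbitrary: \<alpha>)
  case Nil then show ?case using one_filt[OF S] by simp
next
  case (Cons b bs)
  then obtain n \<alpha>' where "\<alpha> = n # \<alpha>'" "length \<alpha>' = length bs" by (cases \<alpha>) auto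
  then show ?case
    using filt_mult[OF S pow_filt[OF S, of b c n] Cons.IH[of \<alpha>']] Cons.prems by (simp add: distrib_left)
qed

text \<open>The quotient T/N is never formed: its linear algebra is expressed by congruences modulo
  N in T. The list \<open>xs\<close> consists of the values that the commuting elements
  \<open>cs\<close> take in Q.\<close>

locale base_change_module = base_change +
  fixes S ST N cs xs
  assumes S: "finite_generators K A S" and ST: "finite_generators Q T ST"
    and N: "submodule Q N T"
    and N_left: "\<lbrakk>t \<in> carrier T; n \<in> N\<rbrakk> \<Longrightarrow> t \<otimes>\<^bsub>T\<^esub> n \<in> N"
    and one_notin_N: "\<one>\<^bsub>T\<^esub> \<notin> N"
    and cs: "set cs \<subseteq> carrier A"
    and cs_xs: "list_all2 (\<lambda>c x. \<iota> c \<ominus>\<^bsub>T\<^esub> x \<odot>\<^bsub>T\<^esub> \<one>\<^bsub>T\<^esub> \<in> N) cs xs"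
    and xs_indep: "alg_independent K Q xs"
begin

lemmas gens' = gens[OF S ST]
lemmas filt_closed' = filt_closed[OF S ST]

lemma N_carrier: "n \<in> N \<Longrightarrow> n \<in> carrier T"
  using submodule.subset[OF N] by auto

lemma xs: "set xs \<subseteq> carrier Q" "length xs = length cs"
  using xs_indep cs_xs by (auto simp: alg_independent_def list_all2_lengthD)

definition specializes where
  "specializes a q \<longleftrightarrow> a \<in> carrier A \<and> q \<in> carrier Q \<and> \<iota> a \<ominus>\<^bsub>T\<^esub> q \<odot>\<^bsub>T\<^esub> \<one>\<^bsub>T\<^esub> \<in> N"

lemma specializes_one: "specializes \<one>\<^bsub>A\<^esub> \<one>\<^bsub>Q\<^esub>"
  using submodule.zero_closed[OF N] by (simp add: specializes_def a_minus_def T.M.r_neg)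

text \<open>N is a left ideal, so a congruence may be multiplied by t from the left: modulo N, right
  multiplication of t by a is scaling by q.\<close>

lemma specializes_action:
  assumes "specializes a q" "t \<in> carrier T"
  shows "t \<otimes>\<^bsub>T\<^esub> \<iota> a \<ominus>\<^bsub>T\<^esub> q \<odot>\<^bsub>T\<^esub> t \<in> N"
proof -
  have "t \<otimes>\<^bsub>T\<^esub> (\<iota> a \<ominus>\<^bsub>T\<^esub> q \<odot>\<^bsub>T\<^esub> \<one>\<^bsub>T\<^esub>) \<in> N" using assms N_left by (auto simp: specializes_def)
  then show ?thesis
    using assms by (simp add: specializes_def a_minus_def T.A.r_distr T.A.r_minus T.smult_right)
qed

lemma specializes_mult:
  assumes "specializes a q" "specializes a' q'"
  shows "specializes (a \<otimes>\<^bsub>A\<^esub> a') (q \<otimes>\<^bsub>Q\<^esub> q')"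
proof -
  have c: "a \<in> carrier A" "a' \<in> carrier A" "q \<in> carrier Q" "q' \<in> carrier Q"
    using assms by (auto simp: specializes_def)
  \<comment> \<open>Only left multiplication preserves N, so the right-hand factor is specialised
    before the left-hand one; commutativity of Q restores the order.\<close>
  have 1: "\<iota> a \<otimes>\<^bsub>T\<^esub> \<iota> a' \<ominus>\<^bsub>T\<^esub> q' \<odot>\<^bsub>T\<^esub> \<iota> a \<in> N"
    by (rule specializes_action[OF assms(2)]) (simp add: c)
  have "q' \<odot>\<^bsub>T\<^esub> (\<iota> a \<ominus>\<^bsub>T\<^esub> q \<odot>\<^bsub>T\<^esub> \<one>\<^bsub>T\<^esub>) \<in> N"
    using assms(1) c submodule.smult_closed[OF N] by (auto simp: specializes_def)
  also have "q' \<odot>\<^bsub>T\<^esub> (\<iota> a \<ominus>\<^bsub>T\<^esub> q \<odot>\<^bsub>T\<^esub> \<one>\<^bsub>T\<^esub>) = q' \<odot>\<^bsub>T\<^esub> \<iota> a \<ominus>\<^bsub>T\<^esub> (q \<otimes>\<^bsub>Q\<^esub> q') \<odot>\<^bsub>T\<^esub> \<one>\<^bsub>T\<^esub>"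
    using c by (simp add: a_minus_def T.smult_r_distr T.smult_r_minus T.smult_assoc1[symmetric] Q.m_comm)
  finally have "\<iota> a \<otimes>\<^bsub>T\<^esub> \<iota> a' \<ominus>\<^bsub>T\<^esub> (q \<otimes>\<^bsub>Q\<^esub> q') \<odot>\<^bsub>T\<^esub> \<one>\<^bsub>T\<^esub> \<in> N"
    using c by (intro T.congruent_trans[OF N _ _ _ 1]) auto
  then show ?thesis using c by (simp add: specializes_def)
qed

lemma specializes_pow:
  assumes "specializes a q"
  shows "specializes (a [^]\<^bsub>A\<^esub> (n::nat)) (q [^]\<^bsub>Q\<^esub> n)"
proof (induction n)
  case 0 show ?case using specializes_one by simp
next
  case (Suc n) then show ?case using specializes_mult[OF Suc assms] by simp
qed

lemma specializes_monomial:
  assumes "length \<alpha> = length cs"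
  shows "specializes (monomial_at A cs \<alpha>) (monomial_at Q xs \<alpha>)"
  using cs_xs cs xs(1) assms
proof (induction arbitrary: \<alpha> rule: list_all2_induct)
  case Nil then show ?case using specializes_one by simp
next
  case (Cons c cs x xs)
  then obtain n \<alpha>' where a: "\<alpha> = n # \<alpha>'" "length \<alpha>' = length cs" by (cases \<alpha>) auto
  have "specializes c x" using Cons by (simp add: specializes_def)
  then show ?case
    using specializes_mult[OF specializes_pow[of c x n] Cons.IH[of \<alpha>']] Cons.prems a by simp
qed

text \<open>Lifts are taken in the filtration step of A itself and not in its Q-span: their products
  with monomials in \<open>cs\<close> are then elements of A and can be counted over K.\<close>

definition families where
  "families j = {B. finite B \<and> B \<subseteq> A.filt S j \<and> indep_mod Q T N B \<iota>}"

definition rank where "rank j = Max (card ` families j)"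

text \<open>A K-basis of the filtration step spans its image over Q, so the sizes of families are
  bounded and the maximum in \<open>rank\<close> is taken over a finite set.\<close>

lemma families_card_le: "B \<in> families j \<Longrightarrow> card B \<le> A.dim_filt S j"
proof (rule ccontr)
  assume B: "B \<in> families j" and "\<not> card B \<le> A.dim_filt S j"
  then have card: "A.dim_filt S j < card B" by simp
  have Bc: "finite B" "B \<subseteq> A.filt S j" "indep_mod Q T N B \<iota>" using B by (auto simp: families_def)
  obtain J where J: "finite J" "J \<subseteq> A.filt S j" "card J = A.dim_filt S j" "indep K A J (\<lambda>x. x)"
      "\<And>w. w \<in> A.filt S j \<Longrightarrow> \<exists>c\<in>J \<rightarrow> carrier K. w = (\<Oplus>\<^bsub>A\<^esub>b\<in>J. c b \<odot>\<^bsub>A\<^esub> b)"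
    by (rule A.filt_basis[OF gens'(1,2)]) (rule that)
  have "\<not> indep_mod Q T N B \<iota>"
  proof (rule T.dependent_mod[OF N Bc(1) J(1), where w = \<iota>])
    show "card J < card B" using card J by simp
    show "\<iota> \<in> B \<rightarrow> carrier T" "\<iota> \<in> J \<rightarrow> carrier T" using Bc J filt_closed' by auto
    fix b assume b: "b \<in> B"
    then have "\<iota> b \<in> ext S j" using Bc(2) by (intro T.in_span iota_filt_carrier[OF S ST]) auto
    then obtain q where q: "q \<in> J \<rightarrow> carrier Q" "\<iota> b = (\<Oplus>\<^bsub>T\<^esub>j\<in>J. q j \<odot>\<^bsub>T\<^esub> \<iota> j)"
      using ext_combination[OF S ST J(2,1) _ J(5)] by blast
    have "\<iota> b \<in> carrier T" using b Bc filt_closed' by auto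
    then show "\<exists>c\<in>J \<rightarrow> carrier Q. \<iota> b \<ominus>\<^bsub>T\<^esub> (\<Oplus>\<^bsub>T\<^esub>j\<in>J. c j \<odot>\<^bsub>T\<^esub> \<iota> j) \<in> N"
      using q submodule.zero_closed[OF N] by (intro bexI[of _ q]) (auto simp: a_minus_def T.M.r_neg)
  qed
  then show False using Bc by simp
qed

lemma card_families: "finite (card ` families j)" "{} \<in> families j"
proof -
  show "finite (card ` families j)"
    by (rule finite_subset[of _ "{..A.dim_filt S j}"]) (auto simp: families_card_le)
qed (simp add: families_def indep_mod_def)

lemma rank_attained: obtains B where "B \<in> families j" "card B = rank j"
  using Max_in[OF card_families(1)[of j]] card_families(2)[of j] unfolding rank_def by fastforce

lemma card_le_rank: "B \<in> families j \<Longrightarrow> card B \<le> rank j"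
  unfolding rank_def using card_families(1) by (intro Max_ge) auto

lemma rank_mono: "mono rank"
proof (rule monoI)
  fix i j :: nat assume "i \<le> j"
  then have "families i \<subseteq> families j" using A.filt_mono[OF gens'(1)] unfolding families_def by blast
  moreover obtain B where "B \<in> families i" "card B = rank i" by (rule rank_attained)
  ultimately show "rank i \<le> rank j" using card_le_rank[of B j] by auto
qed

lemma rank_pos: "1 \<le> rank 0"
proof -
  have "indep_mod Q T N {\<one>\<^bsub>A\<^esub>} \<iota>"
    unfolding indep_mod_def
  proof (intro ballI impI)
    fix q i assume q: "q \<in> {\<one>\<^bsub>A\<^esub>} \<rightarrow> carrier Q" "(\<Oplus>\<^bsub>T\<^esub>i\<in>{\<one>\<^bsub>A\<^esub>}. q i \<odot>\<^bsub>T\<^esub> \<iota> i) \<in> N" "i \<in> {\<one>\<^bsub>A\<^esub>}"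
    then have *: "q i \<in> carrier Q" "q i \<odot>\<^bsub>T\<^esub> \<one>\<^bsub>T\<^esub> \<in> N" by (auto simp: T.M.finsum_insert)
    show "q i = \<zero>\<^bsub>Q\<^esub>"
    proof (rule ccontr)
      assume "q i \<noteq> \<zero>\<^bsub>Q\<^esub>"
      then have iq: "inv\<^bsub>Q\<^esub> (q i) \<in> carrier Q" "inv\<^bsub>Q\<^esub> (q i) \<otimes>\<^bsub>Q\<^esub> q i = \<one>\<^bsub>Q\<^esub>"
        using * QF.field_Units by auto
      then have "inv\<^bsub>Q\<^esub> (q i) \<odot>\<^bsub>T\<^esub> (q i \<odot>\<^bsub>T\<^esub> \<one>\<^bsub>T\<^esub>) \<in> N" using * submodule.smult_closed[OF N] by auto
      then show False using iq * one_notin_N by (simp add: T.smult_assoc1[symmetric])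
    qed
  qed
  then have "{\<one>\<^bsub>A\<^esub>} \<in> families 0" using A.one_filt[OF gens'(1)] by (simp add: families_def)
  then show ?thesis using card_le_rank by fastforce
qed

text \<open>A family of maximal size spans modulo N, since otherwise one more element of the step
  could be adjoined.\<close>

lemma family_spans:
  assumes B: "B \<in> families j" "card B = rank j" and w: "w \<in> A.filt S j"
  shows "\<exists>q\<in>B \<rightarrow> carrier Q. \<iota> w \<ominus>\<^bsub>T\<^esub> (\<Oplus>\<^bsub>T\<^esub>b\<in>B. q b \<odot>\<^bsub>T\<^esub> \<iota> b) \<in> N"
proof -
  have Bc: "finite B" "B \<subseteq> A.filt S j" "indep_mod Q T N B \<iota>" using B by (auto simp: families_def)
  have BA: "\<And>b. b \<in> B \<Longrightarrow> \<iota> b \<in> carrier T" using Bc filt_closed' by auto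
  show ?thesis
  proof (cases "w \<in> B")
    case True
    have "(\<Oplus>\<^bsub>T\<^esub>b\<in>B. (if b = w then \<one>\<^bsub>Q\<^esub> else \<zero>\<^bsub>Q\<^esub>) \<odot>\<^bsub>T\<^esub> \<iota> b) = \<iota> w"
      using T.M.finsum_single[OF Bc(1) True, of "\<lambda>b. (if b = w then \<one>\<^bsub>Q\<^esub> else \<zero>\<^bsub>Q\<^esub>) \<odot>\<^bsub>T\<^esub> \<iota> b"] BA True
      by auto
    then show ?thesis using BA[OF True] submodule.zero_closed[OF N]
      by (intro bexI[of _ "\<lambda>b. if b = w then \<one>\<^bsub>Q\<^esub> else \<zero>\<^bsub>Q\<^esub>"]) (auto simp: a_minus_def T.M.r_neg)
  next
    case False
    have "insert w B \<notin> families j"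
    proof
      assume "insert w B \<in> families j"
      then show False using card_le_rank[of "insert w B" j] B(2) False Bc(1) by simp
    qed
    then have "\<not> indep_mod Q T N (insert w B) \<iota>" using Bc w by (simp add: families_def)
    moreover have "\<iota> \<in> insert w B \<rightarrow> carrier T" using BA filt_closed'[OF w] by auto
    ultimately show ?thesis using T.indep_mod_extend[OF N Bc(1) False] Bc(3) by blast
  qed
qed

text \<open>The products b c^\<alpha>, with b in a maximal family and \<alpha> in a box of
  exponents, are independent over K: modulo N a relation between them turns into a relation between
  the b whose coefficients are polynomials in \<open>xs\<close>. Independence of the family and then
  of \<open>xs\<close> removes all coefficients.\<close>

lemma rank_lower:
  obtains c where "\<And>i j. rank j * (i + 1) ^ length cs \<le> A.dim_filt S (j + c * i)"
proof -
  have "finite (set cs)" by simp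
  then obtain c0 where c0: "set cs \<subseteq> A.filt S c0"
    using cs by (rule A.finite_generators_filt[OF S]) (rule that)
  have "rank j * (i + 1) ^ length cs \<le> A.dim_filt S (j + c0 * length cs * i)" for i j
  proof -
    obtain B where B: "B \<in> families j" "card B = rank j" by (rule rank_attained)
    have Bc: "finite B" "B \<subseteq> A.filt S j" "indep_mod Q T N B \<iota>" using B by (auto simp: families_def)
    have BA: "\<And>b. b \<in> B \<Longrightarrow> b \<in> carrier A" using Bc filt_closed' by auto
    \<comment> \<open>With n = \<open>length cs\<close>, there are (i + 1)^n exponents with entries
      up to i; their total degree is at most n i, whence the constant c0 n in the
      conclusion.\<close>
    define Box where "Box = {\<alpha>. set \<alpha> \<subseteq> {..i} \<and> length \<alpha> = length cs}"
    have Box: "finite Box" "card Box = (i + 1) ^ length cs"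
      unfolding Box_def by (auto simp: finite_lists_length_eq card_lists_length_eq)
    have mA: "\<And>\<alpha>. monomial_at A cs \<alpha> \<in> carrier A" by (rule A.A.monomial_at_closed[OF cs])
    have mQ: "\<And>\<alpha>. monomial_at Q xs \<alpha> \<in> carrier Q" by (rule Q.monomial_at_closed[OF xs(1)])
    let ?w = "\<lambda>(b, \<alpha>). b \<otimes>\<^bsub>A\<^esub> monomial_at A cs \<alpha>"
    have "?w \<in> B \<times> Box \<rightarrow> A.filt S (j + c0 * length cs * i)"
    proof (intro Pi_I)
      fix p assume "p \<in> B \<times> Box"
      then obtain b \<alpha> where p: "p = (b, \<alpha>)" "b \<in> B" "\<alpha> \<in> Box" by auto
      have "sum_list \<alpha> \<le> length \<alpha> * i" using p(3) by (intro sum_list_le_length_mult) (auto simp: Box_def)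
      then have "c0 * sum_list \<alpha> \<le> c0 * length cs * i" using p(3) by (simp add: Box_def mult.assoc)
      moreover have "monomial_at A cs \<alpha> \<in> A.filt S (c0 * sum_list \<alpha>)"
        using p(3) by (intro A.monomial_filt[OF gens'(1) c0]) (simp add: Box_def)
      ultimately have "monomial_at A cs \<alpha> \<in> A.filt S (c0 * length cs * i)"
        using A.filt_mono[OF gens'(1)] by blast
      then show "?w p \<in> A.filt S (j + c0 * length cs * i)"
        using p Bc(2) A.filt_mult[OF gens'(1)] by auto
    qed
    moreover have "indep K A (B \<times> Box) ?w"
      unfolding indep_mod_def
    proof (intro ballI impI)
      fix k p assume k: "k \<in> B \<times> Box \<rightarrow> carrier K" and z: "(\<Oplus>\<^bsub>A\<^esub>i\<in>B \<times> Box. k i \<odot>\<^bsub>A\<^esub> ?w i) \<in> {\<zero>\<^bsub>A\<^esub>}"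
        and p: "p \<in> B \<times> Box"
      have kc: "\<And>b \<alpha>. b \<in> B \<Longrightarrow> \<alpha> \<in> Box \<Longrightarrow> k (b, \<alpha>) \<in> carrier K" using k by auto
      define g where "g b \<alpha> = k (b, \<alpha>) \<odot>\<^bsub>Q\<^esub> monomial_at Q xs \<alpha>" for b \<alpha>
      have gc: "\<And>b \<alpha>. b \<in> B \<Longrightarrow> \<alpha> \<in> Box \<Longrightarrow> g b \<alpha> \<in> carrier Q" using kc mQ by (auto simp: g_def)
      have "(\<Oplus>\<^bsub>T\<^esub>i\<in>B \<times> Box. \<iota> (k i \<odot>\<^bsub>A\<^esub> ?w i)) = \<iota> (\<Oplus>\<^bsub>A\<^esub>i\<in>B \<times> Box. k i \<odot>\<^bsub>A\<^esub> ?w i)"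
        using kc BA mA by (intro iota_finsum[symmetric]) auto
      then have "(\<Oplus>\<^bsub>T\<^esub>i\<in>B \<times> Box. \<iota> (k i \<odot>\<^bsub>A\<^esub> ?w i)) \<in> N"
        using z submodule.zero_closed[OF N] by simp
      \<comment> \<open>Modulo N, multiplication by c^\<alpha> on the right is scaling by
        x^\<alpha>.\<close>
      also have "?this \<longleftrightarrow> (\<Oplus>\<^bsub>T\<^esub>i\<in>B \<times> Box. (\<lambda>(b, \<alpha>). g b \<alpha> \<odot>\<^bsub>T\<^esub> \<iota> b) i) \<in> N"
      proof (rule T.finsum_congruent[OF N])
        fix i assume "i \<in> B \<times> Box"
        then obtain b \<alpha> where i: "i = (b, \<alpha>)" "b \<in> B" "\<alpha> \<in> Box" by auto
        have "specializes (monomial_at A cs \<alpha>) (monomial_at Q xs \<alpha>)"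
          using i by (intro specializes_monomial) (simp add: Box_def)
        then have "\<iota> b \<otimes>\<^bsub>T\<^esub> \<iota> (monomial_at A cs \<alpha>) \<ominus>\<^bsub>T\<^esub> monomial_at Q xs \<alpha> \<odot>\<^bsub>T\<^esub> \<iota> b \<in> N"
          using i BA by (intro specializes_action) auto
        then have "(k i \<odot>\<^bsub>Q\<^esub> \<one>\<^bsub>Q\<^esub>) \<odot>\<^bsub>T\<^esub>
            (\<iota> b \<otimes>\<^bsub>T\<^esub> \<iota> (monomial_at A cs \<alpha>) \<ominus>\<^bsub>T\<^esub> monomial_at Q xs \<alpha> \<odot>\<^bsub>T\<^esub> \<iota> b) \<in> N"
          using kc[of b \<alpha>] i by (intro submodule.smult_closed[OF N]) auto
        also have "(k i \<odot>\<^bsub>Q\<^esub> \<one>\<^bsub>Q\<^esub>) \<odot>\<^bsub>T\<^esub>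
            (\<iota> b \<otimes>\<^bsub>T\<^esub> \<iota> (monomial_at A cs \<alpha>) \<ominus>\<^bsub>T\<^esub> monomial_at Q xs \<alpha> \<odot>\<^bsub>T\<^esub> \<iota> b) =
            \<iota> (k i \<odot>\<^bsub>A\<^esub> ?w i) \<ominus>\<^bsub>T\<^esub> g b \<alpha> \<odot>\<^bsub>T\<^esub> \<iota> b"
          using i kc[of b \<alpha>] BA mA mQ
          by (simp add: g_def iota_smult a_minus_def T.smult_r_distr T.smult_r_minus
              T.smult_assoc1[symmetric] Q.smult_assoc2)
        finally show "\<iota> (k i \<odot>\<^bsub>A\<^esub> ?w i) \<ominus>\<^bsub>T\<^esub> (\<lambda>(b, \<alpha>). g b \<alpha> \<odot>\<^bsub>T\<^esub> \<iota> b) i \<in> N" using i by simp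
      qed (use kc gc BA mA in auto)
      also have "(\<Oplus>\<^bsub>T\<^esub>i\<in>B \<times> Box. (\<lambda>(b, \<alpha>). g b \<alpha> \<odot>\<^bsub>T\<^esub> \<iota> b) i) = (\<Oplus>\<^bsub>T\<^esub>b\<in>B. \<Oplus>\<^bsub>T\<^esub>\<alpha>\<in>Box. g b \<alpha> \<odot>\<^bsub>T\<^esub> \<iota> b)"
        using T.M.finsum_Sigma[of B "\<lambda>_. Box" "\<lambda>b \<alpha>. g b \<alpha> \<odot>\<^bsub>T\<^esub> \<iota> b"] Bc(1) Box(1) gc BA by simp
      also have "\<dots> = (\<Oplus>\<^bsub>T\<^esub>b\<in>B. (\<Oplus>\<^bsub>Q\<^esub>\<alpha>\<in>Box. g b \<alpha>) \<odot>\<^bsub>T\<^esub> \<iota> b)"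
      proof (intro T.M.finsum_cong' refl)
        fix b assume b: "b \<in> B"
        show "(\<Oplus>\<^bsub>T\<^esub>\<alpha>\<in>Box. g b \<alpha> \<odot>\<^bsub>T\<^esub> \<iota> b) = (\<Oplus>\<^bsub>Q\<^esub>\<alpha>\<in>Box. g b \<alpha>) \<odot>\<^bsub>T\<^esub> \<iota> b"
          using b gc BA
          by (intro finsum_hom[symmetric, where h = "\<lambda>x. x \<odot>\<^bsub>T\<^esub> \<iota> b"])
            (auto simp: T.smult_l_distr intro: T.M.abelian_monoid_axioms Q.abelian_monoid_axioms)
      qed (use gc BA in \<open>auto intro!: Q.finsum_closed\<close>)
      finally have "(\<Oplus>\<^bsub>T\<^esub>b\<in>B. (\<Oplus>\<^bsub>Q\<^esub>\<alpha>\<in>Box. g b \<alpha>) \<odot>\<^bsub>T\<^esub> \<iota> b) \<in> N" .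
      moreover have "(\<lambda>b. \<Oplus>\<^bsub>Q\<^esub>\<alpha>\<in>Box. g b \<alpha>) \<in> B \<rightarrow> carrier Q" using gc by (auto intro!: Q.finsum_closed)
      \<comment> \<open>One polynomial relation in \<open>xs\<close> remains for each b.\<close>
      ultimately have gz: "\<forall>b\<in>B. (\<Oplus>\<^bsub>Q\<^esub>\<alpha>\<in>Box. g b \<alpha>) = \<zero>\<^bsub>Q\<^esub>"
        using indep_modD[OF Bc(3), of "\<lambda>b. \<Oplus>\<^bsub>Q\<^esub>\<alpha>\<in>Box. g b \<alpha>"] by blast
      obtain b \<alpha> where ba: "p = (b, \<alpha>)" "b \<in> B" "\<alpha> \<in> Box" using p by auto
      have "Box \<subseteq> {\<alpha>. length \<alpha> = length xs}" using xs by (auto simp: Box_def)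
      moreover have "(\<lambda>\<alpha>. k (b, \<alpha>)) \<in> Box \<rightarrow> carrier K" using kc ba by auto
      moreover have "(\<Oplus>\<^bsub>Q\<^esub>\<alpha>\<in>Box. k (b, \<alpha>) \<odot>\<^bsub>Q\<^esub> monomial_at Q xs \<alpha>) = \<zero>\<^bsub>Q\<^esub>"
        using gz ba(2) by (simp add: g_def)
      ultimately have "k (b, \<alpha>) = \<zero>\<^bsub>K\<^esub>"
        by (rule alg_independentD[OF xs_indep Box(1), where c = "\<lambda>\<alpha>. k (b, \<alpha>)", OF _ _ _ ba(3)])
      then show "k p = \<zero>\<^bsub>K\<^esub>" using ba by simp
    qed
    ultimately have "card (B \<times> Box) \<le> A.dim_filt S (j + c0 * length cs * i)"
      using Bc(1) Box(1) by (intro A.indep_card_le_dim_filt[OF gens'(1,2)]) auto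
    then show ?thesis using B Box by (simp add: card_cartesian_product)
  qed
  then show ?thesis using that[of "c0 * length cs"] by blast
qed

text \<open>Suppose the dimension exceeds the product of ranks. A combination \<tau> of a basis of
  A_i with coefficients in Q satisfies \<tau> B \<subseteq> N as soon as card B times card C linear
  equations hold, so some non-zero \<tau> does. Then \<tau> sends the whole step of T selected by
  the return function into N, and 1, lying in T \<tau> times that step, would be in N.\<close>

lemma rank_upper:
  assumes nu: "nu = return_fun Q T ST \<or> nu = left_return_fun Q T ST"
    and c: "\<And>i. T.filt ST i \<subseteq> ext S (c * i)" "\<And>i. \<iota> ` A.filt S i \<subseteq> T.filt ST (c * i)"
  shows "A.dim_filt S i \<le> rank (c * nu (c * i)) * rank (i + c * nu (c * i))"
proof (rule ccontr)
  define J where "J = c * nu (c * i)"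
  assume "\<not> A.dim_filt S i \<le> rank (c * nu (c * i)) * rank (i + c * nu (c * i))"
  then have less: "rank J * rank (i + J) < A.dim_filt S i" by (simp add: J_def)
  obtain A0 where A0: "finite A0" "A0 \<subseteq> A.filt S i" "card A0 = A.dim_filt S i" "indep K A A0 (\<lambda>x. x)"
      "\<And>w. w \<in> A.filt S i \<Longrightarrow> \<exists>c\<in>A0 \<rightarrow> carrier K. w = (\<Oplus>\<^bsub>A\<^esub>b\<in>A0. c b \<odot>\<^bsub>A\<^esub> b)"
    by (rule A.filt_basis[OF gens'(1,2)]) (rule that)
  obtain B where B: "B \<in> families J" "card B = rank J" by (rule rank_attained)
  obtain C where C: "C \<in> families (i + J)" "card C = rank (i + J)" by (rule rank_attained)
  have Bc: "finite B" "B \<subseteq> A.filt S J" and Cc: "finite C" "C \<subseteq> A.filt S (i + J)"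
    using B C by (auto simp: families_def)
  have Ac: "\<And>a. a \<in> A0 \<Longrightarrow> a \<in> carrier A" "\<And>a. a \<in> B \<Longrightarrow> a \<in> carrier A" "\<And>a. a \<in> C \<Longrightarrow> a \<in> carrier A"
    using A0(2) Bc(2) Cc(2) filt_closed' by auto
  \<comment> \<open>The product of a in degree i and s in degree J has degree i + J, so modulo N it
    has coordinates in the family C.\<close>
  have "\<forall>p\<in>A0 \<times> B. \<exists>q\<in>C \<rightarrow> carrier Q. \<iota> (fst p \<otimes>\<^bsub>A\<^esub> snd p) \<ominus>\<^bsub>T\<^esub> (\<Oplus>\<^bsub>T\<^esub>r\<in>C. q r \<odot>\<^bsub>T\<^esub> \<iota> r) \<in> N"
    using A0(2) Bc(2) by (intro ballI family_spans[OF C] A.filt_mult[OF gens'(1)]) auto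
  from bchoice[OF this[unfolded Bex_def]]
  obtain m where M: "\<forall>p\<in>A0 \<times> B. m p \<in> C \<rightarrow> carrier Q \<and>
      \<iota> (fst p \<otimes>\<^bsub>A\<^esub> snd p) \<ominus>\<^bsub>T\<^esub> (\<Oplus>\<^bsub>T\<^esub>r\<in>C. m p r \<odot>\<^bsub>T\<^esub> \<iota> r) \<in> N" ..
  note m = conjunct1[OF bspec[OF M]] and mN = conjunct2[OF bspec[OF M]]
  have mc: "m (a, s) r \<in> carrier Q" if "a \<in> A0" "s \<in> B" "r \<in> C" for a s r
    using m[of "(a, s)"] that by auto
  have "card (B \<times> C) < card A0" using less A0(3) B(2) C(2) by (simp add: card_cartesian_product)
  \<comment> \<open>One equation for each s in B and r in C: together they make all coordinates of
    \<tau> s modulo N vanish.\<close>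
  then have "\<exists>q\<in>A0 \<rightarrow> carrier Q. (\<exists>a\<in>A0. q a \<noteq> \<zero>\<^bsub>Q\<^esub>) \<and>
      (\<forall>j\<in>B \<times> C. (\<Oplus>\<^bsub>Q\<^esub>a\<in>A0. q a \<otimes>\<^bsub>Q\<^esub> m (a, fst j) (snd j)) = \<zero>\<^bsub>Q\<^esub>)"
    using Bc(1) Cc(1) A0(1) mc
    by (intro QF.homogeneous_system[of "B \<times> C" A0 "\<lambda>a j. m (a, fst j) (snd j)"]) auto
  then obtain q where q: "q \<in> A0 \<rightarrow> carrier Q" "\<exists>a\<in>A0. q a \<noteq> \<zero>\<^bsub>Q\<^esub>"
    and qz': "\<forall>j\<in>B \<times> C. (\<Oplus>\<^bsub>Q\<^esub>a\<in>A0. q a \<otimes>\<^bsub>Q\<^esub> m (a, fst j) (snd j)) = \<zero>\<^bsub>Q\<^esub>"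
    by (elim bexE conjE) (rule that, assumption, rule bexI, assumption+)
  have qz: "(\<Oplus>\<^bsub>Q\<^esub>a\<in>A0. q a \<otimes>\<^bsub>Q\<^esub> m (a, s) r) = \<zero>\<^bsub>Q\<^esub>" if "s \<in> B" "r \<in> C" for s r
    using bspec[OF qz', of "(s, r)"] that by simp
  have qc: "\<And>a. a \<in> A0 \<Longrightarrow> q a \<in> carrier Q" using q by auto
  define \<tau> where "\<tau> = (\<Oplus>\<^bsub>T\<^esub>a\<in>A0. q a \<odot>\<^bsub>T\<^esub> \<iota> a)"
  have \<tau>c: "\<tau> \<in> carrier T" unfolding \<tau>_def using qc Ac by (intro T.M.finsum_closed) auto
  have "\<tau> \<noteq> \<zero>\<^bsub>T\<^esub>"
  proof
    assume "\<tau> = \<zero>\<^bsub>T\<^esub>"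
    moreover have "indep Q T A0 \<iota>" using iota_indep[OF A0(1) _ A0(4)] Ac by simp
    ultimately have "q a = \<zero>\<^bsub>Q\<^esub>" if "a \<in> A0" for a
      by (intro indep_modD[of Q T "{\<zero>\<^bsub>T\<^esub>}" A0 \<iota> q, OF _ q(1) _ that]) (simp_all add: \<tau>_def)
    then show False using q(2) by blast
  qed
  moreover have "\<tau> \<in> T.filt ST (c * i)"
    unfolding \<tau>_def
  proof (rule T.submodule_finsum[OF T.filt_submodule[OF gens'(3)]], intro Pi_I)
    fix a assume a: "a \<in> A0"
    then have "\<iota> a \<in> T.filt ST (c * i)" using c(2)[of i] A0(2) by blast
    then show "q a \<odot>\<^bsub>T\<^esub> \<iota> a \<in> T.filt ST (c * i)"
      by (rule submodule.smult_closed[OF T.filt_submodule[OF gens'(3)] qc[OF a]])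
  qed
  \<comment> \<open>In the filtration of T the element \<tau> has degree at most c i, hence
    \<open>nu\<close> is evaluated at c i.\<close>
  ultimately have one: "\<one>\<^bsub>T\<^esub> \<in> span_sandwich Q T (carrier T) \<tau> (T.filt ST (nu (c * i)))"
    using one_in_return_span[OF S ST nu] by blast
  have \<tau>B: "\<tau> \<otimes>\<^bsub>T\<^esub> \<iota> s \<in> N" if s: "s \<in> B" for s
  proof -
    have "\<tau> \<otimes>\<^bsub>T\<^esub> \<iota> s = (\<Oplus>\<^bsub>T\<^esub>a\<in>A0. (q a \<odot>\<^bsub>T\<^esub> \<iota> a) \<otimes>\<^bsub>T\<^esub> \<iota> s)"
      unfolding \<tau>_def using A0(1) qc Ac s by (intro T.A.finsum_ldistr) auto
    also have "\<dots> = (\<Oplus>\<^bsub>T\<^esub>a\<in>A0. q a \<odot>\<^bsub>T\<^esub> \<iota> (a \<otimes>\<^bsub>A\<^esub> s))"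
      using qc Ac s by (intro T.M.finsum_cong') (auto simp: T.smult_left)
    finally have 1: "\<tau> \<otimes>\<^bsub>T\<^esub> \<iota> s = (\<Oplus>\<^bsub>T\<^esub>a\<in>A0. q a \<odot>\<^bsub>T\<^esub> \<iota> (a \<otimes>\<^bsub>A\<^esub> s))" .
    define u where "u a = (\<Oplus>\<^bsub>T\<^esub>r\<in>C. m (a, s) r \<odot>\<^bsub>T\<^esub> \<iota> r)" for a
    have uc: "u a \<in> carrier T" if "a \<in> A0" for a
      unfolding u_def using mc[OF that s] Ac by (intro T.M.finsum_closed) auto
    have 2: "(\<Oplus>\<^bsub>T\<^esub>a\<in>A0. q a \<odot>\<^bsub>T\<^esub> \<iota> (a \<otimes>\<^bsub>A\<^esub> s)) \<in> N \<longleftrightarrow> (\<Oplus>\<^bsub>T\<^esub>a\<in>A0. q a \<odot>\<^bsub>T\<^esub> u a) \<in> N"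
    proof (rule T.finsum_congruent[OF N])
      fix a assume a: "a \<in> A0"
      have "q a \<odot>\<^bsub>T\<^esub> (\<iota> (a \<otimes>\<^bsub>A\<^esub> s) \<ominus>\<^bsub>T\<^esub> u a) \<in> N"
        using mN[of "(a, s)"] a s qc[OF a] unfolding u_def by (intro submodule.smult_closed[OF N]) auto
      then show "q a \<odot>\<^bsub>T\<^esub> \<iota> (a \<otimes>\<^bsub>A\<^esub> s) \<ominus>\<^bsub>T\<^esub> q a \<odot>\<^bsub>T\<^esub> u a \<in> N"
        using a s qc[OF a] uc[OF a] Ac by (simp add: a_minus_def T.smult_r_distr T.smult_r_minus)
    qed (use qc uc Ac s in auto)
    have "(\<Oplus>\<^bsub>T\<^esub>a\<in>A0. q a \<odot>\<^bsub>T\<^esub> u a) = (\<Oplus>\<^bsub>T\<^esub>a\<in>A0. \<Oplus>\<^bsub>T\<^esub>r\<in>C. (q a \<otimes>\<^bsub>Q\<^esub> m (a, s) r) \<odot>\<^bsub>T\<^esub> \<iota> r)"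
    proof (intro T.M.finsum_cong' refl)
      fix a assume a: "a \<in> A0"
      have "q a \<odot>\<^bsub>T\<^esub> u a = (\<Oplus>\<^bsub>T\<^esub>r\<in>C. q a \<odot>\<^bsub>T\<^esub> (m (a, s) r \<odot>\<^bsub>T\<^esub> \<iota> r))"
        unfolding u_def using qc[OF a] mc[OF a s] Ac by (intro T.finsum_smult) auto
      also have "\<dots> = (\<Oplus>\<^bsub>T\<^esub>r\<in>C. (q a \<otimes>\<^bsub>Q\<^esub> m (a, s) r) \<odot>\<^bsub>T\<^esub> \<iota> r)"
        using qc[OF a] mc[OF a s] Ac by (intro T.M.finsum_cong') (auto simp: T.smult_assoc1)
      finally show "q a \<odot>\<^bsub>T\<^esub> u a = (\<Oplus>\<^bsub>T\<^esub>r\<in>C. (q a \<otimes>\<^bsub>Q\<^esub> m (a, s) r) \<odot>\<^bsub>T\<^esub> \<iota> r)" .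
    qed (use qc mc s Ac in \<open>auto intro!: T.M.finsum_closed\<close>)
    also have "\<dots> = (\<Oplus>\<^bsub>T\<^esub>r\<in>C. \<Oplus>\<^bsub>T\<^esub>a\<in>A0. (q a \<otimes>\<^bsub>Q\<^esub> m (a, s) r) \<odot>\<^bsub>T\<^esub> \<iota> r)"
      using qc mc s Ac A0(1) Cc(1) by (intro T.M.finsum_swap) auto
    also have "\<dots> = (\<Oplus>\<^bsub>T\<^esub>r\<in>C. \<zero>\<^bsub>T\<^esub>)"
    proof (intro T.M.finsum_cong' refl)
      fix r assume r: "r \<in> C"
      have "(\<Oplus>\<^bsub>T\<^esub>a\<in>A0. (q a \<otimes>\<^bsub>Q\<^esub> m (a, s) r) \<odot>\<^bsub>T\<^esub> \<iota> r) = (\<Oplus>\<^bsub>Q\<^esub>a\<in>A0. q a \<otimes>\<^bsub>Q\<^esub> m (a, s) r) \<odot>\<^bsub>T\<^esub> \<iota> r"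
        using qc mc s r Ac
        by (intro finsum_hom[symmetric, where h = "\<lambda>x. x \<odot>\<^bsub>T\<^esub> \<iota> r"])
          (auto simp: T.smult_l_distr intro: T.M.abelian_monoid_axioms Q.abelian_monoid_axioms)
      then show "(\<Oplus>\<^bsub>T\<^esub>a\<in>A0. (q a \<otimes>\<^bsub>Q\<^esub> m (a, s) r) \<odot>\<^bsub>T\<^esub> \<iota> r) = \<zero>\<^bsub>T\<^esub>" using qz[OF s r] Ac r by simp
    qed auto
    finally show ?thesis
      using 1 2 submodule.zero_closed[OF N] by simp
  qed
  \<comment> \<open>This subspace contains N because N is a left ideal, and it contains the image of
    B. As B spans the image of the J-th step modulo N, it contains that whole image.\<close>
  have N\<tau>: "submodule Q {y \<in> carrier T. \<tau> \<otimes>\<^bsub>T\<^esub> y \<in> N} T" by (rule T.submodule_mult_left[OF N \<tau>c])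
  have "\<tau> \<otimes>\<^bsub>T\<^esub> \<iota> w \<in> N" if w: "w \<in> A.filt S J" for w
  proof -
    obtain p where p: "p \<in> B \<rightarrow> carrier Q" "\<iota> w \<ominus>\<^bsub>T\<^esub> (\<Oplus>\<^bsub>T\<^esub>b\<in>B. p b \<odot>\<^bsub>T\<^esub> \<iota> b) \<in> N"
      using bexE[OF family_spans[OF B w]] by metis
    have pc: "\<And>b. b \<in> B \<Longrightarrow> p b \<in> carrier Q" using p by auto
    define u where "u = (\<Oplus>\<^bsub>T\<^esub>b\<in>B. p b \<odot>\<^bsub>T\<^esub> \<iota> b)"
    have uN: "u \<in> {y \<in> carrier T. \<tau> \<otimes>\<^bsub>T\<^esub> y \<in> N}"
      unfolding u_def
    proof (rule T.submodule_finsum[OF N\<tau>], intro Pi_I)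
      fix b assume b: "b \<in> B"
      have "\<iota> b \<in> {y \<in> carrier T. \<tau> \<otimes>\<^bsub>T\<^esub> y \<in> N}" using \<tau>B[OF b] Ac b by simp
      then show "p b \<odot>\<^bsub>T\<^esub> \<iota> b \<in> {y \<in> carrier T. \<tau> \<otimes>\<^bsub>T\<^esub> y \<in> N}" by (rule submodule.smult_closed[OF N\<tau> pc[OF b]])
    qed
    have wc: "\<iota> w \<in> carrier T" using filt_closed'[OF w] by simp
    have "\<iota> w \<ominus>\<^bsub>T\<^esub> u \<in> N" using p by (simp add: u_def)
    then have "\<iota> w \<ominus>\<^bsub>T\<^esub> u \<in> {y \<in> carrier T. \<tau> \<otimes>\<^bsub>T\<^esub> y \<in> N}" using N_left \<tau>c N_carrier by auto
    then have "(\<iota> w \<ominus>\<^bsub>T\<^esub> u) \<oplus>\<^bsub>T\<^esub> u \<in> {y \<in> carrier T. \<tau> \<otimes>\<^bsub>T\<^esub> y \<in> N}"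
      using uN by (rule submodule.m_closed[OF N\<tau>])
    then show ?thesis using wc uN by (simp add: a_minus_def T.M.a_assoc T.M.l_neg)
  qed
  then have "ext S J \<subseteq> {y \<in> carrier T. \<tau> \<otimes>\<^bsub>T\<^esub> y \<in> N}"
    using filt_closed' by (intro T.span_subset_submodule N\<tau>) auto
  \<comment> \<open>J = c nu(c i) was chosen so that the step nu(c i) of T lies in the extension of
    the J-th step of A.\<close>
  then have \<tau>N: "\<tau> \<otimes>\<^bsub>T\<^esub> y \<in> N" "y \<in> carrier T" if "y \<in> T.filt ST (nu (c * i))" for y
    using c(1)[of "nu (c * i)"] that by (auto simp: J_def)
  have "span_sandwich Q T (carrier T) \<tau> (T.filt ST (nu (c * i))) \<subseteq> N"
    unfolding span_sandwich_def
  proof (rule T.span_subset_submodule[OF N], clarify)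
    fix x y assume x: "x \<in> carrier T" and y: "y \<in> T.filt ST (nu (c * i))"
    then show "x \<otimes>\<^bsub>T\<^esub> \<tau> \<otimes>\<^bsub>T\<^esub> y \<in> N"
      using N_left[OF x \<tau>N(1)[OF y]] \<tau>N(2)[OF y] \<tau>c by (simp add: T.A.m_assoc)
  qed
  then show False using one one_notin_N by blast
qed

theorem length_bound:
  assumes g: "growth (A.dim_filt S) = ereal g"
    and nu: "nu = return_fun Q T ST \<or> nu = left_return_fun Q T ST"
  shows "real (length cs) \<le> g"
    and "growth nu \<le> F \<Longrightarrow> ereal (length cs) \<le> ereal g * (1 - 1 / (F + max F 1))"
proof -
  obtain c1 where c1: "\<And>i. T.filt ST i \<subseteq> ext S (c1 * i)" "\<And>i. \<iota> ` A.filt S i \<subseteq> T.filt ST (c1 * i)"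
    by (rule filtrations_equivalent[OF S ST]) (rule that)
  obtain c2 where c2: "\<And>i j. rank j * (i + 1) ^ length cs \<le> A.dim_filt S (j + c2 * i)"
    by (rule rank_lower) (rule that)
  \<comment> \<open>One constant for both estimates; enlarging c2 is harmless as the dimensions of
    the filtration steps increase.\<close>
  define c where "c = max c1 c2"
  have mono_dim: "A.dim_filt S i \<le> A.dim_filt S j" if "i \<le> j" for i j
  proof -
    obtain B where B: "finite B" "B \<subseteq> A.filt S i" "card B = A.dim_filt S i" "indep K A B (\<lambda>x. x)"
        "\<And>w. w \<in> A.filt S i \<Longrightarrow> \<exists>c\<in>B \<rightarrow> carrier K. w = (\<Oplus>\<^bsub>A\<^esub>b\<in>B. c b \<odot>\<^bsub>A\<^esub> b)"
      by (rule A.filt_basis[OF gens'(1,2)]) (rule that)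
    then show ?thesis
      using A.indep_card_le_dim_filt[OF gens'(1,2) B(1) _ B(4), of j] A.filt_mono[OF gens'(1) that] by auto
  qed
  have "growth_data (A.dim_filt S) rank nu c (length cs) g"
  proof
    have "T.filt ST i \<subseteq> ext S (c * i)" for i
      using c1(1)[of i] ext_mono[OF S ST, of "c1 * i" "c * i"] by (auto simp: c_def)
    moreover have "\<iota> ` A.filt S i \<subseteq> T.filt ST (c * i)" for i
      using c1(2)[of i] T.filt_mono[OF gens'(3), of "c1 * i" "c * i"] by (auto simp: c_def)
    ultimately show "A.dim_filt S i \<le> rank (c * nu (c * i)) * rank (i + c * nu (c * i))" for i
      by (rule rank_upper[OF nu])
    show "rank j * (i + 1) ^ length cs \<le> A.dim_filt S (j + c * i)" for i j
      using c2[of j i] mono_dim[of "j + c2 * i" "j + c * i"] by (simp add: c_def)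
  qed (fact rank_pos rank_mono g)+
  then show "real (length cs) \<le> g"
    and "growth nu \<le> F \<Longrightarrow> ereal (length cs) \<le> ereal g * (1 - 1 / (F + max F 1))"
    by (rule growth_data.M_le_g, rule growth_data.M_bound)
qed

end


section \<open>Functionals compatible with a commutative subalgebra\<close>

lemma (in ring) nat_pow_commute:
  "x \<in> carrier R \<Longrightarrow> y \<in> carrier R \<Longrightarrow> x \<otimes> y = y \<otimes> x \<Longrightarrow> x [^] (n::nat) \<otimes> y = y \<otimes> x [^] n"
proof (induction n)
  case (Suc n)
  then have "x [^] Suc n \<otimes> y = x [^] n \<otimes> (y \<otimes> x)" by (simp add: m_assoc)
  also have "\<dots> = y \<otimes> x [^] Suc n" using Suc by (simp add: m_assoc[symmetric])
  finally show ?case .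
qed simp

lemma (in ring) monomial_at_commute:
  assumes "y \<in> carrier R"
  shows "set bs \<subseteq> carrier R \<Longrightarrow> (\<And>b. b \<in> set bs \<Longrightarrow> b \<otimes> y = y \<otimes> b) \<Longrightarrow> length \<alpha> = length bs \<Longrightarrow>
    monomial_at R bs \<alpha> \<otimes> y = y \<otimes> monomial_at R bs \<alpha>"
proof (induction bs arbitrary: \<alpha>)
  case (Cons b bs)
  then obtain n \<alpha>' where a: "\<alpha> = n # \<alpha>'" "length \<alpha>' = length bs" by (cases \<alpha>) auto
  have c: "b \<in> carrier R" "monomial_at R bs \<alpha>' \<in> carrier R" "b \<otimes> y = y \<otimes> b"
    using Cons.prems monomial_at_closed[of bs \<alpha>'] by auto
  have "b [^] n \<otimes> monomial_at R bs \<alpha>' \<otimes> y = b [^] n \<otimes> (y \<otimes> monomial_at R bs \<alpha>')"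
    using c assms Cons a by (simp add: m_assoc)
  also have "\<dots> = y \<otimes> (b [^] n \<otimes> monomial_at R bs \<alpha>')"
    using c assms nat_pow_commute[of b y n] by (simp add: m_assoc[symmetric])
  finally show ?case using a by simp
qed (use assms in simp)

lemma (in ring) monomial_at_add:
  "set bs \<subseteq> carrier R \<Longrightarrow> (\<And>b c. b \<in> set bs \<Longrightarrow> c \<in> set bs \<Longrightarrow> b \<otimes> c = c \<otimes> b) \<Longrightarrow>
    length \<alpha> = length bs \<Longrightarrow> length \<beta> = length bs \<Longrightarrow>
    monomial_at R bs (map2 (+) \<alpha> \<beta>) = monomial_at R bs \<alpha> \<otimes> monomial_at R bs \<beta>"
proof (induction bs arbitrary: \<alpha> \<beta>)
  case (Cons b bs)
  then obtain n \<alpha>' k \<beta>' where a: "\<alpha> = n # \<alpha>'" "length \<alpha>' = length bs" "\<beta> = k # \<beta>'" "length \<beta>' = length bs"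
    by (cases \<alpha>; cases \<beta>) auto
  have c: "b \<in> carrier R" "monomial_at R bs \<alpha>' \<in> carrier R" "monomial_at R bs \<beta>' \<in> carrier R"
    using Cons.prems monomial_at_closed[of bs] by auto
  have "monomial_at R bs \<alpha>' \<otimes> b = b \<otimes> monomial_at R bs \<alpha>'"
    using Cons.prems a by (intro monomial_at_commute) auto
  then have comm: "monomial_at R bs \<alpha>' \<otimes> b [^] k = b [^] k \<otimes> monomial_at R bs \<alpha>'"
    using c by (intro nat_pow_commute[symmetric]) auto
  have "monomial_at R (b # bs) (map2 (+) \<alpha> \<beta>) = b [^] n \<otimes> b [^] k \<otimes> (monomial_at R bs \<alpha>' \<otimes> monomial_at R bs \<beta>')"
    using Cons a c by (simp add: nat_pow_mult)
  also have "\<dots> = b [^] n \<otimes> ((b [^] k \<otimes> monomial_at R bs \<alpha>') \<otimes> monomial_at R bs \<beta>')"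
    using c by (simp add: m_assoc)
  also have "\<dots> = (b [^] n \<otimes> monomial_at R bs \<alpha>') \<otimes> (b [^] k \<otimes> monomial_at R bs \<beta>')"
    unfolding comm[symmetric] using c by (simp add: m_assoc)
  finally show ?case using a by simp
qed simp

lemma (in ring) monomial_at_zero [simp]: "monomial_at R bs (replicate (length bs) 0) = \<one>"
  by (induction bs) auto

definition unit_vector :: "nat \<Rightarrow> nat \<Rightarrow> nat list" where
  "unit_vector m l = (replicate m 0)[l := 1]"

lemma length_unit_vector [simp]: "length (unit_vector m l) = m"
  by (simp add: unit_vector_def)

lemma (in ring) monomial_at_unit_vector:
  "set bs \<subseteq> carrier R \<Longrightarrow> l < length bs \<Longrightarrow> monomial_at R bs (unit_vector (length bs) l) = bs ! l"
proof (induction bs arbitrary: l)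
  case (Cons b bs)
  then show ?case
    by (cases l) (auto simp: unit_vector_def nth_mem subset_iff)
qed simp

context module
begin

lemma congruent_sym:
  assumes N: "submodule R N M" and "x \<in> carrier M" "y \<in> carrier M" "x \<ominus>\<^bsub>M\<^esub> y \<in> N"
  shows "y \<ominus>\<^bsub>M\<^esub> x \<in> N"
  using submodule_uminus[OF N assms(4)] assms(2,3) by (simp add: a_minus_def M.minus_add M.a_comm)

lemma congruent_add:
  assumes N: "submodule R N M" and c: "x \<in> carrier M" "y \<in> carrier M" "x' \<in> carrier M" "y' \<in> carrier M"
    and "x \<ominus>\<^bsub>M\<^esub> y \<in> N" "x' \<ominus>\<^bsub>M\<^esub> y' \<in> N"
  shows "(x \<oplus>\<^bsub>M\<^esub> x') \<ominus>\<^bsub>M\<^esub> (y \<oplus>\<^bsub>M\<^esub> y') \<in> N"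
  using submodule.m_closed[OF N assms(6,7)] c by (simp add: a_minus_def M.minus_add M.a_ac)

lemma congruent_smult:
  assumes N: "submodule R N M" and c: "x \<in> carrier M" "y \<in> carrier M" "k \<in> carrier R"
    and "x \<ominus>\<^bsub>M\<^esub> y \<in> N"
  shows "k \<odot>\<^bsub>M\<^esub> x \<ominus>\<^bsub>M\<^esub> k \<odot>\<^bsub>M\<^esub> y \<in> N"
  using submodule.smult_closed[OF N c(3) assms(5)] c by (simp add: a_minus_def smult_r_distr smult_r_minus)

end

locale commuting_variables =
  A: assoc_algebra K A + Q: algebra K Q + QF: field Q
  for K :: "('k, 'x) ring_scheme" and A :: "('k, 'a) module" and Q :: "('k, 'q) module" +
  fixes cs xs
  assumes cs_indep: "alg_independent K A cs" and xs_indep: "alg_independent K Q xs"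
    and len: "length xs = length cs"
    and comm: "\<And>b c. b \<in> set cs \<Longrightarrow> c \<in> set cs \<Longrightarrow> b \<otimes>\<^bsub>A\<^esub> c = c \<otimes>\<^bsub>A\<^esub> b"
begin

lemma cs: "set cs \<subseteq> carrier A" and xs: "set xs \<subseteq> carrier Q"
  using cs_indep xs_indep by (auto simp: alg_independent_def)

lemma Q_smult_right:
  "\<lbrakk>k \<in> carrier K; x \<in> carrier Q; y \<in> carrier Q\<rbrakk> \<Longrightarrow> x \<otimes>\<^bsub>Q\<^esub> (k \<odot>\<^bsub>Q\<^esub> y) = k \<odot>\<^bsub>Q\<^esub> (x \<otimes>\<^bsub>Q\<^esub> y)"
  using Q.smult_assoc2[of k y x] Q.m_comm[of x] by simp

text \<open>The graph of the isomorphism from \<open>K[cs]\<close> to \<open>K[xs]\<close>.\<close>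

inductive_set graph :: "('a \<times> 'q) set" where
  monomial: "length \<alpha> = length cs \<Longrightarrow> (monomial_at A cs \<alpha>, monomial_at Q xs \<alpha>) \<in> graph"
| smult: "(r, s) \<in> graph \<Longrightarrow> k \<in> carrier K \<Longrightarrow> (k \<odot>\<^bsub>A\<^esub> r, k \<odot>\<^bsub>Q\<^esub> s) \<in> graph"
| add: "(r, s) \<in> graph \<Longrightarrow> (r', s') \<in> graph \<Longrightarrow> (r \<oplus>\<^bsub>A\<^esub> r', s \<oplus>\<^bsub>Q\<^esub> s') \<in> graph"

lemma graph_closed: "(r, s) \<in> graph \<Longrightarrow> r \<in> carrier A \<and> s \<in> carrier Q"
  by (induction rule: graph.induct) (auto simp: A.A.monomial_at_closed[OF cs] Q.monomial_at_closed[OF xs])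

lemma graphA: "(r, s) \<in> graph \<Longrightarrow> r \<in> carrier A" and graphQ: "(r, s) \<in> graph \<Longrightarrow> s \<in> carrier Q"
  using graph_closed by blast+

lemma one_graph: "(\<one>\<^bsub>A\<^esub>, \<one>\<^bsub>Q\<^esub>) \<in> graph"
proof -
  have "(monomial_at A cs (replicate (length cs) 0), monomial_at Q xs (replicate (length xs) 0)) \<in> graph"
    unfolding len by (rule graph.monomial) simp
  then show ?thesis by simp
qed

lemma variable_graph: "l < length cs \<Longrightarrow> (cs ! l, xs ! l) \<in> graph"
  using graph.monomial[of "unit_vector (length cs) l"] A.A.monomial_at_unit_vector[OF cs, of l]
    Q.monomial_at_unit_vector[OF xs, of l] len by simp

lemma monomial_mult_graph:
  assumes "length \<alpha> = length cs" "(r, s) \<in> graph"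
  shows "(monomial_at A cs \<alpha> \<otimes>\<^bsub>A\<^esub> r, monomial_at Q xs \<alpha> \<otimes>\<^bsub>Q\<^esub> s) \<in> graph"
  using assms(2)
proof (induction rule: graph.induct)
  case (monomial \<beta>)
  have "length (map2 (+) \<alpha> \<beta>) = length cs" using monomial assms(1) by simp
  from graph.monomial[OF this] show ?case
    using A.A.monomial_at_add[OF cs comm, of \<alpha> \<beta>] Q.monomial_at_add[OF xs, of \<alpha> \<beta>] len monomial assms(1)
      Q.m_comm xs by (simp add: subset_iff)
next
  case (smult r s k)
  then show ?case
    using graph.smult[OF smult(3,2)] A.A.monomial_at_closed[OF cs, of \<alpha>] Q.monomial_at_closed[OF xs, of \<alpha>]
      graphA[OF smult(1)] graphQ[OF smult(1)] by (simp add: A.smult_right Q_smult_right)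
next
  case (add r s r' s')
  then show ?case
    using graph.add[OF add(3,4)] A.A.monomial_at_closed[OF cs, of \<alpha>] Q.monomial_at_closed[OF xs, of \<alpha>]
      graphA[OF add(1)] graphQ[OF add(1)] graphA[OF add(2)] graphQ[OF add(2)]
    by (simp add: A.A.r_distr Q.r_distr)
qed

lemma mult_graph:
  assumes "(r, s) \<in> graph" "(r', s') \<in> graph"
  shows "(r \<otimes>\<^bsub>A\<^esub> r', s \<otimes>\<^bsub>Q\<^esub> s') \<in> graph"
  using assms(1)
proof (induction rule: graph.induct)
  case (monomial \<alpha>) then show ?case by (rule monomial_mult_graph[OF _ assms(2)])
next
  case (smult r s k)
  then show ?case using graph.smult[OF smult(3,2)] graphA[OF smult(1)] graphQ[OF smult(1)] graphA[OF assms(2)] graphQ[OF assms(2)] by (simp add: A.smult_left Q.smult_assoc2)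
next
  case (add r s r' s')
  then show ?case using graph.add[OF add(3,4)] graphA[OF add(1)] graphQ[OF add(1)] graphA[OF add(2)] graphQ[OF add(2)]
      graphA[OF assms(2)] graphQ[OF assms(2)] by (simp add: A.A.l_distr Q.l_distr)
qed

text \<open>Needed to cross-multiply fractions whose numerators and denominators lie in
  K[cs].\<close>

lemma graph_commute:
  assumes "(r, s) \<in> graph" "(r', s') \<in> graph"
  shows "r \<otimes>\<^bsub>A\<^esub> r' = r' \<otimes>\<^bsub>A\<^esub> r"
proof -
  have 1: "monomial_at A cs \<alpha> \<otimes>\<^bsub>A\<^esub> r = r \<otimes>\<^bsub>A\<^esub> monomial_at A cs \<alpha>"
    if "(r, s) \<in> graph" "length \<alpha> = length cs" for \<alpha> r s
    using that
  proof (induction rule: graph.induct)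
    case (monomial \<beta>)
    have "map2 (+) \<alpha> \<beta> = map2 (+) \<beta> \<alpha>"
      using monomial by (intro nth_equalityI) auto
    then show ?case
      using A.A.monomial_at_add[OF cs comm, of \<alpha> \<beta>] A.A.monomial_at_add[OF cs comm, of \<beta> \<alpha>] monomial by simp
  next
    case (smult r s k)
    then show ?case using graphA[OF smult(1)] A.A.monomial_at_closed[OF cs, of \<alpha>] by (simp add: A.smult_left A.smult_right)
  next
    case (add r s r' s')
    then show ?case using graphA[OF add(1)] graphA[OF add(2)] A.A.monomial_at_closed[OF cs, of \<alpha>]
      by (simp add: A.A.l_distr A.A.r_distr)
  qed
  show ?thesis using assms(1)
  proof (induction rule: graph.induct)
    case (monomial \<alpha>) then show ?case by (rule 1[OF assms(2)])
  next
    case (smult r s k)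
    then show ?case using graphA[OF smult(1)] graphA[OF assms(2)] by (simp add: A.smult_left A.smult_right)
  next
    case (add r s r'' s'')
    then show ?case using graphA[OF add(1)] graphA[OF add(2)] graphA[OF assms(2)] by (simp add: A.A.l_distr A.A.r_distr)
  qed
qed

text \<open>The point is that the same coefficients serve on both sides. They are total functions
  vanishing off S, so that in the case of a sum both supports can be enlarged to their
  union.\<close>

lemma graph_combination:
  assumes "(r, s) \<in> graph"
  shows "\<exists>S c. finite S \<and> S \<subseteq> {\<alpha>. length \<alpha> = length cs} \<and> (\<forall>\<alpha>. c \<alpha> \<in> carrier K) \<and>
    (\<forall>\<alpha>. \<alpha> \<notin> S \<longrightarrow> c \<alpha> = \<zero>\<^bsub>K\<^esub>) \<and>
    r = (\<Oplus>\<^bsub>A\<^esub>\<alpha>\<in>S. c \<alpha> \<odot>\<^bsub>A\<^esub> monomial_at A cs \<alpha>) \<and> s = (\<Oplus>\<^bsub>Q\<^esub>\<alpha>\<in>S. c \<alpha> \<odot>\<^bsub>Q\<^esub> monomial_at Q xs \<alpha>)"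
  using assms
proof (induction rule: graph.induct)
  have m: "monomial_at A cs \<alpha> \<in> carrier A" "monomial_at Q xs \<alpha> \<in> carrier Q" for \<alpha>
    using A.A.monomial_at_closed[OF cs] Q.monomial_at_closed[OF xs] by auto
  {
    case (monomial \<alpha>)
    then show ?case using m
      by (intro exI[of _ "{\<alpha>}"] exI[of _ "\<lambda>\<beta>. if \<beta> = \<alpha> then \<one>\<^bsub>K\<^esub> else \<zero>\<^bsub>K\<^esub>"])
        (simp add: A.M.finsum_insert Q.finsum_insert)
  next
    case (smult r s k)
    then obtain S c where c: "finite S" "S \<subseteq> {\<alpha>. length \<alpha> = length cs}" "\<And>\<alpha>. c \<alpha> \<in> carrier K"
      "\<And>\<alpha>. \<alpha> \<notin> S \<Longrightarrow> c \<alpha> = \<zero>\<^bsub>K\<^esub>"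
      "r = (\<Oplus>\<^bsub>A\<^esub>\<alpha>\<in>S. c \<alpha> \<odot>\<^bsub>A\<^esub> monomial_at A cs \<alpha>)" "s = (\<Oplus>\<^bsub>Q\<^esub>\<alpha>\<in>S. c \<alpha> \<odot>\<^bsub>Q\<^esub> monomial_at Q xs \<alpha>)" by auto
    have "k \<odot>\<^bsub>A\<^esub> r = (\<Oplus>\<^bsub>A\<^esub>\<alpha>\<in>S. k \<odot>\<^bsub>A\<^esub> (c \<alpha> \<odot>\<^bsub>A\<^esub> monomial_at A cs \<alpha>))"
      unfolding c(5) using c m smult by (intro A.finsum_smult) auto
    moreover have "\<dots> = (\<Oplus>\<^bsub>A\<^esub>\<alpha>\<in>S. (k \<otimes>\<^bsub>K\<^esub> c \<alpha>) \<odot>\<^bsub>A\<^esub> monomial_at A cs \<alpha>)"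
      using c m smult by (intro A.M.finsum_cong') (auto simp: A.smult_assoc1)
    moreover have "k \<odot>\<^bsub>Q\<^esub> s = (\<Oplus>\<^bsub>Q\<^esub>\<alpha>\<in>S. k \<odot>\<^bsub>Q\<^esub> (c \<alpha> \<odot>\<^bsub>Q\<^esub> monomial_at Q xs \<alpha>))"
      unfolding c(6) using c m smult by (intro Q.finsum_smult) auto
    moreover have "\<dots> = (\<Oplus>\<^bsub>Q\<^esub>\<alpha>\<in>S. (k \<otimes>\<^bsub>K\<^esub> c \<alpha>) \<odot>\<^bsub>Q\<^esub> monomial_at Q xs \<alpha>)"
      using c m smult by (intro Q.finsum_cong') (auto simp: Q.smult_assoc1)
    ultimately show ?case using c smult by (intro exI[of _ S] exI[of _ "\<lambda>\<alpha>. k \<otimes>\<^bsub>K\<^esub> c \<alpha>"]) simp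
  next
    case (add r s r' s')
    then obtain S c where c: "finite S" "S \<subseteq> {\<alpha>. length \<alpha> = length cs}" "\<And>\<alpha>. c \<alpha> \<in> carrier K"
      "\<And>\<alpha>. \<alpha> \<notin> S \<Longrightarrow> c \<alpha> = \<zero>\<^bsub>K\<^esub>"
      "r = (\<Oplus>\<^bsub>A\<^esub>\<alpha>\<in>S. c \<alpha> \<odot>\<^bsub>A\<^esub> monomial_at A cs \<alpha>)" "s = (\<Oplus>\<^bsub>Q\<^esub>\<alpha>\<in>S. c \<alpha> \<odot>\<^bsub>Q\<^esub> monomial_at Q xs \<alpha>)" by auto
    from add obtain S' c' where c': "finite S'" "S' \<subseteq> {\<alpha>. length \<alpha> = length cs}" "\<And>\<alpha>. c' \<alpha> \<in> carrier K"
      "\<And>\<alpha>. \<alpha> \<notin> S' \<Longrightarrow> c' \<alpha> = \<zero>\<^bsub>K\<^esub>"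
      "r' = (\<Oplus>\<^bsub>A\<^esub>\<alpha>\<in>S'. c' \<alpha> \<odot>\<^bsub>A\<^esub> monomial_at A cs \<alpha>)" "s' = (\<Oplus>\<^bsub>Q\<^esub>\<alpha>\<in>S'. c' \<alpha> \<odot>\<^bsub>Q\<^esub> monomial_at Q xs \<alpha>)" by auto
    have "r = (\<Oplus>\<^bsub>A\<^esub>\<alpha>\<in>S \<union> S'. c \<alpha> \<odot>\<^bsub>A\<^esub> monomial_at A cs \<alpha>)"
      unfolding c(5) using c(1-4) c'(1) m by (intro A.M.finsum_superset[symmetric]) auto
    moreover have "r' = (\<Oplus>\<^bsub>A\<^esub>\<alpha>\<in>S \<union> S'. c' \<alpha> \<odot>\<^bsub>A\<^esub> monomial_at A cs \<alpha>)"
      unfolding c'(5) using c'(1-4) c(1) m by (intro A.M.finsum_superset[symmetric]) auto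
    ultimately have "r \<oplus>\<^bsub>A\<^esub> r' = (\<Oplus>\<^bsub>A\<^esub>\<alpha>\<in>S \<union> S'. c \<alpha> \<odot>\<^bsub>A\<^esub> monomial_at A cs \<alpha> \<oplus>\<^bsub>A\<^esub> c' \<alpha> \<odot>\<^bsub>A\<^esub> monomial_at A cs \<alpha>)"
      using c(3) c'(3) m by (simp add: A.M.finsum_addf)
    also have "\<dots> = (\<Oplus>\<^bsub>A\<^esub>\<alpha>\<in>S \<union> S'. (c \<alpha> \<oplus>\<^bsub>K\<^esub> c' \<alpha>) \<odot>\<^bsub>A\<^esub> monomial_at A cs \<alpha>)"
      using c(3) c'(3) m by (intro A.M.finsum_cong') (auto simp: A.smult_l_distr)
    finally have 1: "r \<oplus>\<^bsub>A\<^esub> r' = (\<Oplus>\<^bsub>A\<^esub>\<alpha>\<in>S \<union> S'. (c \<alpha> \<oplus>\<^bsub>K\<^esub> c' \<alpha>) \<odot>\<^bsub>A\<^esub> monomial_at A cs \<alpha>)" .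
    have "s = (\<Oplus>\<^bsub>Q\<^esub>\<alpha>\<in>S \<union> S'. c \<alpha> \<odot>\<^bsub>Q\<^esub> monomial_at Q xs \<alpha>)"
      unfolding c(6) using c(1-4) c'(1) m by (intro Q.finsum_superset[symmetric]) auto
    moreover have "s' = (\<Oplus>\<^bsub>Q\<^esub>\<alpha>\<in>S \<union> S'. c' \<alpha> \<odot>\<^bsub>Q\<^esub> monomial_at Q xs \<alpha>)"
      unfolding c'(6) using c'(1-4) c(1) m by (intro Q.finsum_superset[symmetric]) auto
    ultimately have "s \<oplus>\<^bsub>Q\<^esub> s' = (\<Oplus>\<^bsub>Q\<^esub>\<alpha>\<in>S \<union> S'. c \<alpha> \<odot>\<^bsub>Q\<^esub> monomial_at Q xs \<alpha> \<oplus>\<^bsub>Q\<^esub> c' \<alpha> \<odot>\<^bsub>Q\<^esub> monomial_at Q xs \<alpha>)"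
      using c(3) c'(3) m by (simp add: Q.finsum_addf)
    also have "\<dots> = (\<Oplus>\<^bsub>Q\<^esub>\<alpha>\<in>S \<union> S'. (c \<alpha> \<oplus>\<^bsub>K\<^esub> c' \<alpha>) \<odot>\<^bsub>Q\<^esub> monomial_at Q xs \<alpha>)"
      using c(3) c'(3) m by (intro Q.finsum_cong') (auto simp: Q.smult_l_distr)
    finally have 2: "s \<oplus>\<^bsub>Q\<^esub> s' = (\<Oplus>\<^bsub>Q\<^esub>\<alpha>\<in>S \<union> S'. (c \<alpha> \<oplus>\<^bsub>K\<^esub> c' \<alpha>) \<odot>\<^bsub>Q\<^esub> monomial_at Q xs \<alpha>)" .
    show ?case using c(1-4) c'(1-4) 1 2
      by (intro exI[of _ "S \<union> S'"] exI[of _ "\<lambda>\<alpha>. c \<alpha> \<oplus>\<^bsub>K\<^esub> c' \<alpha>"]) auto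
  }
qed

text \<open>Well-definedness and injectivity of the isomorphism in one: on either side a vanishing
  element has only zero coefficients, by algebraic independence.\<close>

lemma graph_zero_iff:
  assumes "(r, s) \<in> graph"
  shows "r = \<zero>\<^bsub>A\<^esub> \<longleftrightarrow> s = \<zero>\<^bsub>Q\<^esub>"
proof -
  obtain S c where c: "finite S" "S \<subseteq> {\<alpha>. length \<alpha> = length cs}" "\<And>\<alpha>. c \<alpha> \<in> carrier K"
    and r: "r = (\<Oplus>\<^bsub>A\<^esub>\<alpha>\<in>S. c \<alpha> \<odot>\<^bsub>A\<^esub> monomial_at A cs \<alpha>)"
    and s: "s = (\<Oplus>\<^bsub>Q\<^esub>\<alpha>\<in>S. c \<alpha> \<odot>\<^bsub>Q\<^esub> monomial_at Q xs \<alpha>)"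
    using graph_combination[OF assms] by auto
  have m: "monomial_at A cs \<alpha> \<in> carrier A" "monomial_at Q xs \<alpha> \<in> carrier Q" for \<alpha>
    using A.A.monomial_at_closed[OF cs] Q.monomial_at_closed[OF xs] by auto
  have cS: "c \<in> S \<rightarrow> carrier K" using c by auto
  show ?thesis
  proof
    assume "r = \<zero>\<^bsub>A\<^esub>"
    then have z: "c \<alpha> = \<zero>\<^bsub>K\<^esub>" if "\<alpha> \<in> S" for \<alpha>
      using alg_independentD[OF cs_indep c(1,2) cS _ that] r by simp
    have "s = (\<Oplus>\<^bsub>Q\<^esub>\<alpha>\<in>S. \<zero>\<^bsub>Q\<^esub>)" unfolding s using z m by (intro Q.finsum_cong') auto
    then show "s = \<zero>\<^bsub>Q\<^esub>" by simp
  next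
    assume "s = \<zero>\<^bsub>Q\<^esub>"
    moreover have "S \<subseteq> {\<alpha>. length \<alpha> = length xs}" using c(2) len by simp
    ultimately have z: "c \<alpha> = \<zero>\<^bsub>K\<^esub>" if "\<alpha> \<in> S" for \<alpha>
      using alg_independentD[OF xs_indep c(1) _ cS _ that] s by simp
    have "r = (\<Oplus>\<^bsub>A\<^esub>\<alpha>\<in>S. \<zero>\<^bsub>A\<^esub>)" unfolding r using z m by (intro A.M.finsum_cong') auto
    then show "r = \<zero>\<^bsub>A\<^esub>" by simp
  qed
qed

end


section \<open>A right K[cs]-linear functional with values in Q\<close>

context commuting_variables
begin

text \<open>The right K[cs]-submodules of A that meet K[cs] in zero. Modulo a maximal one, A is an
  essential extension of K[cs] and therefore embeds in its fraction field; this replaces a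
  localisation of A.\<close>

definition compatible :: "'a set \<Rightarrow> bool" where
  "compatible N \<longleftrightarrow> submodule K N A \<and> (\<forall>n\<in>N. \<forall>(r, s)\<in>graph. n \<otimes>\<^bsub>A\<^esub> r \<in> N) \<and>
     (\<forall>(r, s)\<in>graph. r \<in> N \<longrightarrow> r = \<zero>\<^bsub>A\<^esub>)"

lemma compatibleD:
  assumes "compatible N"
  shows "submodule K N A" and "n \<in> N \<Longrightarrow> (r, s) \<in> graph \<Longrightarrow> n \<otimes>\<^bsub>A\<^esub> r \<in> N"
    and "(r, s) \<in> graph \<Longrightarrow> r \<in> N \<Longrightarrow> r = \<zero>\<^bsub>A\<^esub>"
  using assms unfolding compatible_def by auto

text \<open>Zorn's lemma: each condition concerns at most two elements of the submodule, so it
  passes to unions of chains, and the zero submodule is compatible.\<close>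

lemma maximal_compatible: "\<exists>N. compatible N \<and> (\<forall>N'. compatible N' \<and> N \<subseteq> N' \<longrightarrow> N' = N)"
proof -
  have "\<exists>N\<in>{N. compatible N}. \<forall>X\<in>{N. compatible N}. N \<subseteq> X \<longrightarrow> X = N"
  proof (rule subset_Zorn_nonempty)
    have "compatible {\<zero>\<^bsub>A\<^esub>}"
      unfolding compatible_def using A.zero_submodule graphA by auto
    then show "{N. compatible N} \<noteq> {}" by blast
    fix \<C> assume ne: "\<C> \<noteq> {}" and chain: "subset.chain {N. compatible N} \<C>"
    have comp: "compatible N" if "N \<in> \<C>" for N using chain that unfolding subset.chain_def by blast
    have "submodule K (\<Union>\<C>) A"
    proof (rule submodule.intro[OF A.module_axioms])
      show "\<Union>\<C> \<subseteq> carrier A"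
        using comp compatibleD(1) submodule.subset by blast
      obtain N where "N \<in> \<C>" using ne by blast
      then show "\<zero>\<^bsub>A\<^esub> \<in> \<Union>\<C>" using submodule.zero_closed[OF compatibleD(1)[OF comp]] by blast
      show "c \<odot>\<^bsub>A\<^esub> v \<in> \<Union>\<C>" if "c \<in> carrier K" "v \<in> \<Union>\<C>" for c v
        using that submodule.smult_closed[OF compatibleD(1)[OF comp]] by blast
      fix v w assume "v \<in> \<Union>\<C>" "w \<in> \<Union>\<C>"
      then obtain N N' where N: "N \<in> \<C>" "N' \<in> \<C>" "v \<in> N" "w \<in> N'" by blast
      then have "N \<subseteq> N' \<or> N' \<subseteq> N" using chain unfolding subset.chain_def by blast
      then have "v \<in> N' \<or> w \<in> N" using N by blast
      then show "v \<oplus>\<^bsub>A\<^esub> w \<in> \<Union>\<C>"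
        using N submodule.m_closed[OF compatibleD(1)[OF comp]] by blast
    qed
    then show "\<Union>\<C> \<in> {N. compatible N}"
      using comp unfolding compatible_def by blast
  qed
  then show ?thesis by blast
qed

lemma zero_graph: "(\<zero>\<^bsub>A\<^esub>, \<zero>\<^bsub>Q\<^esub>) \<in> graph"
  using graph.smult[OF one_graph, of "\<zero>\<^bsub>K\<^esub>"] by simp


text \<open>If b r is congruent to r' modulo N with r, r' in K[cs] and r non-zero, the value of b
  has to be r'/r. The pairs (r, s) and (r', s') of \<open>graph\<close> transport this quotient to
  Q.\<close>

definition fraction_of :: "'a set \<Rightarrow> 'a \<Rightarrow> 'q \<Rightarrow> bool" where
  "fraction_of N b q \<longleftrightarrow> q \<in> carrier Q \<and> (\<exists>r s r' s'. (r, s) \<in> graph \<and> (r', s') \<in> graph \<and>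
     s \<noteq> \<zero>\<^bsub>Q\<^esub> \<and> b \<otimes>\<^bsub>A\<^esub> r \<ominus>\<^bsub>A\<^esub> r' \<in> N \<and> q \<otimes>\<^bsub>Q\<^esub> s = s')"

lemma congruent_mult:
  assumes N: "compatible N" and c: "x \<in> carrier A" "y \<in> carrier A" "x \<ominus>\<^bsub>A\<^esub> y \<in> N" and g: "(r, s) \<in> graph"
  shows "x \<otimes>\<^bsub>A\<^esub> r \<ominus>\<^bsub>A\<^esub> y \<otimes>\<^bsub>A\<^esub> r \<in> N"
  using compatibleD(2)[OF N c(3) g] c graphA[OF g] by (simp add: a_minus_def A.A.l_distr A.A.l_minus)

text \<open>Cross-multiplication: b r t is congruent to r' t and, as r and t commute, also to t' r.
  The difference r' t - t' r lies both in K[cs] and in N, so it vanishes, and in Q this equates the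
  two quotients.\<close>

lemma fraction_of_unique:
  assumes N: "compatible N" and b: "b \<in> carrier A" and q: "fraction_of N b q" and p: "fraction_of N b p"
  shows "q = p"
proof -
  from q obtain r s r' s' where 1: "q \<in> carrier Q" "(r, s) \<in> graph" "(r', s') \<in> graph"
    "s \<noteq> \<zero>\<^bsub>Q\<^esub>" "b \<otimes>\<^bsub>A\<^esub> r \<ominus>\<^bsub>A\<^esub> r' \<in> N" "q \<otimes>\<^bsub>Q\<^esub> s = s'" unfolding fraction_of_def by blast
  from p obtain t u t' u' where 2: "p \<in> carrier Q" "(t, u) \<in> graph" "(t', u') \<in> graph"
    "u \<noteq> \<zero>\<^bsub>Q\<^esub>" "b \<otimes>\<^bsub>A\<^esub> t \<ominus>\<^bsub>A\<^esub> t' \<in> N" "p \<otimes>\<^bsub>Q\<^esub> u = u'" unfolding fraction_of_def by blast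
  note c = b 1(1) 2(1) graphA[OF 1(2)] graphA[OF 1(3)] graphQ[OF 1(2)] graphQ[OF 1(3)]
    graphA[OF 2(2)] graphA[OF 2(3)] graphQ[OF 2(2)] graphQ[OF 2(3)]
  note NS = compatibleD(1)[OF N]
  have 0: "b \<otimes>\<^bsub>A\<^esub> r \<otimes>\<^bsub>A\<^esub> t \<ominus>\<^bsub>A\<^esub> r' \<otimes>\<^bsub>A\<^esub> t \<in> N" by (rule congruent_mult[OF N _ _ 1(5) 2(2)]) (use c in auto)
  have 3: "r' \<otimes>\<^bsub>A\<^esub> t \<ominus>\<^bsub>A\<^esub> b \<otimes>\<^bsub>A\<^esub> r \<otimes>\<^bsub>A\<^esub> t \<in> N" by (rule A.congruent_sym[OF NS _ _ 0]) (use c in auto)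
  have 4: "b \<otimes>\<^bsub>A\<^esub> t \<otimes>\<^bsub>A\<^esub> r \<ominus>\<^bsub>A\<^esub> t' \<otimes>\<^bsub>A\<^esub> r \<in> N" by (rule congruent_mult[OF N _ _ 2(5) 1(2)]) (use c in auto)
  have "b \<otimes>\<^bsub>A\<^esub> r \<otimes>\<^bsub>A\<^esub> t = b \<otimes>\<^bsub>A\<^esub> t \<otimes>\<^bsub>A\<^esub> r"
    using c graph_commute[OF 1(2) 2(2)] by (simp add: A.A.m_assoc)
  then have 5: "r' \<otimes>\<^bsub>A\<^esub> t \<ominus>\<^bsub>A\<^esub> t' \<otimes>\<^bsub>A\<^esub> r \<in> N"
    using A.congruent_trans[OF NS _ _ _ 3, of "t' \<otimes>\<^bsub>A\<^esub> r"] 4 c by simp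
  have "(r' \<otimes>\<^bsub>A\<^esub> t \<oplus>\<^bsub>A\<^esub> (\<ominus>\<^bsub>K\<^esub> \<one>\<^bsub>K\<^esub>) \<odot>\<^bsub>A\<^esub> (t' \<otimes>\<^bsub>A\<^esub> r), s' \<otimes>\<^bsub>Q\<^esub> u \<oplus>\<^bsub>Q\<^esub> (\<ominus>\<^bsub>K\<^esub> \<one>\<^bsub>K\<^esub>) \<odot>\<^bsub>Q\<^esub> (u' \<otimes>\<^bsub>Q\<^esub> s)) \<in> graph"
    by (intro graph.add graph.smult mult_graph 1 2) simp
  then have 6: "(r' \<otimes>\<^bsub>A\<^esub> t \<ominus>\<^bsub>A\<^esub> t' \<otimes>\<^bsub>A\<^esub> r, s' \<otimes>\<^bsub>Q\<^esub> u \<ominus>\<^bsub>Q\<^esub> u' \<otimes>\<^bsub>Q\<^esub> s) \<in> graph"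
    using c by (simp add: a_minus_def A.smult_l_minus Q.smult_l_minus)
  have "s' \<otimes>\<^bsub>Q\<^esub> u \<ominus>\<^bsub>Q\<^esub> u' \<otimes>\<^bsub>Q\<^esub> s = \<zero>\<^bsub>Q\<^esub>"
    using graph_zero_iff[OF 6] compatibleD(3)[OF N 6 5] by blast
  then have "s' \<otimes>\<^bsub>Q\<^esub> u = u' \<otimes>\<^bsub>Q\<^esub> s" using c by simp
  then have "q \<otimes>\<^bsub>Q\<^esub> (s \<otimes>\<^bsub>Q\<^esub> u) = p \<otimes>\<^bsub>Q\<^esub> (s \<otimes>\<^bsub>Q\<^esub> u)"
    unfolding 1(6)[symmetric] 2(6)[symmetric] using c by (simp add: Q.m_ac)
  moreover have "s \<otimes>\<^bsub>Q\<^esub> u \<noteq> \<zero>\<^bsub>Q\<^esub>" using 1(4) 2(4) c QF.integral by blast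
  ultimately show "q = p" using QF.m_rcancel[of "s \<otimes>\<^bsub>Q\<^esub> u" q p] c by simp
qed

text \<open>If b had no fraction, N + b K[cs] would still meet K[cs] only in zero, and maximality
  would put b into N; but then b has the fraction 0/1.\<close>

lemma fraction_of_exists:
  assumes N: "compatible N" and max: "\<And>N'. compatible N' \<Longrightarrow> N \<subseteq> N' \<Longrightarrow> N' = N" and b: "b \<in> carrier A"
  shows "\<exists>q. fraction_of N b q"
proof -
  note NS = compatibleD(1)[OF N]
  have Nc: "\<And>n. n \<in> N \<Longrightarrow> n \<in> carrier A" using submodule.subset[OF NS] by blast
  have "\<exists>r s r' s'. (r, s) \<in> graph \<and> (r', s') \<in> graph \<and> s \<noteq> \<zero>\<^bsub>Q\<^esub> \<and> b \<otimes>\<^bsub>A\<^esub> r \<ominus>\<^bsub>A\<^esub> r' \<in> N"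
  proof (rule ccontr)
    assume none: "\<nexists>r s r' s'. (r, s) \<in> graph \<and> (r', s') \<in> graph \<and> s \<noteq> \<zero>\<^bsub>Q\<^esub> \<and> b \<otimes>\<^bsub>A\<^esub> r \<ominus>\<^bsub>A\<^esub> r' \<in> N"
    \<comment> \<open>N + b K[cs]. If one of its elements n + b r lies in K[cs], then r is zero for
      lack of a fraction, and n lies in N and K[cs], hence is zero.\<close>
    define N' where "N' = {n \<oplus>\<^bsub>A\<^esub> b \<otimes>\<^bsub>A\<^esub> r | n r s. n \<in> N \<and> (r, s) \<in> graph}"
    have N'I: "n \<oplus>\<^bsub>A\<^esub> b \<otimes>\<^bsub>A\<^esub> r \<in> N'" if "n \<in> N" "(r, s) \<in> graph" for n r s
      using that unfolding N'_def by blast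
    have N'E: "\<exists>n r s. x = n \<oplus>\<^bsub>A\<^esub> b \<otimes>\<^bsub>A\<^esub> r \<and> n \<in> N \<and> (r, s) \<in> graph" if "x \<in> N'" for x
      using that unfolding N'_def by blast
    have sub: "N \<subseteq> N'"
    proof
      fix n assume "n \<in> N"
      then show "n \<in> N'" using N'I[OF _ zero_graph, of n] Nc b by simp
    qed
    have "submodule K N' A"
    proof (rule submodule.intro[OF A.module_axioms])
      show "N' \<subseteq> carrier A" unfolding N'_def using Nc graphA b by blast
      show "\<zero>\<^bsub>A\<^esub> \<in> N'" using sub submodule.zero_closed[OF NS] by blast
      fix v assume "v \<in> N'"
      then obtain n r s where v: "v = n \<oplus>\<^bsub>A\<^esub> b \<otimes>\<^bsub>A\<^esub> r" "n \<in> N" "(r, s) \<in> graph" using N'E by blast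
      show "c \<odot>\<^bsub>A\<^esub> v \<in> N'" if "c \<in> carrier K" for c
        using N'I[OF submodule.smult_closed[OF NS that v(2)] graph.smult[OF v(3) that]] v that b Nc[OF v(2)] graphA[OF v(3)]
        by (simp add: A.smult_r_distr A.smult_right)
      fix w assume "w \<in> N'"
      then obtain n' r' s' where w: "w = n' \<oplus>\<^bsub>A\<^esub> b \<otimes>\<^bsub>A\<^esub> r'" "n' \<in> N" "(r', s') \<in> graph" using N'E by blast
      have "v \<oplus>\<^bsub>A\<^esub> w = (n \<oplus>\<^bsub>A\<^esub> n') \<oplus>\<^bsub>A\<^esub> b \<otimes>\<^bsub>A\<^esub> (r \<oplus>\<^bsub>A\<^esub> r')"
        unfolding v(1) w(1) using b Nc[OF v(2)] graphA[OF v(3)] Nc[OF w(2)] graphA[OF w(3)]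
        by (simp add: A.A.r_distr A.M.a_ac)
      then show "v \<oplus>\<^bsub>A\<^esub> w \<in> N'" using N'I[OF submodule.m_closed[OF NS v(2) w(2)] graph.add[OF v(3) w(3)]] by simp
    qed
    moreover have "n \<otimes>\<^bsub>A\<^esub> r \<in> N'" if n: "n \<in> N'" and r: "(r, s) \<in> graph" for n r s
    proof -
      obtain n' r' s' where w: "n = n' \<oplus>\<^bsub>A\<^esub> b \<otimes>\<^bsub>A\<^esub> r'" "n' \<in> N" "(r', s') \<in> graph" using N'E[OF n] by blast
      then show ?thesis
        using N'I[OF compatibleD(2)[OF N w(2) r] mult_graph[OF w(3) r]] b Nc[OF w(2)] graphA[OF w(3)] graphA[OF r]
        by (simp add: A.A.l_distr A.A.m_assoc)
    qed
    moreover have "r' = \<zero>\<^bsub>A\<^esub>" if g': "(r', s') \<in> graph" and rN: "r' \<in> N'" for r' s'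
    proof -
      obtain n r s where n: "r' = n \<oplus>\<^bsub>A\<^esub> b \<otimes>\<^bsub>A\<^esub> r" "n \<in> N" "(r, s) \<in> graph" using N'E[OF rN] by blast
      have "b \<otimes>\<^bsub>A\<^esub> r \<ominus>\<^bsub>A\<^esub> r' = \<ominus>\<^bsub>A\<^esub> n"
        unfolding n(1) using b Nc[OF n(2)] graphA[OF n(3)]
        by (simp add: a_minus_def A.M.minus_add A.M.a_ac A.M.r_neg2 A.M.r_neg A.M.r_neg1)
      then have "b \<otimes>\<^bsub>A\<^esub> r \<ominus>\<^bsub>A\<^esub> r' \<in> N" using A.submodule_uminus[OF NS n(2)] by simp
      then have "s = \<zero>\<^bsub>Q\<^esub>" using none n(3) g' by blast
      then have "r = \<zero>\<^bsub>A\<^esub>" using graph_zero_iff[OF n(3)] by simp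
      then have "r' = n" using n b Nc by simp
      then show ?thesis using compatibleD(3)[OF N g'] n(2) by simp
    qed
    ultimately have "compatible N'" unfolding compatible_def by blast
    then have "N' = N" using max sub by blast
    \<comment> \<open>With N' = N this makes b congruent to 0, the fraction with denominator 1 that
      was excluded.\<close>
    moreover have "b \<in> N'" using N'I[OF submodule.zero_closed[OF NS] one_graph] b by simp
    ultimately have "b \<otimes>\<^bsub>A\<^esub> \<one>\<^bsub>A\<^esub> \<ominus>\<^bsub>A\<^esub> \<zero>\<^bsub>A\<^esub> \<in> N" using b by (simp add: a_minus_def)
    then show False using none one_graph zero_graph QF.one_not_zero by blast
  qed
  then obtain r s r' s' where g: "(r, s) \<in> graph" "(r', s') \<in> graph" "s \<noteq> \<zero>\<^bsub>Q\<^esub>" "b \<otimes>\<^bsub>A\<^esub> r \<ominus>\<^bsub>A\<^esub> r' \<in> N"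
    by blast
  have "s' \<otimes>\<^bsub>Q\<^esub> inv\<^bsub>Q\<^esub> s \<in> carrier Q" "s' \<otimes>\<^bsub>Q\<^esub> inv\<^bsub>Q\<^esub> s \<otimes>\<^bsub>Q\<^esub> s = s'"
    using g(3) graphQ[OF g(1)] graphQ[OF g(2)] QF.field_Units by (auto simp: Q.m_assoc)
  then have "fraction_of N b (s' \<otimes>\<^bsub>Q\<^esub> inv\<^bsub>Q\<^esub> s)" unfolding fraction_of_def using g by blast
  then show ?thesis by blast
qed

text \<open>The functional is the projection of A modulo a maximal compatible N followed by the
  embedding into Q. By uniqueness of fractions, each identity is proved by exhibiting one fraction
  for its left-hand side.\<close>

theorem compatible_functional:
  obtains \<phi> where "\<And>b. b \<in> carrier A \<Longrightarrow> \<phi> b \<in> carrier Q"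
    "\<And>b b'. b \<in> carrier A \<Longrightarrow> b' \<in> carrier A \<Longrightarrow> \<phi> (b \<oplus>\<^bsub>A\<^esub> b') = \<phi> b \<oplus>\<^bsub>Q\<^esub> \<phi> b'"
    "\<And>k b. k \<in> carrier K \<Longrightarrow> b \<in> carrier A \<Longrightarrow> \<phi> (k \<odot>\<^bsub>A\<^esub> b) = k \<odot>\<^bsub>Q\<^esub> \<phi> b"
    "\<phi> \<one>\<^bsub>A\<^esub> = \<one>\<^bsub>Q\<^esub>"
    "\<And>b l. b \<in> carrier A \<Longrightarrow> l < length cs \<Longrightarrow> \<phi> (b \<otimes>\<^bsub>A\<^esub> cs ! l) = \<phi> b \<otimes>\<^bsub>Q\<^esub> xs ! l"
proof -
  obtain N where N: "compatible N" and max: "\<And>N'. compatible N' \<Longrightarrow> N \<subseteq> N' \<Longrightarrow> N' = N"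
    using maximal_compatible by blast
  note NS = compatibleD(1)[OF N]
  define \<phi> where "\<phi> b = (SOME q. fraction_of N b q)" for b
  have \<phi>: "fraction_of N b (\<phi> b)" if "b \<in> carrier A" for b
    unfolding \<phi>_def using fraction_of_exists[OF N max that] by (rule someI_ex)
  have eq: "\<phi> b = q" if "b \<in> carrier A" "fraction_of N b q" for b q
    using fraction_of_unique[OF N that(1) \<phi>[OF that(1)] that(2)] .
  show ?thesis
  proof
    show closed: "\<phi> b \<in> carrier Q" if "b \<in> carrier A" for b
      using \<phi>[OF that] by (simp add: fraction_of_def)
    have "\<one>\<^bsub>A\<^esub> \<otimes>\<^bsub>A\<^esub> \<one>\<^bsub>A\<^esub> \<ominus>\<^bsub>A\<^esub> \<one>\<^bsub>A\<^esub> \<in> N" using submodule.zero_closed[OF NS] by (simp add: a_minus_def A.M.r_neg)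
    moreover have "\<one>\<^bsub>Q\<^esub> \<otimes>\<^bsub>Q\<^esub> \<one>\<^bsub>Q\<^esub> = \<one>\<^bsub>Q\<^esub>" by simp
    ultimately have "fraction_of N \<one>\<^bsub>A\<^esub> \<one>\<^bsub>Q\<^esub>"
      unfolding fraction_of_def using one_graph QF.one_not_zero Q.one_closed by blast
    then show "\<phi> \<one>\<^bsub>A\<^esub> = \<one>\<^bsub>Q\<^esub>" by (intro eq) auto
    fix b assume b: "b \<in> carrier A"
    from \<phi>[OF b] obtain r s r' s' where 1: "(r, s) \<in> graph" "(r', s') \<in> graph"
      "s \<noteq> \<zero>\<^bsub>Q\<^esub>" "b \<otimes>\<^bsub>A\<^esub> r \<ominus>\<^bsub>A\<^esub> r' \<in> N" "\<phi> b \<otimes>\<^bsub>Q\<^esub> s = s'" unfolding fraction_of_def by blast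
    note c = b closed[OF b] graphA[OF 1(1)] graphA[OF 1(2)] graphQ[OF 1(1)] graphQ[OF 1(2)]
    show "\<phi> (k \<odot>\<^bsub>A\<^esub> b) = k \<odot>\<^bsub>Q\<^esub> \<phi> b" if k: "k \<in> carrier K" for k
    proof (rule eq)
      have "(k \<odot>\<^bsub>A\<^esub> b) \<otimes>\<^bsub>A\<^esub> r \<ominus>\<^bsub>A\<^esub> k \<odot>\<^bsub>A\<^esub> r' \<in> N"
        using A.congruent_smult[OF NS _ _ k 1(4)] c k by (simp add: A.smult_left)
      moreover have "(k \<odot>\<^bsub>Q\<^esub> \<phi> b) \<otimes>\<^bsub>Q\<^esub> s = k \<odot>\<^bsub>Q\<^esub> s'" using c k 1(5) by (simp add: Q.smult_assoc2)
      moreover have "k \<odot>\<^bsub>Q\<^esub> \<phi> b \<in> carrier Q" using c k by simp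
      ultimately show "fraction_of N (k \<odot>\<^bsub>A\<^esub> b) (k \<odot>\<^bsub>Q\<^esub> \<phi> b)"
        unfolding fraction_of_def using 1(1,3) graph.smult[OF 1(2) k] by blast
    qed (use b k in auto)
    show "\<phi> (b \<otimes>\<^bsub>A\<^esub> cs ! l) = \<phi> b \<otimes>\<^bsub>Q\<^esub> xs ! l" if l: "l < length cs" for l
    proof (rule eq)
      note g = variable_graph[OF l]
      have "b \<otimes>\<^bsub>A\<^esub> r \<otimes>\<^bsub>A\<^esub> cs ! l \<ominus>\<^bsub>A\<^esub> r' \<otimes>\<^bsub>A\<^esub> cs ! l \<in> N" by (rule congruent_mult[OF N _ _ 1(4) g]) (use c in auto)
      moreover have "b \<otimes>\<^bsub>A\<^esub> r \<otimes>\<^bsub>A\<^esub> cs ! l = b \<otimes>\<^bsub>A\<^esub> cs ! l \<otimes>\<^bsub>A\<^esub> r"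
        using c graph_commute[OF 1(1) g] graphA[OF g] by (simp add: A.A.m_assoc)
      ultimately have "b \<otimes>\<^bsub>A\<^esub> cs ! l \<otimes>\<^bsub>A\<^esub> r \<ominus>\<^bsub>A\<^esub> r' \<otimes>\<^bsub>A\<^esub> cs ! l \<in> N" by simp
      moreover have "\<phi> b \<otimes>\<^bsub>Q\<^esub> xs ! l \<otimes>\<^bsub>Q\<^esub> s = s' \<otimes>\<^bsub>Q\<^esub> xs ! l"
        unfolding 1(5)[symmetric] using c graphQ[OF g] by (simp add: Q.m_ac)
      moreover have "\<phi> b \<otimes>\<^bsub>Q\<^esub> xs ! l \<in> carrier Q" using c graphQ[OF g] by simp
      ultimately show "fraction_of N (b \<otimes>\<^bsub>A\<^esub> cs ! l) (\<phi> b \<otimes>\<^bsub>Q\<^esub> xs ! l)"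
        unfolding fraction_of_def using 1(1,3) mult_graph[OF 1(2) g] by blast
    qed (use b graphA[OF variable_graph[OF l]] in auto)
    fix b' assume b': "b' \<in> carrier A"
    from \<phi>[OF b'] obtain t u t' u' where 2: "(t, u) \<in> graph" "(t', u') \<in> graph"
      "u \<noteq> \<zero>\<^bsub>Q\<^esub>" "b' \<otimes>\<^bsub>A\<^esub> t \<ominus>\<^bsub>A\<^esub> t' \<in> N" "\<phi> b' \<otimes>\<^bsub>Q\<^esub> u = u'" unfolding fraction_of_def by blast
    note c' = b' closed[OF b'] graphA[OF 2(1)] graphA[OF 2(2)] graphQ[OF 2(1)] graphQ[OF 2(2)]
    show "\<phi> (b \<oplus>\<^bsub>A\<^esub> b') = \<phi> b \<oplus>\<^bsub>Q\<^esub> \<phi> b'"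
    proof (rule eq)
      have 3: "b \<otimes>\<^bsub>A\<^esub> r \<otimes>\<^bsub>A\<^esub> t \<ominus>\<^bsub>A\<^esub> r' \<otimes>\<^bsub>A\<^esub> t \<in> N" by (rule congruent_mult[OF N _ _ 1(4) 2(1)]) (use c in auto)
      have 4: "b' \<otimes>\<^bsub>A\<^esub> t \<otimes>\<^bsub>A\<^esub> r \<ominus>\<^bsub>A\<^esub> t' \<otimes>\<^bsub>A\<^esub> r \<in> N" by (rule congruent_mult[OF N _ _ 2(4) 1(1)]) (use c' in auto)
      have "(b \<otimes>\<^bsub>A\<^esub> r \<otimes>\<^bsub>A\<^esub> t \<oplus>\<^bsub>A\<^esub> b' \<otimes>\<^bsub>A\<^esub> t \<otimes>\<^bsub>A\<^esub> r) \<ominus>\<^bsub>A\<^esub> (r' \<otimes>\<^bsub>A\<^esub> t \<oplus>\<^bsub>A\<^esub> t' \<otimes>\<^bsub>A\<^esub> r) \<in> N"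
        by (rule A.congruent_add[OF NS _ _ _ _ 3 4]) (use c c' in auto)
      moreover have "b \<otimes>\<^bsub>A\<^esub> r \<otimes>\<^bsub>A\<^esub> t \<oplus>\<^bsub>A\<^esub> b' \<otimes>\<^bsub>A\<^esub> t \<otimes>\<^bsub>A\<^esub> r = (b \<oplus>\<^bsub>A\<^esub> b') \<otimes>\<^bsub>A\<^esub> (r \<otimes>\<^bsub>A\<^esub> t)"
        using c c' graph_commute[OF 1(1) 2(1)] by (simp add: A.A.l_distr A.A.m_assoc)
      ultimately have "(b \<oplus>\<^bsub>A\<^esub> b') \<otimes>\<^bsub>A\<^esub> (r \<otimes>\<^bsub>A\<^esub> t) \<ominus>\<^bsub>A\<^esub> (r' \<otimes>\<^bsub>A\<^esub> t \<oplus>\<^bsub>A\<^esub> t' \<otimes>\<^bsub>A\<^esub> r) \<in> N" by simp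
      moreover have "(\<phi> b \<oplus>\<^bsub>Q\<^esub> \<phi> b') \<otimes>\<^bsub>Q\<^esub> (s \<otimes>\<^bsub>Q\<^esub> u) = s' \<otimes>\<^bsub>Q\<^esub> u \<oplus>\<^bsub>Q\<^esub> u' \<otimes>\<^bsub>Q\<^esub> s"
        unfolding 1(5)[symmetric] 2(5)[symmetric] using c c' by (simp add: Q.l_distr Q.r_distr Q.m_ac)
      moreover have "\<phi> b \<oplus>\<^bsub>Q\<^esub> \<phi> b' \<in> carrier Q" using c c' by simp
      moreover have "s \<otimes>\<^bsub>Q\<^esub> u \<noteq> \<zero>\<^bsub>Q\<^esub>" using 1(3) 2(3) c c' QF.integral by blast
      ultimately show "fraction_of N (b \<oplus>\<^bsub>A\<^esub> b') (\<phi> b \<oplus>\<^bsub>Q\<^esub> \<phi> b')"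
        unfolding fraction_of_def
        using mult_graph[OF 1(1) 2(1)] graph.add[OF mult_graph[OF 1(2) 2(1)] mult_graph[OF 2(2) 1(1)]] by blast
    qed (use b b' in auto)
  qed
qed

end


section \<open>Scalar extensions\<close>

lemma frag_extend_diff_fun:
  "frag_extend (\<lambda>x. f x - g x) u = frag_extend f u - frag_extend g u"
  using subset_UNIV[of "Poly_Mapping.keys u"]
  by (induction u rule: frag_induction) (auto simp: frag_extend_diff)

locale scalars =
  A: assoc_algebra K A + Q: algebra K Q + QF: field Q
  for K :: "('k, 'x) ring_scheme" and A :: "('k, 'a) module" and Q :: "('k, 'q) module"
begin

abbreviation "F \<equiv> free_product_ring Q A"
abbreviation "I \<equiv> tensor_ideal K Q A"
abbreviation "T \<equiv> scalar_extension K Q A"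
abbreviation "S \<equiv> carrier Q \<times> carrier A"

lemma F_simps [simp]:
  "carrier F = {u. Poly_Mapping.keys u \<subseteq> S}" "\<zero>\<^bsub>F\<^esub> = 0" "add F = (+)"
  "one F = frag_of (\<one>\<^bsub>Q\<^esub>, \<one>\<^bsub>A\<^esub>)"
  by (auto simp: free_product_ring_def)

lemma F_mult_frag [simp]:
  "frag_of (q, a) \<otimes>\<^bsub>F\<^esub> frag_of (q', a') = frag_of (q \<otimes>\<^bsub>Q\<^esub> q', a \<otimes>\<^bsub>A\<^esub> a')"
  by (simp add: free_product_ring_def)

text \<open>\<open>frag_induction\<close> builds elements of a free abelian group from generators by
  differences, so biadditivity is recorded for subtraction; the version for sums is derived from
  it.\<close>

lemma F_mult_diff:
  "(u - v) \<otimes>\<^bsub>F\<^esub> w = u \<otimes>\<^bsub>F\<^esub> w - v \<otimes>\<^bsub>F\<^esub> w"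
  "w \<otimes>\<^bsub>F\<^esub> (u - v) = w \<otimes>\<^bsub>F\<^esub> u - w \<otimes>\<^bsub>F\<^esub> v"
proof -
  show "(u - v) \<otimes>\<^bsub>F\<^esub> w = u \<otimes>\<^bsub>F\<^esub> w - v \<otimes>\<^bsub>F\<^esub> w"
    by (simp add: free_product_ring_def frag_extend_diff)
  have "(\<lambda>(q, a). frag_extend (\<lambda>(q', a'). frag_of (q \<otimes>\<^bsub>Q\<^esub> q', a \<otimes>\<^bsub>A\<^esub> a')) (u - v)) =
    (\<lambda>x. (case x of (q, a) \<Rightarrow> frag_extend (\<lambda>(q', a'). frag_of (q \<otimes>\<^bsub>Q\<^esub> q', a \<otimes>\<^bsub>A\<^esub> a')) u) -
      (case x of (q, a) \<Rightarrow> frag_extend (\<lambda>(q', a'). frag_of (q \<otimes>\<^bsub>Q\<^esub> q', a \<otimes>\<^bsub>A\<^esub> a')) v))"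
    by (auto simp: frag_extend_diff)
  then show "w \<otimes>\<^bsub>F\<^esub> (u - v) = w \<otimes>\<^bsub>F\<^esub> u - w \<otimes>\<^bsub>F\<^esub> v"
    by (simp add: free_product_ring_def frag_extend_diff_fun)
qed

lemma F_mult_zero: "0 \<otimes>\<^bsub>F\<^esub> u = 0" "u \<otimes>\<^bsub>F\<^esub> 0 = 0"
  using F_mult_diff(1)[of 0 0 u] F_mult_diff(2)[of u 0 0] by simp_all

lemma keys_diff_subset: "Poly_Mapping.keys u \<subseteq> X \<Longrightarrow> Poly_Mapping.keys v \<subseteq> X \<Longrightarrow> Poly_Mapping.keys (u - v) \<subseteq> X"
  using keys_diff[of u v] by blast

lemma F_mult_closed:
  assumes "Poly_Mapping.keys u \<subseteq> S" "Poly_Mapping.keys v \<subseteq> S"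
  shows "Poly_Mapping.keys (u \<otimes>\<^bsub>F\<^esub> v) \<subseteq> S"
  using assms(1)
proof (induction u rule: frag_induction)
  case (one x)
  show ?case using assms(2)
  proof (induction v rule: frag_induction)
    case (one y) then show ?case using \<open>x \<in> S\<close> by (cases x; cases y) (auto simp: keys_frag_of)
  qed (simp_all add: F_mult_zero F_mult_diff keys_diff_subset)
qed (simp_all add: F_mult_zero F_mult_diff keys_diff_subset)

lemma F_mult_assoc:
  assumes "Poly_Mapping.keys u \<subseteq> S" "Poly_Mapping.keys v \<subseteq> S" "Poly_Mapping.keys w \<subseteq> S"
  shows "u \<otimes>\<^bsub>F\<^esub> v \<otimes>\<^bsub>F\<^esub> w = u \<otimes>\<^bsub>F\<^esub> (v \<otimes>\<^bsub>F\<^esub> w)"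
  using assms(1)
proof (induction u rule: frag_induction)
  case (one x)
  show ?case using assms(2)
  proof (induction v rule: frag_induction)
    case (one y)
    show ?case using assms(3)
    proof (induction w rule: frag_induction)
      case (one z)
      then show ?case using \<open>x \<in> S\<close> \<open>y \<in> S\<close>
        by (cases x; cases y; cases z) (auto simp: A.A.m_assoc Q.m_assoc)
    qed (simp_all add: F_mult_zero F_mult_diff)
  qed (simp_all add: F_mult_zero F_mult_diff)
qed (simp_all add: F_mult_zero F_mult_diff)

lemma F_mult_one:
  assumes "Poly_Mapping.keys u \<subseteq> S"
  shows "frag_of (\<one>\<^bsub>Q\<^esub>, \<one>\<^bsub>A\<^esub>) \<otimes>\<^bsub>F\<^esub> u = u \<and> u \<otimes>\<^bsub>F\<^esub> frag_of (\<one>\<^bsub>Q\<^esub>, \<one>\<^bsub>A\<^esub>) = u"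
  using assms
proof (induction u rule: frag_induction)
  case (one x) then show ?case by (cases x) auto
qed (auto simp: F_mult_zero F_mult_diff)

lemma F_mult_add:
  "(u + v) \<otimes>\<^bsub>F\<^esub> w = u \<otimes>\<^bsub>F\<^esub> w + v \<otimes>\<^bsub>F\<^esub> w" "w \<otimes>\<^bsub>F\<^esub> (u + v) = w \<otimes>\<^bsub>F\<^esub> u + w \<otimes>\<^bsub>F\<^esub> v"
  using F_mult_diff(1)[of u "0 - v" w] F_mult_diff(1)[of 0 v w]
    F_mult_diff(2)[of w u "0 - v"] F_mult_diff(2)[of w 0 v] by (simp_all add: F_mult_zero)

lemma ring_F: "ring F"
proof (rule ringI)
  show "abelian_group F"
  proof (rule abelian_groupI)
    fix x assume "x \<in> carrier F"
    then show "\<exists>y\<in>carrier F. y \<oplus>\<^bsub>F\<^esub> x = \<zero>\<^bsub>F\<^esub>" by (intro bexI[of _ "- x"]) (auto simp: keys_minus)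
  qed (use keys_add in \<open>fastforce simp: add_ac\<close>)+
  show "monoid F"
    by (rule monoidI) (use F_mult_closed F_mult_assoc F_mult_one in \<open>auto simp: keys_frag_of\<close>)
qed (simp_all add: F_mult_add)

sublocale F: ring F by (rule ring_F)

lemma frag_closed: "q \<in> carrier Q \<Longrightarrow> a \<in> carrier A \<Longrightarrow> frag_of (q, a) \<in> carrier F"
  by (simp add: keys_frag_of)

lemma F_diff_closed: "u \<in> carrier F \<Longrightarrow> v \<in> carrier F \<Longrightarrow> u - v \<in> carrier F"
  by (simp add: keys_diff_subset)

lemma relations_closed: "tensor_relations K Q A \<subseteq> carrier F"
proof
  fix r assume "r \<in> tensor_relations K Q A"
  then show "r \<in> carrier F"
    unfolding tensor_relations_def
    by (elim UnE CollectE exE conjE) (simp_all add: F_diff_closed frag_closed del: F_simps(1))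
qed

lemma I_ideal: "ideal I F"
  unfolding tensor_ideal_def by (rule F.genideal_ideal[OF relations_closed])

sublocale I: ideal I F by (rule I_ideal)

lemma F_minus: "u \<in> carrier F \<Longrightarrow> \<ominus>\<^bsub>F\<^esub> u = - u"
  by (rule F.minus_equality) (auto simp: keys_minus)

abbreviation proj where "proj u \<equiv> I +>\<^bsub>F\<^esub> u"

lemma T_simps:
  "carrier T = carrier (F Quot I)" "mult T = mult (F Quot I)" "one T = one (F Quot I)"
  "\<zero>\<^bsub>T\<^esub> = \<zero>\<^bsub>F Quot I\<^esub>" "add T = add (F Quot I)"
  "q \<odot>\<^bsub>T\<^esub> X = proj (frag_of (q, \<one>\<^bsub>A\<^esub>)) \<otimes>\<^bsub>T\<^esub> X"
  by (simp_all add: scalar_extension_def Let_def)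

lemma T_carrier: "X \<in> carrier T \<longleftrightarrow> (\<exists>u\<in>carrier F. X = proj u)"
  unfolding T_simps(1) FactRing_def A_RCOSETS_def' by (auto simp del: F_simps)

lemma proj_hom: "proj \<in> ring_hom F T"
  using I.rcos_ring_hom unfolding ring_hom_def T_simps by simp

text \<open>\<open>T\<close> is the record of the quotient ring with a scalar multiplication added,
  so the identity map transports the ring structure.\<close>

lemma T_ring: "ring T"
proof -
  interpret R: ring "F Quot I" by (rule I.quotient_is_ring)
  have "(\<lambda>x. x) \<in> ring_hom (F Quot I) T" by (simp add: ring_hom_def T_simps)
  then have "ring (T \<lparr>carrier := (\<lambda>x. x) ` carrier (F Quot I), zero := \<zero>\<^bsub>F Quot I\<^esub>\<rparr>)"
    by (rule R.ring_hom_imp_img_ring)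
  also have "T \<lparr>carrier := (\<lambda>x. x) ` carrier (F Quot I), zero := \<zero>\<^bsub>F Quot I\<^esub>\<rparr> = T"
    by (simp add: scalar_extension_def Let_def)
  finally show ?thesis .
qed

sublocale TR: ring T by (rule T_ring)

lemma proj_simps:
  "u \<in> carrier F \<Longrightarrow> proj u \<in> carrier T"
  "u \<in> carrier F \<Longrightarrow> v \<in> carrier F \<Longrightarrow> proj (u \<otimes>\<^bsub>F\<^esub> v) = proj u \<otimes>\<^bsub>T\<^esub> proj v"
  "u \<in> carrier F \<Longrightarrow> v \<in> carrier F \<Longrightarrow> proj (u + v) = proj u \<oplus>\<^bsub>T\<^esub> proj v"
  "proj (one F) = \<one>\<^bsub>T\<^esub>" "proj 0 = \<zero>\<^bsub>T\<^esub>"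
  using proj_hom ring_hom_zero[OF proj_hom ring_F T_ring] unfolding ring_hom_def by auto

lemma proj_diff:
  assumes "u \<in> carrier F" "v \<in> carrier F"
  shows "proj (u - v) = proj u \<ominus>\<^bsub>T\<^esub> proj v"
proof -
  have uv: "u - v \<in> carrier F" using assms F_diff_closed by blast
  have "proj u = proj ((u - v) + v)" by simp
  also have "\<dots> = proj (u - v) \<oplus>\<^bsub>T\<^esub> proj v" by (rule proj_simps(3)[OF uv assms(2)])
  finally show ?thesis
    using proj_simps(1)[OF uv] proj_simps(1)[OF assms(2)] by (simp add: a_minus_def TR.a_assoc TR.r_neg)
qed

lemma proj_eqI:
  assumes "u \<in> carrier F" "v \<in> carrier F" "u - v \<in> I"
  shows "proj u = proj v"
proof -
  have "proj (u - v) = \<zero>\<^bsub>T\<^esub>"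
    using I.a_rcos_const[OF assms(3)] by (simp add: T_simps FactRing_def)
  then have "proj u \<ominus>\<^bsub>T\<^esub> proj v = \<zero>\<^bsub>T\<^esub>" using proj_diff[OF assms(1,2)] by simp
  then show ?thesis using assms(1,2) proj_simps(1) by simp
qed

lemma proj_eqD:
  assumes "u \<in> carrier F" "v \<in> carrier F" "proj u = proj v"
  shows "u - v \<in> I"
proof -
  have "u \<in> proj v" using I.a_rcos_self[OF assms(1)] assms(3) by simp
  then obtain i where "i \<in> I" "u = i + v" by (auto simp: a_r_coset_def')
  then show ?thesis by simp
qed

abbreviation tens where "tens q a \<equiv> proj (frag_of (q, a))"

lemma tens_closed: "q \<in> carrier Q \<Longrightarrow> a \<in> carrier A \<Longrightarrow> tens q a \<in> carrier T"
  by (rule proj_simps(1)) (rule frag_closed)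

lemma tens_mult:
  "q \<in> carrier Q \<Longrightarrow> a \<in> carrier A \<Longrightarrow> q' \<in> carrier Q \<Longrightarrow> a' \<in> carrier A \<Longrightarrow>
    tens q a \<otimes>\<^bsub>T\<^esub> tens q' a' = tens (q \<otimes>\<^bsub>Q\<^esub> q') (a \<otimes>\<^bsub>A\<^esub> a')"
  using proj_simps(2)[OF frag_closed frag_closed, of q a q' a'] by simp

lemma relation_in_I: "r \<in> tensor_relations K Q A \<Longrightarrow> r \<in> I"
  unfolding tensor_ideal_def using F.genideal_self[OF relations_closed] by blast

lemma tens_add_left:
  assumes "q \<in> carrier Q" "q' \<in> carrier Q" "a \<in> carrier A"
  shows "tens (q \<oplus>\<^bsub>Q\<^esub> q') a = tens q a \<oplus>\<^bsub>T\<^esub> tens q' a"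
proof -
  have "frag_of (q \<oplus>\<^bsub>Q\<^esub> q', a) - frag_of (q, a) - frag_of (q', a) \<in> I"
    using assms by (intro relation_in_I) (auto simp: tensor_relations_def)
  then have "tens (q \<oplus>\<^bsub>Q\<^esub> q') a = proj (frag_of (q, a) + frag_of (q', a))"
    using assms F.a_closed[OF frag_closed frag_closed, of q a q' a] by (intro proj_eqI frag_closed) (auto simp: diff_diff_eq)
  then show ?thesis using assms by (simp add: proj_simps(3) frag_closed del: F_simps(1))
qed

lemma tens_add_right:
  assumes "q \<in> carrier Q" "a \<in> carrier A" "a' \<in> carrier A"
  shows "tens q (a \<oplus>\<^bsub>A\<^esub> a') = tens q a \<oplus>\<^bsub>T\<^esub> tens q a'"
proof -
  have "frag_of (q, a \<oplus>\<^bsub>A\<^esub> a') - frag_of (q, a) - frag_of (q, a') \<in> I"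
    using assms by (intro relation_in_I) (auto simp: tensor_relations_def)
  then have "tens q (a \<oplus>\<^bsub>A\<^esub> a') = proj (frag_of (q, a) + frag_of (q, a'))"
    using assms F.a_closed[OF frag_closed frag_closed, of q a q a'] by (intro proj_eqI frag_closed) (auto simp: diff_diff_eq)
  then show ?thesis using assms by (simp add: proj_simps(3) frag_closed del: F_simps(1))
qed

lemma tens_balanced:
  assumes "k \<in> carrier K" "q \<in> carrier Q" "a \<in> carrier A"
  shows "tens (k \<odot>\<^bsub>Q\<^esub> q) a = tens q (k \<odot>\<^bsub>A\<^esub> a)"
proof (rule proj_eqI)
  show "frag_of (k \<odot>\<^bsub>Q\<^esub> q, a) - frag_of (q, k \<odot>\<^bsub>A\<^esub> a) \<in> I"
    using assms by (intro relation_in_I) (auto simp: tensor_relations_def)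
qed (use assms in \<open>auto intro!: frag_closed simp del: F_simps(1)\<close>)

text \<open>Commutativity of Q gives the identity for pairs already in the free product ring, and it
  extends additively; this is what makes T an algebra over Q.\<close>

lemma tens_central:
  assumes q: "q \<in> carrier Q" and X: "X \<in> carrier T"
  shows "tens q \<one>\<^bsub>A\<^esub> \<otimes>\<^bsub>T\<^esub> X = X \<otimes>\<^bsub>T\<^esub> tens q \<one>\<^bsub>A\<^esub>"
proof -
  obtain u where u: "u \<in> carrier F" "X = proj u" using X T_carrier by blast
  have "Poly_Mapping.keys u \<subseteq> S" using u by simp
  then have "frag_of (q, \<one>\<^bsub>A\<^esub>) \<otimes>\<^bsub>F\<^esub> u = u \<otimes>\<^bsub>F\<^esub> frag_of (q, \<one>\<^bsub>A\<^esub>)"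
  proof (induction u rule: frag_induction)
    case (one x) then show ?case using q by (cases x) (auto simp: Q.m_comm)
  qed (simp_all add: F_mult_zero F_mult_diff)
  then show ?thesis
    using proj_simps(2)[OF frag_closed[OF q A.A.one_closed] u(1)] proj_simps(2)[OF u(1) frag_closed[OF q A.A.one_closed]]
    by (simp add: u(2))
qed

lemma T_assoc_algebra: "assoc_algebra Q T"
proof -
  have one: "tens q \<one>\<^bsub>A\<^esub> \<in> carrier T" if "q \<in> carrier Q" for q by (rule tens_closed[OF that A.A.one_closed])
  have "module Q T"
  proof (rule moduleI)
    fix q q' X assume q: "q \<in> carrier Q" "q' \<in> carrier Q" and X: "X \<in> carrier T"
    show "(q \<oplus>\<^bsub>Q\<^esub> q') \<odot>\<^bsub>T\<^esub> X = q \<odot>\<^bsub>T\<^esub> X \<oplus>\<^bsub>T\<^esub> q' \<odot>\<^bsub>T\<^esub> X"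
      unfolding T_simps(6) tens_add_left[OF q A.A.one_closed] by (rule TR.l_distr[OF one[OF q(1)] one[OF q(2)] X])
    have "(q \<otimes>\<^bsub>Q\<^esub> q') \<odot>\<^bsub>T\<^esub> X = (tens q \<one>\<^bsub>A\<^esub> \<otimes>\<^bsub>T\<^esub> tens q' \<one>\<^bsub>A\<^esub>) \<otimes>\<^bsub>T\<^esub> X"
      unfolding T_simps(6) using tens_mult[OF q(1) A.A.one_closed q(2) A.A.one_closed] by simp
    then show "(q \<otimes>\<^bsub>Q\<^esub> q') \<odot>\<^bsub>T\<^esub> X = q \<odot>\<^bsub>T\<^esub> (q' \<odot>\<^bsub>T\<^esub> X)"
      unfolding T_simps(6) using TR.m_assoc[OF one[OF q(1)] one[OF q(2)] X] by simp
  next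
    fix X assume X: "X \<in> carrier T"
    show "\<one>\<^bsub>Q\<^esub> \<odot>\<^bsub>T\<^esub> X = X"
      unfolding T_simps(6) using TR.l_one[OF X] proj_simps(4) by simp
    fix q assume q: "q \<in> carrier Q"
    show "q \<odot>\<^bsub>T\<^esub> X \<in> carrier T"
      unfolding T_simps(6) by (rule TR.m_closed[OF one[OF q] X])
    fix Y assume Y: "Y \<in> carrier T"
    show "q \<odot>\<^bsub>T\<^esub> (X \<oplus>\<^bsub>T\<^esub> Y) = q \<odot>\<^bsub>T\<^esub> X \<oplus>\<^bsub>T\<^esub> q \<odot>\<^bsub>T\<^esub> Y"
      unfolding T_simps(6) by (rule TR.r_distr[OF X Y one[OF q]])
  qed (rule Q.M_cring, rule TR.abelian_group_axioms)
  then have "vectorspace Q T" by (intro vectorspace.intro QF.field_axioms)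
  moreover have "assoc_algebra_axioms Q T"
  proof
    fix q X Y assume q: "q \<in> carrier Q" and X: "X \<in> carrier T" and Y: "Y \<in> carrier T"
    show "q \<odot>\<^bsub>T\<^esub> X \<otimes>\<^bsub>T\<^esub> Y = q \<odot>\<^bsub>T\<^esub> (X \<otimes>\<^bsub>T\<^esub> Y)"
      unfolding T_simps(6) by (rule TR.m_assoc[OF one[OF q] X Y])
    have "X \<otimes>\<^bsub>T\<^esub> (tens q \<one>\<^bsub>A\<^esub> \<otimes>\<^bsub>T\<^esub> Y) = (X \<otimes>\<^bsub>T\<^esub> tens q \<one>\<^bsub>A\<^esub>) \<otimes>\<^bsub>T\<^esub> Y"
      by (rule TR.m_assoc[OF X one[OF q] Y, symmetric])
    also have "\<dots> = tens q \<one>\<^bsub>A\<^esub> \<otimes>\<^bsub>T\<^esub> (X \<otimes>\<^bsub>T\<^esub> Y)"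
      unfolding tens_central[OF q X, symmetric] by (rule TR.m_assoc[OF one[OF q] X Y])
    finally show "X \<otimes>\<^bsub>T\<^esub> (q \<odot>\<^bsub>T\<^esub> Y) = q \<odot>\<^bsub>T\<^esub> (X \<otimes>\<^bsub>T\<^esub> Y)" unfolding T_simps(6) .
  qed
  ultimately show ?thesis by (intro assoc_algebra.intro T_ring)
qed

sublocale T: assoc_algebra Q T by (rule T_assoc_algebra)

definition embed :: "'a \<Rightarrow> (('q \<times> 'a) \<Rightarrow>\<^sub>0 int) set" where
  "embed a = tens \<one>\<^bsub>Q\<^esub> a"

lemma smult_embed: "q \<in> carrier Q \<Longrightarrow> a \<in> carrier A \<Longrightarrow> q \<odot>\<^bsub>T\<^esub> embed a = tens q a"
  unfolding T_simps(6) embed_def by (simp add: tens_mult)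

lemma embed_closed: "a \<in> carrier A \<Longrightarrow> embed a \<in> carrier T"
  unfolding embed_def by (rule tens_closed) auto

lemma embed_hom: "embed \<in> ring_hom A T"
proof (rule ring_hom_memI)
  show "embed (x \<otimes>\<^bsub>A\<^esub> y) = embed x \<otimes>\<^bsub>T\<^esub> embed y" if "x \<in> carrier A" "y \<in> carrier A" for x y
    using that tens_mult[of "\<one>\<^bsub>Q\<^esub>" x "\<one>\<^bsub>Q\<^esub>" y] by (simp add: embed_def)
  show "embed (x \<oplus>\<^bsub>A\<^esub> y) = embed x \<oplus>\<^bsub>T\<^esub> embed y" if "x \<in> carrier A" "y \<in> carrier A" for x y
    using that by (simp add: embed_def tens_add_right)
  show "embed \<one>\<^bsub>A\<^esub> = \<one>\<^bsub>T\<^esub>" using proj_simps(4) by (simp add: embed_def)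
qed (rule embed_closed)

lemma span_embed: "T.span (embed ` carrier A) = carrier T"
proof
  have c: "embed ` carrier A \<subseteq> carrier T" using embed_closed by auto
  show "T.span (embed ` carrier A) \<subseteq> carrier T" by (rule T.span_is_subset2[OF c])
  note sub = T.span_is_submodule[OF c]
  show "carrier T \<subseteq> T.span (embed ` carrier A)"
  proof
    fix X assume "X \<in> carrier T"
    then obtain u where u: "u \<in> carrier F" "X = proj u" using T_carrier by blast
    have "Poly_Mapping.keys u \<subseteq> S" using u by simp
    then have "u \<in> carrier F \<and> proj u \<in> T.span (embed ` carrier A)"
    proof (induction u rule: frag_induction)
      case zero
      then show ?case using proj_simps(5) submodule.zero_closed[OF sub] by simp
    next
      case (one x)
      then obtain q a where x: "x = (q, a)" "q \<in> carrier Q" "a \<in> carrier A" by auto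
      have "embed a \<in> T.span (embed ` carrier A)" using x by (intro T.in_span[OF c]) auto
      then have "tens q a \<in> T.span (embed ` carrier A)"
        unfolding smult_embed[OF x(2,3), symmetric] by (rule submodule.smult_closed[OF sub x(2)])
      then show ?case using frag_closed[OF x(2,3)] x(1) by simp
    next
      case (diff u v)
      then have "proj (u - v) \<in> T.span (embed ` carrier A)"
        using proj_diff[of u v] T.submodule_minus[OF sub, of "proj u" "proj v"] by simp
      then show ?case using diff keys_diff_subset[of u S v] by simp
    qed
    then show "X \<in> T.span (embed ` carrier A)" using u by simp
  qed
qed

definition functionals :: "('a \<Rightarrow> 'q) set" where
  "functionals = {\<phi>. (\<forall>a\<in>carrier A. \<phi> a \<in> carrier Q) \<and>
    (\<forall>a\<in>carrier A. \<forall>b\<in>carrier A. \<phi> (a \<oplus>\<^bsub>A\<^esub> b) = \<phi> a \<oplus>\<^bsub>Q\<^esub> \<phi> b) \<and>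
    (\<forall>k\<in>carrier K. \<forall>a\<in>carrier A. \<phi> (k \<odot>\<^bsub>A\<^esub> a) = k \<odot>\<^bsub>Q\<^esub> \<phi> a)}"

text \<open>The additive extension of (q, a) \<mapsto> q \<phi>(a) to the free abelian group,
  obtained from its universal property; it will descend to the tensor product.\<close>

definition evaluation :: "('a \<Rightarrow> 'q) \<Rightarrow> (('q \<times> 'a) \<Rightarrow>\<^sub>0 int) \<Rightarrow> 'q" where
  "evaluation \<phi> = (SOME h. h \<in> hom (free_Abelian_group S) (add_monoid Q) \<and>
     (\<forall>(q, a)\<in>S. h (frag_of (q, a)) = q \<otimes>\<^bsub>Q\<^esub> \<phi> a))"

lemma evaluation:
  assumes "\<phi> \<in> functionals"
  shows "evaluation \<phi> \<in> hom (free_Abelian_group S) (add_monoid Q)"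
    and "q \<in> carrier Q \<Longrightarrow> a \<in> carrier A \<Longrightarrow> evaluation \<phi> (frag_of (q, a)) = q \<otimes>\<^bsub>Q\<^esub> \<phi> a"
proof -
  have "(\<lambda>(q, a). q \<otimes>\<^bsub>Q\<^esub> \<phi> a) ` S \<subseteq> carrier (add_monoid Q)"
    using assms by (auto simp: functionals_def)
  then obtain h where "h \<in> hom (free_Abelian_group S) (add_monoid Q)"
    "\<And>x. x \<in> S \<Longrightarrow> h (frag_of x) = (\<lambda>(q, a). q \<otimes>\<^bsub>Q\<^esub> \<phi> a) x"
    by (rule comm_group.free_Abelian_group_universal[OF Q.a_comm_group]) (rule that)
  then have "\<exists>h. h \<in> hom (free_Abelian_group S) (add_monoid Q) \<and>
     (\<forall>(q, a)\<in>S. h (frag_of (q, a)) = q \<otimes>\<^bsub>Q\<^esub> \<phi> a)" by (intro exI[of _ h]) auto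
  from someI_ex[OF this] show "evaluation \<phi> \<in> hom (free_Abelian_group S) (add_monoid Q)"
    and "q \<in> carrier Q \<Longrightarrow> a \<in> carrier A \<Longrightarrow> evaluation \<phi> (frag_of (q, a)) = q \<otimes>\<^bsub>Q\<^esub> \<phi> a"
    unfolding evaluation_def by auto
qed

lemma evaluation_closed: "\<phi> \<in> functionals \<Longrightarrow> u \<in> carrier F \<Longrightarrow> evaluation \<phi> u \<in> carrier Q"
  using hom_carrier[OF evaluation(1), of \<phi>] by fastforce

lemma evaluation_add:
  "\<phi> \<in> functionals \<Longrightarrow> u \<in> carrier F \<Longrightarrow> v \<in> carrier F \<Longrightarrow> evaluation \<phi> (u + v) = evaluation \<phi> u \<oplus>\<^bsub>Q\<^esub> evaluation \<phi> v"
  using hom_mult[OF evaluation(1), of \<phi> u v] by simp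

lemma evaluation_diff:
  assumes "\<phi> \<in> functionals" "u \<in> carrier F" "v \<in> carrier F"
  shows "evaluation \<phi> (u - v) = evaluation \<phi> u \<ominus>\<^bsub>Q\<^esub> evaluation \<phi> v"
proof -
  have uv: "u - v \<in> carrier F" using assms F_diff_closed by blast
  have "evaluation \<phi> u = evaluation \<phi> (u - v) \<oplus>\<^bsub>Q\<^esub> evaluation \<phi> v"
    using evaluation_add[OF assms(1) uv assms(3)] by simp
  then show ?thesis
    using evaluation_closed[OF assms(1) uv] evaluation_closed[OF assms(1,3)]
    by (simp add: a_minus_def Q.a_assoc Q.r_neg)
qed

lemma evaluation_zero: "\<phi> \<in> functionals \<Longrightarrow> evaluation \<phi> 0 = \<zero>\<^bsub>Q\<^esub>"
  using evaluation_diff[of \<phi> 0 0] evaluation_closed[of \<phi> 0] by (simp add: a_minus_def Q.r_neg)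

lemma functional_translate:
  assumes "\<phi> \<in> functionals" "b \<in> carrier A"
  shows "(\<lambda>a. \<phi> (b \<otimes>\<^bsub>A\<^esub> a)) \<in> functionals" "(\<lambda>a. \<phi> (a \<otimes>\<^bsub>A\<^esub> b)) \<in> functionals"
  using assms by (auto simp: functionals_def A.A.l_distr A.A.r_distr A.smult_left A.smult_right)

lemma evaluation_mult_left:
  assumes \<phi>: "\<phi> \<in> functionals" and p: "p \<in> carrier Q" "b \<in> carrier A" and u: "u \<in> carrier F"
  shows "evaluation \<phi> (frag_of (p, b) \<otimes>\<^bsub>F\<^esub> u) = p \<otimes>\<^bsub>Q\<^esub> evaluation (\<lambda>a. \<phi> (b \<otimes>\<^bsub>A\<^esub> a)) u"
proof -
  note \<psi> = functional_translate(1)[OF \<phi> p(2)]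
  have "Poly_Mapping.keys u \<subseteq> S" using u by simp
  then have "u \<in> carrier F \<and> evaluation \<phi> (frag_of (p, b) \<otimes>\<^bsub>F\<^esub> u) = p \<otimes>\<^bsub>Q\<^esub> evaluation (\<lambda>a. \<phi> (b \<otimes>\<^bsub>A\<^esub> a)) u"
  proof (induction u rule: frag_induction)
    case zero then show ?case using \<phi> \<psi> p by (simp add: F_mult_zero evaluation_zero)
  next
    case (one x)
    then obtain q a where x: "x = (q, a)" "q \<in> carrier Q" "a \<in> carrier A" by auto
    have "\<phi> (b \<otimes>\<^bsub>A\<^esub> a) \<in> carrier Q" using \<phi> p x by (auto simp: functionals_def)
    then show ?case using x p \<phi> \<psi> frag_closed[OF x(2,3)]
      by (simp add: evaluation(2)[OF \<phi>] evaluation(2)[OF \<psi>] Q.m_assoc)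
  next
    case (diff u v)
    have c: "frag_of (p, b) \<otimes>\<^bsub>F\<^esub> u \<in> carrier F" "frag_of (p, b) \<otimes>\<^bsub>F\<^esub> v \<in> carrier F"
      using diff frag_closed[OF p] by (auto simp del: F_simps(1))
    have "evaluation \<phi> (frag_of (p, b) \<otimes>\<^bsub>F\<^esub> (u - v)) =
        p \<otimes>\<^bsub>Q\<^esub> evaluation (\<lambda>a. \<phi> (b \<otimes>\<^bsub>A\<^esub> a)) u \<ominus>\<^bsub>Q\<^esub> p \<otimes>\<^bsub>Q\<^esub> evaluation (\<lambda>a. \<phi> (b \<otimes>\<^bsub>A\<^esub> a)) v"
      using diff unfolding F_mult_diff(2) evaluation_diff[OF \<phi> c] by simp
    also have "\<dots> = p \<otimes>\<^bsub>Q\<^esub> evaluation (\<lambda>a. \<phi> (b \<otimes>\<^bsub>A\<^esub> a)) (u - v)"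
      using diff p evaluation_closed[OF \<psi>, of u] evaluation_closed[OF \<psi>, of v] evaluation_diff[OF \<psi>, of u v]
      by (simp add: a_minus_def Q.r_distr Q.r_minus del: F_simps(1))
    finally show ?case using diff keys_diff_subset[of u S v] by simp
  qed
  then show ?thesis by simp
qed

lemma evaluation_mult_right:
  assumes \<phi>: "\<phi> \<in> functionals" and p: "p \<in> carrier Q" "b \<in> carrier A" and u: "u \<in> carrier F"
  shows "evaluation \<phi> (u \<otimes>\<^bsub>F\<^esub> frag_of (p, b)) = p \<otimes>\<^bsub>Q\<^esub> evaluation (\<lambda>a. \<phi> (a \<otimes>\<^bsub>A\<^esub> b)) u"
proof -
  note \<psi> = functional_translate(2)[OF \<phi> p(2)]
  have "Poly_Mapping.keys u \<subseteq> S" using u by simp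
  then have "u \<in> carrier F \<and> evaluation \<phi> (u \<otimes>\<^bsub>F\<^esub> frag_of (p, b)) = p \<otimes>\<^bsub>Q\<^esub> evaluation (\<lambda>a. \<phi> (a \<otimes>\<^bsub>A\<^esub> b)) u"
  proof (induction u rule: frag_induction)
    case zero then show ?case using \<phi> \<psi> p by (simp add: F_mult_zero evaluation_zero)
  next
    case (one x)
    then obtain q a where x: "x = (q, a)" "q \<in> carrier Q" "a \<in> carrier A" by auto
    have "\<phi> (a \<otimes>\<^bsub>A\<^esub> b) \<in> carrier Q" using \<phi> p x by (auto simp: functionals_def)
    then show ?case using x p \<phi> \<psi> frag_closed[OF x(2,3)]
      by (simp add: evaluation(2)[OF \<phi>] evaluation(2)[OF \<psi>] Q.m_ac)
  next
    case (diff u v)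
    have c: "u \<otimes>\<^bsub>F\<^esub> frag_of (p, b) \<in> carrier F" "v \<otimes>\<^bsub>F\<^esub> frag_of (p, b) \<in> carrier F"
      using diff frag_closed[OF p] by (auto simp del: F_simps(1))
    have "evaluation \<phi> ((u - v) \<otimes>\<^bsub>F\<^esub> frag_of (p, b)) =
        p \<otimes>\<^bsub>Q\<^esub> evaluation (\<lambda>a. \<phi> (a \<otimes>\<^bsub>A\<^esub> b)) u \<ominus>\<^bsub>Q\<^esub> p \<otimes>\<^bsub>Q\<^esub> evaluation (\<lambda>a. \<phi> (a \<otimes>\<^bsub>A\<^esub> b)) v"
      using diff unfolding F_mult_diff(1) evaluation_diff[OF \<phi> c] by simp
    also have "\<dots> = p \<otimes>\<^bsub>Q\<^esub> evaluation (\<lambda>a. \<phi> (a \<otimes>\<^bsub>A\<^esub> b)) (u - v)"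
      using diff p evaluation_closed[OF \<psi>, of u] evaluation_closed[OF \<psi>, of v] evaluation_diff[OF \<psi>, of u v]
      by (simp add: a_minus_def Q.r_distr Q.r_minus del: F_simps(1))
    finally show ?case using diff keys_diff_subset[of u S v] by simp
  qed
  then show ?thesis by simp
qed

text \<open>The ideal is generated as a two-sided ideal, so vanishing on the relations for a single
  \<phi> would not suffice. The common kernel of all functionals is an ideal, because translating
  \<phi> by an element of A on either side gives a functional again.\<close>

lemma evaluation_tensor_ideal:
  assumes "u \<in> I" "\<phi> \<in> functionals"
  shows "evaluation \<phi> u = \<zero>\<^bsub>Q\<^esub>"
proof -
  define J where "J = {u \<in> carrier F. \<forall>\<phi>\<in>functionals. evaluation \<phi> u = \<zero>\<^bsub>Q\<^esub>}"
  have Jd: "u - v \<in> J" if "u \<in> J" "v \<in> J" for u v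
    using that keys_diff_subset[of u S v] by (auto simp: J_def evaluation_diff a_minus_def Q.r_neg)
  have J0: "0 \<in> J" by (auto simp: J_def evaluation_zero)
  have "ideal J F"
  proof (rule idealI[OF ring_F])
    show "subgroup J (add_monoid F)"
    proof (rule F.add.subgroupI)
      show "J \<subseteq> carrier F" "J \<noteq> {}" using J0 by (auto simp: J_def)
      fix u assume u: "u \<in> J"
      then show "\<ominus>\<^bsub>F\<^esub> u \<in> J" using Jd[OF J0 u] F_minus[of u] by (simp add: J_def)
      fix v assume v: "v \<in> J"
      show "u \<oplus>\<^bsub>F\<^esub> v \<in> J" using Jd[OF u Jd[OF J0 v]] by simp
    qed
    fix u w assume u: "u \<in> J" and w: "w \<in> carrier F"
    have uF: "u \<in> carrier F" and uz: "\<And>\<phi>. \<phi> \<in> functionals \<Longrightarrow> evaluation \<phi> u = \<zero>\<^bsub>Q\<^esub>" using u by (auto simp: J_def)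
    have "Poly_Mapping.keys w \<subseteq> S" using w by simp
    then have "w \<otimes>\<^bsub>F\<^esub> u \<in> J \<and> u \<otimes>\<^bsub>F\<^esub> w \<in> J"
    proof (induction w rule: frag_induction)
      case zero show ?case using J0 by (simp add: F_mult_zero)
    next
      case (one x)
      then obtain q a where x: "x = (q, a)" "q \<in> carrier Q" "a \<in> carrier A" by auto
      then show ?case
        using F.m_closed[OF frag_closed[OF x(2,3)] uF] F.m_closed[OF uF frag_closed[OF x(2,3)]]
        unfolding J_def
        by (auto simp: evaluation_mult_left[OF _ x(2,3) uF] evaluation_mult_right[OF _ x(2,3) uF]
            uz functional_translate simp del: F_simps(1))
    next
      case (diff w w') then show ?case using Jd by (simp add: F_mult_diff)
    qed
    then show "w \<otimes>\<^bsub>F\<^esub> u \<in> J" "u \<otimes>\<^bsub>F\<^esub> w \<in> J" by auto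
  qed
  moreover have "tensor_relations K Q A \<subseteq> J"
  proof
    fix r assume r: "r \<in> tensor_relations K Q A"
    have rF: "r \<in> carrier F" using relations_closed r by blast
    have "evaluation \<phi> r = \<zero>\<^bsub>Q\<^esub>" if \<phi>: "\<phi> \<in> functionals" for \<phi>
    proof -
      have \<phi>c: "\<And>a. a \<in> carrier A \<Longrightarrow> \<phi> a \<in> carrier Q" using \<phi> by (simp add: functionals_def)
      have d: "x - y \<in> carrier F" if "x \<in> carrier F" "y \<in> carrier F" for x y
        using that F_diff_closed by blast
      consider q q' a where "r = frag_of (q \<oplus>\<^bsub>Q\<^esub> q', a) - frag_of (q, a) - frag_of (q', a)"
          "q \<in> carrier Q" "q' \<in> carrier Q" "a \<in> carrier A"
        | q a a' where "r = frag_of (q, a \<oplus>\<^bsub>A\<^esub> a') - frag_of (q, a) - frag_of (q, a')"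
          "q \<in> carrier Q" "a \<in> carrier A" "a' \<in> carrier A"
        | c q a where "r = frag_of (c \<odot>\<^bsub>Q\<^esub> q, a) - frag_of (q, c \<odot>\<^bsub>A\<^esub> a)"
          "c \<in> carrier K" "q \<in> carrier Q" "a \<in> carrier A"
        using r unfolding tensor_relations_def by blast
      then show ?thesis
      proof cases
        case 1
        then show ?thesis using \<phi>c
          by (simp add: evaluation_diff[OF \<phi>] evaluation(2)[OF \<phi>] d frag_closed Q.l_distr a_minus_def Q.minus_add
              Q.a_ac Q.r_neg Q.r_neg1 Q.r_neg2 del: F_simps(1))
      next
        case 2
        then have "\<phi> (a \<oplus>\<^bsub>A\<^esub> a') = \<phi> a \<oplus>\<^bsub>Q\<^esub> \<phi> a'" using \<phi> by (simp add: functionals_def)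
        then show ?thesis using 2 \<phi>c
          by (simp add: evaluation_diff[OF \<phi>] evaluation(2)[OF \<phi>] d frag_closed Q.r_distr a_minus_def Q.minus_add
              Q.a_ac Q.r_neg Q.r_neg1 Q.r_neg2 del: F_simps(1))
      next
        case 3
        then have "\<phi> (c \<odot>\<^bsub>A\<^esub> a) = c \<odot>\<^bsub>Q\<^esub> \<phi> a" using \<phi> by (simp add: functionals_def)
        moreover have "q \<otimes>\<^bsub>Q\<^esub> (c \<odot>\<^bsub>Q\<^esub> \<phi> a) = (c \<odot>\<^bsub>Q\<^esub> q) \<otimes>\<^bsub>Q\<^esub> \<phi> a"
          using 3 \<phi>c[of a] Q.smult_assoc2[of c "\<phi> a" q] Q.smult_assoc2[of c q "\<phi> a"]
            Q.m_comm[of q "c \<odot>\<^bsub>Q\<^esub> \<phi> a"] Q.m_comm[of "\<phi> a" q] by simp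
        ultimately show ?thesis using 3 \<phi>c
          by (simp add: evaluation_diff[OF \<phi>] evaluation(2)[OF \<phi>] frag_closed a_minus_def Q.r_neg del: F_simps(1))
      qed
    qed
    then show "r \<in> J" using rF by (simp add: J_def)
  qed
  ultimately have "I \<subseteq> J" unfolding tensor_ideal_def by (rule F.genideal_minimal)
  then show ?thesis using assms by (auto simp: J_def)
qed

text \<open>This yields the map id \<otimes> \<phi> on T: the value is computed on a representative,
  and two representatives differ by an element of the ideal, on which the evaluation
  vanishes.\<close>

theorem functional_extends:
  assumes \<phi>: "\<phi> \<in> functionals"
  obtains H where "\<And>X. X \<in> carrier T \<Longrightarrow> H X \<in> carrier Q"
    "\<And>X Y. X \<in> carrier T \<Longrightarrow> Y \<in> carrier T \<Longrightarrow> H (X \<oplus>\<^bsub>T\<^esub> Y) = H X \<oplus>\<^bsub>Q\<^esub> H Y"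
    "\<And>q X. q \<in> carrier Q \<Longrightarrow> X \<in> carrier T \<Longrightarrow> H (q \<odot>\<^bsub>T\<^esub> X) = q \<otimes>\<^bsub>Q\<^esub> H X"
    "\<And>a. a \<in> carrier A \<Longrightarrow> H (embed a) = \<phi> a"
proof -
  define H where "H X = evaluation \<phi> (SOME u. u \<in> carrier F \<and> X = proj u)" for X
  have H: "H (proj u) = evaluation \<phi> u" if u: "u \<in> carrier F" for u
  proof -
    define v where "v = (SOME v. v \<in> carrier F \<and> proj u = proj v)"
    have v: "v \<in> carrier F \<and> proj u = proj v" 
      unfolding v_def by (rule someI[of "\<lambda>v. v \<in> carrier F \<and> proj u = proj v" u]) (rule conjI[OF u refl])
    then have "evaluation \<phi> (u - v) = \<zero>\<^bsub>Q\<^esub>" using proj_eqD[OF u] evaluation_tensor_ideal[OF _ \<phi>] by blast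
    then have "evaluation \<phi> u \<ominus>\<^bsub>Q\<^esub> evaluation \<phi> v = \<zero>\<^bsub>Q\<^esub>"
      using evaluation_diff[OF \<phi> u, of v] v by simp
    then have "evaluation \<phi> u = evaluation \<phi> v"
      using v evaluation_closed[OF \<phi> u] evaluation_closed[OF \<phi>, of v] by simp
    then show ?thesis by (simp add: H_def v_def)
  qed
  show ?thesis
  proof
    fix X assume "X \<in> carrier T"
    then obtain u where u: "u \<in> carrier F" "X = proj u" using T_carrier by blast
    show "H X \<in> carrier Q" unfolding u(2) H[OF u(1)] by (rule evaluation_closed[OF \<phi> u(1)])
    show "H (q \<odot>\<^bsub>T\<^esub> X) = q \<otimes>\<^bsub>Q\<^esub> H X" if q: "q \<in> carrier Q" for q
    proof -
      note f = frag_closed[OF q A.A.one_closed]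
      have "q \<odot>\<^bsub>T\<^esub> X = proj (frag_of (q, \<one>\<^bsub>A\<^esub>) \<otimes>\<^bsub>F\<^esub> u)"
        unfolding T_simps(6) u(2) by (rule proj_simps(2)[OF f u(1), symmetric])
      then have "H (q \<odot>\<^bsub>T\<^esub> X) = q \<otimes>\<^bsub>Q\<^esub> evaluation (\<lambda>a. \<phi> (\<one>\<^bsub>A\<^esub> \<otimes>\<^bsub>A\<^esub> a)) u"
        using H[OF F.m_closed[OF f u(1)]] evaluation_mult_left[OF \<phi> q A.A.one_closed u(1)] by simp
      \<comment> \<open>The two functionals agree on the carrier but need not be equal as functions,
        so their evaluations are compared by induction on u.\<close>
      also have "evaluation (\<lambda>a. \<phi> (\<one>\<^bsub>A\<^esub> \<otimes>\<^bsub>A\<^esub> a)) u = evaluation \<phi> u"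
      proof -
        note \<psi> = functional_translate(1)[OF \<phi> A.A.one_closed]
        have "Poly_Mapping.keys u \<subseteq> S" using u by simp
        then have "u \<in> carrier F \<and> evaluation (\<lambda>a. \<phi> (\<one>\<^bsub>A\<^esub> \<otimes>\<^bsub>A\<^esub> a)) u = evaluation \<phi> u"
        proof (induction u rule: frag_induction)
          case zero then show ?case using \<phi> \<psi> by (simp add: evaluation_zero)
        next
          case (one x)
          then show ?case using evaluation(2)[OF \<phi>] evaluation(2)[OF \<psi>] by (cases x) (auto simp: keys_frag_of)
        next
          case (diff u v)
          then show ?case using keys_diff_subset[of u S v] evaluation_diff[OF \<phi>, of u v] evaluation_diff[OF \<psi>, of u v] by simp
        qed
        then show ?thesis ..
      qed
      finally show ?thesis unfolding u(2) H[OF u(1)] .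
    qed
    fix Y assume "Y \<in> carrier T"
    then obtain v where v: "v \<in> carrier F" "Y = proj v" using T_carrier by blast
    have uv: "u + v \<in> carrier F" using F.a_closed[OF u(1) v(1)] by simp
    show "H (X \<oplus>\<^bsub>T\<^esub> Y) = H X \<oplus>\<^bsub>Q\<^esub> H Y"
      unfolding u(2) v(2) proj_simps(3)[OF u(1) v(1), symmetric] H[OF uv] H[OF u(1)] H[OF v(1)]
      by (rule evaluation_add[OF \<phi> u(1) v(1)])
  next
    fix a assume a: "a \<in> carrier A"
    then show "H (embed a) = \<phi> a"
      using H[OF frag_closed[OF Q.one_closed a]] evaluation(2)[OF \<phi> Q.one_closed a] \<phi>
      by (simp add: embed_def functionals_def)
  qed
qed

end


section \<open>The bound for commuting elements\<close>

context base_change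
begin

text \<open>Guarantees that the choice operator in \<open>filter_dim\<close> and
  \<open>left_filter_dim\<close> returns an actual generating set.\<close>

lemma image_finite_generators:
  assumes S: "finite_generators K A S"
  shows "finite_generators Q T (\<iota> ` S)"
proof -
  have SA: "S \<subseteq> carrier A" "finite S" using S by (auto simp: finite_generators_def)
  then have c: "\<iota> ` S \<subseteq> carrier T" by auto
  have "carrier T \<subseteq> B" if B: "is_subalgebra Q T B" "\<iota> ` S \<subseteq> B" for B
  proof -
    have sr: "subring B T" using B by (simp add: is_subalgebra_def)
    note sub = T.subalgebra_submodule[OF B(1)]
    have "A.filt S i \<subseteq> {a \<in> carrier A. \<iota> a \<in> B}" for i
    proof (rule A.filt_induct[OF SA(1)])
      show "submodule K {a \<in> carrier A. \<iota> a \<in> B} A" by (rule preimage_submodule[OF sub])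
      show "\<one>\<^bsub>A\<^esub> \<in> {a \<in> carrier A. \<iota> a \<in> B}" using subringE(3)[OF sr] by simp
      fix x y assume x: "x \<in> {a \<in> carrier A. \<iota> a \<in> B}" and y: "y \<in> insert \<one>\<^bsub>A\<^esub> S"
      have "y \<in> carrier A" "\<iota> y \<in> B" using y B(2) SA subringE(3)[OF sr] by auto
      then show "x \<otimes>\<^bsub>A\<^esub> y \<in> {a \<in> carrier A. \<iota> a \<in> B}"
        using subringE(6)[OF sr, of "\<iota> x" "\<iota> y"] x by simp
    qed
    moreover have "(\<Union>i. A.filt S i) = carrier A"
      using S A.gen_subalgebra_eq_Union_filt[OF SA(1)] by (simp add: finite_generators_def)
    ultimately have "\<iota> ` carrier A \<subseteq> B" by blast
    then show ?thesis unfolding span_iota[symmetric] by (rule T.span_subset_submodule[OF sub])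
  qed
  moreover have "is_subalgebra Q T (carrier T)"
    using T.A.carrier_is_subring by (simp add: is_subalgebra_def)
  ultimately have "gen_subalgebra Q T (\<iota> ` S) = carrier T"
    using c unfolding gen_subalgebra_def by blast
  then show ?thesis using c SA by (simp add: finite_generators_def)
qed

end

context commuting_variables
begin

theorem commuting_variables_bound:
  assumes central: "central_simple K A" and S: "finite_generators K A S"
    and g: "growth (A.dim_filt S) = ereal g"
  shows "real (length cs) \<le> g"
    and "filter_dim Q (scalar_extension K Q A) \<le> F \<or> left_filter_dim Q (scalar_extension K Q A) \<le> F \<Longrightarrow>
      ereal (length cs) \<le> ereal g * (1 - 1 / (F + max F 1))"
proof -
  interpret E: scalars K A Q ..
  obtain \<phi> where \<phi>: "\<And>b. b \<in> carrier A \<Longrightarrow> \<phi> b \<in> carrier Q"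
    "\<And>b b'. b \<in> carrier A \<Longrightarrow> b' \<in> carrier A \<Longrightarrow> \<phi> (b \<oplus>\<^bsub>A\<^esub> b') = \<phi> b \<oplus>\<^bsub>Q\<^esub> \<phi> b'"
    "\<And>k b. k \<in> carrier K \<Longrightarrow> b \<in> carrier A \<Longrightarrow> \<phi> (k \<odot>\<^bsub>A\<^esub> b) = k \<odot>\<^bsub>Q\<^esub> \<phi> b"
    "\<phi> \<one>\<^bsub>A\<^esub> = \<one>\<^bsub>Q\<^esub>"
    "\<And>b l. b \<in> carrier A \<Longrightarrow> l < length cs \<Longrightarrow> \<phi> (b \<otimes>\<^bsub>A\<^esub> cs ! l) = \<phi> b \<otimes>\<^bsub>Q\<^esub> xs ! l"
    by (rule compatible_functional) (rule that)
  have "\<phi> \<in> E.functionals" using \<phi> by (simp add: E.functionals_def)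
  then obtain H where H: "\<And>X. X \<in> carrier E.T \<Longrightarrow> H X \<in> carrier Q"
    "\<And>X Y. X \<in> carrier E.T \<Longrightarrow> Y \<in> carrier E.T \<Longrightarrow> H (X \<oplus>\<^bsub>E.T\<^esub> Y) = H X \<oplus>\<^bsub>Q\<^esub> H Y"
    "\<And>q X. q \<in> carrier Q \<Longrightarrow> X \<in> carrier E.T \<Longrightarrow> H (q \<odot>\<^bsub>E.T\<^esub> X) = q \<otimes>\<^bsub>Q\<^esub> H X"
    "\<And>a. a \<in> carrier A \<Longrightarrow> H (E.embed a) = \<phi> a"
    by (rule E.functional_extends) (rule that)
  have emb: "E.embed \<one>\<^bsub>A\<^esub> = \<one>\<^bsub>E.T\<^esub>" using E.embed_hom by (simp add: ring_hom_def)
  \<comment> \<open>This value shows that T is non-zero and, further below, that N is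
    proper.\<close>
  have H1: "H \<one>\<^bsub>E.T\<^esub> = \<one>\<^bsub>Q\<^esub>" using H(4)[of "\<one>\<^bsub>A\<^esub>"] \<phi>(4) emb by simp
  have H0: "H \<zero>\<^bsub>E.T\<^esub> = \<zero>\<^bsub>Q\<^esub>" using H(3)[of "\<zero>\<^bsub>Q\<^esub>" "\<zero>\<^bsub>E.T\<^esub>"] H(1)[of "\<zero>\<^bsub>E.T\<^esub>"] E.T.smult_r_null[of "\<zero>\<^bsub>Q\<^esub>"] by simp
  have "base_change_axioms K A Q E.T E.embed"
  proof
    show "E.embed \<in> ring_hom A E.T" by (rule E.embed_hom)
    show "E.embed (k \<odot>\<^bsub>A\<^esub> a) = (k \<odot>\<^bsub>Q\<^esub> \<one>\<^bsub>Q\<^esub>) \<odot>\<^bsub>E.T\<^esub> E.embed a" if "k \<in> carrier K" "a \<in> carrier A" for k a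
      using that E.smult_embed[of "k \<odot>\<^bsub>Q\<^esub> \<one>\<^bsub>Q\<^esub>" a] E.tens_balanced[OF that(1) Q.one_closed that(2)]
      by (simp add: E.embed_def)
    show "\<one>\<^bsub>E.T\<^esub> \<noteq> \<zero>\<^bsub>E.T\<^esub>" using H0 H1 QF.one_not_zero by auto
  qed (rule E.span_embed, rule central)
  then interpret B: base_change K A Q E.T E.embed
    by (intro base_change.intro A.assoc_algebra_axioms Q.algebra_axioms QF.field_axioms E.T_assoc_algebra)
  have sub: "submodule Q {X \<in> carrier E.T. H (Y \<otimes>\<^bsub>E.T\<^esub> X) = \<zero>\<^bsub>Q\<^esub>} E.T" if "Y \<in> carrier E.T" for Y
    using that
    by (intro submodule.intro[OF E.T.module_axioms])
      (auto simp: H H0 E.TR.r_distr E.T.smult_right)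
  have subr: "submodule Q {Y \<in> carrier E.T. H (Y \<otimes>\<^bsub>E.T\<^esub> X) = \<zero>\<^bsub>Q\<^esub>} E.T" if "X \<in> carrier E.T" for X
    using that
    by (intro submodule.intro[OF E.T.module_axioms])
      (auto simp: H H0 E.TR.l_distr E.T.smult_left)
  \<comment> \<open>The largest left ideal contained in the kernel of H.\<close>
  define N where "N = (\<Inter>Y\<in>carrier E.T. {X \<in> carrier E.T. H (Y \<otimes>\<^bsub>E.T\<^esub> X) = \<zero>\<^bsub>Q\<^esub>})"
  have NI: "X \<in> N" if "X \<in> carrier E.T" "\<And>Y. Y \<in> carrier E.T \<Longrightarrow> H (Y \<otimes>\<^bsub>E.T\<^esub> X) = \<zero>\<^bsub>Q\<^esub>" for X
    using that by (simp add: N_def)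
  have ND: "X \<in> carrier E.T" "Y \<in> carrier E.T \<Longrightarrow> H (Y \<otimes>\<^bsub>E.T\<^esub> X) = \<zero>\<^bsub>Q\<^esub>" if "X \<in> N" for X Y
    using that E.TR.one_closed by (auto simp: N_def)
  \<comment> \<open>Literally the choice made in \<open>filter_dim\<close> and
    \<open>left_filter_dim\<close>, so that their return functions are those of
    \<open>ST\<close>.\<close>
  define ST where "ST = (SOME ST. finite_generators Q E.T ST)"
  have ST: "finite_generators Q E.T ST"
    unfolding ST_def by (rule someI) (rule B.image_finite_generators[OF S])
  have "base_change_module_axioms K A Q E.T E.embed S ST N cs xs"
  proof (rule base_change_module_axioms.intro)
    show "submodule Q N E.T" unfolding N_def using E.TR.one_closed by (intro E.T.submodule_INT sub) auto
    fix t n assume t: "t \<in> carrier E.T" and n: "n \<in> N"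
    have nc: "n \<in> carrier E.T" using ND(1)[OF n] .
    have tn: "t \<otimes>\<^bsub>E.T\<^esub> n \<in> carrier E.T" using t nc by (rule E.TR.m_closed)
    have "H (Y \<otimes>\<^bsub>E.T\<^esub> (t \<otimes>\<^bsub>E.T\<^esub> n)) = \<zero>\<^bsub>Q\<^esub>" if Y: "Y \<in> carrier E.T" for Y
      using ND(2)[OF n E.TR.m_closed[OF Y t]] E.TR.m_assoc[OF Y t nc] by simp
    then show "t \<otimes>\<^bsub>E.T\<^esub> n \<in> N" by (rule NI[OF tn])
  next
    show "\<one>\<^bsub>E.T\<^esub> \<notin> N"
    proof
      assume "\<one>\<^bsub>E.T\<^esub> \<in> N"
      then have "H (\<one>\<^bsub>E.T\<^esub> \<otimes>\<^bsub>E.T\<^esub> \<one>\<^bsub>E.T\<^esub>) = \<zero>\<^bsub>Q\<^esub>" using ND(2) E.TR.one_closed by blast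
      then show False using H1 QF.one_not_zero by simp
    qed
    show "list_all2 (\<lambda>c x. E.embed c \<ominus>\<^bsub>E.T\<^esub> x \<odot>\<^bsub>E.T\<^esub> \<one>\<^bsub>E.T\<^esub> \<in> N) cs xs"
      unfolding list_all2_conv_all_nth
    proof (intro conjI allI impI)
      fix l assume l: "l < length cs"
      have c: "cs ! l \<in> carrier A" "xs ! l \<in> carrier Q" using l cs xs len by auto
      \<comment> \<open>For a in A, H(a Z) = \<phi>(a c_l) - x_l \<phi>(a) = 0. The condition is
        Q-linear in the left factor, so it extends from the image of A to all of T.\<close>
      define Z where "Z = E.embed (cs ! l) \<oplus>\<^bsub>E.T\<^esub> (\<ominus>\<^bsub>Q\<^esub> xs ! l) \<odot>\<^bsub>E.T\<^esub> \<one>\<^bsub>E.T\<^esub>"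
      have Z: "Z \<in> carrier E.T" using c by (simp add: Z_def)
      have "E.embed ` carrier A \<subseteq> {Y \<in> carrier E.T. H (Y \<otimes>\<^bsub>E.T\<^esub> Z) = \<zero>\<^bsub>Q\<^esub>}"
      proof
        fix Y assume "Y \<in> E.embed ` carrier A"
        then obtain a where a: "a \<in> carrier A" "Y = E.embed a" by auto
        have "Y \<otimes>\<^bsub>E.T\<^esub> Z = E.embed (a \<otimes>\<^bsub>A\<^esub> cs ! l) \<oplus>\<^bsub>E.T\<^esub> (\<ominus>\<^bsub>Q\<^esub> xs ! l) \<odot>\<^bsub>E.T\<^esub> E.embed a"
          using a c by (simp add: Z_def E.TR.r_distr E.T.smult_right)
        moreover have e: "E.embed a \<in> carrier E.T" "E.embed (a \<otimes>\<^bsub>A\<^esub> cs ! l) \<in> carrier E.T"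
          "\<ominus>\<^bsub>Q\<^esub> xs ! l \<in> carrier Q" "a \<otimes>\<^bsub>A\<^esub> cs ! l \<in> carrier A"
          using a c E.embed_closed by auto
        ultimately have "H (Y \<otimes>\<^bsub>E.T\<^esub> Z) = \<phi> a \<otimes>\<^bsub>Q\<^esub> xs ! l \<oplus>\<^bsub>Q\<^esub> (\<ominus>\<^bsub>Q\<^esub> xs ! l) \<otimes>\<^bsub>Q\<^esub> \<phi> a"
          using H(2)[OF e(2) E.T.smult_closed[OF e(3,1)]] H(3)[OF e(3,1)] H(4)[OF e(4)] H(4)[OF a(1)] \<phi>(5)[OF a(1) l]
          by (simp only:)
        then show "Y \<in> {Y \<in> carrier E.T. H (Y \<otimes>\<^bsub>E.T\<^esub> Z) = \<zero>\<^bsub>Q\<^esub>}"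
          using a c \<phi>(1)[OF a(1)] E.embed_closed by (simp add: Q.l_minus Q.r_minus Q.m_comm Q.r_neg)
      qed
      then have "carrier E.T \<subseteq> {Y \<in> carrier E.T. H (Y \<otimes>\<^bsub>E.T\<^esub> Z) = \<zero>\<^bsub>Q\<^esub>}"
        unfolding E.span_embed[symmetric] by (rule E.T.span_subset_submodule[OF subr[OF Z, folded E.span_embed]])
      then have "Z \<in> N" using Z by (intro NI) auto
      then show "E.embed (cs ! l) \<ominus>\<^bsub>E.T\<^esub> xs ! l \<odot>\<^bsub>E.T\<^esub> \<one>\<^bsub>E.T\<^esub> \<in> N"
        using c by (simp add: Z_def a_minus_def E.T.smult_l_minus)
    qed (simp add: len)
  qed (fact S ST cs xs_indep)+
  then interpret M: base_change_module K A Q E.T E.embed S ST N cs xs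
    by (intro base_change_module.intro B.base_change_axioms)
  show "real (length cs) \<le> g" by (rule M.length_bound(1)[OF g]) blast
  show "ereal (length cs) \<le> ereal g * (1 - 1 / (F + max F 1))"
    if "filter_dim Q E.T \<le> F \<or> left_filter_dim Q E.T \<le> F"
    using that
  proof
    assume "filter_dim Q E.T \<le> F"
    then have "growth (return_fun Q E.T ST) \<le> F" by (simp add: filter_dim_def ST_def)
    then show ?thesis using M.length_bound(2)[OF g] by blast
  next
    assume "left_filter_dim Q E.T \<le> F"
    then have "growth (left_return_fun Q E.T ST) \<le> F" by (simp add: left_filter_dim_def ST_def)
    then show ?thesis using M.length_bound(2)[OF g] by blast
  qed
qed

end


section \<open>Exponents and the degree-lexicographic order\<close>

abbreviation add_exp (infixl \<open>+\<^sub>e\<close> 65) where "\<alpha> +\<^sub>e \<beta> \<equiv> map2 (+) \<alpha> (\<beta> :: nat list)"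

fun lex_less :: "nat list \<Rightarrow> nat list \<Rightarrow> bool" where
  "lex_less (a # \<alpha>) (b # \<beta>) \<longleftrightarrow> a < b \<or> a = b \<and> lex_less \<alpha> \<beta>"
| "lex_less _ _ \<longleftrightarrow> False"

definition deglex (infix \<open>\<prec>\<^sub>e\<close> 50) where
  "\<alpha> \<prec>\<^sub>e \<beta> \<longleftrightarrow> lex_less (sum_list \<alpha> # \<alpha>) (sum_list \<beta> # \<beta>)"

lemma lex_less_irrefl: "\<not> lex_less \<alpha> \<alpha>"
  by (induction \<alpha>) auto

lemma lex_less_trans: "lex_less \<alpha> \<beta> \<Longrightarrow> lex_less \<beta> \<gamma> \<Longrightarrow> lex_less \<alpha> \<gamma>"
proof (induction \<alpha> \<beta> arbitrary: \<gamma> rule: lex_less.induct)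
  case (1 a \<alpha> b \<beta>) then show ?case by (cases \<gamma>) auto
qed auto

lemma lex_less_total: "length \<alpha> = length \<beta> \<Longrightarrow> lex_less \<alpha> \<beta> \<or> \<alpha> = \<beta> \<or> lex_less \<beta> \<alpha>"
  by (induction \<alpha> \<beta> rule: list_induct2) auto

lemma lex_less_add:
  "length \<alpha> = length \<beta> \<Longrightarrow> length \<gamma> = length \<beta> \<Longrightarrow> lex_less (\<alpha> +\<^sub>e \<gamma>) (\<beta> +\<^sub>e \<gamma>) \<longleftrightarrow> lex_less \<alpha> \<beta>"
proof (induction \<alpha> \<beta> arbitrary: \<gamma> rule: list_induct2)
  case (Cons x xs y ys) then show ?case by (cases \<gamma>) auto
qed simp

lemma sum_list_add_exp: "length \<alpha> = length \<beta> \<Longrightarrow> sum_list (\<alpha> +\<^sub>e \<beta>) = sum_list \<alpha> + sum_list \<beta>"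
  by (induction \<alpha> \<beta> rule: list_induct2) auto

lemma deglex_irrefl: "\<not> \<alpha> \<prec>\<^sub>e \<alpha>"
  by (simp add: deglex_def lex_less_irrefl)

lemma deglex_trans: "\<alpha> \<prec>\<^sub>e \<beta> \<Longrightarrow> \<beta> \<prec>\<^sub>e \<gamma> \<Longrightarrow> \<alpha> \<prec>\<^sub>e \<gamma>"
  unfolding deglex_def by (rule lex_less_trans)

lemma deglex_total: "length \<alpha> = length \<beta> \<Longrightarrow> \<alpha> \<prec>\<^sub>e \<beta> \<or> \<alpha> = \<beta> \<or> \<beta> \<prec>\<^sub>e \<alpha>"
  using lex_less_total[of "sum_list \<alpha> # \<alpha>" "sum_list \<beta> # \<beta>"] by (auto simp: deglex_def)

lemma deglex_add:
  assumes "length \<alpha> = length \<beta>" "length \<gamma> = length \<beta>" "\<alpha> \<prec>\<^sub>e \<beta>"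
  shows "\<alpha> +\<^sub>e \<gamma> \<prec>\<^sub>e \<beta> +\<^sub>e \<gamma>"
  using assms by (auto simp: deglex_def sum_list_add_exp lex_less_add)

text \<open>The reason for comparing degrees first: an exponent has only finitely many predecessors
  of its length, and reductions to smaller monomials do not raise the degree.\<close>

lemma deglex_sum_le: "\<alpha> \<prec>\<^sub>e \<beta> \<Longrightarrow> sum_list \<alpha> \<le> sum_list \<beta>"
  by (auto simp: deglex_def)

lemma deglex_max:
  assumes "finite X" "X \<noteq> {}" "X \<subseteq> {\<alpha>. length \<alpha> = m}"
  shows "\<exists>\<alpha>\<in>X. \<forall>\<beta>\<in>X. \<beta> \<noteq> \<alpha> \<longrightarrow> \<beta> \<prec>\<^sub>e \<alpha>"
  using assms
proof (induction X rule: finite_ne_induct)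
  case (insert \<gamma> X)
  then obtain \<alpha> where \<alpha>: "\<alpha> \<in> X" "\<forall>\<beta>\<in>X. \<beta> \<noteq> \<alpha> \<longrightarrow> \<beta> \<prec>\<^sub>e \<alpha>" by auto
  have "\<gamma> \<prec>\<^sub>e \<alpha> \<or> \<gamma> = \<alpha> \<or> \<alpha> \<prec>\<^sub>e \<gamma>" using insert.prems \<alpha>(1) by (intro deglex_total) auto
  then show ?case using \<alpha> deglex_trans by (metis insert_iff)
qed auto

lemma finite_exponents: "finite {\<alpha>. length \<alpha> = m \<and> sum_list \<alpha> \<le> (i::nat)}"
proof (rule finite_subset)
  show "{\<alpha>. length \<alpha> = m \<and> sum_list \<alpha> \<le> i} \<subseteq> {\<alpha>. set \<alpha> \<subseteq> {..i} \<and> length \<alpha> = m}"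
    using member_le_sum_list by fastforce
qed (simp add: finite_lists_length_eq)

text \<open>Lengths are immaterial here, because \<open>zip\<close> truncates both lists
  alike.\<close>

lemma add_exp_commute: "\<alpha> +\<^sub>e \<beta> = \<beta> +\<^sub>e \<alpha>"
  by (simp add: zip_commute[of \<alpha> \<beta>] case_prod_unfold add.commute comp_def)

lemma add_exp_assoc: "(\<alpha> +\<^sub>e \<beta>) +\<^sub>e \<gamma> = \<alpha> +\<^sub>e (\<beta> +\<^sub>e \<gamma>)"
  by (rule nth_equalityI) auto

lemma add_exp_zero: "length \<alpha> = m \<Longrightarrow> replicate m 0 +\<^sub>e \<alpha> = \<alpha>"
  by (rule nth_equalityI) auto

section \<open>Polynomials and rational functions\<close>

locale mpoly = field K for K :: "('k, 'x) ring_scheme" (structure) + fixes m :: nat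
begin

abbreviation "P \<equiv> mpoly_algebra K m"
abbreviation "L \<equiv> {\<alpha> :: nat list. length \<alpha> = m}"
definition supp where "supp p = {\<alpha> :: nat list. p \<alpha> \<noteq> \<zero>}"
definition mon :: "nat list \<Rightarrow> nat list \<Rightarrow> 'k" where "mon \<alpha> \<beta> = (if \<beta> = \<alpha> then \<one> else \<zero>)"

lemma P_carrier: "p \<in> carrier P \<longleftrightarrow> (\<forall>\<alpha>. p \<alpha> \<in> carrier K) \<and> finite (supp p) \<and> supp p \<subseteq> L"
  by (simp add: mpoly_algebra_def supp_def)

lemma P_simps [simp]:
  "\<one>\<^bsub>P\<^esub> = mon (replicate m 0)" "\<zero>\<^bsub>P\<^esub> = (\<lambda>_. \<zero>)" "p \<oplus>\<^bsub>P\<^esub> q = (\<lambda>\<alpha>. p \<alpha> \<oplus> q \<alpha>)"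
  "c \<odot>\<^bsub>P\<^esub> p = (\<lambda>\<alpha>. c \<otimes> p \<alpha>)"
  by (auto simp: mpoly_algebra_def mon_def)

lemma P_coeff: "p \<in> carrier P \<Longrightarrow> p \<alpha> \<in> carrier K"
  by (simp add: P_carrier)

lemma P_supp: "p \<in> carrier P \<Longrightarrow> finite (supp p)" "p \<in> carrier P \<Longrightarrow> supp p \<subseteq> L"
  by (auto simp: P_carrier)

lemma add_image_L:
  assumes "X \<subseteq> L" "Y \<subseteq> L"
  shows "(\<lambda>(\<alpha>, \<beta>). \<alpha> +\<^sub>e \<beta>) ` (X \<times> Y) \<subseteq> L"
proof clarify
  fix \<alpha> \<beta> assume "\<alpha> \<in> X" "\<beta> \<in> Y"
  then have "\<alpha> \<in> L" "\<beta> \<in> L" using assms by blast+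
  then show "length (\<alpha> +\<^sub>e \<beta>) = m" by simp
qed

lemma P_carrierI:
  assumes "\<And>\<alpha>. p \<alpha> \<in> carrier K" "finite U" "U \<subseteq> L" "\<And>\<alpha>. \<alpha> \<notin> U \<Longrightarrow> p \<alpha> = \<zero>"
  shows "p \<in> carrier P"
proof -
  have "supp p \<subseteq> U" using assms(4) by (auto simp: supp_def)
  then show ?thesis using assms finite_subset by (auto simp: P_carrier)
qed

text \<open>The kernel \<open>ind\<close> turns the product into an unrestricted double sum.\<close>

definition ind :: "nat list \<Rightarrow> nat list \<Rightarrow> 'k" where "ind \<alpha> \<gamma> = (if \<alpha> = \<gamma> then \<one> else \<zero>)"

lemma ind_closed [simp]: "ind \<alpha> \<gamma> \<in> carrier K"
  by (simp add: ind_def)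

text \<open>The defining sum ranges over pairs with prescribed sum \<gamma>; here the index sets are
  independent of \<gamma>, so that sums can be interchanged. U and V may be larger than the
  supports, which is needed when p or q is itself a sum or product.\<close>

lemma mult_expand:
  assumes p: "p \<in> carrier P" and q: "q \<in> carrier P"
    and U: "finite U" "supp p \<subseteq> U" "U \<subseteq> L" and V: "finite V" "supp q \<subseteq> V" "V \<subseteq> L"
  shows "(p \<otimes>\<^bsub>P\<^esub> q) \<gamma> = (\<Oplus>\<alpha>\<in>U. \<Oplus>\<beta>\<in>V. p \<alpha> \<otimes> q \<beta> \<otimes> ind (\<alpha> +\<^sub>e \<beta>) \<gamma>)"
proof -
  let ?f = "\<lambda>(\<alpha>, \<beta>). p \<alpha> \<otimes> q \<beta>"
  define D where "D = {(\<alpha>, \<beta>). length \<alpha> = m \<and> length \<beta> = m \<and> \<alpha> +\<^sub>e \<beta> = \<gamma>}"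
  have c: "\<And>\<alpha>. p \<alpha> \<in> carrier K" "\<And>\<alpha>. q \<alpha> \<in> carrier K" using P_coeff p q by auto
  let ?B = "{\<alpha>. length \<alpha> = m \<and> sum_list \<alpha> \<le> sum_list \<gamma>}"
  \<comment> \<open>Finiteness matters: a sum over an infinite set would be zero by
    convention.\<close>
  have "D \<subseteq> ?B \<times> ?B" by (auto simp: D_def sum_list_add_exp)
  then have fD: "finite D" using finite_exponents finite_subset by blast
  have "(p \<otimes>\<^bsub>P\<^esub> q) \<gamma> = finsum K ?f D" by (simp add: mpoly_algebra_def D_def)
  also have "\<dots> = finsum K ?f (D \<inter> U \<times> V)"
  proof (rule finsum_superset[OF fD])
    have "\<And>\<alpha>. \<alpha> \<notin> U \<Longrightarrow> p \<alpha> = \<zero>" "\<And>\<beta>. \<beta> \<notin> V \<Longrightarrow> q \<beta> = \<zero>" using U(2) V(2) by (auto simp: supp_def)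
    then show "(case x of (\<alpha>, \<beta>) \<Rightarrow> p \<alpha> \<otimes> q \<beta>) = \<zero>" if "x \<in> D - D \<inter> U \<times> V" for x
      using that c by (cases x) auto
  qed (use c in auto)
  also have "\<dots> = finsum K (\<lambda>(\<alpha>, \<beta>). p \<alpha> \<otimes> q \<beta> \<otimes> ind (\<alpha> +\<^sub>e \<beta>) \<gamma>) (D \<inter> U \<times> V)"
    using c by (intro finsum_cong') (auto simp: D_def ind_def)
  also have "\<dots> = finsum K (\<lambda>(\<alpha>, \<beta>). p \<alpha> \<otimes> q \<beta> \<otimes> ind (\<alpha> +\<^sub>e \<beta>) \<gamma>) (U \<times> V)"
  proof (rule finsum_superset[symmetric])
    fix x assume x: "x \<in> U \<times> V - D \<inter> U \<times> V"
    then obtain \<alpha> \<beta> where ab: "x = (\<alpha>, \<beta>)" "\<alpha> \<in> U" "\<beta> \<in> V" "(\<alpha>, \<beta>) \<notin> D" by auto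
    then have "length \<alpha> = m" "length \<beta> = m" using U(3) V(3) by auto
    then have "ind (\<alpha> +\<^sub>e \<beta>) \<gamma> = \<zero>" using ab(4) by (simp add: D_def ind_def)
    then show "(case x of (\<alpha>, \<beta>) \<Rightarrow> p \<alpha> \<otimes> q \<beta> \<otimes> ind (\<alpha> +\<^sub>e \<beta>) \<gamma>) = \<zero>"
      using c by (simp add: ab(1))
  qed (use c U V in auto)
  also have "\<dots> = (\<Oplus>\<alpha>\<in>U. \<Oplus>\<beta>\<in>V. p \<alpha> \<otimes> q \<beta> \<otimes> ind (\<alpha> +\<^sub>e \<beta>) \<gamma>)"
    using c U V by (intro finsum_Sigma[symmetric]) auto
  finally show ?thesis .
qed

lemma mult_closed:
  assumes p: "p \<in> carrier P" and q: "q \<in> carrier P"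
  shows "p \<otimes>\<^bsub>P\<^esub> q \<in> carrier P"
proof (rule P_carrierI)
  have c: "\<And>\<alpha>. p \<alpha> \<in> carrier K" "\<And>\<alpha>. q \<alpha> \<in> carrier K" using P_coeff p q by auto
  note e = mult_expand[OF p q P_supp(1)[OF p] order_refl P_supp(2)[OF p] P_supp(1)[OF q] order_refl P_supp(2)[OF q]]
  let ?U = "(\<lambda>(\<alpha>, \<beta>). \<alpha> +\<^sub>e \<beta>) ` (supp p \<times> supp q)"
  show "finite ?U" using P_supp[OF p] P_supp[OF q] by auto
  show "?U \<subseteq> L" by (rule add_image_L[OF P_supp(2)[OF p] P_supp(2)[OF q]])
  show "(p \<otimes>\<^bsub>P\<^esub> q) \<gamma> \<in> carrier K" for \<gamma> unfolding e using c by (auto intro!: finsum_closed)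
  show "(p \<otimes>\<^bsub>P\<^esub> q) \<gamma> = \<zero>" if "\<gamma> \<notin> ?U" for \<gamma>
  proof -
    have "(\<Oplus>\<beta>\<in>supp q. p \<alpha> \<otimes> q \<beta> \<otimes> ind (\<alpha> +\<^sub>e \<beta>) \<gamma>) = (\<Oplus>\<beta>\<in>supp q. \<zero>)" if "\<alpha> \<in> supp p" for \<alpha>
      using that \<open>\<gamma> \<notin> ?U\<close> c by (intro finsum_cong') (auto simp: ind_def split: if_splits)
    then have "(\<Oplus>\<alpha>\<in>supp p. \<Oplus>\<beta>\<in>supp q. p \<alpha> \<otimes> q \<beta> \<otimes> ind (\<alpha> +\<^sub>e \<beta>) \<gamma>) = (\<Oplus>\<alpha>\<in>supp p. \<zero>)"
      by (intro finsum_cong') auto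
    then show ?thesis unfolding e by simp
  qed
qed

text \<open>Testing a product against an arbitrary function f of the exponent avoids treating its
  coefficients one by one; associativity is the case where f is itself a sum over the third
  factor.\<close>

lemma pairing_mult:
  assumes p: "p \<in> carrier P" and q: "q \<in> carrier P" and f: "\<And>\<alpha>. f \<alpha> \<in> carrier K"
    and W: "finite W" "(\<lambda>(\<alpha>, \<beta>). \<alpha> +\<^sub>e \<beta>) ` (supp p \<times> supp q) \<subseteq> W" "W \<subseteq> L"
  shows "(\<Oplus>\<delta>\<in>W. (p \<otimes>\<^bsub>P\<^esub> q) \<delta> \<otimes> f \<delta>) = (\<Oplus>\<alpha>\<in>supp p. \<Oplus>\<beta>\<in>supp q. p \<alpha> \<otimes> q \<beta> \<otimes> f (\<alpha> +\<^sub>e \<beta>))"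
proof -
  have c: "\<And>\<alpha>. p \<alpha> \<in> carrier K" "\<And>\<alpha>. q \<alpha> \<in> carrier K" using P_coeff p q by auto
  note e = mult_expand[OF p q P_supp(1)[OF p] order_refl P_supp(2)[OF p] P_supp(1)[OF q] order_refl P_supp(2)[OF q]]
  note fin = P_supp(1)[OF p] P_supp(1)[OF q]
  have "(\<Oplus>\<delta>\<in>W. (p \<otimes>\<^bsub>P\<^esub> q) \<delta> \<otimes> f \<delta>) =
      (\<Oplus>\<delta>\<in>W. \<Oplus>\<alpha>\<in>supp p. \<Oplus>\<beta>\<in>supp q. p \<alpha> \<otimes> q \<beta> \<otimes> ind (\<alpha> +\<^sub>e \<beta>) \<delta> \<otimes> f \<delta>)"
  proof (intro finsum_cong' refl)
    fix \<delta> assume "\<delta> \<in> W"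
    have "(p \<otimes>\<^bsub>P\<^esub> q) \<delta> \<otimes> f \<delta> = (\<Oplus>\<alpha>\<in>supp p. (\<Oplus>\<beta>\<in>supp q. p \<alpha> \<otimes> q \<beta> \<otimes> ind (\<alpha> +\<^sub>e \<beta>) \<delta>) \<otimes> f \<delta>)"
      unfolding e using fin f c by (intro finsum_ldistr) (auto intro!: finsum_closed)
    also have "\<dots> = (\<Oplus>\<alpha>\<in>supp p. \<Oplus>\<beta>\<in>supp q. p \<alpha> \<otimes> q \<beta> \<otimes> ind (\<alpha> +\<^sub>e \<beta>) \<delta> \<otimes> f \<delta>)"
      using fin f c by (intro finsum_cong' finsum_ldistr refl) (auto intro!: finsum_closed)
    finally show "(p \<otimes>\<^bsub>P\<^esub> q) \<delta> \<otimes> f \<delta> = (\<Oplus>\<alpha>\<in>supp p. \<Oplus>\<beta>\<in>supp q. p \<alpha> \<otimes> q \<beta> \<otimes> ind (\<alpha> +\<^sub>e \<beta>) \<delta> \<otimes> f \<delta>)" .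
  qed (use c f in \<open>auto intro!: finsum_closed\<close>)
  also have "\<dots> = (\<Oplus>\<alpha>\<in>supp p. \<Oplus>\<delta>\<in>W. \<Oplus>\<beta>\<in>supp q. p \<alpha> \<otimes> q \<beta> \<otimes> ind (\<alpha> +\<^sub>e \<beta>) \<delta> \<otimes> f \<delta>)"
    using c f fin W(1) by (intro finsum_swap) (auto intro!: finsum_closed)
  also have "\<dots> = (\<Oplus>\<alpha>\<in>supp p. \<Oplus>\<beta>\<in>supp q. \<Oplus>\<delta>\<in>W. p \<alpha> \<otimes> q \<beta> \<otimes> ind (\<alpha> +\<^sub>e \<beta>) \<delta> \<otimes> f \<delta>)"
    using c f fin W(1) by (intro finsum_cong' finsum_swap refl) (auto intro!: finsum_closed)
  also have "\<dots> = (\<Oplus>\<alpha>\<in>supp p. \<Oplus>\<beta>\<in>supp q. p \<alpha> \<otimes> q \<beta> \<otimes> f (\<alpha> +\<^sub>e \<beta>))"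
  proof (intro finsum_cong' refl)
    fix \<alpha> \<beta> assume ab: "\<alpha> \<in> supp p" "\<beta> \<in> supp q"
    have "(\<Oplus>\<delta>\<in>W. p \<alpha> \<otimes> q \<beta> \<otimes> ind (\<alpha> +\<^sub>e \<beta>) \<delta> \<otimes> f \<delta>) = p \<alpha> \<otimes> q \<beta> \<otimes> ind (\<alpha> +\<^sub>e \<beta>) (\<alpha> +\<^sub>e \<beta>) \<otimes> f (\<alpha> +\<^sub>e \<beta>)"
      using W ab c f by (intro finsum_single) (auto simp: ind_def)
    then show "(\<Oplus>\<delta>\<in>W. p \<alpha> \<otimes> q \<beta> \<otimes> ind (\<alpha> +\<^sub>e \<beta>) \<delta> \<otimes> f \<delta>) = p \<alpha> \<otimes> q \<beta> \<otimes> f (\<alpha> +\<^sub>e \<beta>)"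
      using c by (simp add: ind_def)
  qed (use c f in \<open>auto intro!: finsum_closed\<close>)
  finally show ?thesis .
qed

lemma mult_comm:
  assumes p: "p \<in> carrier P" and q: "q \<in> carrier P"
  shows "p \<otimes>\<^bsub>P\<^esub> q = q \<otimes>\<^bsub>P\<^esub> p"
proof
  fix \<gamma>
  have c: "\<And>\<alpha>. p \<alpha> \<in> carrier K" "\<And>\<alpha>. q \<alpha> \<in> carrier K" using P_coeff p q by auto
  note fin = P_supp(1)[OF p] P_supp(1)[OF q]
  have "(p \<otimes>\<^bsub>P\<^esub> q) \<gamma> = (\<Oplus>\<alpha>\<in>supp p. \<Oplus>\<beta>\<in>supp q. p \<alpha> \<otimes> q \<beta> \<otimes> ind (\<alpha> +\<^sub>e \<beta>) \<gamma>)"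
    by (rule mult_expand[OF p q P_supp(1)[OF p] order_refl P_supp(2)[OF p] P_supp(1)[OF q] order_refl P_supp(2)[OF q]])
  also have "\<dots> = (\<Oplus>\<beta>\<in>supp q. \<Oplus>\<alpha>\<in>supp p. p \<alpha> \<otimes> q \<beta> \<otimes> ind (\<alpha> +\<^sub>e \<beta>) \<gamma>)"
    using c fin by (intro finsum_swap) auto
  also have "\<dots> = (\<Oplus>\<beta>\<in>supp q. \<Oplus>\<alpha>\<in>supp p. q \<beta> \<otimes> p \<alpha> \<otimes> ind (\<beta> +\<^sub>e \<alpha>) \<gamma>)"
    using c by (intro finsum_cong') (auto simp: m_comm add_exp_commute intro!: finsum_closed)
  also have "\<dots> = (q \<otimes>\<^bsub>P\<^esub> p) \<gamma>"
    by (rule mult_expand[OF q p P_supp(1)[OF q] order_refl P_supp(2)[OF q] P_supp(1)[OF p] order_refl P_supp(2)[OF p], symmetric])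
  finally show "(p \<otimes>\<^bsub>P\<^esub> q) \<gamma> = (q \<otimes>\<^bsub>P\<^esub> p) \<gamma>" .
qed

lemma mult_assoc:
  assumes p: "p \<in> carrier P" and q: "q \<in> carrier P" and r: "r \<in> carrier P"
  shows "p \<otimes>\<^bsub>P\<^esub> q \<otimes>\<^bsub>P\<^esub> r = p \<otimes>\<^bsub>P\<^esub> (q \<otimes>\<^bsub>P\<^esub> r)"
proof
  fix \<gamma>
  have c: "\<And>\<alpha>. p \<alpha> \<in> carrier K" "\<And>\<alpha>. q \<alpha> \<in> carrier K" "\<And>\<alpha>. r \<alpha> \<in> carrier K"
    "\<And>\<alpha>. (p \<otimes>\<^bsub>P\<^esub> q) \<alpha> \<in> carrier K" "\<And>\<alpha>. (q \<otimes>\<^bsub>P\<^esub> r) \<alpha> \<in> carrier K"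
    using P_coeff p q r mult_closed by auto
  note s = P_supp[OF p] P_supp[OF q] P_supp[OF r]
  note fin = s(1,3,5)
  have expand: "(x \<otimes>\<^bsub>P\<^esub> y \<otimes>\<^bsub>P\<^esub> z) \<gamma> =
      (\<Oplus>\<alpha>\<in>supp x. \<Oplus>\<beta>\<in>supp y. \<Oplus>\<epsilon>\<in>supp z. x \<alpha> \<otimes> y \<beta> \<otimes> (z \<epsilon> \<otimes> ind (\<alpha> +\<^sub>e \<beta> +\<^sub>e \<epsilon>) \<gamma>))"
    if x: "x \<in> carrier P" and y: "y \<in> carrier P" and z: "z \<in> carrier P" for x y z
  proof -
    have c: "\<And>\<alpha>. x \<alpha> \<in> carrier K" "\<And>\<alpha>. y \<alpha> \<in> carrier K" "\<And>\<alpha>. z \<alpha> \<in> carrier K"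
      "\<And>\<alpha>. (x \<otimes>\<^bsub>P\<^esub> y) \<alpha> \<in> carrier K"
      using P_coeff x y z mult_closed by auto
    note s = P_supp[OF x] P_supp[OF y] P_supp[OF z] P_supp[OF mult_closed[OF x y]]
    let ?W = "supp (x \<otimes>\<^bsub>P\<^esub> y) \<union> (\<lambda>(\<alpha>, \<beta>). \<alpha> +\<^sub>e \<beta>) ` (supp x \<times> supp y)"
    have W: "finite ?W" "?W \<subseteq> L" using s add_image_L[OF s(2,4)] by auto
    have "(x \<otimes>\<^bsub>P\<^esub> y \<otimes>\<^bsub>P\<^esub> z) \<gamma> = (\<Oplus>\<delta>\<in>?W. \<Oplus>\<epsilon>\<in>supp z. (x \<otimes>\<^bsub>P\<^esub> y) \<delta> \<otimes> z \<epsilon> \<otimes> ind (\<delta> +\<^sub>e \<epsilon>) \<gamma>)"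
      using W s by (intro mult_expand mult_closed x y z) auto
    also have "\<dots> = (\<Oplus>\<delta>\<in>?W. (x \<otimes>\<^bsub>P\<^esub> y) \<delta> \<otimes> (\<Oplus>\<epsilon>\<in>supp z. z \<epsilon> \<otimes> ind (\<delta> +\<^sub>e \<epsilon>) \<gamma>))"
      using c s(5) by (intro finsum_cong') (auto simp: finsum_rdistr m_assoc intro!: finsum_closed)
    also have "\<dots> = (\<Oplus>\<alpha>\<in>supp x. \<Oplus>\<beta>\<in>supp y. x \<alpha> \<otimes> y \<beta> \<otimes> (\<Oplus>\<epsilon>\<in>supp z. z \<epsilon> \<otimes> ind (\<alpha> +\<^sub>e \<beta> +\<^sub>e \<epsilon>) \<gamma>))"
      using W c by (intro pairing_mult x y) (auto intro!: finsum_closed)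
    also have "\<dots> = (\<Oplus>\<alpha>\<in>supp x. \<Oplus>\<beta>\<in>supp y. \<Oplus>\<epsilon>\<in>supp z. x \<alpha> \<otimes> y \<beta> \<otimes> (z \<epsilon> \<otimes> ind (\<alpha> +\<^sub>e \<beta> +\<^sub>e \<epsilon>) \<gamma>))"
      using c s(5) by (intro finsum_cong' finsum_rdistr refl) (auto intro!: finsum_closed)
    finally show ?thesis .
  qed
  \<comment> \<open>By commutativity only left-bracketed products have to be expanded; the other
    bracketing becomes (q r) p.\<close>
  have "(p \<otimes>\<^bsub>P\<^esub> (q \<otimes>\<^bsub>P\<^esub> r)) \<gamma> = (q \<otimes>\<^bsub>P\<^esub> r \<otimes>\<^bsub>P\<^esub> p) \<gamma>"
    using mult_comm[OF p mult_closed[OF q r]] by simp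
  also have "\<dots> = (\<Oplus>\<beta>\<in>supp q. \<Oplus>\<epsilon>\<in>supp r. \<Oplus>\<alpha>\<in>supp p. q \<beta> \<otimes> r \<epsilon> \<otimes> (p \<alpha> \<otimes> ind (\<beta> +\<^sub>e \<epsilon> +\<^sub>e \<alpha>) \<gamma>))"
    by (rule expand[OF q r p])
  also have "\<dots> = (\<Oplus>\<beta>\<in>supp q. \<Oplus>\<alpha>\<in>supp p. \<Oplus>\<epsilon>\<in>supp r. q \<beta> \<otimes> r \<epsilon> \<otimes> (p \<alpha> \<otimes> ind (\<beta> +\<^sub>e \<epsilon> +\<^sub>e \<alpha>) \<gamma>))"
    using c fin by (intro finsum_cong' finsum_swap refl) (auto intro!: finsum_closed)
  also have "\<dots> = (\<Oplus>\<alpha>\<in>supp p. \<Oplus>\<beta>\<in>supp q. \<Oplus>\<epsilon>\<in>supp r. q \<beta> \<otimes> r \<epsilon> \<otimes> (p \<alpha> \<otimes> ind (\<beta> +\<^sub>e \<epsilon> +\<^sub>e \<alpha>) \<gamma>))"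
    using c fin by (intro finsum_swap) (auto intro!: finsum_closed)
  also have "\<dots> = (\<Oplus>\<alpha>\<in>supp p. \<Oplus>\<beta>\<in>supp q. \<Oplus>\<epsilon>\<in>supp r. p \<alpha> \<otimes> q \<beta> \<otimes> (r \<epsilon> \<otimes> ind (\<alpha> +\<^sub>e \<beta> +\<^sub>e \<epsilon>) \<gamma>))"
  proof (intro finsum_cong' refl)
    fix \<alpha> \<beta> \<epsilon>
    have "\<beta> +\<^sub>e \<epsilon> +\<^sub>e \<alpha> = \<alpha> +\<^sub>e \<beta> +\<^sub>e \<epsilon>" unfolding add_exp_commute[of "\<beta> +\<^sub>e \<epsilon>" \<alpha>] by (rule add_exp_assoc[symmetric])
    then show "q \<beta> \<otimes> r \<epsilon> \<otimes> (p \<alpha> \<otimes> ind (\<beta> +\<^sub>e \<epsilon> +\<^sub>e \<alpha>) \<gamma>) = p \<alpha> \<otimes> q \<beta> \<otimes> (r \<epsilon> \<otimes> ind (\<alpha> +\<^sub>e \<beta> +\<^sub>e \<epsilon>) \<gamma>)"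
      using c by (simp add: m_ac)
  qed (use c in \<open>auto intro!: finsum_closed\<close>)
  also have "\<dots> = (p \<otimes>\<^bsub>P\<^esub> q \<otimes>\<^bsub>P\<^esub> r) \<gamma>" by (rule expand[OF p q r, symmetric])
  finally show "(p \<otimes>\<^bsub>P\<^esub> q \<otimes>\<^bsub>P\<^esub> r) \<gamma> = (p \<otimes>\<^bsub>P\<^esub> (q \<otimes>\<^bsub>P\<^esub> r)) \<gamma>" by simp
qed

lemma mon_closed: "\<alpha> \<in> L \<Longrightarrow> mon \<alpha> \<in> carrier P"
  by (rule P_carrierI[of _ "{\<alpha>}"]) (auto simp: mon_def)

lemma mon_mult:
  assumes "\<alpha> \<in> L" "\<beta> \<in> L"
  shows "mon \<alpha> \<otimes>\<^bsub>P\<^esub> mon \<beta> = mon (\<alpha> +\<^sub>e \<beta>)"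
proof
  fix \<gamma>
  have "(mon \<alpha> \<otimes>\<^bsub>P\<^esub> mon \<beta>) \<gamma> = (\<Oplus>\<alpha>'\<in>{\<alpha>}. \<Oplus>\<beta>'\<in>{\<beta>}. mon \<alpha> \<alpha>' \<otimes> mon \<beta> \<beta>' \<otimes> ind (\<alpha>' +\<^sub>e \<beta>') \<gamma>)"
    using assms by (intro mult_expand mon_closed) (auto simp: mon_def supp_def)
  then show "(mon \<alpha> \<otimes>\<^bsub>P\<^esub> mon \<beta>) \<gamma> = mon (\<alpha> +\<^sub>e \<beta>) \<gamma>" by (simp add: mon_def ind_def finsum_insert)
qed

lemma one_mult:
  assumes p: "p \<in> carrier P"
  shows "mon (replicate m 0) \<otimes>\<^bsub>P\<^esub> p = p"
proof
  fix \<gamma>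
  have c: "\<And>\<alpha>. p \<alpha> \<in> carrier K" using P_coeff p by auto
  have "(mon (replicate m 0) \<otimes>\<^bsub>P\<^esub> p) \<gamma> =
      (\<Oplus>\<alpha>\<in>{replicate m 0}. \<Oplus>\<beta>\<in>supp p. mon (replicate m 0) \<alpha> \<otimes> p \<beta> \<otimes> ind (\<alpha> +\<^sub>e \<beta>) \<gamma>)"
    using P_supp[OF p] by (intro mult_expand mon_closed p) (auto simp: mon_def supp_def)
  also have "\<dots> = (\<Oplus>\<beta>\<in>supp p. mon (replicate m 0) (replicate m 0) \<otimes> p \<beta> \<otimes> ind (replicate m 0 +\<^sub>e \<beta>) \<gamma>)"
    using c by (subst finsum_insert) (auto simp: mon_def intro!: finsum_closed)
  also have "\<dots> = (\<Oplus>\<beta>\<in>supp p. if \<gamma> = \<beta> then p \<beta> else \<zero>)"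
    using c P_supp(2)[OF p] by (intro finsum_cong') (auto simp: mon_def ind_def add_exp_zero)
  also have "\<dots> = p \<gamma>"
  proof (cases "\<gamma> \<in> supp p")
    case True then show ?thesis using c P_supp(1)[OF p] finsum_singleton[of \<gamma> "supp p" p] by simp
  next
    case False
    then have "(\<Oplus>\<beta>\<in>supp p. if \<gamma> = \<beta> then p \<beta> else \<zero>) = (\<Oplus>\<beta>\<in>supp p. \<zero>)"
      by (intro finsum_cong') auto
    then show ?thesis using False by (simp add: supp_def)
  qed
  finally show "(mon (replicate m 0) \<otimes>\<^bsub>P\<^esub> p) \<gamma> = p \<gamma>" .
qed

lemma P_add_closed: "p \<in> carrier P \<Longrightarrow> q \<in> carrier P \<Longrightarrow> (\<lambda>\<alpha>. p \<alpha> \<oplus> q \<alpha>) \<in> carrier P"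
  using P_supp[of p] P_supp[of q]
  by (intro P_carrierI[of _ "supp p \<union> supp q"]) (auto simp: P_coeff supp_def)

lemma P_smult_closed: "c \<in> carrier K \<Longrightarrow> p \<in> carrier P \<Longrightarrow> (\<lambda>\<alpha>. c \<otimes> p \<alpha>) \<in> carrier P"
  using P_supp[of p] by (intro P_carrierI[of _ "supp p"]) (auto simp: P_coeff supp_def)

lemma mult_l_distr:
  assumes p: "p \<in> carrier P" and q: "q \<in> carrier P" and r: "r \<in> carrier P"
  shows "(p \<oplus>\<^bsub>P\<^esub> q) \<otimes>\<^bsub>P\<^esub> r = p \<otimes>\<^bsub>P\<^esub> r \<oplus>\<^bsub>P\<^esub> q \<otimes>\<^bsub>P\<^esub> r"
proof
  fix \<gamma>
  have c: "\<And>\<alpha>. p \<alpha> \<in> carrier K" "\<And>\<alpha>. q \<alpha> \<in> carrier K" "\<And>\<alpha>. r \<alpha> \<in> carrier K" using P_coeff p q r by auto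
  let ?U = "supp p \<union> supp q"
  note s = P_supp[OF p] P_supp[OF q] P_supp[OF r]
  have U: "finite ?U" "?U \<subseteq> L" using s by auto
  have pq: "p \<oplus>\<^bsub>P\<^esub> q \<in> carrier P" using P_add_closed[OF p q] by simp
  have "((p \<oplus>\<^bsub>P\<^esub> q) \<otimes>\<^bsub>P\<^esub> r) \<gamma> = (\<Oplus>\<alpha>\<in>?U. \<Oplus>\<beta>\<in>supp r. (p \<oplus>\<^bsub>P\<^esub> q) \<alpha> \<otimes> r \<beta> \<otimes> ind (\<alpha> +\<^sub>e \<beta>) \<gamma>)"
    using U s by (intro mult_expand[OF pq r]) (auto simp: supp_def)
  also have "\<dots> = (\<Oplus>\<alpha>\<in>?U. (\<Oplus>\<beta>\<in>supp r. p \<alpha> \<otimes> r \<beta> \<otimes> ind (\<alpha> +\<^sub>e \<beta>) \<gamma>) \<oplus> (\<Oplus>\<beta>\<in>supp r. q \<alpha> \<otimes> r \<beta> \<otimes> ind (\<alpha> +\<^sub>e \<beta>) \<gamma>))"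
  proof (intro finsum_cong' refl)
    fix \<alpha>
    have "(\<Oplus>\<beta>\<in>supp r. (p \<oplus>\<^bsub>P\<^esub> q) \<alpha> \<otimes> r \<beta> \<otimes> ind (\<alpha> +\<^sub>e \<beta>) \<gamma>) =
        (\<Oplus>\<beta>\<in>supp r. p \<alpha> \<otimes> r \<beta> \<otimes> ind (\<alpha> +\<^sub>e \<beta>) \<gamma> \<oplus> q \<alpha> \<otimes> r \<beta> \<otimes> ind (\<alpha> +\<^sub>e \<beta>) \<gamma>)"
      using c by (intro finsum_cong') (auto simp: l_distr)
    also have "\<dots> = (\<Oplus>\<beta>\<in>supp r. p \<alpha> \<otimes> r \<beta> \<otimes> ind (\<alpha> +\<^sub>e \<beta>) \<gamma>) \<oplus> (\<Oplus>\<beta>\<in>supp r. q \<alpha> \<otimes> r \<beta> \<otimes> ind (\<alpha> +\<^sub>e \<beta>) \<gamma>)"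
      using c by (intro finsum_addf) auto
    finally show "(\<Oplus>\<beta>\<in>supp r. (p \<oplus>\<^bsub>P\<^esub> q) \<alpha> \<otimes> r \<beta> \<otimes> ind (\<alpha> +\<^sub>e \<beta>) \<gamma>) =
        (\<Oplus>\<beta>\<in>supp r. p \<alpha> \<otimes> r \<beta> \<otimes> ind (\<alpha> +\<^sub>e \<beta>) \<gamma>) \<oplus> (\<Oplus>\<beta>\<in>supp r. q \<alpha> \<otimes> r \<beta> \<otimes> ind (\<alpha> +\<^sub>e \<beta>) \<gamma>)" .
  qed (use c in \<open>auto intro!: finsum_closed\<close>)
  also have "\<dots> = (\<Oplus>\<alpha>\<in>?U. \<Oplus>\<beta>\<in>supp r. p \<alpha> \<otimes> r \<beta> \<otimes> ind (\<alpha> +\<^sub>e \<beta>) \<gamma>) \<oplus>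
      (\<Oplus>\<alpha>\<in>?U. \<Oplus>\<beta>\<in>supp r. q \<alpha> \<otimes> r \<beta> \<otimes> ind (\<alpha> +\<^sub>e \<beta>) \<gamma>)"
    using c by (intro finsum_addf) (auto intro!: finsum_closed)
  also have "(\<Oplus>\<alpha>\<in>?U. \<Oplus>\<beta>\<in>supp r. p \<alpha> \<otimes> r \<beta> \<otimes> ind (\<alpha> +\<^sub>e \<beta>) \<gamma>) = (p \<otimes>\<^bsub>P\<^esub> r) \<gamma>"
    using U s by (intro mult_expand[OF p r, symmetric]) auto
  also have "(\<Oplus>\<alpha>\<in>?U. \<Oplus>\<beta>\<in>supp r. q \<alpha> \<otimes> r \<beta> \<otimes> ind (\<alpha> +\<^sub>e \<beta>) \<gamma>) = (q \<otimes>\<^bsub>P\<^esub> r) \<gamma>"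
    using U s by (intro mult_expand[OF q r, symmetric]) auto
  finally show "((p \<oplus>\<^bsub>P\<^esub> q) \<otimes>\<^bsub>P\<^esub> r) \<gamma> = (p \<otimes>\<^bsub>P\<^esub> r \<oplus>\<^bsub>P\<^esub> q \<otimes>\<^bsub>P\<^esub> r) \<gamma>" by simp
qed

lemma mult_smult:
  assumes k: "k \<in> carrier K" and p: "p \<in> carrier P" and q: "q \<in> carrier P"
  shows "(k \<odot>\<^bsub>P\<^esub> p) \<otimes>\<^bsub>P\<^esub> q = k \<odot>\<^bsub>P\<^esub> (p \<otimes>\<^bsub>P\<^esub> q)"
proof
  fix \<gamma>
  have c: "\<And>\<alpha>. p \<alpha> \<in> carrier K" "\<And>\<alpha>. q \<alpha> \<in> carrier K" using P_coeff p q by auto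
  note s = P_supp[OF p] P_supp[OF q]
  have kp: "k \<odot>\<^bsub>P\<^esub> p \<in> carrier P" using P_smult_closed[OF k p] by simp
  have "((k \<odot>\<^bsub>P\<^esub> p) \<otimes>\<^bsub>P\<^esub> q) \<gamma> = (\<Oplus>\<alpha>\<in>supp p. \<Oplus>\<beta>\<in>supp q. (k \<odot>\<^bsub>P\<^esub> p) \<alpha> \<otimes> q \<beta> \<otimes> ind (\<alpha> +\<^sub>e \<beta>) \<gamma>)"
    using s k by (intro mult_expand[OF kp q]) (auto simp: supp_def)
  also have "\<dots> = (\<Oplus>\<alpha>\<in>supp p. k \<otimes> (\<Oplus>\<beta>\<in>supp q. p \<alpha> \<otimes> q \<beta> \<otimes> ind (\<alpha> +\<^sub>e \<beta>) \<gamma>))"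
    using c k s by (intro finsum_cong') (auto simp: finsum_rdistr m_assoc intro!: finsum_closed)
  also have "\<dots> = k \<otimes> (\<Oplus>\<alpha>\<in>supp p. \<Oplus>\<beta>\<in>supp q. p \<alpha> \<otimes> q \<beta> \<otimes> ind (\<alpha> +\<^sub>e \<beta>) \<gamma>)"
    using c k s by (intro finsum_rdistr[symmetric]) (auto intro!: finsum_closed)
  also have "(\<Oplus>\<alpha>\<in>supp p. \<Oplus>\<beta>\<in>supp q. p \<alpha> \<otimes> q \<beta> \<otimes> ind (\<alpha> +\<^sub>e \<beta>) \<gamma>) = (p \<otimes>\<^bsub>P\<^esub> q) \<gamma>"
    using s by (intro mult_expand[OF p q, symmetric]) auto
  finally show "((k \<odot>\<^bsub>P\<^esub> p) \<otimes>\<^bsub>P\<^esub> q) \<gamma> = (k \<odot>\<^bsub>P\<^esub> (p \<otimes>\<^bsub>P\<^esub> q)) \<gamma>" by simp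
qed

lemma P_cring: "cring P"
proof (rule cringI)
  show "abelian_group P"
  proof (rule abelian_groupI)
    fix p assume p: "p \<in> carrier P"
    show "\<exists>q\<in>carrier P. q \<oplus>\<^bsub>P\<^esub> p = \<zero>\<^bsub>P\<^esub>"
      using P_smult_closed[of "\<ominus> \<one>", OF _ p] P_coeff[OF p]
      by (intro bexI[of _ "\<lambda>\<alpha>. (\<ominus> \<one>) \<otimes> p \<alpha>"]) (auto simp: l_minus l_neg)
  next
    show "\<zero>\<^bsub>P\<^esub> \<in> carrier P" by (rule P_carrierI[of _ "{}"]) auto
  qed (use P_add_closed P_coeff in \<open>auto simp: a_ac\<close>)
  show "comm_monoid P"
    by (rule comm_monoidI) (use mult_closed mult_assoc mult_comm one_mult mon_closed in auto)
qed (rule mult_l_distr)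

lemma P_algebra: "algebra K P"
  by (rule algebraI)
    (use P_cring P_smult_closed P_coeff mult_smult cring_axioms in
      \<open>auto simp: l_distr r_distr m_assoc simp del: P_simps(1)\<close>)

text \<open>The deglex-leading exponents \<alpha> and \<beta> add up to an exponent that no other
  pair from the supports attains, so the coefficient there is a product of two non-zero
  scalars.\<close>

lemma P_domain: "domain P"
proof (rule domain.intro[OF P_cring], rule domain_axioms.intro)
  have "mon (replicate m 0) (replicate m 0) \<noteq> \<zero>" by (simp add: mon_def)
  then show "\<one>\<^bsub>P\<^esub> \<noteq> \<zero>\<^bsub>P\<^esub>" by (metis P_simps(1,2))
  fix p q assume z: "p \<otimes>\<^bsub>P\<^esub> q = \<zero>\<^bsub>P\<^esub>" and p: "p \<in> carrier P" and q: "q \<in> carrier P"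
  show "p = \<zero>\<^bsub>P\<^esub> \<or> q = \<zero>\<^bsub>P\<^esub>"
  proof (rule ccontr)
    assume "\<not> (p = \<zero>\<^bsub>P\<^esub> \<or> q = \<zero>\<^bsub>P\<^esub>)"
    then have ne: "supp p \<noteq> {}" "supp q \<noteq> {}" by (auto simp: supp_def)
    note s = P_supp[OF p] P_supp[OF q]
    have c: "\<And>\<alpha>. p \<alpha> \<in> carrier K" "\<And>\<alpha>. q \<alpha> \<in> carrier K" using P_coeff p q by auto
    obtain \<alpha> where \<alpha>: "\<alpha> \<in> supp p" "\<And>\<alpha>'. \<alpha>' \<in> supp p \<Longrightarrow> \<alpha>' \<noteq> \<alpha> \<Longrightarrow> \<alpha>' \<prec>\<^sub>e \<alpha>"
      using deglex_max[OF s(1) ne(1) s(2)] by blast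
    obtain \<beta> where \<beta>: "\<beta> \<in> supp q" "\<And>\<beta>'. \<beta>' \<in> supp q \<Longrightarrow> \<beta>' \<noteq> \<beta> \<Longrightarrow> \<beta>' \<prec>\<^sub>e \<beta>"
      using deglex_max[OF s(3) ne(2) s(4)] by blast
    \<comment> \<open>Replacing a non-leading exponent by the leading one strictly increases the
      sum, since \<open>deglex\<close> is compatible with addition.\<close>
    have lead: "\<alpha>' = \<alpha> \<and> \<beta>' = \<beta>" if ab: "\<alpha>' \<in> supp p" "\<beta>' \<in> supp q" "\<alpha>' +\<^sub>e \<beta>' = \<alpha> +\<^sub>e \<beta>" for \<alpha>' \<beta>'
    proof -
      have len: "length \<alpha> = m" "length \<beta> = m" "length \<alpha>' = m" "length \<beta>' = m"
        using ab \<alpha>(1) \<beta>(1) s by auto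
      have 1: "\<alpha>' +\<^sub>e \<beta>' \<prec>\<^sub>e \<alpha> +\<^sub>e \<beta>'" if "\<alpha>' \<noteq> \<alpha>" using deglex_add[OF _ _ \<alpha>(2)[OF ab(1) that]] len by simp
      have 2: "\<alpha> +\<^sub>e \<beta>' \<prec>\<^sub>e \<alpha> +\<^sub>e \<beta>" if "\<beta>' \<noteq> \<beta>"
        using deglex_add[OF _ _ \<beta>(2)[OF ab(2) that], of \<alpha>] len by (simp add: add_exp_commute[of \<alpha>])
      have 3: "\<alpha>' = \<alpha>"
      proof (rule ccontr)
        assume n: "\<alpha>' \<noteq> \<alpha>"
        have "\<alpha>' +\<^sub>e \<beta>' \<prec>\<^sub>e \<alpha> +\<^sub>e \<beta>"
          using 1[OF n] 2 deglex_trans by (cases "\<beta>' = \<beta>") blast+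
        then show False unfolding ab(3) using deglex_irrefl by blast
      qed
      have "\<beta>' = \<beta>"
      proof (rule ccontr)
        assume "\<beta>' \<noteq> \<beta>"
        then show False using 2 ab(3) deglex_irrefl unfolding 3 by metis
      qed
      then show ?thesis using 3 by blast
    qed
    have "(p \<otimes>\<^bsub>P\<^esub> q) (\<alpha> +\<^sub>e \<beta>) = (\<Oplus>\<alpha>'\<in>supp p. \<Oplus>\<beta>'\<in>supp q. p \<alpha>' \<otimes> q \<beta>' \<otimes> ind (\<alpha>' +\<^sub>e \<beta>') (\<alpha> +\<^sub>e \<beta>))"
      using s by (intro mult_expand[OF p q]) auto
    also have "\<dots> = (\<Oplus>\<beta>'\<in>supp q. p \<alpha> \<otimes> q \<beta>' \<otimes> ind (\<alpha> +\<^sub>e \<beta>') (\<alpha> +\<^sub>e \<beta>))"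
    proof (rule finsum_single[OF s(1) \<alpha>(1)])
      fix \<alpha>' assume a: "\<alpha>' \<in> supp p" "\<alpha>' \<noteq> \<alpha>"
      have "(\<Oplus>\<beta>'\<in>supp q. p \<alpha>' \<otimes> q \<beta>' \<otimes> ind (\<alpha>' +\<^sub>e \<beta>') (\<alpha> +\<^sub>e \<beta>)) = (\<Oplus>\<beta>'\<in>supp q. \<zero>)"
        using c lead a by (intro finsum_cong') (auto simp: ind_def split: if_splits)
      then show "(\<Oplus>\<beta>'\<in>supp q. p \<alpha>' \<otimes> q \<beta>' \<otimes> ind (\<alpha>' +\<^sub>e \<beta>') (\<alpha> +\<^sub>e \<beta>)) = \<zero>" by simp
    qed (use c in \<open>auto intro!: finsum_closed\<close>)
    also have "\<dots> = p \<alpha> \<otimes> q \<beta> \<otimes> ind (\<alpha> +\<^sub>e \<beta>) (\<alpha> +\<^sub>e \<beta>)"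
      using c lead[OF \<alpha>(1)] by (intro finsum_single[OF s(3) \<beta>(1)]) (auto simp: ind_def)
    finally have "p \<alpha> \<otimes> q \<beta> = \<zero>" using z c by (simp add: ind_def)
    then show False using \<alpha>(1) \<beta>(1) c integral by (auto simp: supp_def)
  qed
qed

end


section \<open>Fields of fractions\<close>

lemma UN_pair_const:
  assumes "p \<in> X" "\<And>a b. (a, b) \<in> X \<Longrightarrow> f a b = Z"
  shows "(\<Union>(a, b)\<in>X. f a b) = Z"
proof -
  have "(\<Union>(a, b)\<in>X. f a b) = (\<Union>x\<in>X. Z)" using assms(2) by (intro SUP_cong refl) auto
  then show ?thesis using assms(1) by auto
qed

locale fractions = algebra K R + D: domain R + KF: field K
  for K :: "('k, 'x) ring_scheme" and R :: "('k, 'a) module" (structure)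
begin

abbreviation "Fr \<equiv> frac_algebra R"
abbreviation fr where "fr a b \<equiv> frac_class R a b"

lemma fr_mem_iff: "(c, d) \<in> fr a b \<longleftrightarrow> c \<in> carrier R \<and> d \<in> carrier R \<and> d \<noteq> \<zero> \<and> a \<otimes> d = c \<otimes> b"
  by (auto simp: frac_class_def)

lemma fr_eq_iff:
  assumes a: "a \<in> carrier R" "b \<in> carrier R" "b \<noteq> \<zero>" and c: "c \<in> carrier R" "d \<in> carrier R" "d \<noteq> \<zero>"
  shows "fr a b = fr c d \<longleftrightarrow> a \<otimes> d = c \<otimes> b"
proof
  assume "fr a b = fr c d"
  moreover have "(c, d) \<in> fr c d" using c by (simp add: fr_mem_iff)
  ultimately have "(c, d) \<in> fr a b" by simp
  then show "a \<otimes> d = c \<otimes> b" by (simp add: fr_mem_iff)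
next
  assume eq: "a \<otimes> d = c \<otimes> b"
  have "a \<otimes> f = e \<otimes> b \<longleftrightarrow> c \<otimes> f = e \<otimes> d" if e: "e \<in> carrier R" "f \<in> carrier R" for e f
  proof
    assume f: "a \<otimes> f = e \<otimes> b"
    have "b \<otimes> (c \<otimes> f) = (c \<otimes> b) \<otimes> f" using a c e by (simp add: m_ac)
    also have "\<dots> = (a \<otimes> f) \<otimes> d" unfolding eq[symmetric] using a c e by (simp add: m_ac)
    also have "\<dots> = b \<otimes> (e \<otimes> d)" unfolding f using a c e by (simp add: m_ac)
    finally have "b \<otimes> (c \<otimes> f) = b \<otimes> (e \<otimes> d)" .
    then show "c \<otimes> f = e \<otimes> d" using a c e D.m_lcancel[of b "c \<otimes> f" "e \<otimes> d"] by simp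
  next
    assume f: "c \<otimes> f = e \<otimes> d"
    have "d \<otimes> (a \<otimes> f) = (a \<otimes> d) \<otimes> f" using a c e by (simp add: m_ac)
    also have "\<dots> = (c \<otimes> f) \<otimes> b" unfolding eq using a c e by (simp add: m_ac)
    also have "\<dots> = d \<otimes> (e \<otimes> b)" unfolding f using a c e by (simp add: m_ac)
    finally have "d \<otimes> (a \<otimes> f) = d \<otimes> (e \<otimes> b)" .
    then show "a \<otimes> f = e \<otimes> b" using a c e D.m_lcancel[of d "a \<otimes> f" "e \<otimes> b"] by simp
  qed
  then show "fr a b = fr c d" by (auto simp: frac_class_def)
qed

definition den where "den b \<longleftrightarrow> b \<in> carrier R \<and> b \<noteq> \<zero>"

lemma den: "den b \<Longrightarrow> b \<in> carrier R" "den \<one>" "den b \<Longrightarrow> den d \<Longrightarrow> den (b \<otimes> d)"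
  by (auto simp: den_def D.integral_iff)

lemma Fr_carrier: "X \<in> carrier Fr \<longleftrightarrow> (\<exists>a b. X = fr a b \<and> a \<in> carrier R \<and> den b)"
  by (auto simp: frac_algebra_def den_def)

lemma fr_closed: "a \<in> carrier R \<Longrightarrow> den b \<Longrightarrow> fr a b \<in> carrier Fr"
  by (auto simp: Fr_carrier)

lemma fr_eqI: "a \<in> carrier R \<Longrightarrow> c \<in> carrier R \<Longrightarrow> den b \<Longrightarrow> den d \<Longrightarrow> a \<otimes> d = c \<otimes> b \<Longrightarrow> fr a b = fr c d"
  by (simp add: fr_eq_iff den_def)

lemma fr_mem: "(a, b) \<in> fr a b" if "a \<in> carrier R" "den b"
  using that by (simp add: fr_mem_iff den_def)

text \<open>Any two representatives yield the same class by cross-multiplication, so the union over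
  representatives collapses to this class.\<close>

lemma Fr_mult:
  assumes a: "a \<in> carrier R" "den b" and c: "c \<in> carrier R" "den d"
  shows "fr a b \<otimes>\<^bsub>Fr\<^esub> fr c d = fr (a \<otimes> c) (b \<otimes> d)"
proof -
  have "fr (a' \<otimes> c') (b' \<otimes> d') = fr (a \<otimes> c) (b \<otimes> d)" if m: "(a', b') \<in> fr a b" "(c', d') \<in> fr c d" for a' b' c' d'
  proof (rule fr_eqI)
    have e: "a' \<in> carrier R" "b' \<in> carrier R" "c' \<in> carrier R" "d' \<in> carrier R"
      "a \<otimes> b' = a' \<otimes> b" "c \<otimes> d' = c' \<otimes> d" using m by (auto simp: fr_mem_iff)
    note k = e(1-4) a(1) c(1) den(1)[OF a(2)] den(1)[OF c(2)]
    have "a' \<otimes> c' \<otimes> (b \<otimes> d) = (a' \<otimes> b) \<otimes> (c' \<otimes> d)" using k by (simp add: m_ac)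
    also have "\<dots> = (a \<otimes> b') \<otimes> (c \<otimes> d')" using e(5,6) by simp
    also have "\<dots> = a \<otimes> c \<otimes> (b' \<otimes> d')" using k by (simp add: m_ac)
    finally show "a' \<otimes> c' \<otimes> (b \<otimes> d) = a \<otimes> c \<otimes> (b' \<otimes> d')" .
  qed (use m a c den in \<open>auto simp: fr_mem_iff den_def\<close>)
  then have "(\<Union>(a', b')\<in>fr a b. \<Union>(c', d')\<in>fr c d. fr (a' \<otimes> c') (b' \<otimes> d')) = fr (a \<otimes> c) (b \<otimes> d)"
    by (intro UN_pair_const[OF fr_mem[OF a]] UN_pair_const[OF fr_mem[OF c]])
  then show ?thesis by (simp add: frac_algebra_def)
qed

lemma Fr_add:
  assumes a: "a \<in> carrier R" "den b" and c: "c \<in> carrier R" "den d"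
  shows "fr a b \<oplus>\<^bsub>Fr\<^esub> fr c d = fr (a \<otimes> d \<oplus> c \<otimes> b) (b \<otimes> d)"
proof -
  have "fr (a' \<otimes> d' \<oplus> c' \<otimes> b') (b' \<otimes> d') = fr (a \<otimes> d \<oplus> c \<otimes> b) (b \<otimes> d)"
    if m: "(a', b') \<in> fr a b" "(c', d') \<in> fr c d" for a' b' c' d'
  proof (rule fr_eqI)
    have e: "a' \<in> carrier R" "b' \<in> carrier R" "c' \<in> carrier R" "d' \<in> carrier R"
      "a \<otimes> b' = a' \<otimes> b" "c \<otimes> d' = c' \<otimes> d" using m by (auto simp: fr_mem_iff)
    note k = e(1-4) a(1) c(1) den(1)[OF a(2)] den(1)[OF c(2)]
    have "(a' \<otimes> d' \<oplus> c' \<otimes> b') \<otimes> (b \<otimes> d) = (a' \<otimes> b) \<otimes> (d' \<otimes> d) \<oplus> (c' \<otimes> d) \<otimes> (b' \<otimes> b)"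
      using k by (simp add: l_distr r_distr m_ac)
    also have "\<dots> = (a \<otimes> b') \<otimes> (d' \<otimes> d) \<oplus> (c \<otimes> d') \<otimes> (b' \<otimes> b)" using e(5,6) by simp
    also have "\<dots> = (a \<otimes> d \<oplus> c \<otimes> b) \<otimes> (b' \<otimes> d')" using k by (simp add: l_distr r_distr m_ac)
    finally show "(a' \<otimes> d' \<oplus> c' \<otimes> b') \<otimes> (b \<otimes> d) = (a \<otimes> d \<oplus> c \<otimes> b) \<otimes> (b' \<otimes> d')" .
  qed (use m a c den in \<open>auto simp: fr_mem_iff den_def\<close>)
  then have "(\<Union>(a', b')\<in>fr a b. \<Union>(c', d')\<in>fr c d. fr (a' \<otimes> d' \<oplus> c' \<otimes> b') (b' \<otimes> d')) =
      fr (a \<otimes> d \<oplus> c \<otimes> b) (b \<otimes> d)"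
    by (intro UN_pair_const[OF fr_mem[OF a]] UN_pair_const[OF fr_mem[OF c]])
  then show ?thesis by (simp add: frac_algebra_def)
qed

lemma Fr_smult:
  assumes s: "s \<in> carrier K" and a: "a \<in> carrier R" "den b"
  shows "s \<odot>\<^bsub>Fr\<^esub> fr a b = fr (s \<odot> a) b"
proof -
  have "fr (s \<odot> a') b' = fr (s \<odot> a) b" if m: "(a', b') \<in> fr a b" for a' b'
  proof (rule fr_eqI)
    show "s \<odot> a' \<otimes> b = s \<odot> a \<otimes> b'"
      using m s a den(1)[OF a(2)] by (simp add: fr_mem_iff smult_assoc2)
  qed (use m a s in \<open>auto simp: fr_mem_iff den_def\<close>)
  then have "(\<Union>(a', b')\<in>fr a b. fr (s \<odot> a') b') = fr (s \<odot> a) b"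
    by (intro UN_pair_const[OF fr_mem[OF a]])
  then show ?thesis by (simp add: frac_algebra_def)
qed

lemma Fr_one_zero: "\<one>\<^bsub>Fr\<^esub> = fr \<one> \<one>" "\<zero>\<^bsub>Fr\<^esub> = fr \<zero> \<one>"
  by (simp_all add: frac_algebra_def)

lemma Fr_cases:
  assumes "X \<in> carrier Fr"
  obtains a b where "X = fr a b" "a \<in> carrier R" "den b" "b \<in> carrier R"
  using assms den(1) unfolding Fr_carrier by blast

lemma Fr_cring: "cring Fr"
proof (rule cringI)
  show "abelian_group Fr"
  proof (rule abelian_groupI)
    show "\<zero>\<^bsub>Fr\<^esub> \<in> carrier Fr" unfolding Fr_one_zero by (rule fr_closed) (simp_all add: den(2))
    fix X assume "X \<in> carrier Fr"
    then obtain a b where X: "X = fr a b" "a \<in> carrier R" "den b" "b \<in> carrier R" by (rule Fr_cases)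
    show "\<zero>\<^bsub>Fr\<^esub> \<oplus>\<^bsub>Fr\<^esub> X = X" using X by (simp add: Fr_one_zero Fr_add den(2))
    have "fr (\<ominus> a) b \<oplus>\<^bsub>Fr\<^esub> X = fr (\<ominus> a \<otimes> b \<oplus> a \<otimes> b) (b \<otimes> b)" using X by (simp add: Fr_add)
    also have "\<dots> = fr \<zero> \<one>" by (rule fr_eqI) (use X den in \<open>auto simp: l_minus l_neg\<close>)
    finally show "\<exists>Y\<in>carrier Fr. Y \<oplus>\<^bsub>Fr\<^esub> X = \<zero>\<^bsub>Fr\<^esub>"
      unfolding Fr_one_zero using fr_closed[of "\<ominus> a" b] X by (intro bexI[of _ "fr (\<ominus> a) b"]) auto
    fix Y assume "Y \<in> carrier Fr"
    then obtain c d where Y: "Y = fr c d" "c \<in> carrier R" "den d" "d \<in> carrier R" by (rule Fr_cases)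
    show "X \<oplus>\<^bsub>Fr\<^esub> Y \<in> carrier Fr" using X Y by (auto simp: Fr_add intro!: fr_closed den(3))
    show "X \<oplus>\<^bsub>Fr\<^esub> Y = Y \<oplus>\<^bsub>Fr\<^esub> X" using X Y by (simp add: Fr_add m_comm a_comm)
    fix Z assume "Z \<in> carrier Fr"
    then obtain e f where Z: "Z = fr e f" "e \<in> carrier R" "den f" "f \<in> carrier R" by (rule Fr_cases)
    show "X \<oplus>\<^bsub>Fr\<^esub> Y \<oplus>\<^bsub>Fr\<^esub> Z = X \<oplus>\<^bsub>Fr\<^esub> (Y \<oplus>\<^bsub>Fr\<^esub> Z)"
      using X Y Z by (simp add: Fr_add den(3) l_distr r_distr m_ac a_ac)
  qed
  show "comm_monoid Fr"
  proof (rule comm_monoidI)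
    show "\<one>\<^bsub>Fr\<^esub> \<in> carrier Fr" unfolding Fr_one_zero by (rule fr_closed) (simp_all add: den(2))
    fix X assume "X \<in> carrier Fr"
    then obtain a b where X: "X = fr a b" "a \<in> carrier R" "den b" "b \<in> carrier R" by (rule Fr_cases)
    show "\<one>\<^bsub>Fr\<^esub> \<otimes>\<^bsub>Fr\<^esub> X = X" using X by (simp add: Fr_one_zero Fr_mult den(2))
    fix Y assume "Y \<in> carrier Fr"
    then obtain c d where Y: "Y = fr c d" "c \<in> carrier R" "den d" "d \<in> carrier R" by (rule Fr_cases)
    show "X \<otimes>\<^bsub>Fr\<^esub> Y \<in> carrier Fr" using X Y by (auto simp: Fr_mult intro!: fr_closed den(3))
    show "X \<otimes>\<^bsub>Fr\<^esub> Y = Y \<otimes>\<^bsub>Fr\<^esub> X" using X Y by (simp add: Fr_mult m_comm)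
    fix Z assume "Z \<in> carrier Fr"
    then obtain e f where Z: "Z = fr e f" "e \<in> carrier R" "den f" "f \<in> carrier R" by (rule Fr_cases)
    show "X \<otimes>\<^bsub>Fr\<^esub> Y \<otimes>\<^bsub>Fr\<^esub> Z = X \<otimes>\<^bsub>Fr\<^esub> (Y \<otimes>\<^bsub>Fr\<^esub> Z)" using X Y Z by (simp add: Fr_mult den(3) m_assoc)
  qed
  fix X Y Z assume XYZ: "X \<in> carrier Fr" "Y \<in> carrier Fr" "Z \<in> carrier Fr"
  obtain a b where X: "X = fr a b" "a \<in> carrier R" "den b" "b \<in> carrier R" by (rule Fr_cases[OF XYZ(1)])
  obtain c d where Y: "Y = fr c d" "c \<in> carrier R" "den d" "d \<in> carrier R" by (rule Fr_cases[OF XYZ(2)])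
  obtain e f where Z: "Z = fr e f" "e \<in> carrier R" "den f" "f \<in> carrier R" by (rule Fr_cases[OF XYZ(3)])
  have "(X \<oplus>\<^bsub>Fr\<^esub> Y) \<otimes>\<^bsub>Fr\<^esub> Z = fr ((a \<otimes> d \<oplus> c \<otimes> b) \<otimes> e) ((b \<otimes> d) \<otimes> f)"
    using X Y Z by (simp add: Fr_add Fr_mult den(3))
  also have "\<dots> = fr ((a \<otimes> e) \<otimes> (d \<otimes> f) \<oplus> (c \<otimes> e) \<otimes> (b \<otimes> f)) ((b \<otimes> f) \<otimes> (d \<otimes> f))"
    by (rule fr_eqI) (use X Y Z in \<open>auto simp: den(3) l_distr r_distr m_ac\<close>)
  also have "\<dots> = X \<otimes>\<^bsub>Fr\<^esub> Z \<oplus>\<^bsub>Fr\<^esub> Y \<otimes>\<^bsub>Fr\<^esub> Z" using X Y Z by (simp add: Fr_add Fr_mult den(3))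
  finally show "(X \<oplus>\<^bsub>Fr\<^esub> Y) \<otimes>\<^bsub>Fr\<^esub> Z = X \<otimes>\<^bsub>Fr\<^esub> Z \<oplus>\<^bsub>Fr\<^esub> Y \<otimes>\<^bsub>Fr\<^esub> Z" .
qed

lemma Fr_field: "field Fr"
proof (rule cring.cring_fieldI2[OF Fr_cring])
  have "fr \<zero> \<one> \<noteq> fr \<one> \<one>" by (subst fr_eq_iff) auto
  then show "\<zero>\<^bsub>Fr\<^esub> \<noteq> \<one>\<^bsub>Fr\<^esub>" by (simp add: Fr_one_zero)
  fix X assume Xc: "X \<in> carrier Fr" and nz: "X \<noteq> \<zero>\<^bsub>Fr\<^esub>"
  obtain a b where X: "X = fr a b" "a \<in> carrier R" "den b" "b \<in> carrier R" by (rule Fr_cases[OF Xc])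
  have "a \<noteq> \<zero>"
  proof
    assume "a = \<zero>"
    then have "fr a b = fr \<zero> \<one>" using X by (intro fr_eqI) (auto simp: den(2))
    then show False using nz X by (simp add: Fr_one_zero)
  qed
  then have a: "den a" using X by (simp add: den_def)
  have "X \<otimes>\<^bsub>Fr\<^esub> fr b a = fr \<one> \<one>"
    unfolding X(1) Fr_mult[OF X(2,3,4) a] by (rule fr_eqI) (use X a den in \<open>auto simp: m_comm\<close>)
  then show "\<exists>Y\<in>carrier Fr. X \<otimes>\<^bsub>Fr\<^esub> Y = \<one>\<^bsub>Fr\<^esub>"
    using fr_closed[OF X(4) a] by (auto simp: Fr_one_zero)
qed

lemma Fr_algebra: "algebra K Fr"
proof (rule algebraI)
  show "cring K" by (rule R.cring_axioms)
  show "cring Fr" by (rule Fr_cring)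
  fix X assume Xc: "X \<in> carrier Fr"
  obtain a b where X: "X = fr a b" "a \<in> carrier R" "den b" "b \<in> carrier R" by (rule Fr_cases[OF Xc])
  show "\<one>\<^bsub>K\<^esub> \<odot>\<^bsub>Fr\<^esub> X = X" using X by (simp add: Fr_smult)
  fix s assume s: "s \<in> carrier K"
  show "s \<odot>\<^bsub>Fr\<^esub> X \<in> carrier Fr" using X s by (auto simp: Fr_smult intro!: fr_closed)
  {
    fix t assume t: "t \<in> carrier K"
    have "(s \<oplus>\<^bsub>K\<^esub> t) \<odot>\<^bsub>Fr\<^esub> X = fr (s \<odot> a \<oplus> t \<odot> a) b" using X s t by (simp add: Fr_smult smult_l_distr)
    also have "\<dots> = fr ((s \<odot> a) \<otimes> b \<oplus> (t \<odot> a) \<otimes> b) (b \<otimes> b)"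
      by (rule fr_eqI) (use X s t in \<open>auto simp: den(3) l_distr r_distr m_ac\<close>)
    finally show "(s \<oplus>\<^bsub>K\<^esub> t) \<odot>\<^bsub>Fr\<^esub> X = s \<odot>\<^bsub>Fr\<^esub> X \<oplus>\<^bsub>Fr\<^esub> t \<odot>\<^bsub>Fr\<^esub> X" using X s t by (simp add: Fr_smult Fr_add)
    show "(s \<otimes>\<^bsub>K\<^esub> t) \<odot>\<^bsub>Fr\<^esub> X = s \<odot>\<^bsub>Fr\<^esub> (t \<odot>\<^bsub>Fr\<^esub> X)" using X s t by (simp add: Fr_smult smult_assoc1)
  }
  fix Y assume Yc: "Y \<in> carrier Fr"
  obtain c d where Y: "Y = fr c d" "c \<in> carrier R" "den d" "d \<in> carrier R" by (rule Fr_cases[OF Yc])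
  show "s \<odot>\<^bsub>Fr\<^esub> (X \<oplus>\<^bsub>Fr\<^esub> Y) = s \<odot>\<^bsub>Fr\<^esub> X \<oplus>\<^bsub>Fr\<^esub> s \<odot>\<^bsub>Fr\<^esub> Y"
    using X Y s by (simp add: Fr_smult Fr_add den(3) smult_r_distr smult_assoc2)
  show "s \<odot>\<^bsub>Fr\<^esub> X \<otimes>\<^bsub>Fr\<^esub> Y = s \<odot>\<^bsub>Fr\<^esub> (X \<otimes>\<^bsub>Fr\<^esub> Y)"
    using X Y s by (simp add: Fr_smult Fr_mult den(3) smult_assoc2)
qed

definition frac_of where "frac_of a = fr a \<one>"

lemma frac_of:
  "a \<in> carrier R \<Longrightarrow> frac_of a \<in> carrier Fr" "frac_of \<one> = \<one>\<^bsub>Fr\<^esub>" "frac_of \<zero> = \<zero>\<^bsub>Fr\<^esub>"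
  "a \<in> carrier R \<Longrightarrow> b \<in> carrier R \<Longrightarrow> frac_of (a \<otimes> b) = frac_of a \<otimes>\<^bsub>Fr\<^esub> frac_of b"
  "a \<in> carrier R \<Longrightarrow> b \<in> carrier R \<Longrightarrow> frac_of (a \<oplus> b) = frac_of a \<oplus>\<^bsub>Fr\<^esub> frac_of b"
  "s \<in> carrier K \<Longrightarrow> a \<in> carrier R \<Longrightarrow> frac_of (s \<odot> a) = s \<odot>\<^bsub>Fr\<^esub> frac_of a"
  "a \<in> carrier R \<Longrightarrow> frac_of a = \<zero>\<^bsub>Fr\<^esub> \<Longrightarrow> a = \<zero>"
  by (auto simp: frac_of_def Fr_one_zero fr_closed Fr_mult Fr_add Fr_smult den(2) fr_eq_iff)

end

section \<open>Algebraic independence of the indeterminates\<close>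

lemma hom_monomial_at:
  assumes "ring R" "ring S" and h: "h \<in> ring_hom R S"
  shows "set bs \<subseteq> carrier R \<Longrightarrow> length \<alpha> = length bs \<Longrightarrow> h (monomial_at R bs \<alpha>) = monomial_at S (map h bs) \<alpha>"
proof (induction bs arbitrary: \<alpha>)
  interpret R: ring R by fact
  interpret S: ring S by fact
  interpret H: ring_hom_ring R S h by (rule ring_hom_ringI2) fact+
  {
    case Nil then show ?case by simp
  next
    case (Cons b bs)
    then obtain n \<beta> where a: "\<alpha> = n # \<beta>" "length \<beta> = length bs" by (cases \<alpha>) auto
    then show ?case using Cons R.monomial_at_closed[of bs \<beta>] H.hom_nat_pow by simp
  }
qed

context mpoly
begin

lemma mon_pow:
  assumes "\<alpha> \<in> L"
  shows "mon \<alpha> [^]\<^bsub>P\<^esub> (n::nat) = mon (map ((*) n) \<alpha>)"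
proof (induction n)
  case 0
  have "map (\<lambda>a. 0 :: nat) \<alpha> = replicate m 0" using assms by (intro nth_equalityI) auto
  then show ?case by simp
next
  case (Suc n)
  have "map ((*) n) \<alpha> +\<^sub>e \<alpha> = map ((*) (Suc n)) \<alpha>" by (rule nth_equalityI) auto
  then show ?case using Suc mon_mult[of "map ((*) n) \<alpha>" \<alpha>] assms by (simp del: mult_Suc)
qed

text \<open>Exponents of products of powers are linear combinations of the exponents
  \<open>vs\<close>; for unit vectors the combination is \<alpha> itself.\<close>

lemma monomial_at_mon:
  "set vs \<subseteq> L \<Longrightarrow> length \<alpha> = length vs \<Longrightarrow>
    \<exists>\<gamma>\<in>L. monomial_at P (map mon vs) \<alpha> = mon \<gamma> \<and> (\<forall>i<m. \<gamma> ! i = (\<Sum>l<length vs. \<alpha> ! l * (vs ! l) ! i))"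
proof (induction vs arbitrary: \<alpha>)
  case Nil
  then show ?case by (intro bexI[of _ "replicate m 0"]) auto
next
  case (Cons v vs)
  then obtain n \<beta> where a: "\<alpha> = n # \<beta>" "length \<beta> = length vs" by (cases \<alpha>) auto
  obtain \<gamma> where \<gamma>: "\<gamma> \<in> L" "monomial_at P (map mon vs) \<beta> = mon \<gamma>"
    "\<forall>i<m. \<gamma> ! i = (\<Sum>l<length vs. \<beta> ! l * (vs ! l) ! i)"
    using Cons.IH[of \<beta>] Cons.prems a by auto
  have v: "v \<in> L" using Cons.prems by simp
  have "monomial_at P (map mon (v # vs)) \<alpha> = mon (map ((*) n) v +\<^sub>e \<gamma>)"
    using a \<gamma> mon_pow[OF v] mon_mult[of "map ((*) n) v" \<gamma>] v by simp
  moreover have "(map ((*) n) v +\<^sub>e \<gamma>) ! i = (\<Sum>l<length (v # vs). \<alpha> ! l * ((v # vs) ! l) ! i)" if "i < m" for i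
    using that v \<gamma> a by (simp add: sum.lessThan_Suc_shift del: sum.lessThan_Suc)
  moreover have "map ((*) n) v +\<^sub>e \<gamma> \<in> L" using v \<gamma> by simp
  ultimately show ?case by blast
qed

definition variables where "variables = map (\<lambda>l. mon (unit_vector m l)) [0..<m]"

lemma monomial_at_variables:
  assumes "\<alpha> \<in> L"
  shows "monomial_at P variables \<alpha> = mon \<alpha>"
proof -
  let ?vs = "map (unit_vector m) [0..<m]"
  have vs: "set ?vs \<subseteq> L" and len: "length \<alpha> = length ?vs" using assms by auto
  from monomial_at_mon[OF vs len]
  obtain \<gamma> where \<gamma>: "\<gamma> \<in> L" "monomial_at P (map mon ?vs) \<alpha> = mon \<gamma>"
    "\<forall>i<m. \<gamma> ! i = (\<Sum>l<length ?vs. \<alpha> ! l * (?vs ! l) ! i)"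
    by blast
  have "\<gamma> = \<alpha>"
  proof (rule nth_equalityI)
    fix i assume "i < length \<gamma>"
    then have i: "i < m" using \<gamma>(1) by simp
    have "\<gamma> ! i = (\<Sum>l<m. \<alpha> ! l * (?vs ! l) ! i)" using \<gamma>(3) i by simp
    also have "\<dots> = (\<Sum>l<m. if l = i then \<alpha> ! l else 0)"
    proof (rule sum.cong[OF refl])
      fix l assume "l \<in> {..<m}"
      then show "\<alpha> ! l * (?vs ! l) ! i = (if l = i then \<alpha> ! l else 0)"
        using i by (simp add: unit_vector_def nth_list_update)
    qed
    finally show "\<gamma> ! i = \<alpha> ! i" using i by simp
  qed (use \<gamma> assms in simp)
  then show ?thesis using \<gamma>(2) by (simp add: variables_def comp_def)
qed

sublocale Fr: fractions K P
  by (intro fractions.intro P_algebra P_domain field_axioms)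

lemma rational_functions_field: "field (rational_functions K m)"
  and rational_functions_algebra: "algebra K (rational_functions K m)"
  unfolding rational_functions_def by (rule Fr.Fr_field, rule Fr.Fr_algebra)

text \<open>A relation between the indeterminates in the fraction field comes from one between
  polynomials, since the embedding is injective; there the coefficient at \<alpha> can be read
  off.\<close>

lemma rational_functions_variables:
  "\<exists>xs. length xs = m \<and> alg_independent K (rational_functions K m) xs"
proof (intro exI conjI)
  let ?xs = "map Fr.frac_of variables"
  show "length ?xs = m" by (simp add: variables_def)
  have hom: "Fr.frac_of \<in> ring_hom P Fr.Fr"
    by (rule ring_hom_memI) (rule Fr.frac_of | assumption)+
  have v: "set variables \<subseteq> carrier P" by (auto simp: variables_def intro!: mon_closed)
  have rP: "ring P" and rF: "ring Fr.Fr"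
    using P_cring Fr.Fr_cring cring.axioms(1) by auto
  have mono: "monomial_at Fr.Fr ?xs \<alpha> = Fr.frac_of (mon \<alpha>)" if "\<alpha> \<in> L" for \<alpha>
    using hom_monomial_at[OF rP rF hom v, of \<alpha>] monomial_at_variables[OF that] that
    by (simp add: variables_def)
  have amP: "abelian_monoid P" and amF: "abelian_monoid Fr.Fr"
    using rP rF by (simp_all add: ring_def abelian_group_def)
  show "alg_independent K (rational_functions K m) ?xs"
    unfolding alg_independent_def rational_functions_def
  proof (intro conjI allI impI ballI)
    show "set ?xs \<subseteq> carrier Fr.Fr" using v Fr.frac_of(1) by auto
    fix S c \<alpha> assume S: "finite S \<and> S \<subseteq> {\<alpha>. length \<alpha> = length ?xs}" and c: "c \<in> S \<rightarrow> carrier K"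
      and z: "(\<Oplus>\<^bsub>Fr.Fr\<^esub>\<alpha>\<in>S. c \<alpha> \<odot>\<^bsub>Fr.Fr\<^esub> monomial_at Fr.Fr ?xs \<alpha>) = \<zero>\<^bsub>Fr.Fr\<^esub>" and \<alpha>: "\<alpha> \<in> S"
    have SL: "\<And>\<beta>. \<beta> \<in> S \<Longrightarrow> \<beta> \<in> L" using S by (auto simp: variables_def)
    have cc: "\<And>\<beta>. \<beta> \<in> S \<Longrightarrow> c \<beta> \<in> carrier K" using c by auto
    have cm: "\<And>\<beta>. \<beta> \<in> S \<Longrightarrow> (\<lambda>\<gamma>. c \<beta> \<otimes> mon \<beta> \<gamma>) \<in> carrier P"
      using P_smult_closed[OF cc mon_closed[OF SL]] by blast
    define p where "p = (\<Oplus>\<^bsub>P\<^esub>\<beta>\<in>S. (\<lambda>\<gamma>. c \<beta> \<otimes> mon \<beta> \<gamma>))"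
    have pc: "p \<in> carrier P" unfolding p_def using cm by (intro abelian_monoid.finsum_closed[OF amP]) auto
    have "Fr.frac_of p = (\<Oplus>\<^bsub>Fr.Fr\<^esub>\<beta>\<in>S. Fr.frac_of (\<lambda>\<gamma>. c \<beta> \<otimes> mon \<beta> \<gamma>))"
      unfolding p_def
      by (rule finsum_hom[OF amP amF, where h = Fr.frac_of and f = "\<lambda>\<beta> \<gamma>. c \<beta> \<otimes> mon \<beta> \<gamma>"])
        (use cm Fr.frac_of(1,3,5) in \<open>auto simp del: P_simps\<close>)
    also have "\<dots> = (\<Oplus>\<^bsub>Fr.Fr\<^esub>\<alpha>\<in>S. c \<alpha> \<odot>\<^bsub>Fr.Fr\<^esub> monomial_at Fr.Fr ?xs \<alpha>)"
    proof (intro abelian_monoid.finsum_cong'[OF amF] refl Pi_I)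
      fix \<beta> assume b: "\<beta> \<in> S"
      have e: "Fr.frac_of (\<lambda>\<gamma>. c \<beta> \<otimes> mon \<beta> \<gamma>) = c \<beta> \<odot>\<^bsub>Fr.Fr\<^esub> Fr.frac_of (mon \<beta>)"
        using Fr.frac_of(6)[OF cc[OF b] mon_closed[OF SL[OF b]]] by simp
      show "Fr.frac_of (\<lambda>\<gamma>. c \<beta> \<otimes> mon \<beta> \<gamma>) = c \<beta> \<odot>\<^bsub>Fr.Fr\<^esub> monomial_at Fr.Fr ?xs \<beta>"
        using e mono[OF SL[OF b]] by simp
      show "c \<beta> \<odot>\<^bsub>Fr.Fr\<^esub> monomial_at Fr.Fr ?xs \<beta> \<in> carrier Fr.Fr"
        using mono[OF SL[OF b]] Fr.frac_of(6)[OF cc[OF b] mon_closed[OF SL[OF b]]]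
          Fr.frac_of(1)[OF cm[OF b]] by simp
    qed
    finally have "p = \<zero>\<^bsub>P\<^esub>" using z Fr.frac_of(7)[OF pc] by simp
    then have "\<zero> = p \<alpha>" by simp
    also have "\<dots> = (\<Oplus>\<beta>\<in>S. c \<beta> \<otimes> mon \<beta> \<alpha>)"
      unfolding p_def
      by (rule finsum_hom[OF amP abelian_monoid_axioms, where h = "\<lambda>p. p \<alpha>" and f = "\<lambda>\<beta> \<gamma>. c \<beta> \<otimes> mon \<beta> \<gamma>"])
        (use cm P_coeff in auto)
    also have "\<dots> = c \<alpha> \<otimes> mon \<alpha> \<alpha>"
      using S \<alpha> cc by (intro finsum_single) (auto simp: mon_def)
    finally show "c \<alpha> = \<zero>" using cc[OF \<alpha>] by (simp add: mon_def)
  qed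
qed

end


section \<open>Growth of commutative algebras\<close>

text \<open>A Boolean mask selects some of the generators. \<open>spread\<close> turns an exponent
  for the selected ones into an exponent for all of them, with 0 at the other places; exponents that
  are too short are padded with 0.\<close>

fun spread :: "bool list \<Rightarrow> nat list \<Rightarrow> nat list" where
  "spread [] \<beta> = []"
| "spread (False # ms) \<beta> = 0 # spread ms \<beta>"
| "spread (True # ms) [] = 0 # spread ms []"
| "spread (True # ms) (b # \<beta>) = b # spread ms \<beta>"

fun pick :: "bool list \<Rightarrow> 'a list \<Rightarrow> 'a list" where
  "pick (m # ms) (b # bs) = (if m then b # pick ms bs else pick ms bs)"
| "pick _ _ = []"

lemma length_spread [simp]: "length (spread ms \<beta>) = length ms"
  by (induction ms \<beta> rule: spread.induct) auto

lemma spread_support: "l < length ms \<Longrightarrow> \<not> ms ! l \<Longrightarrow> spread ms \<beta> ! l = 0"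
  by (induction ms \<beta> arbitrary: l rule: spread.induct) (auto simp: nth_Cons split: nat.splits)

lemma set_pick: "set (pick ms bs) \<subseteq> set bs"
  by (induction ms bs rule: pick.induct) auto

lemma length_pick: "length ms = length bs \<Longrightarrow> length (pick ms bs) = card {l. l < length ms \<and> ms ! l}"
proof (induction ms bs rule: list_induct2)
  case (Cons m ms b bs)
  have "{l. l < length (m # ms) \<and> (m # ms) ! l} = (if m then {0} else {}) \<union> Suc ` {l. l < length ms \<and> ms ! l}"
  proof (rule Set.set_eqI)
    fix l show "l \<in> {l. l < length (m # ms) \<and> (m # ms) ! l} \<longleftrightarrow> l \<in> (if m then {0} else {}) \<union> Suc ` {l. l < length ms \<and> ms ! l}"
      by (cases l) auto
  qed
  then show ?case using Cons by (simp add: card_image)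
qed simp

lemma spread_inj:
  "length ms = length bs \<Longrightarrow> length \<beta> = length (pick ms bs) \<Longrightarrow> length \<gamma> = length (pick ms bs) \<Longrightarrow>
    spread ms \<beta> = spread ms \<gamma> \<Longrightarrow> \<beta> = \<gamma>"
proof (induction ms bs arbitrary: \<beta> \<gamma> rule: list_induct2)
  case (Cons m ms b bs)
  show ?case
  proof (cases m)
    case True
    then show ?thesis using Cons by (cases \<beta>; cases \<gamma>) auto
  next
    case False
    then show ?thesis using Cons.IH[of \<beta> \<gamma>] Cons.prems by auto
  qed
qed simp

lemma (in ring) monomial_at_spread:
  "length ms = length bs \<Longrightarrow> set bs \<subseteq> carrier R \<Longrightarrow> length \<beta> = length (pick ms bs) \<Longrightarrow>
    monomial_at R bs (spread ms \<beta>) = monomial_at R (pick ms bs) \<beta>"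
proof (induction ms bs arbitrary: \<beta> rule: list_induct2)
  case (Cons m ms b bs)
  have p: "set (pick ms bs) \<subseteq> carrier R" using set_pick[of ms bs] Cons.prems by auto
  show ?case
  proof (cases m)
    case True
    then obtain n \<beta>' where "\<beta> = n # \<beta>'" using Cons.prems by (cases \<beta>) auto
    then show ?thesis using True Cons by auto
  next
    case False
    then show ?thesis using Cons.IH[of \<beta>] Cons.prems monomial_at_closed[OF p] by auto
  qed
qed simp

text \<open>There are at most 2^s choices for the set of places with a large entry. Each of these at
  most M places has i + 1 values, and every other place at most D + 1.\<close>

lemma card_exponents_le:
  "card {\<alpha>. length \<alpha> = s \<and> set \<alpha> \<subseteq> {..i} \<and> card {l. l < s \<and> D \<le> \<alpha> ! l} \<le> M} \<le> 2 ^ s * (D + 1) ^ s * (i + 1) ^ M"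
  (is "card ?X \<le> _")
proof -
  define Z where "Z Y = {\<alpha> :: nat list. length \<alpha> = s \<and> (\<forall>l<s. \<alpha> ! l \<in> (if l \<in> Y then {..i} else {..D}))}" for Y
  have Z: "finite (Z Y) \<and> card (Z Y) \<le> (D + 1) ^ s * (i + 1) ^ M" if Y: "Y \<subseteq> {..<s}" "card Y \<le> M" for Y
  proof -
    let ?P = "PiE {..<s} (\<lambda>l. if l \<in> Y then {..i} else {..D})"
    let ?h = "\<lambda>\<alpha>. \<lambda>l\<in>{..<s}. \<alpha> ! l :: nat"
    have inj: "inj_on ?h (Z Y)"
    proof (rule inj_onI)
      fix \<alpha> \<beta> assume "\<alpha> \<in> Z Y" "\<beta> \<in> Z Y" and eq: "?h \<alpha> = ?h \<beta>"
      then have len: "length \<alpha> = s" "length \<beta> = s" by (auto simp: Z_def)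
      show "\<alpha> = \<beta>"
      proof (rule nth_equalityI)
        fix l assume "l < length \<alpha>"
        then show "\<alpha> ! l = \<beta> ! l" using fun_cong[OF eq, of l] len by simp
      qed (simp add: len)
    qed
    have sub: "?h ` Z Y \<subseteq> ?P" by (auto simp: Z_def split: if_splits)
    have finP: "finite ?P" by (intro finite_PiE) auto
    have "finite (Z Y)" using inj sub finP by (metis finite_imageD finite_subset)
    moreover have "card (Z Y) \<le> (D + 1) ^ s * (i + 1) ^ M"
    proof -
      have "card (Z Y) \<le> card ?P" using card_image[OF inj] card_mono[OF finP sub] by simp
      also have "\<dots> = (\<Prod>l<s. card (if l \<in> Y then {..i} else {..D}))" by (simp add: card_PiE)
      also have "\<dots> \<le> (\<Prod>l<s. (D + 1) * (if l \<in> Y then i + 1 else 1))" by (intro prod_mono) auto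
      also have "\<dots> = (D + 1) ^ s * (\<Prod>l<s. if l \<in> Y then i + 1 else 1)"
        unfolding prod.distrib by simp
      also have "(\<Prod>l<s. if l \<in> Y then i + 1 else 1) = (i + 1) ^ card Y"
        using Y(1) by (simp add: prod.If_cases Int_absorb1 Int_absorb2)
      also have "(D + 1) ^ s * (i + 1) ^ card Y \<le> (D + 1) ^ s * (i + 1) ^ M"
        using Y(2) by (intro mult_left_mono power_increasing) auto
      finally show ?thesis .
    qed
    ultimately show ?thesis by simp
  qed
  have "?X \<subseteq> (\<Union>Y\<in>{Y. Y \<subseteq> {..<s} \<and> card Y \<le> M}. Z Y)"
  proof
    fix \<alpha> assume a: "\<alpha> \<in> ?X"
    have "\<alpha> \<in> Z {l. l < s \<and> D \<le> \<alpha> ! l}" using a by (auto simp: Z_def subset_iff)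
    then show "\<alpha> \<in> (\<Union>Y\<in>{Y. Y \<subseteq> {..<s} \<and> card Y \<le> M}. Z Y)" using a by blast
  qed
  moreover have fin: "finite {Y. Y \<subseteq> {..<s} \<and> card Y \<le> M}" by simp
  ultimately have "card ?X \<le> card (\<Union>Y\<in>{Y. Y \<subseteq> {..<s} \<and> card Y \<le> M}. Z Y)"
    using Z by (intro card_mono finite_UN_I) auto
  also have "\<dots> \<le> (\<Sum>Y\<in>{Y. Y \<subseteq> {..<s} \<and> card Y \<le> M}. card (Z Y))" by (rule card_UN_le[OF fin])
  also have "\<dots> \<le> of_nat (card {Y. Y \<subseteq> {..<s} \<and> card Y \<le> M}) * ((D + 1) ^ s * (i + 1) ^ M)"
    using Z by (intro sum_bounded_above) auto
  also have "card {Y. Y \<subseteq> {..<s} \<and> card Y \<le> M} \<le> card (Pow {..<s})" by (intro card_mono) auto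
  then have "of_nat (card {Y. Y \<subseteq> {..<s} \<and> card Y \<le> M}) * ((D + 1) ^ s * (i + 1) ^ M) \<le> 2 ^ s * ((D + 1) ^ s * (i + 1) ^ M)"
    by (intro mult_right_mono) (auto simp: card_Pow)
  finally show ?thesis by (simp add: mult.assoc)
qed

lemma growth_le_polynomial:
  assumes "\<And>i. f i \<le> C * (i + 1) ^ M"
  shows "growth f \<le> ereal (real M)"
proof (rule growth_le_mult[where C = "real C * 2 ^ M"])
  have "real (f i) \<le> real C * 2 ^ M * real i powr real M" if i: "1 \<le> i" for i
  proof -
    have "real (f i) \<le> real (C * (i + 1) ^ M)" using assms[of i] by (simp only: of_nat_le_iff)
    also have "\<dots> = real C * (real i + 1) ^ M" by (simp add: add.commute)
    also have "\<dots> \<le> real C * (2 * real i) ^ M" using i by (intro mult_left_mono power_mono) auto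
    also have "\<dots> = real C * 2 ^ M * real i powr real M" using i by (simp add: power_mult_distrib powr_realpow)
    finally show ?thesis .
  qed
  then show "eventually (\<lambda>i. real (f i) \<le> real C * 2 ^ M * real i powr real M) sequentially"
    by (rule eventually_sequentiallyI)
qed simp

locale commutative_generators = assoc_algebra K A for K :: "('k, 'x) ring_scheme" and A :: "('k, 'a) module" (structure) +
  fixes bs :: "'a list"
  assumes comm: "\<And>x y. x \<in> carrier A \<Longrightarrow> y \<in> carrier A \<Longrightarrow> x \<otimes> y = y \<otimes> x"
    and bs: "set bs \<subseteq> carrier A"
begin

abbreviation "s \<equiv> length bs"
abbreviation "monl \<equiv> monomial_at A bs"

lemma mono_closed: "monl \<alpha> \<in> carrier A"
  by (rule A.monomial_at_closed[OF bs])

lemma monos_closed: "monl ` X \<subseteq> carrier A"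
  using mono_closed by auto

lemma mono_add: "length \<alpha> = s \<Longrightarrow> length \<beta> = s \<Longrightarrow> monl (\<alpha> +\<^sub>e \<beta>) = monl \<alpha> \<otimes> monl \<beta>"
  using bs comm by (intro A.monomial_at_add) auto

text \<open>The standard monomials of Groebner basis theory: the exponents outside the initial ideal
  of the relations among \<open>bs\<close>.\<close>

definition standard where
  "standard \<alpha> \<longleftrightarrow> length \<alpha> = s \<and> monl \<alpha> \<notin> span (monl ` {\<beta>. length \<beta> = s \<and> \<beta> \<prec>\<^sub>e \<alpha>})"

text \<open>Multiplying a reduction of the monomial \<alpha> to smaller ones by the monomial
  \<gamma> reduces their product, because \<open>deglex\<close> is compatible with addition.\<close>

lemma standard_divisor:
  assumes "standard (\<alpha> +\<^sub>e \<gamma>)" "length \<alpha> = s" "length \<gamma> = s"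
  shows "standard \<alpha>"
proof (rule ccontr)
  assume "\<not> standard \<alpha>"
  then have m: "monl \<alpha> \<in> span (monl ` {\<beta>. length \<beta> = s \<and> \<beta> \<prec>\<^sub>e \<alpha>})" using assms by (simp add: standard_def)
  let ?N = "span (monl ` {\<beta>. length \<beta> = s \<and> \<beta> \<prec>\<^sub>e \<alpha> +\<^sub>e \<gamma>})"
  have N: "submodule K ?N A" by (rule span_is_submodule[OF monos_closed])
  have "span (monl ` {\<beta>. length \<beta> = s \<and> \<beta> \<prec>\<^sub>e \<alpha>}) \<subseteq> {x \<in> carrier A. x \<otimes> monl \<gamma> \<in> ?N}"
  proof (rule span_subset_submodule[OF submodule_mult_right[OF N mono_closed]], rule image_subsetI)
    fix \<beta> assume b: "\<beta> \<in> {\<beta>. length \<beta> = s \<and> \<beta> \<prec>\<^sub>e \<alpha>}"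
    then have "\<beta> +\<^sub>e \<gamma> \<prec>\<^sub>e \<alpha> +\<^sub>e \<gamma>" using assms by (intro deglex_add) auto
    then have "monl (\<beta> +\<^sub>e \<gamma>) \<in> ?N" using b assms by (intro in_span[OF monos_closed] imageI) auto
    then show "monl \<beta> \<in> {x \<in> carrier A. x \<otimes> monl \<gamma> \<in> ?N}" using b assms mono_closed by (simp add: mono_add)
  qed
  then have "monl \<alpha> \<otimes> monl \<gamma> \<in> ?N" using m by blast
  then show False using assms by (simp add: standard_def mono_add)
qed

text \<open>A non-standard monomial is replaced by deglex-smaller ones, whose degree is no larger.
  The induction is on the number of predecessors, which is finite for \<open>deglex\<close>.\<close>

lemma standard_spans:
  "length \<alpha> = s \<Longrightarrow> monl \<alpha> \<in> span (monl ` {\<beta>. standard \<beta> \<and> sum_list \<beta> \<le> sum_list \<alpha>})"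
proof (induction "card {\<beta>. length \<beta> = s \<and> \<beta> \<prec>\<^sub>e \<alpha>}" arbitrary: \<alpha> rule: less_induct)
  case less
  let ?N = "span (monl ` {\<beta>. standard \<beta> \<and> sum_list \<beta> \<le> sum_list \<alpha>})"
  show ?case
  proof (cases "standard \<alpha>")
    case True
    then show ?thesis by (intro in_span[OF monos_closed] imageI) auto
  next
    case False
    have fin: "finite {\<beta>. length \<beta> = s \<and> \<beta> \<prec>\<^sub>e \<alpha>}"
      by (rule finite_subset[OF _ finite_exponents[of s "sum_list \<alpha>"]]) (auto simp: deglex_sum_le)
    have "monl ` {\<beta>. length \<beta> = s \<and> \<beta> \<prec>\<^sub>e \<alpha>} \<subseteq> ?N"
    proof (rule image_subsetI)
      fix \<beta> assume b: "\<beta> \<in> {\<beta>. length \<beta> = s \<and> \<beta> \<prec>\<^sub>e \<alpha>}"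
      then have "{\<gamma>. length \<gamma> = s \<and> \<gamma> \<prec>\<^sub>e \<beta>} \<subset> {\<gamma>. length \<gamma> = s \<and> \<gamma> \<prec>\<^sub>e \<alpha>}"
        using deglex_trans deglex_irrefl by blast
      then have "monl \<beta> \<in> span (monl ` {\<gamma>. standard \<gamma> \<and> sum_list \<gamma> \<le> sum_list \<beta>})"
        using b by (intro less.hyps psubset_card_mono[OF fin]) auto
      moreover have "span (monl ` {\<gamma>. standard \<gamma> \<and> sum_list \<gamma> \<le> sum_list \<beta>}) \<subseteq> ?N"
        using b deglex_sum_le[of \<beta> \<alpha>] by (intro span_is_monotone image_mono) auto
      ultimately show "monl \<beta> \<in> ?N" by blast
    qed
    then have "span (monl ` {\<beta>. length \<beta> = s \<and> \<beta> \<prec>\<^sub>e \<alpha>}) \<subseteq> ?N"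
      by (intro span_subset_submodule span_is_submodule[OF monos_closed])
    then show ?thesis using False less.prems by (auto simp: standard_def)
  qed
qed

lemma filt_monomials: "filt (set bs) i \<subseteq> span (monl ` {\<beta>. length \<beta> = s \<and> sum_list \<beta> \<le> i})"
proof -
  let ?M = "\<lambda>i. monl ` {\<beta>. length \<beta> = s \<and> sum_list \<beta> \<le> i}"
  show "filt (set bs) i \<subseteq> span (?M i)"
  proof (rule filt_induct[OF bs])
    show "submodule K (span (?M i)) A" for i by (rule span_is_submodule[OF monos_closed])
    have "monl (replicate s 0) \<in> span (?M 0)" by (intro in_span[OF monos_closed] imageI) simp
    then show "\<one> \<in> span (?M 0)" by simp
    fix i x y assume x: "x \<in> span (?M i)" and y: "y \<in> insert \<one> (set bs)"
    show "x \<otimes> y \<in> span (?M (Suc i))"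
    proof (cases "y = \<one>")
      case True
      have "span (?M i) \<subseteq> span (?M (Suc i))" by (intro span_is_monotone image_mono) auto
      moreover have "x \<otimes> \<one> = x" using subsetD[OF span_is_subset2[OF monos_closed] x] by simp
      ultimately show ?thesis using True x by auto
    next
      case False
      then obtain l where l: "l < s" "y = bs ! l" using y by (auto simp: in_set_conv_nth)
      have yl: "y = monl (unit_vector s l)" using A.monomial_at_unit_vector[OF bs l(1)] l(2) by simp
      have sl: "sum_list (unit_vector s l) = 1" using l(1) by (simp add: unit_vector_def sum_list_update)
      have "span (?M i) \<subseteq> {x \<in> carrier A. x \<otimes> y \<in> span (?M (Suc i))}"
      proof (intro span_subset_submodule submodule_mult_right span_is_submodule monos_closed image_subsetI)
        show "y \<in> carrier A" unfolding yl by (rule mono_closed)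
        fix \<beta> assume b: "\<beta> \<in> {\<beta>. length \<beta> = s \<and> sum_list \<beta> \<le> i}"
        then have "monl (\<beta> +\<^sub>e unit_vector s l) \<in> span (?M (Suc i))"
          by (intro in_span[OF monos_closed] imageI) (simp add: sum_list_add_exp sl)
        then show "monl \<beta> \<in> {x \<in> carrier A. x \<otimes> y \<in> span (?M (Suc i))}"
          unfolding yl using b by (simp add: mono_add mono_closed)
      qed
      then show ?thesis using x by blast
    qed
  qed
qed

text \<open>A crude polynomial bound by counting all monomials; it serves to show that A(P) has
  finite growth.\<close>

lemma dim_filt_le_power: "dim_filt (set bs) i \<le> (i + 1) ^ s"
proof -
  let ?J = "{\<beta>. length \<beta> = s \<and> sum_list \<beta> \<le> i}"
  have fJ: "finite ?J" by (rule finite_exponents)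
  have "dim_filt (set bs) i \<le> card (monl ` ?J)"
  proof (rule dim_filt_le_card[OF bs _ _, where w = "\<lambda>x. x"])
    show "(\<lambda>x. x) \<in> monl ` ?J \<rightarrow> carrier A" using monos_closed by auto
    fix x assume "x \<in> filt (set bs) i"
    then have "x \<in> span (monl ` ?J)" using filt_monomials by blast
    then show "\<exists>c\<in>monl ` ?J \<rightarrow> carrier K. x = (\<Oplus>j\<in>monl ` ?J. c j \<odot> j)"
      using span_eq_combinations[OF finite_imageI[OF fJ] monos_closed] by blast
  qed (use fJ in auto)
  also have "\<dots> \<le> card ?J" by (rule card_image_le[OF fJ])
  also have "\<dots> \<le> card {\<beta>. set \<beta> \<subseteq> {..i} \<and> length \<beta> = s}"
  proof (intro card_mono finite_lists_length_eq subsetI)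
    fix \<alpha> assume a: "\<alpha> \<in> ?J"
    have "x \<le> i" if "x \<in> set \<alpha>" for x using member_le_sum_list[OF that] a by simp
    then show "\<alpha> \<in> {\<beta>. set \<beta> \<subseteq> {..i} \<and> length \<beta> = s}" using a by auto
  qed simp
  also have "\<dots> = (i + 1) ^ s" by (simp add: card_lists_length_eq)
  finally show ?thesis .
qed

lemma filt_standard: "filt (set bs) i \<subseteq> span (monl ` {\<beta>. standard \<beta> \<and> sum_list \<beta> \<le> i})"
proof -
  note filt_monomials
  also have "span (monl ` {\<beta>. length \<beta> = s \<and> sum_list \<beta> \<le> i}) \<subseteq> span (monl ` {\<beta>. standard \<beta> \<and> sum_list \<beta> \<le> i})"
  proof (intro span_subset_submodule span_is_submodule[OF monos_closed] image_subsetI)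
    fix \<alpha> assume a: "\<alpha> \<in> {\<beta>. length \<beta> = s \<and> sum_list \<beta> \<le> i}"
    have "span (monl ` {\<beta>. standard \<beta> \<and> sum_list \<beta> \<le> sum_list \<alpha>}) \<subseteq> span (monl ` {\<beta>. standard \<beta> \<and> sum_list \<beta> \<le> i})"
      using a by (intro span_is_monotone image_mono) auto
    then show "monl \<alpha> \<in> span (monl ` {\<beta>. standard \<beta> \<and> sum_list \<beta> \<le> i})" using standard_spans[of \<alpha>] a by blast
  qed
  finally show ?thesis .
qed

text \<open>The M + 1 generators marked by the mask are algebraically dependent, and the
  deglex-largest monomial of a relation between them is a combination of smaller ones.\<close>

lemma nonstandard_exponent:
  assumes dep: "\<And>as. set as \<subseteq> carrier A \<Longrightarrow> length as = Suc M \<Longrightarrow> \<not> alg_independent K A as"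
    and ms: "length ms = s" "card {l. l < s \<and> ms ! l} = Suc M"
  shows "\<exists>\<alpha>. length \<alpha> = s \<and> \<not> standard \<alpha> \<and> (\<forall>l<s. \<not> ms ! l \<longrightarrow> \<alpha> ! l = 0)"
proof -
  let ?as = "pick ms bs"
  have as: "set ?as \<subseteq> carrier A" "length ?as = Suc M" using set_pick[of ms bs] bs length_pick[of ms bs] ms by auto
  obtain X c where X: "finite X" "X \<subseteq> {\<beta>. length \<beta> = length ?as}" and c: "c \<in> X \<rightarrow> carrier K"
    and z: "(\<Oplus>\<beta>\<in>X. c \<beta> \<odot> monomial_at A ?as \<beta>) = \<zero>" and ex: "\<exists>\<beta>\<in>X. c \<beta> \<noteq> \<zero>\<^bsub>K\<^esub>"
    using dep[OF as] as(1) unfolding alg_independent_def by auto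
  define Y where "Y = {\<beta>\<in>X. c \<beta> \<noteq> \<zero>\<^bsub>K\<^esub>}"
  have cY: "\<And>\<beta>. \<beta> \<in> X \<Longrightarrow> c \<beta> \<in> carrier K" using c by auto
  have YX: "finite Y" "Y \<subseteq> X" "Y \<noteq> {}" using X ex by (auto simp: Y_def)
  have mY: "monomial_at A ?as \<beta> = monl (spread ms \<beta>)" if "\<beta> \<in> Y" for \<beta>
    using A.monomial_at_spread[OF ms(1) bs, of \<beta>] that YX X(2) by auto
  have "\<exists>\<alpha>\<in>spread ms ` Y. \<forall>\<beta>\<in>spread ms ` Y. \<beta> \<noteq> \<alpha> \<longrightarrow> \<beta> \<prec>\<^sub>e \<alpha>"
    using YX ms by (intro deglex_max[where m = s]) auto
  then obtain \<beta>0 where \<beta>0: "\<beta>0 \<in> Y" "\<And>\<beta>. \<beta> \<in> Y \<Longrightarrow> spread ms \<beta> \<noteq> spread ms \<beta>0 \<Longrightarrow> spread ms \<beta> \<prec>\<^sub>e spread ms \<beta>0"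
    by auto
  let ?\<alpha> = "spread ms \<beta>0"
  \<comment> \<open>\<open>spread\<close> is injective on exponents of the right length, so
    different terms of the relation stay different and the maximum is strict.\<close>
  have smaller: "spread ms \<beta> \<prec>\<^sub>e ?\<alpha>" if "\<beta> \<in> Y - {\<beta>0}" for \<beta>
  proof (rule \<beta>0(2))
    show "spread ms \<beta> \<noteq> ?\<alpha>"
      using spread_inj[OF ms(1), of \<beta> \<beta>0] that \<beta>0(1) YX(2) X(2) by blast
  qed (use that in auto)
  let ?N = "span (monl ` {\<beta>. length \<beta> = s \<and> \<beta> \<prec>\<^sub>e ?\<alpha>})"
  have N: "submodule K ?N A" by (rule span_is_submodule[OF monos_closed])
  define r where "r = (\<Oplus>\<beta>\<in>Y - {\<beta>0}. c \<beta> \<odot> monomial_at A ?as \<beta>)"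
  have rN: "r \<in> ?N" unfolding r_def
  proof (rule submodule_finsum[OF N], rule Pi_I)
    fix \<beta> assume b: "\<beta> \<in> Y - {\<beta>0}"
    have "monl (spread ms \<beta>) \<in> ?N" using smaller[OF b] ms by (intro in_span[OF monos_closed] imageI) auto
    then show "c \<beta> \<odot> monomial_at A ?as \<beta> \<in> ?N"
      using mY[of \<beta>] b cY[of \<beta>] YX(2) by (auto intro: submodule.smult_closed[OF N])
  qed
  have mc: "\<And>\<beta>. monomial_at A ?as \<beta> \<in> carrier A" by (rule A.monomial_at_closed[OF as(1)])
  have c0: "c \<beta>0 \<in> carrier K" "c \<beta>0 \<noteq> \<zero>\<^bsub>K\<^esub>" using \<beta>0(1) cY by (auto simp: Y_def)
  have "\<zero> = (\<Oplus>\<beta>\<in>Y. c \<beta> \<odot> monomial_at A ?as \<beta>)"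
    unfolding z[symmetric] using X(1) YX(2) cY mc
    by (intro M.finsum_superset) (auto simp: Y_def)
  also have "\<dots> = (\<Oplus>\<beta>\<in>insert \<beta>0 (Y - {\<beta>0}). c \<beta> \<odot> monomial_at A ?as \<beta>)" using \<beta>0(1) by (simp add: insert_absorb)
  also have "\<dots> = c \<beta>0 \<odot> monl ?\<alpha> \<oplus> r"
    unfolding r_def mY[OF \<beta>0(1), symmetric] using YX cY mc c0 by (intro M.finsum_insert) auto
  finally have e: "c \<beta>0 \<odot> monl ?\<alpha> \<oplus> r = \<zero>" by simp
  have rc: "r \<in> carrier A" using rN submodule.subset[OF N] by blast
  have "c \<beta>0 \<odot> monl ?\<alpha> = \<ominus> r"
    using M.minus_equality[OF e rc] c0 mono_closed by simp
  then have "c \<beta>0 \<odot> monl ?\<alpha> \<in> ?N" using submodule_uminus[OF N rN] by simp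
  moreover have ic: "inv\<^bsub>K\<^esub> (c \<beta>0) \<in> carrier K" "inv\<^bsub>K\<^esub> (c \<beta>0) \<otimes>\<^bsub>K\<^esub> c \<beta>0 = \<one>\<^bsub>K\<^esub>" using c0 field_Units by auto
  ultimately have "inv\<^bsub>K\<^esub> (c \<beta>0) \<odot> (c \<beta>0 \<odot> monl ?\<alpha>) \<in> ?N" by (auto intro: submodule.smult_closed[OF N])
  then have "monl ?\<alpha> \<in> ?N" using ic c0 mono_closed by (simp add: smult_assoc1[symmetric])
  then have "\<not> standard ?\<alpha>" by (simp add: standard_def)
  then show ?thesis using ms spread_support[of _ ms \<beta>0] by (intro exI[of _ ?\<alpha>]) auto
qed

text \<open>Choose a non-standard exponent for each of the finitely many sets of M + 1 generators. A
  standard exponent that is large at M + 1 places would be divisible by one of them, so standard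
  exponents are large at no more than M places, and the number of those of degree up to i is of
  order i^M.\<close>

theorem growth_le_transcendence_degree:
  assumes dep: "\<And>as. set as \<subseteq> carrier A \<Longrightarrow> length as = Suc M \<Longrightarrow> \<not> alg_independent K A as"
  shows "growth (dim_filt (set bs)) \<le> ereal M"
proof -
  define masks where "masks = {ms. set ms \<subseteq> (UNIV :: bool set) \<and> length ms = s \<and> card {l. l < s \<and> ms ! l} = Suc M}"
  have fin: "finite masks" unfolding masks_def
    by (rule finite_subset[OF _ finite_lists_length_eq[of "UNIV :: bool set" s]]) auto
  have "\<exists>\<alpha>. length \<alpha> = s \<and> \<not> standard \<alpha> \<and> (\<forall>l<s. \<not> ms ! l \<longrightarrow> \<alpha> ! l = 0)" if "ms \<in> masks" for ms
  proof (rule nonstandard_exponent)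
    show "\<not> alg_independent K A as" if "set as \<subseteq> carrier A" "length as = Suc M" for as
      using that by (rule dep)
  qed (use that in \<open>auto simp: masks_def\<close>)
  then obtain w where w: "\<And>ms. ms \<in> masks \<Longrightarrow> length (w ms) = s" "\<And>ms. ms \<in> masks \<Longrightarrow> \<not> standard (w ms)"
    "\<And>ms l. ms \<in> masks \<Longrightarrow> l < s \<Longrightarrow> \<not> ms ! l \<Longrightarrow> w ms ! l = 0"
    by metis
  \<comment> \<open>Bounds every entry of every chosen exponent; a sum instead of a maximum is also
    meaningful when there are no masks.\<close>
  define D where "D = (\<Sum>ms\<in>masks. sum_list (w ms))"
  have wD: "w ms ! l \<le> D" if "ms \<in> masks" "l < s" for ms l
  proof -
    have "w ms ! l \<le> sum_list (w ms)" using that w(1) by (intro member_le_sum_list) auto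
    also have "\<dots> \<le> D" unfolding D_def using that fin by (intro member_le_sum) auto
    finally show ?thesis .
  qed
  have few: "card {l. l < s \<and> D \<le> \<alpha> ! l} \<le> M" if st: "standard \<alpha>" for \<alpha>
  proof (rule ccontr)
    assume "\<not> card {l. l < s \<and> D \<le> \<alpha> ! l} \<le> M"
    then have "Suc M \<le> card {l. l < s \<and> D \<le> \<alpha> ! l}" by simp
    then obtain Y where Y: "Y \<subseteq> {l. l < s \<and> D \<le> \<alpha> ! l}" "card Y = Suc M"
      by (rule obtain_subset_with_card_n) blast
    define ms where "ms = map (\<lambda>l. l \<in> Y) [0..<s]"
    have "{l. l < s \<and> ms ! l} = Y" using Y(1) by (auto simp: ms_def)
    then have ms: "ms \<in> masks" using Y(2) by (simp add: masks_def ms_def)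
    have len: "length \<alpha> = s" using st by (simp add: standard_def)
    have le: "w ms ! l \<le> \<alpha> ! l" if "l < s" for l
      using w(3)[OF ms that] wD[OF ms that] Y(1) that by (cases "l \<in> Y") (auto simp: ms_def)
    \<comment> \<open>The truncated differences are exact: the chosen exponent vanishes outside Y,
      and on Y it is at most D.\<close>
    define \<gamma> where "\<gamma> = map2 (-) \<alpha> (w ms)"
    have "\<alpha> = w ms +\<^sub>e \<gamma>" using le len w(1)[OF ms] by (intro nth_equalityI) (auto simp: \<gamma>_def)
    then show False using standard_divisor[of "w ms" \<gamma>] st w(1,2)[OF ms] len by (simp add: \<gamma>_def)
  qed
  let ?C = "2 ^ s * (D + 1) ^ s"
  have "dim_filt (set bs) i \<le> ?C * (i + 1) ^ M" for i
  proof -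
    let ?J = "{\<beta>. standard \<beta> \<and> sum_list \<beta> \<le> i}"
    have fJ: "finite ?J" by (rule finite_subset[OF _ finite_exponents[of s i]]) (auto simp: standard_def)
    have "dim_filt (set bs) i \<le> card (monl ` ?J)"
    proof (rule dim_filt_le_card[OF bs _ _, where w = "\<lambda>x. x"])
      show "(\<lambda>x. x) \<in> monl ` ?J \<rightarrow> carrier A" using monos_closed by auto
      fix x assume "x \<in> filt (set bs) i"
      then have "x \<in> span (monl ` ?J)" using filt_standard by blast
      then show "\<exists>c\<in>monl ` ?J \<rightarrow> carrier K. x = (\<Oplus>j\<in>monl ` ?J. c j \<odot> j)"
        using span_eq_combinations[OF finite_imageI[OF fJ] monos_closed] by blast
    qed (use fJ in auto)
    also have "\<dots> \<le> card ?J" by (rule card_image_le[OF fJ])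
    also have "\<dots> \<le> card {\<alpha>. length \<alpha> = s \<and> set \<alpha> \<subseteq> {..i} \<and> card {l. l < s \<and> D \<le> \<alpha> ! l} \<le> M}"
    proof (rule card_mono)
      show "finite {\<alpha>. length \<alpha> = s \<and> set \<alpha> \<subseteq> {..i} \<and> card {l. l < s \<and> D \<le> \<alpha> ! l} \<le> M}"
        by (rule finite_subset[OF _ finite_lists_length_eq[of "{..i}" s]]) auto
      show "?J \<subseteq> {\<alpha>. length \<alpha> = s \<and> set \<alpha> \<subseteq> {..i} \<and> card {l. l < s \<and> D \<le> \<alpha> ! l} \<le> M}"
      proof
        fix \<alpha> assume a: "\<alpha> \<in> ?J"
        have "x \<le> i" if "x \<in> set \<alpha>" for x using member_le_sum_list[OF that] a by simp
        then show "\<alpha> \<in> {\<alpha>. length \<alpha> = s \<and> set \<alpha> \<subseteq> {..i} \<and> card {l. l < s \<and> D \<le> \<alpha> ! l} \<le> M}"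
          using a few by (auto simp: standard_def)
      qed
    qed
    also have "\<dots> \<le> ?C * (i + 1) ^ M" by (rule card_exponents_le)
    finally show ?thesis .
  qed
  then show ?thesis by (rule growth_le_polynomial)
qed

end


section \<open>Subalgebras and endomorphisms\<close>

context assoc_algebra
begin

lemma is_subalgebraI:
  assumes "X \<subseteq> carrier A" "\<one> \<in> X" "\<And>x y. x \<in> X \<Longrightarrow> y \<in> X \<Longrightarrow> x \<oplus> y \<in> X"
    and "\<And>x y. x \<in> X \<Longrightarrow> y \<in> X \<Longrightarrow> x \<otimes> y \<in> X" "\<And>c x. c \<in> carrier K \<Longrightarrow> x \<in> X \<Longrightarrow> c \<odot> x \<in> X"
  shows "is_subalgebra K A X"
  unfolding is_subalgebra_def
proof (intro conjI ballI A.subringI)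
  fix h assume h: "h \<in> X"
  have "(\<ominus>\<^bsub>K\<^esub> \<one>\<^bsub>K\<^esub>) \<odot> h \<in> X" using h by (intro assms(5)) auto
  then show "\<ominus> h \<in> X" using h assms(1) by (auto simp: smult_l_minus)
qed (use assms in auto)

lemma is_subalgebra_restrict:
  assumes B: "is_subalgebra K A B" and X: "is_subalgebra K (A\<lparr>carrier := B\<rparr>) X"
  shows "is_subalgebra K A X"
proof (rule is_subalgebraI)
  have s: "subring B A" "subring X (A\<lparr>carrier := B\<rparr>)" using assms by (simp_all add: is_subalgebra_def)
  show "X \<subseteq> carrier A" using subringE(1)[OF s(1)] subringE(1)[OF s(2)] by simp
  show "\<one> \<in> X" using subringE(3)[OF s(2)] by simp
  show "x \<oplus> y \<in> X" if "x \<in> X" "y \<in> X" for x y using subringE(7)[OF s(2) that] by simp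
  show "x \<otimes> y \<in> X" if "x \<in> X" "y \<in> X" for x y using subringE(6)[OF s(2) that] by simp
  show "c \<odot> x \<in> X" if "c \<in> carrier K" "x \<in> X" for c x using X that by (simp add: is_subalgebra_def)
qed

lemma carrier_is_subalgebra: "is_subalgebra K A (carrier A)"
  by (rule is_subalgebraI) auto

lemma gen_subalgebra_is_subalgebra:
  assumes S: "S \<subseteq> carrier A"
  shows "is_subalgebra K A (gen_subalgebra K A S)"
proof (rule is_subalgebraI)
  have sr: "subring B A" if "B \<in> {B. is_subalgebra K A B \<and> S \<subseteq> B}" for B
    using that by (simp add: is_subalgebra_def)
  show "gen_subalgebra K A S \<subseteq> carrier A"
    using carrier_is_subalgebra S by (auto simp: gen_subalgebra_def)
  show "\<one> \<in> gen_subalgebra K A S"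
    unfolding gen_subalgebra_def by (rule InterI) (rule subringE(3)[OF sr])
  fix x y assume x: "x \<in> gen_subalgebra K A S"
  show "c \<odot> x \<in> gen_subalgebra K A S" if "c \<in> carrier K" for c
    using x that by (auto simp: gen_subalgebra_def is_subalgebra_def)
  assume y: "y \<in> gen_subalgebra K A S"
  have xy: "x \<in> B" "y \<in> B" if "B \<in> {B. is_subalgebra K A B \<and> S \<subseteq> B}" for B
    using x y that by (auto simp: gen_subalgebra_def)
  show "x \<oplus> y \<in> gen_subalgebra K A S"
    unfolding gen_subalgebra_def by (rule InterI) (rule subringE(7)[OF sr xy])
  show "x \<otimes> y \<in> gen_subalgebra K A S"
    unfolding gen_subalgebra_def by (rule InterI) (rule subringE(6)[OF sr xy])
qed

lemma gen_subalgebra_least: "is_subalgebra K A B \<Longrightarrow> S \<subseteq> B \<Longrightarrow> gen_subalgebra K A S \<subseteq> B"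
  by (auto simp: gen_subalgebra_def)

lemma monomial_at_restrict: "monomial_at (A\<lparr>carrier := B\<rparr>) = monomial_at A"
  by (intro ext) (simp add: monomial_at_def nat_pow_def)

lemma alg_independent_restrict:
  assumes B: "is_subalgebra K A B" and as: "alg_independent K (A\<lparr>carrier := B\<rparr>) as"
  shows "alg_independent K A as"
proof -
  interpret B: assoc_algebra K "A\<lparr>carrier := B\<rparr>" by (rule subalgebra_assoc_algebra[OF B])
  have BA: "B \<subseteq> carrier A" using submodule.subset[OF subalgebra_submodule[OF B]] .
  have asB: "set as \<subseteq> B" using as by (simp add: alg_independent_def)
  have mB: "monomial_at A as \<alpha> \<in> B" for \<alpha>
    using B.A.monomial_at_closed[of as \<alpha>] asB by (simp add: monomial_at_restrict)
  have am: "abelian_monoid A" "abelian_monoid (A\<lparr>carrier := B\<rparr>)"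
    using A.ring_axioms subalgebra_assoc_algebra[OF B] by (simp_all add: assoc_algebra_def ring_def abelian_group_def)
  show ?thesis unfolding alg_independent_def
  proof (intro conjI allI impI ballI)
    show "set as \<subseteq> carrier A" using asB BA by blast
    fix S c \<alpha> assume S: "finite S \<and> S \<subseteq> {\<alpha>. length \<alpha> = length as}" and c: "c \<in> S \<rightarrow> carrier K"
      and z: "(\<Oplus>\<alpha>\<in>S. c \<alpha> \<odot> monomial_at A as \<alpha>) = \<zero>" and \<alpha>: "\<alpha> \<in> S"
    have cb: "c \<beta> \<odot> monomial_at A as \<beta> \<in> B" if "\<beta> \<in> S" for \<beta>
      using B mB c that by (auto simp: is_subalgebra_def)
    have "finsum (A\<lparr>carrier := B\<rparr>) (\<lambda>\<alpha>. c \<alpha> \<odot> monomial_at A as \<alpha>) S = (\<Oplus>\<alpha>\<in>S. c \<alpha> \<odot> monomial_at A as \<alpha>)"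
      by (rule finsum_hom[OF am(2,1), where h = "\<lambda>x. x"]) (use cb BA in auto)
    then have "finsum (A\<lparr>carrier := B\<rparr>) (\<lambda>\<alpha>. c \<alpha> \<odot>\<^bsub>A\<lparr>carrier := B\<rparr>\<^esub> monomial_at (A\<lparr>carrier := B\<rparr>) as \<alpha>) S
        = \<zero>\<^bsub>A\<lparr>carrier := B\<rparr>\<^esub>"
      using z by (simp add: monomial_at_restrict)
    then show "c \<alpha> = \<zero>\<^bsub>K\<^esub>" using as S c \<alpha> unfolding alg_independent_def by blast
  qed
qed

abbreviation "E \<equiv> End_algebra K A"

lemma End_carrier:
  "f \<in> carrier E \<longleftrightarrow> f \<in> extensional (carrier A) \<and> (\<forall>x\<in>carrier A. f x \<in> carrier A) \<and>
    (\<forall>x\<in>carrier A. \<forall>y\<in>carrier A. f (x \<oplus> y) = f x \<oplus> f y) \<and>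
    (\<forall>c\<in>carrier K. \<forall>x\<in>carrier A. f (c \<odot> x) = c \<odot> f x)"
  by (auto simp: End_algebra_def module_hom_def)

lemma End_apply:
  assumes "x \<in> carrier A"
  shows "(f \<oplus>\<^bsub>E\<^esub> g) x = f x \<oplus> g x" "(f \<otimes>\<^bsub>E\<^esub> g) x = f (g x)" "(c \<odot>\<^bsub>E\<^esub> f) x = c \<odot> f x"
    "\<one>\<^bsub>E\<^esub> x = x" "\<zero>\<^bsub>E\<^esub> x = \<zero>"
  using assms by (simp_all add: End_algebra_def compose_def)

text \<open>Operators are extensional functions, so equality of operators can be checked on the
  carrier; all ring and module laws below are proved in this way.\<close>

lemma End_ext:
  "f \<oplus>\<^bsub>E\<^esub> g \<in> extensional (carrier A)" "f \<otimes>\<^bsub>E\<^esub> g \<in> extensional (carrier A)"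
  "c \<odot>\<^bsub>E\<^esub> f \<in> extensional (carrier A)" "\<one>\<^bsub>E\<^esub> \<in> extensional (carrier A)" "\<zero>\<^bsub>E\<^esub> \<in> extensional (carrier A)"
  by (simp_all add: End_algebra_def compose_def)

lemma End_D:
  assumes "f \<in> carrier E"
  shows "x \<in> carrier A \<Longrightarrow> f x \<in> carrier A"
    "x \<in> carrier A \<Longrightarrow> y \<in> carrier A \<Longrightarrow> f (x \<oplus> y) = f x \<oplus> f y"
    "c \<in> carrier K \<Longrightarrow> x \<in> carrier A \<Longrightarrow> f (c \<odot> x) = c \<odot> f x"
    "f \<in> extensional (carrier A)"
  using assms by (auto simp: End_carrier)

lemma smult_swap:
  assumes "c \<in> carrier K" "d \<in> carrier K" "x \<in> carrier A"
  shows "c \<odot> (d \<odot> x) = d \<odot> (c \<odot> x)"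
proof -
  have "c \<otimes>\<^bsub>K\<^esub> d = d \<otimes>\<^bsub>K\<^esub> c" using assms by (intro m_comm)
  then show ?thesis using smult_assoc1[of c d x] smult_assoc1[of d c x] assms by simp
qed

lemma End_closed:
  shows "f \<in> carrier E \<Longrightarrow> g \<in> carrier E \<Longrightarrow> f \<oplus>\<^bsub>E\<^esub> g \<in> carrier E"
    and "f \<in> carrier E \<Longrightarrow> g \<in> carrier E \<Longrightarrow> f \<otimes>\<^bsub>E\<^esub> g \<in> carrier E"
    and "c \<in> carrier K \<Longrightarrow> f \<in> carrier E \<Longrightarrow> c \<odot>\<^bsub>E\<^esub> f \<in> carrier E"
    and "\<one>\<^bsub>E\<^esub> \<in> carrier E" and "\<zero>\<^bsub>E\<^esub> \<in> carrier E"
proof -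
  show "f \<oplus>\<^bsub>E\<^esub> g \<in> carrier E" if "f \<in> carrier E" "g \<in> carrier E" for f g
    by (subst End_carrier) (simp add: End_apply End_ext End_D[OF that(1)] End_D[OF that(2)] smult_r_distr M.a_ac)
  show "f \<otimes>\<^bsub>E\<^esub> g \<in> carrier E" if "f \<in> carrier E" "g \<in> carrier E" for f g
    by (subst End_carrier) (simp add: End_apply End_ext End_D[OF that(1)] End_D[OF that(2)])
  show "c \<odot>\<^bsub>E\<^esub> f \<in> carrier E" if "c \<in> carrier K" "f \<in> carrier E" for c f
    by (subst End_carrier) (simp add: End_apply End_ext End_D[OF that(2)] that(1) smult_r_distr smult_swap[of c])
  show "\<one>\<^bsub>E\<^esub> \<in> carrier E" "\<zero>\<^bsub>E\<^esub> \<in> carrier E"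
    by (subst End_carrier, simp add: End_apply End_ext)+
qed

lemma End_ring: "ring E"
proof (rule ringI)
  show "abelian_group E"
  proof (rule abelian_groupI)
    fix f assume f: "f \<in> carrier E"
    note fD = End_D[OF f]
    show "\<zero>\<^bsub>E\<^esub> \<oplus>\<^bsub>E\<^esub> f = f" by (rule extensionalityI[OF End_ext(1) fD(4)]) (simp add: End_apply fD)
    have "((\<ominus>\<^bsub>K\<^esub> \<one>\<^bsub>K\<^esub>) \<odot>\<^bsub>E\<^esub> f) \<oplus>\<^bsub>E\<^esub> f = \<zero>\<^bsub>E\<^esub>"
      by (rule extensionalityI[OF End_ext(1) End_ext(5)]) (simp add: End_apply fD smult_l_minus M.l_neg)
    then show "\<exists>g\<in>carrier E. g \<oplus>\<^bsub>E\<^esub> f = \<zero>\<^bsub>E\<^esub>"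
      using End_closed(3)[OF _ f, of "\<ominus>\<^bsub>K\<^esub> \<one>\<^bsub>K\<^esub>"]
      by (intro bexI[of _ "(\<ominus>\<^bsub>K\<^esub> \<one>\<^bsub>K\<^esub>) \<odot>\<^bsub>E\<^esub> f"]) auto
    fix g assume g: "g \<in> carrier E"
    note gD = End_D[OF g]
    show "f \<oplus>\<^bsub>E\<^esub> g \<in> carrier E" by (rule End_closed(1)[OF f g])
    show "f \<oplus>\<^bsub>E\<^esub> g = g \<oplus>\<^bsub>E\<^esub> f"
      by (rule extensionalityI[OF End_ext(1) End_ext(1)]) (simp add: End_apply fD gD M.a_comm)
    fix h assume h: "h \<in> carrier E"
    show "f \<oplus>\<^bsub>E\<^esub> g \<oplus>\<^bsub>E\<^esub> h = f \<oplus>\<^bsub>E\<^esub> (g \<oplus>\<^bsub>E\<^esub> h)"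
      by (rule extensionalityI[OF End_ext(1) End_ext(1)]) (simp add: End_apply fD gD End_D[OF h] M.a_assoc)
  qed (rule End_closed)
  show "monoid E"
  proof (rule monoidI)
    fix f assume f: "f \<in> carrier E"
    note fD = End_D[OF f]
    show "\<one>\<^bsub>E\<^esub> \<otimes>\<^bsub>E\<^esub> f = f" "f \<otimes>\<^bsub>E\<^esub> \<one>\<^bsub>E\<^esub> = f"
      by (rule extensionalityI[OF End_ext(2) fD(4)], simp add: End_apply fD)+
    fix g assume g: "g \<in> carrier E"
    show "f \<otimes>\<^bsub>E\<^esub> g \<in> carrier E" by (rule End_closed(2)[OF f g])
    fix h assume h: "h \<in> carrier E"
    show "f \<otimes>\<^bsub>E\<^esub> g \<otimes>\<^bsub>E\<^esub> h = f \<otimes>\<^bsub>E\<^esub> (g \<otimes>\<^bsub>E\<^esub> h)"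
      by (rule extensionalityI[OF End_ext(2) End_ext(2)]) (simp add: End_apply fD End_D[OF g] End_D[OF h])
  qed (rule End_closed)
  fix f g h assume f: "f \<in> carrier E" and g: "g \<in> carrier E" and h: "h \<in> carrier E"
  show "(f \<oplus>\<^bsub>E\<^esub> g) \<otimes>\<^bsub>E\<^esub> h = f \<otimes>\<^bsub>E\<^esub> h \<oplus>\<^bsub>E\<^esub> g \<otimes>\<^bsub>E\<^esub> h"
    "h \<otimes>\<^bsub>E\<^esub> (f \<oplus>\<^bsub>E\<^esub> g) = h \<otimes>\<^bsub>E\<^esub> f \<oplus>\<^bsub>E\<^esub> h \<otimes>\<^bsub>E\<^esub> g"
    by (rule extensionalityI[OF End_ext(2) End_ext(1)], simp add: End_apply End_D[OF f] End_D[OF g] End_D[OF h])+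
qed

lemma End_assoc_algebra: "assoc_algebra K E"
proof -
  have m: "module K E"
  proof (rule moduleI)
    show "cring K" by (rule module.axioms(1)[OF module_axioms])
    show "abelian_group E" using End_ring by (simp add: ring_def)
    fix c f assume c: "c \<in> carrier K" and f: "f \<in> carrier E"
    note fD = End_D[OF f]
    show "c \<odot>\<^bsub>E\<^esub> f \<in> carrier E" by (rule End_closed(3)[OF c f])
    show "(c \<oplus>\<^bsub>K\<^esub> d) \<odot>\<^bsub>E\<^esub> f = c \<odot>\<^bsub>E\<^esub> f \<oplus>\<^bsub>E\<^esub> d \<odot>\<^bsub>E\<^esub> f" if "d \<in> carrier K" for d
      by (rule extensionalityI[OF End_ext(3) End_ext(1)]) (simp add: End_apply fD c that smult_l_distr)
    show "(c \<otimes>\<^bsub>K\<^esub> d) \<odot>\<^bsub>E\<^esub> f = c \<odot>\<^bsub>E\<^esub> (d \<odot>\<^bsub>E\<^esub> f)" if "d \<in> carrier K" for d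
      by (rule extensionalityI[OF End_ext(3) End_ext(3)]) (simp add: End_apply fD c that smult_assoc1)
    show "c \<odot>\<^bsub>E\<^esub> (f \<oplus>\<^bsub>E\<^esub> g) = c \<odot>\<^bsub>E\<^esub> f \<oplus>\<^bsub>E\<^esub> c \<odot>\<^bsub>E\<^esub> g" if "g \<in> carrier E" for g
      by (rule extensionalityI[OF End_ext(3) End_ext(1)]) (simp add: End_apply fD End_D[OF that] c smult_r_distr)
  next
    fix f assume f: "f \<in> carrier E"
    show "\<one>\<^bsub>K\<^esub> \<odot>\<^bsub>E\<^esub> f = f"
      by (rule extensionalityI[OF End_ext(3) End_D(4)[OF f]]) (simp add: End_apply End_D[OF f])
  qed
  have "assoc_algebra_axioms K E"
  proof (rule assoc_algebra_axioms.intro)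
    fix c f g assume c: "c \<in> carrier K" and f: "f \<in> carrier E" and g: "g \<in> carrier E"
    show "(c \<odot>\<^bsub>E\<^esub> f) \<otimes>\<^bsub>E\<^esub> g = c \<odot>\<^bsub>E\<^esub> (f \<otimes>\<^bsub>E\<^esub> g)" "f \<otimes>\<^bsub>E\<^esub> (c \<odot>\<^bsub>E\<^esub> g) = c \<odot>\<^bsub>E\<^esub> (f \<otimes>\<^bsub>E\<^esub> g)"
      by (rule extensionalityI[OF End_ext(2) End_ext(3)], simp add: End_apply End_D[OF f] End_D[OF g] c)+
  qed
  then show ?thesis
    by (rule assoc_algebra.intro[OF vectorspace.intro[OF m vectorspace.axioms(2)[OF vectorspace_axioms]] End_ring])
qed

end


section \<open>The algebra \<open>A(P)\<close>\<close>

lemma (in poisson_algebra) assoc_algebra: "assoc_algebra K P"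
proof -
  have cP: "cring P" and m: "module K P" using algebra_axioms by (simp_all add: algebra_def)
  interpret P: cring P by (rule cP)
  have "assoc_algebra_axioms K P"
  proof (rule assoc_algebra_axioms.intro)
    fix c x y assume c: "c \<in> carrier K" and x: "x \<in> carrier P" and y: "y \<in> carrier P"
    show l: "(c \<odot>\<^bsub>P\<^esub> x) \<otimes>\<^bsub>P\<^esub> y = c \<odot>\<^bsub>P\<^esub> (x \<otimes>\<^bsub>P\<^esub> y)" by (rule smult_assoc2[OF c x y])
    have cy: "c \<odot>\<^bsub>P\<^esub> y \<in> carrier P" using c y by (rule module.smult_closed[OF m])
    show "x \<otimes>\<^bsub>P\<^esub> (c \<odot>\<^bsub>P\<^esub> y) = c \<odot>\<^bsub>P\<^esub> (x \<otimes>\<^bsub>P\<^esub> y)"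
      using smult_assoc2[OF c y x] cring.cring_simprules(14)[OF cP x cy] cring.cring_simprules(14)[OF cP x y] by simp
  qed
  then show ?thesis
    by (rule assoc_algebra.intro[OF vectorspace.intro[OF m field_axioms] cring.axioms(1)[OF cP]])
qed

locale poisson_operators = commutative_generators K P bs + PA: poisson_algebra K P br
  for K :: "('k, 'x) ring_scheme" and P :: "('k, 'p) module" (structure) and bs :: "'p list"
    and br :: "'p \<Rightarrow> 'p \<Rightarrow> 'p" +
  assumes gen: "finite_generators K P (set bs)"
begin

lemma br_zero_right: "x \<in> carrier P \<Longrightarrow> br x \<zero> = \<zero>"
  using PA.br_smult_right[of "\<zero>\<^bsub>K\<^esub>" x "\<zero>"] PA.br_closed[of x "\<zero>"] by simp

lemma br_antisym:
  assumes a: "a \<in> carrier P" and b: "b \<in> carrier P"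
  shows "br a b = \<ominus> br b a"
proof -
  have ab: "a \<oplus> b \<in> carrier P" using a b by simp
  have "\<zero> = br (a \<oplus> b) (a \<oplus> b)" by (rule PA.br_alternating[OF ab, symmetric])
  also have "\<dots> = br a (a \<oplus> b) \<oplus> br b (a \<oplus> b)" by (rule PA.br_add_left[OF a b ab])
  also have "\<dots> = br a b \<oplus> br b a"
    using a b by (simp add: PA.br_add_right PA.br_alternating PA.br_closed)
  finally have "\<ominus> br b a = br a b"
    using a b by (intro M.minus_equality) (simp_all add: PA.br_closed)
  then show ?thesis by simp
qed

lemma br_leibniz_left:
  assumes x: "x \<in> carrier P" and y: "y \<in> carrier P" and a: "a \<in> carrier P"
  shows "br (x \<otimes> y) a = x \<otimes> br y a \<oplus> y \<otimes> br x a"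
proof -
  have "br (x \<otimes> y) a = \<ominus> (br a x \<otimes> y \<oplus> x \<otimes> br a y)"
    using br_antisym[of "x \<otimes> y" a] PA.br_leibniz[OF a x y] x y a by simp
  also have "\<dots> = x \<otimes> (\<ominus> br a y) \<oplus> y \<otimes> (\<ominus> br a x)"
    using x y a comm[of "br a x" y] by (simp add: PA.br_closed M.minus_add A.l_minus A.r_minus M.a_comm)
  finally show ?thesis using br_antisym[OF y a] br_antisym[OF x a] by simp
qed

lemma m_lcomm: "x \<in> carrier P \<Longrightarrow> y \<in> carrier P \<Longrightarrow> z \<in> carrier P \<Longrightarrow> x \<otimes> (y \<otimes> z) = y \<otimes> (x \<otimes> z)"
  using comm[of x y] by (simp add: A.m_assoc[symmetric])

sublocale EA: assoc_algebra K "End_algebra K P"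
  by (rule End_assoc_algebra)

lemma op_apply: "x \<in> carrier P \<Longrightarrow> mult_op P a x = a \<otimes> x" "x \<in> carrier P \<Longrightarrow> ad_op P br a x = br a x"
  by (simp_all add: mult_op_def ad_op_def)

lemma op_ext: "mult_op P a \<in> extensional (carrier P)" "ad_op P br a \<in> extensional (carrier P)"
  by (simp_all add: mult_op_def ad_op_def)

lemma op_closed:
  assumes "a \<in> carrier P"
  shows "mult_op P a \<in> carrier E" "ad_op P br a \<in> carrier E"
  using assms
  by (simp_all add: End_carrier op_apply op_ext A.r_distr smult_right PA.br_closed PA.br_add_right PA.br_smult_right)

lemma op_hom:
  assumes "a \<in> carrier P" "b \<in> carrier P"
  shows "mult_op P (a \<oplus> b) = mult_op P a \<oplus>\<^bsub>E\<^esub> mult_op P b"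
    and "ad_op P br (a \<oplus> b) = ad_op P br a \<oplus>\<^bsub>E\<^esub> ad_op P br b"
    and "mult_op P (a \<otimes> b) = mult_op P a \<otimes>\<^bsub>E\<^esub> mult_op P b"
    and "ad_op P br (a \<otimes> b) = mult_op P a \<otimes>\<^bsub>E\<^esub> ad_op P br b \<oplus>\<^bsub>E\<^esub> mult_op P b \<otimes>\<^bsub>E\<^esub> ad_op P br a"
    and "c \<in> carrier K \<Longrightarrow> mult_op P (c \<odot> a) = c \<odot>\<^bsub>E\<^esub> mult_op P a"
    and "c \<in> carrier K \<Longrightarrow> ad_op P br (c \<odot> a) = c \<odot>\<^bsub>E\<^esub> ad_op P br a"
    and "mult_op P \<one> = \<one>\<^bsub>E\<^esub>" and "ad_op P br \<one> = \<zero>\<^bsub>E\<^esub>"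
proof -
  note ext = op_ext End_ext
  show "mult_op P (a \<oplus> b) = mult_op P a \<oplus>\<^bsub>E\<^esub> mult_op P b"
    "ad_op P br (a \<oplus> b) = ad_op P br a \<oplus>\<^bsub>E\<^esub> ad_op P br b"
    "mult_op P (a \<otimes> b) = mult_op P a \<otimes>\<^bsub>E\<^esub> mult_op P b"
    "ad_op P br (a \<otimes> b) = mult_op P a \<otimes>\<^bsub>E\<^esub> ad_op P br b \<oplus>\<^bsub>E\<^esub> mult_op P b \<otimes>\<^bsub>E\<^esub> ad_op P br a"
    "mult_op P \<one> = \<one>\<^bsub>E\<^esub>"
    by (rule extensionalityI, rule ext, rule ext,
      simp add: End_apply op_apply assms A.l_distr A.m_assoc PA.br_closed PA.br_add_left br_leibniz_left)+
  show "mult_op P (c \<odot> a) = c \<odot>\<^bsub>E\<^esub> mult_op P a" "ad_op P br (c \<odot> a) = c \<odot>\<^bsub>E\<^esub> ad_op P br a" if "c \<in> carrier K"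
    by (rule extensionalityI, rule ext, rule ext,
      simp add: End_apply op_apply assms that smult_left PA.br_smult_left)+
  \<comment> \<open>The Leibniz rule at 1 = 1 \<otimes> 1 shows that this element equals its
    double.\<close>
  have "br \<one> x = \<zero>" if x: "x \<in> carrier P" for x
  proof -
    have bc: "br \<one> x \<in> carrier P" using x by (intro PA.br_closed) auto
    have "br \<one> x \<oplus> br \<one> x = br \<one> x" using br_leibniz_left[of \<one> \<one> x] x bc by simp
    then have "(br \<one> x \<oplus> br \<one> x) \<oplus> \<ominus> br \<one> x = br \<one> x \<oplus> \<ominus> br \<one> x" by simp
    then show ?thesis using bc by (simp add: M.a_assoc M.r_neg)
  qed
  then show "ad_op P br \<one> = \<zero>\<^bsub>E\<^esub>"
    by (intro extensionalityI[OF op_ext(2) End_ext(5)]) (simp add: End_apply op_apply)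
qed

abbreviation "AP \<equiv> AP_algebra K P br"
abbreviation "ops \<equiv> \<lambda>X. mult_op P ` X \<union> ad_op P br ` X"

lemma ops_closed: "X \<subseteq> carrier P \<Longrightarrow> ops X \<subseteq> carrier E"
  using op_closed by auto

lemma AP_subalgebra: "is_subalgebra K E (carrier AP)"
  using EA.gen_subalgebra_is_subalgebra[OF ops_closed[OF order_refl]] by (simp add: AP_algebra_def)

lemma AP_eq: "AP = E\<lparr>carrier := carrier AP\<rparr>"
  by (simp add: AP_algebra_def)

lemma AP_ops: "ops (carrier P) \<subseteq> carrier AP"
  by (auto simp: AP_algebra_def gen_subalgebra_def)

lemma AP_simps:
  "f \<oplus>\<^bsub>AP\<^esub> g = f \<oplus>\<^bsub>E\<^esub> g" "f \<otimes>\<^bsub>AP\<^esub> g = f \<otimes>\<^bsub>E\<^esub> g" "c \<odot>\<^bsub>AP\<^esub> f = c \<odot>\<^bsub>E\<^esub> f" "\<one>\<^bsub>AP\<^esub> = \<one>\<^bsub>E\<^esub>" "\<zero>\<^bsub>AP\<^esub> = \<zero>\<^bsub>E\<^esub>"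
  by (simp_all add: AP_algebra_def)

lemma AP_assoc_algebra: "assoc_algebra K AP"
  using EA.subalgebra_assoc_algebra[OF AP_subalgebra] AP_eq by simp

sublocale AP: assoc_algebra K AP
  by (rule AP_assoc_algebra)

lemma AP_carrier: "f \<in> carrier AP \<Longrightarrow> f \<in> carrier E"
  using submodule.subset[OF EA.subalgebra_submodule[OF AP_subalgebra]] by blast

lemma subalgebra_ops:
  assumes Y: "is_subalgebra K E Y" and G: "ops (set bs) \<subseteq> Y"
  shows "ops (carrier P) \<subseteq> Y"
proof -
  have sr: "subring Y E" using Y by (simp add: is_subalgebra_def)
  note Yc = subringE(2,3,6,7)[OF sr]
  have Ys: "c \<odot>\<^bsub>E\<^esub> f \<in> Y" if "c \<in> carrier K" "f \<in> Y" for c f using Y that by (simp add: is_subalgebra_def)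
  \<comment> \<open>By \<open>op_hom\<close>, the elements whose multiplication and derivation both
    lie in Y form a subalgebra: the derivation of a product ab is a ad(b) + b ad(a). So generators
    of P suffice to generate A(P).\<close>
  define T where "T = {a \<in> carrier P. mult_op P a \<in> Y \<and> ad_op P br a \<in> Y}"
  have "is_subalgebra K P T"
    by (rule is_subalgebraI) (auto simp: T_def op_hom op_hom(7,8)[OF A.one_closed A.one_closed] Yc Ys)
  moreover have "set bs \<subseteq> T" using bs G by (auto simp: T_def)
  ultimately have "gen_subalgebra K P (set bs) \<subseteq> T" by (rule gen_subalgebra_least)
  then have "carrier P \<subseteq> T" using gen by (simp add: finite_generators_def)
  then show ?thesis by (auto simp: T_def)
qed

lemma AP_finite_generators: "finite_generators K AP (ops (set bs))"
  unfolding finite_generators_def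
proof (intro conjI Set.equalityI)
  show G: "ops (set bs) \<subseteq> carrier AP" using AP_ops bs by auto
  show "gen_subalgebra K AP (ops (set bs)) \<subseteq> carrier AP"
    by (rule AP.gen_subalgebra_least[OF AP.carrier_is_subalgebra G])
  show "carrier AP \<subseteq> gen_subalgebra K AP (ops (set bs))"
  proof -
    let ?Y = "gen_subalgebra K AP (ops (set bs))"
    have "is_subalgebra K AP ?Y" by (rule AP.gen_subalgebra_is_subalgebra[OF G])
    then have Y: "is_subalgebra K E ?Y"
      using EA.is_subalgebra_restrict[OF AP_subalgebra, of ?Y] AP_eq by simp
    have "ops (set bs) \<subseteq> ?Y" by (auto simp: gen_subalgebra_def)
    then have "ops (carrier P) \<subseteq> ?Y" by (rule subalgebra_ops[OF Y])
    then show ?thesis using EA.gen_subalgebra_least[OF Y] by (simp add: AP_algebra_def)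
  qed
qed simp

text \<open>Differential operators of order less than \<open>i\<close>, in Grothendieck's sense.\<close>

primrec diffop :: "nat \<Rightarrow> ('p \<Rightarrow> 'p) \<Rightarrow> bool" where
  "diffop 0 u \<longleftrightarrow> (\<forall>x\<in>carrier P. u x = \<zero>)"
| "diffop (Suc i) u \<longleftrightarrow> (\<forall>p\<in>set bs. diffop i (\<lambda>x. u (p \<otimes> x) \<ominus> p \<otimes> u x))"

abbreviation "lin \<equiv> module_hom K P P"

lemma linD:
  assumes "u \<in> lin"
  shows "x \<in> carrier P \<Longrightarrow> u x \<in> carrier P"
    "x \<in> carrier P \<Longrightarrow> y \<in> carrier P \<Longrightarrow> u (x \<oplus> y) = u x \<oplus> u y"
    "c \<in> carrier K \<Longrightarrow> x \<in> carrier P \<Longrightarrow> u (c \<odot> x) = c \<odot> u x"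
  using assms by (auto simp: module_hom_def)

lemma linI:
  assumes "\<And>x. x \<in> carrier P \<Longrightarrow> u x \<in> carrier P"
    "\<And>x y. x \<in> carrier P \<Longrightarrow> y \<in> carrier P \<Longrightarrow> u (x \<oplus> y) = u x \<oplus> u y"
    "\<And>c x. c \<in> carrier K \<Longrightarrow> x \<in> carrier P \<Longrightarrow> u (c \<odot> x) = c \<odot> u x"
  shows "u \<in> lin"
  using assms by (auto simp: module_hom_def)

lemma AP_lin: "u \<in> carrier AP \<Longrightarrow> u \<in> lin"
  using AP_carrier[of u] by (auto simp: End_algebra_def)

lemma gens_carrier: "p \<in> set bs \<Longrightarrow> p \<in> carrier P"
  using bs by blast

lemma lin_commutator:
  assumes u: "u \<in> lin" and p: "p \<in> carrier P"
  shows "(\<lambda>x. u (p \<otimes> x) \<ominus> p \<otimes> u x) \<in> lin"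
proof (rule linI)
  note [simp] = linD[OF u] p
  show "u (p \<otimes> x) \<ominus> p \<otimes> u x \<in> carrier P" if "x \<in> carrier P" for x using that by simp
  show "u (p \<otimes> (x \<oplus> y)) \<ominus> p \<otimes> u (x \<oplus> y) = u (p \<otimes> x) \<ominus> p \<otimes> u x \<oplus> (u (p \<otimes> y) \<ominus> p \<otimes> u y)"
    if "x \<in> carrier P" "y \<in> carrier P" for x y
    using that by (simp add: a_minus_def A.r_distr M.minus_add M.a_ac)
  show "u (p \<otimes> (c \<odot> x)) \<ominus> p \<otimes> u (c \<odot> x) = c \<odot> (u (p \<otimes> x) \<ominus> p \<otimes> u x)"
    if "c \<in> carrier K" "x \<in> carrier P" for c x
    using that by (simp add: a_minus_def smult_right smult_r_distr smult_r_minus)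
qed

text \<open>Commutators are written as plain functions, whose values outside the carrier are
  irrelevant to being a differential operator.\<close>

lemma diffop_cong:
  "diffop i u \<Longrightarrow> (\<And>x. x \<in> carrier P \<Longrightarrow> u x = v x) \<Longrightarrow> diffop i v"
proof (induction i arbitrary: u v)
  case 0 then show ?case by simp
next
  case (Suc i)
  show ?case unfolding diffop.simps
  proof
    fix p assume p: "p \<in> set bs"
    show "diffop i (\<lambda>x. v (p \<otimes> x) \<ominus> p \<otimes> v x)"
    proof (rule Suc.IH)
      show "diffop i (\<lambda>x. u (p \<otimes> x) \<ominus> p \<otimes> u x)" using Suc.prems(1) p by simp
      show "u (p \<otimes> x) \<ominus> p \<otimes> u x = v (p \<otimes> x) \<ominus> p \<otimes> v x" if "x \<in> carrier P" for x
        using Suc.prems(2)[OF that] Suc.prems(2)[of "p \<otimes> x"] that gens_carrier[OF p] by simp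
    qed
  qed
qed

lemma diffop_trivial: "(\<And>x. x \<in> carrier P \<Longrightarrow> u x = \<zero>) \<Longrightarrow> diffop i u"
proof (induction i arbitrary: u)
  case (Suc i)
  show ?case unfolding diffop.simps
    by (intro ballI Suc.IH) (use Suc.prems gens_carrier in \<open>simp add: a_minus_def\<close>)
qed simp

lemma diffop_Suc: "u \<in> lin \<Longrightarrow> diffop i u \<Longrightarrow> diffop (Suc i) u"
proof (induction i arbitrary: u)
  case 0 then show ?case by (intro diffop_trivial) simp
next
  case (Suc i)
  have "diffop (Suc i) (\<lambda>x. u (p \<otimes> x) \<ominus> p \<otimes> u x)" if p: "p \<in> set bs" for p
    using Suc.prems(2) p by (intro Suc.IH lin_commutator[OF Suc.prems(1) gens_carrier[OF p]]) simp
  then show ?case unfolding diffop.simps(2)[of "Suc i"] by blast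
qed

lemma diffop_add:
  "u \<in> lin \<Longrightarrow> v \<in> lin \<Longrightarrow> diffop i u \<Longrightarrow> diffop i v \<Longrightarrow> diffop i (\<lambda>x. u x \<oplus> v x)"
proof (induction i arbitrary: u v)
  case 0 then show ?case by simp
next
  case (Suc i)
  show ?case unfolding diffop.simps
  proof
    fix p assume p: "p \<in> set bs"
    note pc = gens_carrier[OF p]
    have "diffop i (\<lambda>x. (u (p \<otimes> x) \<ominus> p \<otimes> u x) \<oplus> (v (p \<otimes> x) \<ominus> p \<otimes> v x))"
      using Suc.prems(3,4) p by (intro Suc.IH lin_commutator Suc.prems pc) simp_all
    then show "diffop i (\<lambda>x. u (p \<otimes> x) \<oplus> v (p \<otimes> x) \<ominus> p \<otimes> (u x \<oplus> v x))"
      by (rule diffop_cong)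
        (simp add: pc linD[OF Suc.prems(1)] linD[OF Suc.prems(2)] a_minus_def A.r_distr M.minus_add M.a_ac)
  qed
qed

lemma diffop_smult: "u \<in> lin \<Longrightarrow> c \<in> carrier K \<Longrightarrow> diffop i u \<Longrightarrow> diffop i (\<lambda>x. c \<odot> u x)"
proof (induction i arbitrary: u)
  case 0 then show ?case by simp
next
  case (Suc i)
  show ?case unfolding diffop.simps
  proof
    fix p assume p: "p \<in> set bs"
    note pc = gens_carrier[OF p]
    have "diffop i (\<lambda>x. c \<odot> (u (p \<otimes> x) \<ominus> p \<otimes> u x))"
      using Suc.prems(3) p by (intro Suc.IH lin_commutator Suc.prems pc) simp
    then show "diffop i (\<lambda>x. c \<odot> u (p \<otimes> x) \<ominus> p \<otimes> (c \<odot> u x))"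
      by (rule diffop_cong)
        (simp add: pc linD[OF Suc.prems(1)] Suc.prems(2) a_minus_def smult_right smult_r_distr smult_r_minus)
  qed
qed

lemma lin_mult:
  assumes "u \<in> lin" "a \<in> carrier P"
  shows "(\<lambda>x. u (a \<otimes> x)) \<in> lin"
  using linD[OF assms(1)] assms(2) by (intro linI) (simp_all add: A.r_distr smult_right)

lemma lin_br:
  assumes "u \<in> lin" "a \<in> carrier P"
  shows "(\<lambda>x. u (br a x)) \<in> lin"
  using linD[OF assms(1)] assms(2)
  by (intro linI) (simp_all add: PA.br_closed PA.br_add_right PA.br_smult_right)

text \<open>Since P is commutative, taking commutators with multiplications is compatible with
  precomposition by another multiplication, so the order does not rise.\<close>

lemma diffop_mult: "u \<in> lin \<Longrightarrow> a \<in> carrier P \<Longrightarrow> diffop i u \<Longrightarrow> diffop i (\<lambda>x. u (a \<otimes> x))"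
proof (induction i arbitrary: u)
  case 0 then show ?case by simp
next
  case (Suc i)
  show ?case unfolding diffop.simps
  proof
    fix p assume p: "p \<in> set bs"
    note pc = gens_carrier[OF p]
    have "diffop i (\<lambda>x. u (p \<otimes> (a \<otimes> x)) \<ominus> p \<otimes> u (a \<otimes> x))"
      using Suc.prems(3) p by (intro Suc.IH[OF lin_commutator[OF Suc.prems(1) pc]] Suc.prems(2)) simp
    then show "diffop i (\<lambda>x. u (a \<otimes> (p \<otimes> x)) \<ominus> p \<otimes> u (a \<otimes> x))"
      by (rule diffop_cong) (simp add: m_lcomm[OF Suc.prems(2) pc])
  qed
qed

text \<open>By the Leibniz rule the commutator of u ad(q) with p is [u, p] ad(q) plus u composed
  with multiplication by {q, p}. The induction hypothesis covers the first summand and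
  \<open>diffop_mult\<close> the second. Precomposition is treated because the filtration of A(P)
  grows on the right.\<close>

lemma diffop_br: "u \<in> lin \<Longrightarrow> q \<in> carrier P \<Longrightarrow> diffop i u \<Longrightarrow> diffop (Suc i) (\<lambda>x. u (br q x))"
proof (induction i arbitrary: u)
  case 0 then show ?case by (intro diffop_trivial) (simp add: PA.br_closed)
next
  case (Suc i)
  note uD = linD[OF Suc.prems(1)] and q = Suc.prems(2)
  have "diffop (Suc i) (\<lambda>x. u (br q (p \<otimes> x)) \<ominus> p \<otimes> u (br q x))" if p: "p \<in> set bs" for p
  proof -
    note pc = gens_carrier[OF p]
    have bc: "br q p \<in> carrier P" using q pc by (rule PA.br_closed)
    have 1: "diffop (Suc i) (\<lambda>x. u (p \<otimes> br q x) \<ominus> p \<otimes> u (br q x))"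
      using Suc.prems(3) p by (intro Suc.IH[OF lin_commutator[OF Suc.prems(1) pc]] q) simp
    have 2: "diffop (Suc i) (\<lambda>x. u (br q p \<otimes> x))"
      by (rule diffop_mult[OF Suc.prems(1) bc Suc.prems(3)])
    have "diffop (Suc i) (\<lambda>x. (u (p \<otimes> br q x) \<ominus> p \<otimes> u (br q x)) \<oplus> u (br q p \<otimes> x))"
      using lin_br[OF lin_commutator[OF Suc.prems(1) pc] q] lin_mult[OF Suc.prems(1) bc] 1 2 by (rule diffop_add)
    then show ?thesis
      by (rule diffop_cong)
        (simp add: PA.br_leibniz[OF q pc] PA.br_closed q pc bc uD a_minus_def M.a_ac)
  qed
  then show ?case unfolding diffop.simps(2)[of "Suc i"] by blast
qed

abbreviation "V \<equiv> std_filtration K P (set bs)"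

lemma carrier_eq_Union_V: "carrier P = (\<Union>i. V i)"
  using gen gen_subalgebra_eq_Union_filt[OF bs] by (simp add: finite_generators_def)

lemma kernel_submodule: "u \<in> lin \<Longrightarrow> submodule K {x \<in> carrier P. u x \<in> {\<zero>}} P"
  by (rule preimage_submodule[OF zero_submodule]) (auto simp: linD)

lemma gen_mult_V: "p \<in> set bs \<Longrightarrow> x \<in> V i \<Longrightarrow> p \<otimes> x \<in> V (Suc i)"
  using filt_mult[OF bs gen_filt[OF bs], of p x i] by simp

text \<open>The kernel is a subspace that contains 1 and is stable under the generators, so it
  exhausts P.\<close>

lemma commuting_op_zero:
  assumes u: "u \<in> lin" and one: "u \<one> = \<zero>" and c: "\<And>p x. p \<in> set bs \<Longrightarrow> x \<in> carrier P \<Longrightarrow> u (p \<otimes> x) = p \<otimes> u x"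
    and x: "x \<in> carrier P"
  shows "u x = \<zero>"
proof -
  have "V i \<subseteq> {x \<in> carrier P. u x \<in> {\<zero>}}" for i
  proof (rule filt_induct[OF bs kernel_submodule[OF u]])
    show "\<one> \<in> {x \<in> carrier P. u x \<in> {\<zero>}}" using one by simp
    fix x y assume x: "x \<in> {x \<in> carrier P. u x \<in> {\<zero>}}" and y: "y \<in> insert \<one> (set bs)"
    have yc: "y \<in> carrier P" using y bs by auto
    show "x \<otimes> y \<in> {x \<in> carrier P. u x \<in> {\<zero>}}"
    proof (cases "y = \<one>")
      case False
      then have "u (y \<otimes> x) = \<zero>" using c[of y x] x y yc by simp
      then show ?thesis using x yc comm[of x y] by simp
    qed (use x in simp)
  qed
  then show ?thesis using x unfolding carrier_eq_Union_V by blast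
qed

text \<open>An operator of order at most i is determined on V_i: its commutator with a generator p
  has order at most i - 1 and vanishes on V_(i-1), as p V_(i-1) \<subseteq> V_i. By induction u
  commutes with all generators, and it kills 1.\<close>

lemma diffop_zero:
  "u \<in> lin \<Longrightarrow> diffop (Suc i) u \<Longrightarrow> (\<And>x. x \<in> V i \<Longrightarrow> u x = \<zero>) \<Longrightarrow> x \<in> carrier P \<Longrightarrow> u x = \<zero>"
proof (induction i arbitrary: u x)
  case 0
  have "u (p \<otimes> x) = p \<otimes> u x" if "p \<in> set bs" "x \<in> carrier P" for p x
  proof -
    have "u (p \<otimes> x) \<ominus> p \<otimes> u x = \<zero>" using 0(2) that by simp
    then show ?thesis using that gens_carrier[of p] linD[OF 0(1)] by simp
  qed
  with 0(1) 0(3)[OF one_filt[OF bs]] show ?case using 0(4) by (rule commuting_op_zero)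
next
  case (Suc i)
  have "u (p \<otimes> x) = p \<otimes> u x" if p: "p \<in> set bs" and x: "x \<in> carrier P" for p x
  proof -
    have "u (p \<otimes> x) \<ominus> p \<otimes> u x = \<zero>"
    proof (rule Suc.IH[OF lin_commutator[OF Suc.prems(1) gens_carrier[OF p]] _ _ x])
      show "diffop (Suc i) (\<lambda>x. u (p \<otimes> x) \<ominus> p \<otimes> u x)" using Suc.prems(2) p unfolding diffop.simps(2)[of "Suc i"] by blast
      fix y assume y: "y \<in> V i"
      then have "u (p \<otimes> y) = \<zero>" "u y = \<zero>"
        using Suc.prems(3) gen_mult_V[OF p y] filt_Suc_mono[OF bs, of i] by auto
      then show "u (p \<otimes> y) \<ominus> p \<otimes> u y = \<zero>" using gens_carrier[OF p] by (simp add: a_minus_def)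
    qed
    then show ?thesis using x gens_carrier[OF p] linD[OF Suc.prems(1)] by simp
  qed
  with Suc.prems(1) Suc.prems(3)[OF one_filt[OF bs]] show ?case using Suc.prems(4) by (rule commuting_op_zero)
qed

end


section \<open>Finite growth of A(P)\<close>

context poisson_operators
begin

lemma br_one:
  assumes x: "x \<in> carrier P"
  shows "br x \<one> = \<zero>"
proof -
  have "br \<one> x = ad_op P br \<one> x" using x by (simp add: op_apply)
  also have "\<dots> = \<zero>" unfolding op_hom(8)[OF A.one_closed A.one_closed] using x by (rule End_apply(5))
  finally show ?thesis using br_antisym[OF x A.one_closed] by simp
qed

text \<open>The brackets of the finitely many generators lie in one step, and by the Leibniz rule
  ad(p) then raises every degree by at most a constant.\<close>

lemma br_V:
  obtains c where "1 \<le> c" "\<And>p j x. p \<in> set bs \<Longrightarrow> x \<in> V j \<Longrightarrow> br p x \<in> V (j + c)"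
proof -
  have "(\<lambda>(p, q). br p q) ` (set bs \<times> set bs) \<subseteq> carrier P" using bs by (auto intro: PA.br_closed)
  then obtain c where "(\<lambda>(p, q). br p q) ` (set bs \<times> set bs) \<subseteq> V c"
    by (rule finite_generators_filt[OF gen, rotated]) (auto intro: that)
  then have c: "br p q \<in> V c" if "p \<in> set bs" "q \<in> set bs" for p q using that by auto
  have Vc: "x \<in> carrier P" if "x \<in> V j" for x j using filt_carrier[OF bs] that by blast
  have mono: "x \<in> V j" if "x \<in> V i" "i \<le> j" for x i j using filt_mono[OF bs that(2)] that(1) by blast
  \<comment> \<open>The successor ensures a constant of at least 1, so that later it also bounds the
    degree by which multiplication by a generator raises V.\<close>
  have "br p x \<in> V (j + Suc c)" if p: "p \<in> set bs" and x: "x \<in> V j" for p j x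
  proof -
    note pc = gens_carrier[OF p]
    define N where "N j = {x \<in> V j. br p x \<in> V (j + Suc c)}" for j
    have "V j \<subseteq> N j"
    proof (rule filt_induct[OF bs])
      fix j
      note V1 = filt_submodule[OF bs, of j] and V2 = filt_submodule[OF bs, of "j + Suc c"]
      show "submodule K (N j) P"
      proof (rule submodule.intro[OF module_axioms])
        show "N j \<subseteq> carrier P" using Vc by (auto simp: N_def)
        show "\<zero> \<in> N j"
          using submodule.zero_closed[OF V1] submodule.zero_closed[OF V2] by (simp add: N_def br_zero_right[OF pc])
        show "x \<oplus> y \<in> N j" if "x \<in> N j" "y \<in> N j" for x y
        proof -
          have xy: "x \<in> V j" "y \<in> V j" "br p x \<in> V (j + Suc c)" "br p y \<in> V (j + Suc c)" using that by (simp_all add: N_def)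
          show ?thesis
            using submodule.m_closed[OF V1 xy(1,2)] submodule.m_closed[OF V2 xy(3,4)]
              PA.br_add_right[OF pc Vc[OF xy(1)] Vc[OF xy(2)]] by (simp add: N_def)
        qed
        show "a \<odot> x \<in> N j" if a: "a \<in> carrier K" and "x \<in> N j" for a x
        proof -
          have x: "x \<in> V j" "br p x \<in> V (j + Suc c)" using that by (simp_all add: N_def)
          show ?thesis
            using submodule.smult_closed[OF V1 a x(1)] submodule.smult_closed[OF V2 a x(2)]
              PA.br_smult_right[OF a pc Vc[OF x(1)]] by (simp add: N_def)
        qed
      qed
    next
      show "\<one> \<in> N 0"
        using one_filt[OF bs] submodule.zero_closed[OF filt_submodule[OF bs]] by (simp add: N_def br_one[OF pc])
      fix j x y assume "x \<in> N j" and y: "y \<in> insert \<one> (set bs)"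
      then have x: "x \<in> V j" "br p x \<in> V (j + Suc c)" by (simp_all add: N_def)
      show "x \<otimes> y \<in> N (Suc j)"
      proof (cases "y = \<one>")
        case True
        have "x \<in> V (Suc j)" "br p x \<in> V (Suc j + Suc c)" by (rule mono[OF x(1)], simp, rule mono[OF x(2)], simp)
        then show ?thesis using True Vc[OF x(1)] by (simp add: N_def)
      next
        case False
        then have y: "y \<in> set bs" using y by simp
        have y1: "y \<in> V 1" by (rule gen_filt[OF bs y])
        have "x \<otimes> y \<in> V (j + 1)" by (rule filt_mult[OF bs x(1) y1])
        moreover have "br p x \<otimes> y \<in> V (Suc j + Suc c)"
          by (rule mono[OF filt_mult[OF bs x(2) y1]]) simp
        moreover have "x \<otimes> br p y \<in> V (Suc j + Suc c)"
          by (rule mono[OF filt_mult[OF bs x(1) c[OF p y]]]) simp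
        ultimately show ?thesis
          using PA.br_leibniz[OF pc Vc[OF x(1)] Vc[OF y1]]
            submodule.m_closed[OF filt_submodule[OF bs, of "Suc j + Suc c"]] by (simp add: N_def)
      qed
    qed
    then show ?thesis using x by (auto simp: N_def)
  qed
  then show ?thesis by (intro that[of "Suc c"]) auto
qed

text \<open>Order and shift of degree are both controlled by the filtration degree; together they
  confine an operator of degree i to a matrix between two finite-dimensional steps of P.\<close>

lemma AP_filt:
  assumes c: "1 \<le> c" "\<And>p j x. p \<in> set bs \<Longrightarrow> x \<in> V j \<Longrightarrow> br p x \<in> V (j + c)"
    and u: "u \<in> AP.filt (ops (set bs)) i"
  shows "diffop (Suc i) u" and "x \<in> V j \<Longrightarrow> u x \<in> V (j + c * i)"
proof -
  have G: "ops (set bs) \<subseteq> carrier AP" using AP_ops bs by auto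
  have Vc: "x \<in> carrier P" if "x \<in> V j" for x j using filt_carrier[OF bs] that by blast
  have mono: "x \<in> V j" if "x \<in> V i" "i \<le> j" for x i j using filt_mono[OF bs that(2)] that(1) by blast
  define N where "N i = {u \<in> carrier AP. diffop (Suc i) u \<and> (\<forall>j. \<forall>x\<in>V j. u x \<in> V (j + c * i))}" for i
  have "AP.filt (ops (set bs)) i \<subseteq> N i"
  proof (rule AP.filt_induct[OF G])
    fix i
    note V = filt_submodule[OF bs]
    show "submodule K (N i) AP"
    proof (rule submodule.intro[OF AP.module_axioms])
      show "N i \<subseteq> carrier AP" by (auto simp: N_def)
      have "diffop (Suc i) \<zero>\<^bsub>AP\<^esub>" by (rule diffop_trivial) (simp add: AP_simps End_apply)
      moreover have "\<zero>\<^bsub>AP\<^esub> x \<in> V (j + c * i)" if "x \<in> V j" for x j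
        using submodule.zero_closed[OF V] Vc[OF that] by (simp add: AP_simps End_apply)
      ultimately show "\<zero>\<^bsub>AP\<^esub> \<in> N i" by (simp add: N_def)
      fix u assume u: "u \<in> N i"
      then have u': "u \<in> carrier AP" "u \<in> lin" "diffop (Suc i) u" "\<And>x j. x \<in> V j \<Longrightarrow> u x \<in> V (j + c * i)"
        using AP_lin by (simp_all add: N_def)
      show "u \<oplus>\<^bsub>AP\<^esub> v \<in> N i" if "v \<in> N i" for v
      proof -
        have v: "v \<in> carrier AP" "v \<in> lin" "diffop (Suc i) v" "\<And>x j. x \<in> V j \<Longrightarrow> v x \<in> V (j + c * i)"
          using that AP_lin by (simp_all add: N_def)
        have "diffop (Suc i) (u \<oplus>\<^bsub>AP\<^esub> v)"
          by (rule diffop_cong[OF diffop_add[OF u'(2) v(2) u'(3) v(3)]]) (simp add: AP_simps End_apply)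
        moreover have "(u \<oplus>\<^bsub>AP\<^esub> v) x \<in> V (j + c * i)" if "x \<in> V j" for x j
          using submodule.m_closed[OF V u'(4)[OF that] v(4)[OF that]] Vc[OF that] by (simp add: AP_simps End_apply)
        moreover have "u \<oplus>\<^bsub>AP\<^esub> v \<in> carrier AP" using u'(1) v(1) by (rule AP.M.a_closed)
        ultimately show ?thesis by (simp add: N_def)
      qed
      show "a \<odot>\<^bsub>AP\<^esub> u \<in> N i" if a: "a \<in> carrier K" for a
      proof -
        have "diffop (Suc i) (a \<odot>\<^bsub>AP\<^esub> u)"
          by (rule diffop_cong[OF diffop_smult[OF u'(2) a u'(3)]]) (simp add: AP_simps End_apply)
        moreover have "(a \<odot>\<^bsub>AP\<^esub> u) x \<in> V (j + c * i)" if "x \<in> V j" for x j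
          using submodule.smult_closed[OF V a u'(4)[OF that]] Vc[OF that] by (simp add: AP_simps End_apply)
        moreover have "a \<odot>\<^bsub>AP\<^esub> u \<in> carrier AP" using a u'(1) by (rule AP.smult_closed)
        ultimately show ?thesis by (simp add: N_def)
      qed
    qed
  next
    have "diffop (Suc 0) \<one>\<^bsub>AP\<^esub>"
      using gens_carrier by (simp add: AP_simps End_apply a_minus_def M.r_neg)
    moreover have "\<one>\<^bsub>AP\<^esub> x \<in> V (j + c * 0)" if "x \<in> V j" for x j
      using that Vc[OF that] by (simp add: AP_simps End_apply)
    ultimately show "\<one>\<^bsub>AP\<^esub> \<in> N 0" unfolding N_def using AP.A.one_closed by blast
  next
    fix i u y assume "u \<in> N i" and y: "y \<in> insert \<one>\<^bsub>AP\<^esub> (ops (set bs))"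
    then have u: "u \<in> carrier AP" "u \<in> lin" "diffop (Suc i) u" "\<And>x j. x \<in> V j \<Longrightarrow> u x \<in> V (j + c * i)"
      using AP_lin by (simp_all add: N_def)
    have yc: "y \<in> carrier AP" using y G by auto
    have "diffop (Suc (Suc i)) (u \<otimes>\<^bsub>AP\<^esub> y) \<and> (\<forall>j. \<forall>x\<in>V j. (u \<otimes>\<^bsub>AP\<^esub> y) x \<in> V (j + c * Suc i))"
    proof -
      consider "y = \<one>\<^bsub>AP\<^esub>" | p where "p \<in> set bs" "y = mult_op P p" | p where "p \<in> set bs" "y = ad_op P br p"
        using y by auto
      then show ?thesis
      proof cases
        case 1
        then have "u \<otimes>\<^bsub>AP\<^esub> y = u" using u(1) by simp
        then show ?thesis using diffop_Suc[OF u(2,3)] mono[OF u(4)] by auto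
      next
        case 2
        note pc = gens_carrier[OF 2(1)]
        have e: "(u \<otimes>\<^bsub>AP\<^esub> y) x = u (p \<otimes> x)" if "x \<in> carrier P" for x
          using that by (simp add: AP_simps End_apply 2(2) op_apply)
        have "diffop (Suc (Suc i)) (u \<otimes>\<^bsub>AP\<^esub> y)"
          by (rule diffop_cong[OF diffop_Suc[OF lin_mult[OF u(2) pc] diffop_mult[OF u(2) pc u(3)]]]) (simp add: e)
        moreover have "(u \<otimes>\<^bsub>AP\<^esub> y) x \<in> V (j + c * Suc i)" if "x \<in> V j" for x j
          unfolding e[OF Vc[OF that]]
          by (rule mono[OF u(4)[OF gen_mult_V[OF 2(1) that]]]) (use c(1) in simp)
        ultimately show ?thesis by blast
      next
        case 3
        note pc = gens_carrier[OF 3(1)]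
        have e: "(u \<otimes>\<^bsub>AP\<^esub> y) x = u (br p x)" if "x \<in> carrier P" for x
          using that by (simp add: AP_simps End_apply 3(2) op_apply)
        have "diffop (Suc (Suc i)) (u \<otimes>\<^bsub>AP\<^esub> y)"
          by (rule diffop_cong[OF diffop_br[OF u(2) pc u(3)]]) (simp add: e)
        moreover have "(u \<otimes>\<^bsub>AP\<^esub> y) x \<in> V (j + c * Suc i)" if "x \<in> V j" for x j
          unfolding e[OF Vc[OF that]]
          by (rule mono[OF u(4)[OF c(2)[OF 3(1) that]]]) simp
        ultimately show ?thesis by blast
      qed
    qed
    then show "u \<otimes>\<^bsub>AP\<^esub> y \<in> N (Suc i)" unfolding N_def using AP.A.m_closed[OF u(1) yc] by blast
  qed
  then have "u \<in> N i" using u by blast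
  then show "diffop (Suc i) u" and "x \<in> V j \<Longrightarrow> u x \<in> V (j + c * i)" unfolding N_def by blast+
qed

text \<open>An operator of degree i has order at most n = d i and is thus determined by its
  restriction from V_n to V_n'. Hence the dimension is at most dim V_n times dim V_n', which is
  polynomial in i of degree 2 s. The factor d accounts for the arbitrary generating set S.\<close>

theorem AP_growth_finite:
  assumes S: "finite_generators K AP S"
  shows "growth (AP.dim_filt S) \<le> ereal (real (s + s))"
proof -
  obtain c where c: "1 \<le> c" "\<And>p j x. p \<in> set bs \<Longrightarrow> x \<in> V j \<Longrightarrow> br p x \<in> V (j + c)"
    by (rule br_V) blast
  have Sf: "finite S" and Sc: "S \<subseteq> carrier AP" using S by (simp_all add: finite_generators_def)
  have G: "ops (set bs) \<subseteq> carrier AP" using AP_ops bs by auto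
  obtain d where d: "S \<subseteq> AP.filt (ops (set bs)) d"
    by (rule AP.finite_generators_filt[OF AP_finite_generators Sf Sc])
  have bound: "AP.dim_filt S i \<le> dim_filt (set bs) (d * i) * dim_filt (set bs) (d * i + c * (d * i))" for i
  proof (rule ccontr)
    let ?n = "d * i" and ?n' = "d * i + c * (d * i)"
    assume less: "\<not> AP.dim_filt S i \<le> dim_filt (set bs) ?n * dim_filt (set bs) ?n'"
    obtain B where B: "finite B" "B \<subseteq> AP.filt S i" "card B = AP.dim_filt S i" "indep K AP B (\<lambda>x. x)"
      by (rule AP.filt_basis[OF Sc Sf]) blast
    obtain J where J: "finite J" "J \<subseteq> V ?n" "card J = dim_filt (set bs) ?n"
      "\<And>w. w \<in> V ?n \<Longrightarrow> \<exists>f\<in>J \<rightarrow> carrier K. w = (\<Oplus>b\<in>J. f b \<odot> b)"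
      by (rule filt_basis[OF bs finite_set]) blast
    obtain J' where J': "finite J'" "J' \<subseteq> V ?n'" "card J' = dim_filt (set bs) ?n'"
      "\<And>w. w \<in> V ?n' \<Longrightarrow> \<exists>f\<in>J' \<rightarrow> carrier K. w = (\<Oplus>b\<in>J'. f b \<odot> b)"
      by (rule filt_basis[OF bs finite_set]) blast
    have Jc: "b \<in> carrier P" if "b \<in> J" for b using that J(2) filt_carrier[OF bs] by blast
    have J'c: "b \<in> carrier P" if "b \<in> J'" for b using that J'(2) filt_carrier[OF bs] by blast
    have filt: "u \<in> AP.filt (ops (set bs)) ?n" if "u \<in> AP.filt S i" for u
      using AP.filt_subset_filt[OF G d, of i] that by blast
    have filtc: "u \<in> carrier AP" if "u \<in> AP.filt S i" for u using AP.filt_carrier[OF Sc] that by blast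
    have Bc: "u \<in> carrier AP" "u \<in> lin" if "u \<in> B" for u using filtc[of u] AP_lin[of u] that B(2) by auto
    define m :: "('p \<Rightarrow> 'p) \<Rightarrow> 'p \<Rightarrow> 'p \<Rightarrow> 'k" where "m u b = (SOME f. f \<in> J' \<rightarrow> carrier K \<and> u b = (\<Oplus>j\<in>J'. f j \<odot> j))" for u b
    have m: "m u b \<in> J' \<rightarrow> carrier K \<and> u b = (\<Oplus>j\<in>J'. m u b j \<odot> j)" if "u \<in> B" "b \<in> J" for u b
    proof -
      have "u b \<in> V ?n'" using AP_filt(2)[OF c filt] that B(2) J(2) by blast
      then have ex: "\<exists>f. f \<in> J' \<rightarrow> carrier K \<and> u b = (\<Oplus>j\<in>J'. f j \<odot> j)" using J'(4)[of "u b"] by blast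
      show ?thesis using someI_ex[OF ex] unfolding m_def .
    qed
    have mc: "m u b j \<in> carrier K" if "u \<in> B" "b \<in> J" "j \<in> J'" for u b j using m[OF that(1,2)] that(3) by auto
    \<comment> \<open>With more operators than matrix entries, a non-trivial combination of them
      vanishes on V_n.\<close>
    have card: "card (J \<times> J') < card B" using less by (simp add: card_cartesian_product B(3) J(3) J'(3))
    have mz: "m u (fst z) (snd z) \<in> carrier K" if "u \<in> B" "z \<in> J \<times> J'" for u z
      using that by (auto intro: mc)
    have "\<exists>k\<in>B \<rightarrow> carrier K. (\<exists>u\<in>B. k u \<noteq> \<zero>\<^bsub>K\<^esub>) \<and>
      (\<forall>z\<in>J \<times> J'. (\<Oplus>\<^bsub>K\<^esub>u\<in>B. k u \<otimes>\<^bsub>K\<^esub> m u (fst z) (snd z)) = \<zero>\<^bsub>K\<^esub>)"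
      by (rule homogeneous_system[OF finite_cartesian_product[OF J(1) J'(1)] B(1) card]) (rule mz)
    then obtain k where k1: "k \<in> B \<rightarrow> carrier K" and k2: "(\<exists>u\<in>B. k u \<noteq> \<zero>\<^bsub>K\<^esub>) \<and>
      (\<forall>z\<in>J \<times> J'. (\<Oplus>\<^bsub>K\<^esub>u\<in>B. k u \<otimes>\<^bsub>K\<^esub> m u (fst z) (snd z)) = \<zero>\<^bsub>K\<^esub>)"
      by (rule bexE)
    note k = k1 conjunct1[OF k2] conjunct2[OF k2]
    have kc: "k u \<in> carrier K" if "u \<in> B" for u using k(1) that by auto
    define w where "w = (\<Oplus>\<^bsub>AP\<^esub>u\<in>B. k u \<odot>\<^bsub>AP\<^esub> u)"
    have w: "w \<in> AP.filt S i" unfolding w_def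
    proof (rule AP.submodule_finsum[OF AP.filt_submodule[OF Sc]], rule Pi_I)
      show "k u \<odot>\<^bsub>AP\<^esub> u \<in> AP.filt S i" if "u \<in> B" for u
        using submodule.smult_closed[OF AP.filt_submodule[OF Sc] kc[OF that]] B(2) that by blast
    qed
    have wl: "w \<in> lin" using AP_lin[OF filtc[OF w]] .
    have am: "abelian_monoid AP" "abelian_monoid P"
      using AP_assoc_algebra A.ring_axioms by (simp_all add: assoc_algebra_def ring_def abelian_group_def)
    have kB: "k u \<odot>\<^bsub>AP\<^esub> u \<in> carrier AP" if "u \<in> B" for u
      using kc[OF that] Bc(1)[OF that] by (rule AP.smult_closed)
    have wb: "w b = (\<Oplus>u\<in>B. k u \<odot> u b)" if b: "b \<in> carrier P" for b
    proof -
      have "w b = (\<Oplus>u\<in>B. (k u \<odot>\<^bsub>AP\<^esub> u) b)" unfolding w_def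
        by (rule finsum_hom[OF am, where h = "\<lambda>u. u b"])
          (use b kB kB[unfolded AP_simps] AP_lin linD(1) in \<open>auto simp: AP_simps End_apply\<close>)
      also have "\<dots> = (\<Oplus>u\<in>B. k u \<odot> u b)"
        using b kc Bc(2) linD(1) by (intro M.finsum_cong') (auto simp: AP_simps End_apply)
      finally show ?thesis .
    qed
    have zero: "w b = \<zero>" if b: "b \<in> J" for b
    proof -
      have mj: "m u b j \<odot> j \<in> carrier P" if "u \<in> B" "j \<in> J'" for u j using mc[OF that(1) b that(2)] J'c[OF that(2)] by simp
      have ub: "(\<Oplus>j\<in>J'. m u b j \<odot> j) = u b" if "u \<in> B" for u using m[OF that b] by simp
      have "w b = (\<Oplus>u\<in>B. \<Oplus>j\<in>J'. k u \<odot> (m u b j \<odot> j))" unfolding wb[OF Jc[OF b]]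
      proof (rule M.finsum_cong'[OF refl])
        show "(\<lambda>u. \<Oplus>j\<in>J'. k u \<odot> (m u b j \<odot> j)) \<in> B \<rightarrow> carrier P"
          using kc mj by (auto intro!: M.finsum_closed)
        fix u assume u: "u \<in> B"
        have "k u \<odot> u b = k u \<odot> (\<Oplus>j\<in>J'. m u b j \<odot> j)" using ub[OF u] by simp
        also have "\<dots> = (\<Oplus>j\<in>J'. k u \<odot> (m u b j \<odot> j))"
          by (rule finsum_hom[OF am(2) am(2), where h = "\<lambda>x. k u \<odot> x"])
            (use kc[OF u] mj[OF u] in \<open>auto simp: smult_r_distr\<close>)
        finally show "k u \<odot> u b = (\<Oplus>j\<in>J'. k u \<odot> (m u b j \<odot> j))" .
      qed
      also have "\<dots> = (\<Oplus>j\<in>J'. \<Oplus>u\<in>B. k u \<odot> (m u b j \<odot> j))"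
        using kc mj B(1) J'(1) by (intro M.finsum_swap) auto
      also have "\<dots> = (\<Oplus>j\<in>J'. \<zero>)"
      proof (rule M.finsum_cong'[OF refl])
        fix j assume j: "j \<in> J'"
        have "(\<Oplus>u\<in>B. k u \<odot> (m u b j \<odot> j)) = (\<Oplus>u\<in>B. (k u \<otimes>\<^bsub>K\<^esub> m u b j) \<odot> j)"
          using kc mc[OF _ b j] J'c[OF j] by (intro M.finsum_cong') (auto simp: smult_assoc1)
        also have "\<dots> = (\<Oplus>\<^bsub>K\<^esub>u\<in>B. k u \<otimes>\<^bsub>K\<^esub> m u b j) \<odot> j"
          using kc mc[OF _ b j] J'c[OF j]
          by (intro finsum_hom[symmetric, where h = "\<lambda>x. x \<odot> j"])
            (auto simp: smult_l_distr intro: M.abelian_monoid_axioms R.abelian_monoid_axioms)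
        also have "(\<Oplus>\<^bsub>K\<^esub>u\<in>B. k u \<otimes>\<^bsub>K\<^esub> m u b j) = \<zero>\<^bsub>K\<^esub>" using bspec[OF k(3), of "(b, j)"] b j by simp
        finally show "(\<Oplus>u\<in>B. k u \<odot> (m u b j \<odot> j)) = \<zero>" using J'c[OF j] by simp
      qed simp
      finally show ?thesis by simp
    qed
    \<comment> \<open>The combination has order at most n and vanishes on V_n, hence everywhere;
      this contradicts the independence of B.\<close>
    have "w x = \<zero>" if x: "x \<in> carrier P" for x
    proof (rule diffop_zero[OF wl AP_filt(1)[OF c filt[OF w]] _ x])
      fix y assume "y \<in> V ?n"
      then obtain f where f: "f \<in> J \<rightarrow> carrier K" "y = (\<Oplus>b\<in>J. f b \<odot> b)" using J(4)[of y] by blast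
      have "y \<in> {x \<in> carrier P. w x \<in> {\<zero>}}" unfolding f(2)
      proof (rule submodule_finsum[OF kernel_submodule[OF wl]], rule Pi_I)
        fix b assume b: "b \<in> J"
        have "f b \<in> carrier K" using f(1) b by auto
        then show "f b \<odot> b \<in> {x \<in> carrier P. w x \<in> {\<zero>}}" using linD(3)[OF wl] Jc[OF b] zero[OF b] by simp
      qed
      then show "w y = \<zero>" by simp
    qed
    then have "w = \<zero>\<^bsub>AP\<^esub>"
      using End_D(4)[OF AP_carrier[OF filtc[OF w]]] End_ext(5)
      by (intro extensionalityI[where A = "carrier P"]) (auto simp: AP_simps End_apply)
    then show False using B(4) k(1,2) unfolding indep_mod_def w_def by blast
  qed
  \<comment> \<open>Chosen so that n + 1 \<le> e (i + 1) for every n up to d i + c d i, the larger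
    of the two degrees.\<close>
  let ?e = "d + c * d + 1"
  have "AP.dim_filt S i \<le> (?e ^ s * ?e ^ s) * (i + 1) ^ (s + s)" for i
  proof -
    have "dim_filt (set bs) n \<le> ?e ^ s * (i + 1) ^ s" if "n \<le> d * i + c * (d * i)" for n
    proof -
      have "n + 1 \<le> ?e * (i + 1)" using that by (simp add: algebra_simps)
      then have "(n + 1) ^ s \<le> (?e * (i + 1)) ^ s" by (rule power_mono) simp
      then show ?thesis using dim_filt_le_power[of n] by (simp only: power_mult_distrib)
    qed
    then have "dim_filt (set bs) (d * i) * dim_filt (set bs) (d * i + c * (d * i))
        \<le> (?e ^ s * (i + 1) ^ s) * (?e ^ s * (i + 1) ^ s)"
      by (intro mult_le_mono) simp_all
    also have "\<dots> = (?e ^ s * ?e ^ s) * (i + 1) ^ (s + s)" by (simp only: power_add ac_simps)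
    finally show ?thesis using bound[of i] by (rule le_trans[rotated])
  qed
  then show ?thesis by (rule growth_le_polynomial)
qed

text \<open>The Jacobi identity turns {a, b} = 0 into commuting derivations, and the Leibniz rule
  makes ad(a) commute with multiplication by b.\<close>

lemma ops_commute:
  assumes a: "a \<in> carrier P" and b: "b \<in> carrier P" and z: "br a b = \<zero>"
    and f: "f \<in> {mult_op P a, ad_op P br a}" and g: "g \<in> {mult_op P b, ad_op P br b}"
  shows "f \<otimes>\<^bsub>AP\<^esub> g = g \<otimes>\<^bsub>AP\<^esub> f"
proof -
  have z': "br b a = \<zero>" using br_antisym[OF b a] z by simp
  have "f (g x) = g (f x)" if x: "x \<in> carrier P" for x
  proof -
    note cl = PA.br_closed[OF a x] PA.br_closed[OF b x]
    have "br a (br b x) \<oplus> br b (br x a) \<oplus> br x (br a b) = \<zero>" by (rule PA.br_jacobi[OF a b x])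
    then have "br a (br b x) \<oplus> br b (br x a) = \<zero>"
      using z br_zero_right[OF x] a b x by (simp add: PA.br_closed)
    then have "br a (br b x) = \<ominus> br b (br x a)"
      using M.minus_equality[of "br a (br b x)" "br b (br x a)"] a b x by (simp add: PA.br_closed)
    moreover have "br b (br x a) \<oplus> br b (br a x) = br b (br x a \<oplus> br a x)"
      using a b x by (simp add: PA.br_add_right PA.br_closed)
    moreover have "br x a \<oplus> br a x = \<zero>" using br_antisym[OF x a] cl by (simp add: M.l_neg)
    ultimately have j: "br a (br b x) = br b (br a x)"
      using M.minus_equality[of "br b (br a x)" "br b (br x a)"] br_zero_right[OF b] a b x
      by (simp add: PA.br_closed M.a_comm)
    show ?thesis
      using f g j z z' a b x cl PA.br_leibniz[OF a b x] PA.br_leibniz[OF b a x] m_lcomm[OF a b x]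
      by (auto simp: op_apply)
  qed
  then show ?thesis
    unfolding AP_simps by (intro extensionalityI[OF End_ext(2) End_ext(2)]) (simp add: End_apply)
qed

end


section \<open>Isotropic subalgebras\<close>

text \<open>Ensures that the set of lengths of independent lists, whose maximum is taken below, is
  not empty.\<close>

lemma (in assoc_algebra) alg_independent_Nil:
  assumes "\<one> \<noteq> \<zero>"
  shows "alg_independent K A []"
  unfolding alg_independent_def
proof (intro conjI allI impI ballI)
  fix S c \<alpha> assume S: "finite S \<and> S \<subseteq> {\<alpha>. length \<alpha> = length []}" and c: "c \<in> S \<rightarrow> carrier K"
    and z: "(\<Oplus>\<alpha>\<in>S. c \<alpha> \<odot> monomial_at A [] \<alpha>) = \<zero>" and \<alpha>: "\<alpha> \<in> S"
  have S': "S = {\<alpha>}" "\<alpha> = []" using S \<alpha> by auto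
  have c0: "c \<alpha> \<in> carrier K" using c \<alpha> by auto
  have e: "c \<alpha> \<odot> \<one> = \<zero>" using z c0 by (simp add: S' monomial_at_def M.finsum_insert)
  show "c \<alpha> = \<zero>\<^bsub>K\<^esub>"
  proof (rule ccontr)
    assume "c \<alpha> \<noteq> \<zero>\<^bsub>K\<^esub>"
    then have i: "inv\<^bsub>K\<^esub> (c \<alpha>) \<in> carrier K" "inv\<^bsub>K\<^esub> (c \<alpha>) \<otimes>\<^bsub>K\<^esub> c \<alpha> = \<one>\<^bsub>K\<^esub>" using c0 field_Units by auto
    have "\<one> = inv\<^bsub>K\<^esub> (c \<alpha>) \<odot> (c \<alpha> \<odot> \<one>)" using i c0 by (simp add: smult_assoc1[symmetric])
    then show False using e i assms by simp
  qed
qed simp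

lemma GK_fin_gen_le:
  assumes P: "poisson_algebra K P br" and B: "is_subalgebra K P B"
    and fg: "fin_gen_algebra K (P\<lparr>carrier := B\<rparr>)"
    and dep: "\<And>as. set as \<subseteq> B \<Longrightarrow> length as = Suc M \<Longrightarrow> \<not> alg_independent K P as"
  shows "GK_fin_gen K (P\<lparr>carrier := B\<rparr>) \<le> ereal (real M)"
proof -
  interpret PP: assoc_algebra K P by (rule poisson_algebra.assoc_algebra[OF P])
  have cP: "cring P" using P by (simp add: poisson_algebra_def algebra_def)
  have BP: "\<And>x. x \<in> B \<Longrightarrow> x \<in> carrier P" using submodule.subset[OF PP.subalgebra_submodule[OF B]] by blast
  define S where "S = (SOME S. finite_generators K (P\<lparr>carrier := B\<rparr>) S)"
  have "\<exists>S. finite_generators K (P\<lparr>carrier := B\<rparr>) S" using fg by (simp add: fin_gen_algebra_def)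
  then have S: "finite_generators K (P\<lparr>carrier := B\<rparr>) S" unfolding S_def by (rule someI_ex)
  then have "finite S" by (simp add: finite_generators_def)
  then obtain bs where bs: "set bs = S" using finite_list by blast
  have cg: "commutative_generators K (P\<lparr>carrier := B\<rparr>) bs"
    using PP.subalgebra_assoc_algebra[OF B] S bs BP cring.cring_simprules(14)[OF cP]
    by (intro commutative_generators.intro commutative_generators_axioms.intro) (auto simp: finite_generators_def)
  have "growth (\<lambda>i. vectorspace.dim K (P\<lparr>carrier := B\<rparr>\<lparr>carrier := std_filtration K (P\<lparr>carrier := B\<rparr>) (set bs) i\<rparr>))
      \<le> ereal (real M)"
  proof (rule commutative_generators.growth_le_transcendence_degree[OF cg])
    fix as assume "set as \<subseteq> carrier (P\<lparr>carrier := B\<rparr>)" "length as = Suc M"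
    then have "\<not> alg_independent K P as" using dep[of as] by simp
    then show "\<not> alg_independent K (P\<lparr>carrier := B\<rparr>) as" using PP.alg_independent_restrict[OF B, of as] by blast
  qed
  then show ?thesis unfolding GK_fin_gen_def S_def[symmetric] bs .
qed

text \<open>C need not be finitely generated; in that case each member of the supremum is a finitely
  generated subalgebra of P contained in C and inherits the absence of longer independent
  lists.\<close>

lemma GK_subalgebra_le:
  assumes P: "poisson_algebra K P br" and C: "is_subalgebra K P C"
    and dep: "\<And>as. set as \<subseteq> C \<Longrightarrow> length as = Suc M \<Longrightarrow> \<not> alg_independent K P as"
  shows "GK K (P\<lparr>carrier := C\<rparr>) \<le> ereal (real M)"
proof (cases "fin_gen_algebra K (P\<lparr>carrier := C\<rparr>)")
  case True
  then show ?thesis unfolding GK_def using GK_fin_gen_le[OF P C True dep] by simp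
next
  case False
  interpret PP: assoc_algebra K P by (rule poisson_algebra.assoc_algebra[OF P])
  have "GK_fin_gen K (P\<lparr>carrier := C\<rparr>\<lparr>carrier := B\<rparr>) \<le> ereal (real M)"
    if B: "is_subalgebra K (P\<lparr>carrier := C\<rparr>) B" and fg: "fin_gen_algebra K (P\<lparr>carrier := C\<rparr>\<lparr>carrier := B\<rparr>)" for B
  proof -
    have "subring B (P\<lparr>carrier := C\<rparr>)" using B by (simp add: is_subalgebra_def)
    from subringE(1)[OF this] have BC: "B \<subseteq> C" by simp
    have "GK_fin_gen K (P\<lparr>carrier := B\<rparr>) \<le> ereal (real M)"
    proof (rule GK_fin_gen_le[OF P PP.is_subalgebra_restrict[OF C B]])
      show "fin_gen_algebra K (P\<lparr>carrier := B\<rparr>)" using fg by simp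
      show "\<not> alg_independent K P as" if "set as \<subseteq> B" "length as = Suc M" for as using that BC by (intro dep) auto
    qed
    then show ?thesis by simp
  qed
  then show ?thesis unfolding GK_def if_not_P[OF False] by (intro SUP_least) blast
qed


theorem theorem1p9:
  fixes K :: "'k ring" and P :: "('k, 'p) module"
    and br :: "'p \<Rightarrow> 'p \<Rightarrow> 'p" and C :: "'p set"
  assumes "poisson_algebra K P br"
    and "strongly_simple K P br"
    and "isotropic_subalgebra K P br C"
    and "d = filter_dim \<or> d = left_filter_dim"
  shows "GK K (P\<lparr>carrier := C\<rparr>)
      \<le> GK K (AP_algebra K P br) / 2
         * (1 - 1 / (f_AP d K P br + max (f_AP d K P br) 1))"
proof -
  let ?A = "AP_algebra K P br" and ?F = "f_AP d K P br"
  have C: "is_subalgebra K P C" and iso: "\<And>a b. a \<in> C \<Longrightarrow> b \<in> C \<Longrightarrow> br a b = \<zero>\<^bsub>P\<^esub>"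
    using assms(3) by (auto simp: isotropic_subalgebra_def)
  have fg: "fin_gen_algebra K P" and dom: "domain P" and central: "central_simple K ?A"
    and strong: "\<And>as. alg_independent K P as \<Longrightarrow> (\<forall>a\<in>set as. \<forall>b\<in>set as. br a b = \<zero>\<^bsub>P\<^esub>) \<Longrightarrow>
      alg_independent K ?A (map (mult_op P) as @ map (ad_op P br) as)"
    using assms(2) by (auto simp: strongly_simple_def)
  have cP: "cring P" using assms(1) by (simp add: poisson_algebra_def algebra_def)
  obtain S0 where S0: "finite_generators K P S0" using fg by (auto simp: fin_gen_algebra_def)
  then have "finite S0" by (simp add: finite_generators_def)
  then obtain bs where bs: "set bs = S0" using finite_list by blast
  have "commutative_generators K P bs"
    using poisson_algebra.assoc_algebra[OF assms(1)] S0 bs cring.cring_simprules(14)[OF cP]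
    by (intro commutative_generators.intro commutative_generators_axioms.intro) (auto simp: finite_generators_def)
  then interpret O: poisson_operators K P bs br
    using assms(1) S0 bs by (intro poisson_operators.intro poisson_operators_axioms.intro) auto
  have fgA: "\<exists>S. finite_generators K ?A S" using O.AP_finite_generators by blast
  \<comment> \<open>The generating set chosen in \<open>GK_fin_gen\<close>, so that the growth of
    its filtration is GK(A(P)).\<close>
  define S where "S = (SOME S. finite_generators K ?A S)"
  have S: "finite_generators K ?A S" unfolding S_def using fgA by (rule someI_ex)
  have GK: "GK K ?A = growth (O.AP.dim_filt S)"
    using fgA by (simp add: GK_def fin_gen_algebra_def GK_fin_gen_def S_def)
  \<comment> \<open>Finiteness makes g a real number and the index set of the maximum in
    \<open>f_AP\<close> finite.\<close>
  have le: "growth (O.AP.dim_filt S) \<le> ereal (real (length bs + length bs))" by (rule O.AP_growth_finite[OF S])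
  have ge: "0 \<le> growth (O.AP.dim_filt S)" by (rule growth_nonneg)
  obtain g where g: "growth (O.AP.dim_filt S) = ereal g"
    using le ge by (cases "growth (O.AP.dim_filt S)") auto
  have core: "real (2 * length as) \<le> g \<and> ereal (real (2 * length as)) \<le> ereal g * (1 - 1 / (?F + max ?F 1))"
    if as: "set as \<subseteq> C" "alg_independent K P as" for as
  proof -
    let ?cs = "map (mult_op P) as @ map (ad_op P br) as"
    let ?Q = "rational_functions K (length ?cs)"
    have asP: "a \<in> carrier P" if "a \<in> set as" for a using as(2) that by (auto simp: alg_independent_def)
    have z: "br a b = \<zero>\<^bsub>P\<^esub>" if "a \<in> set as" "b \<in> set as" for a b using iso as(1) that by blast
    have csi: "alg_independent K ?A ?cs" by (rule strong[OF as(2)]) (use z in blast)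
    interpret mp: mpoly K "length ?cs" by (rule mpoly.intro[OF vectorspace.axioms(2)[OF O.vectorspace_axioms]])
    obtain xs where xs: "length xs = length ?cs" "alg_independent K ?Q xs"
      using mp.rational_functions_variables by blast
    have cm: "f \<otimes>\<^bsub>?A\<^esub> h = h \<otimes>\<^bsub>?A\<^esub> f" if fh: "f \<in> set ?cs" "h \<in> set ?cs" for f h
    proof -
      obtain a where a: "a \<in> set as" "f \<in> {mult_op P a, ad_op P br a}" using fh(1) by auto
      obtain b where b: "b \<in> set as" "h \<in> {mult_op P b, ad_op P br b}" using fh(2) by auto
      show ?thesis by (rule O.ops_commute[OF asP[OF a(1)] asP[OF b(1)] z[OF a(1) b(1)] a(2) b(2)])
    qed
    have CV: "commuting_variables K ?A ?Q ?cs xs"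
      by (intro commuting_variables.intro commuting_variables_axioms.intro O.AP_assoc_algebra
          mp.rational_functions_algebra mp.rational_functions_field csi xs cm)
    \<comment> \<open>This inequality places m = \<open>length ?cs\<close> in the range of the
      maximum defining \<open>f_AP\<close>, which therefore bounds the filter dimension over exactly
      this field.\<close>
    have 1: "real (length ?cs) \<le> g"
      by (rule commuting_variables.commuting_variables_bound(1)[OF CV central S g])
    have "d ?Q (scalar_extension K ?Q ?A) \<le> ?F"
      unfolding f_AP_def
    proof (rule Max_ge)
      have "{m. ereal (real m) \<le> GK K ?A} \<subseteq> {..nat \<lfloor>g\<rfloor>}"
        unfolding GK g by (auto simp: le_nat_floor)
      then show "finite ((\<lambda>m. d (rational_functions K m) (scalar_extension K (rational_functions K m) ?A)) `
          {m. ereal (real m) \<le> GK K ?A})"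
        by (intro finite_imageI) (rule finite_subset, auto)
      show "d ?Q (scalar_extension K ?Q ?A) \<in> (\<lambda>m. d (rational_functions K m) (scalar_extension K (rational_functions K m) ?A)) `
          {m. ereal (real m) \<le> GK K ?A}"
        by (rule imageI) (use 1 in \<open>simp add: GK g\<close>)
    qed
    then have "filter_dim ?Q (scalar_extension K ?Q ?A) \<le> ?F \<or> left_filter_dim ?Q (scalar_extension K ?Q ?A) \<le> ?F"
      using assms(4) by blast
    then have "ereal (real (length ?cs)) \<le> ereal g * (1 - 1 / (?F + max ?F 1))"
      by (rule commuting_variables.commuting_variables_bound(2)[OF CV central S g])
    moreover have "length ?cs = 2 * length as" by simp
    ultimately show ?thesis using 1 by (simp only:)
  qed
  \<comment> \<open>All lengths are bounded by g, so there is a longest independent list in C; lists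
    one longer are dependent, as \<open>GK_subalgebra_le\<close> requires.\<close>
  define R where "R = {length as | as. set as \<subseteq> C \<and> alg_independent K P as}"
  have "\<one>\<^bsub>P\<^esub> \<noteq> \<zero>\<^bsub>P\<^esub>" using domain.one_not_zero[OF dom] .
  then have "alg_independent K P []" by (rule O.alg_independent_Nil)
  then have "0 \<in> R" unfolding R_def by (intro CollectI exI[of _ "[]"]) simp
  have finR: "finite R"
  proof (rule finite_subset)
    show "R \<subseteq> {..nat \<lfloor>g\<rfloor>}"
    proof
      fix r assume "r \<in> R"
      then obtain as where "r = length as" "set as \<subseteq> C" "alg_independent K P as" by (auto simp: R_def)
      then have "real r \<le> g" using core[of as] by simp
      then show "r \<in> {..nat \<lfloor>g\<rfloor>}" by (simp add: le_nat_floor)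
    qed
  qed simp
  have "Max R \<in> R" using finR \<open>0 \<in> R\<close> by (intro Max_in) auto
  then obtain as where as: "Max R = length as" "set as \<subseteq> C" "alg_independent K P as" by (auto simp: R_def)
  have "GK K (P\<lparr>carrier := C\<rparr>) \<le> ereal (real (Max R))"
  proof (rule GK_subalgebra_le[OF assms(1) C])
    fix as' assume as': "set as' \<subseteq> C" "length as' = Suc (Max R)"
    show "\<not> alg_independent K P as'"
    proof
      assume "alg_independent K P as'"
      then have "length as' \<in> R" using as'(1) by (auto simp: R_def)
      then show False using Max_ge[OF finR, of "length as'"] as'(2) by simp
    qed
  qed
  also have "\<dots> \<le> ereal g / 2 * (1 - 1 / (?F + max ?F 1))"
  proof -
    have "ereal (2 * real (Max R)) \<le> ereal g * (1 - 1 / (?F + max ?F 1))" using core[OF as(2,3)] as(1) by simp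
    \<comment> \<open>The second factor is only known to be an extended real, so halving is
      justified by cases on it.\<close>
    moreover have "ereal (real n) \<le> ereal g / 2 * t" if "ereal (2 * real n) \<le> ereal g * t" for n t
      using that by (cases t) (auto simp: zero_less_divide_iff divide_less_0_iff split: if_splits)
    ultimately show ?thesis by blast
  qed
  finally show ?thesis unfolding GK g .
qed

end
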